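(* Let $p\ge3$ be a prime and $k$ an algebraically closed field of characteristic $p$. For all integers $n\ge 0$, $s\ge 1$ and all $\mathfrak d=(d_1,\dots,d_s),\ \mathfrak f=(f_1,\dots,f_s)\in\{0,1,\dots,p-1\}^s$, $$\dim_k\mathrm{Ext}^n_{kSL_2(p^s)}(L_{\mathfrak d},L_{\mathfrak f})\le\left(2n+2\max_i\{d_i\}+7\right)C_n\prod_{i=1}^s\left(\min\{d_i,f_i\}+1\right).$$ Consequently, if $\mathfrak d$ is fixed, the dimension of $\mathrm{Ext}^n_{kSL_2(p^s)}(L_{\mathfrak d},L_{\mathfrak f})$ has an exponential upper bound for all $\mathfrak f$. In particular, when $\mathfrak d=(0,\dots,0)$, for all $s\ge1$ and all $\mathfrak f\in\{0,1,\dots,p-1\}^s$, $$\dim_k \mathrm{H}^n(SL_2(p^s),L_{\mathfrak f})\le(2n+7)C_n.$$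
   Context: $SL_2(p^s)$ is the finite group $SL_2(\mathbb F_{p^s})$. For a dominant weight $m\in\mathbb N$ (non-negative integers), $L(m)$ is the simple module of highest weight $m$ of the algebraic group $SL_2$ over $k$. For $\mathfrak m=(m_1,\dots,m_s)\in\{0,\dots,p-1\}^s$, $L_{\mathfrak m}$ denotes the restriction to $SL_2(p^s)$ of $L(m)$ with $m=\sum_{i=1}^s m_ip^{i-1}$, i.e. of $L(m_1)\otimes L(m_2)^{(1)}\otimes\cdots\otimes L(m_s)^{(s-1)}$, where $(j)$ denotes the $j$-th Frobenius twist; these are the simple $kSL_2(p^s)$-modules. $C_n=n\,4^n e^{2\pi n/\sqrt3}$.
   Formalization: Since C_0 = 0, the first bound fails for n = 0, d = f (Ext^0 contains the identity) and the last for n = 0, f = (0,…,0); these cases are excluded from those two bounds. The exponential bound for fixed d keeps all n ≥ 0. *)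

theory Defs
  imports
    "HOL-Analysis.Determinants"
    "HOL-Library.Extended_Real"
    "HOL-Algebra.Group"
    "HOL-Library.Poly_Mapping"
    "HOL-Computational_Algebra.Polynomial"
begin

section \<open>Modules over a group algebra\<close>

text \<open>A module over the group algebra \<open>kG\<close> is recorded as a subspace \<open>vecs\<close> of an ambient
  \<open>k\<close>-vector space together with a linear action of \<open>G\<close>.\<close>

record ('k, 'g, 'v) gmod =
  vecs :: "'v set"
  smul :: "'k \<Rightarrow> 'v \<Rightarrow> 'v"
  act :: "'g \<Rightarrow> 'v \<Rightarrow> 'v"

definition is_gmod ::
  "('g, 'b) monoid_scheme \<Rightarrow> ('k::field, 'g, 'v::ab_group_add) gmod \<Rightarrow> bool" where
  "is_gmod G M \<longleftrightarrow>
     vector_space (smul M) \<and> module.subspace (smul M) (vecs M) \<and>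
     (\<forall>g\<in>carrier G. \<forall>v\<in>vecs M. act M g v \<in> vecs M) \<and>
     (\<forall>g\<in>carrier G. \<forall>u\<in>vecs M. \<forall>v\<in>vecs M. act M g (u + v) = act M g u + act M g v) \<and>
     (\<forall>g\<in>carrier G. \<forall>c. \<forall>v\<in>vecs M. act M g (smul M c v) = smul M c (act M g v)) \<and>
     (\<forall>v\<in>vecs M. act M \<one>\<^bsub>G\<^esub> v = v) \<and>
     (\<forall>g\<in>carrier G. \<forall>h\<in>carrier G. \<forall>v\<in>vecs M. act M (g \<otimes>\<^bsub>G\<^esub> h) v = act M g (act M h v))"

definition simple_gmod ::
  "('g, 'b) monoid_scheme \<Rightarrow> ('k::field, 'g, 'v::ab_group_add) gmod \<Rightarrow> bool" where
  "simple_gmod G M \<longleftrightarrow>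
     is_gmod G M \<and> vecs M \<noteq> {0} \<and>
     (\<forall>U. module.subspace (smul M) U \<and> U \<subseteq> vecs M \<and>
          (\<forall>g\<in>carrier G. \<forall>v\<in>U. act M g v \<in> U) \<longrightarrow> U = {0} \<or> U = vecs M)"

definition trivial_gmod :: "('k::field, 'g, 'k) gmod" where
  "trivial_gmod = \<lparr>vecs = UNIV, smul = (*), act = (\<lambda>_ v. v)\<rparr>"

text \<open>Elements of \<open>Hom\<^sub>k\<^sub>G(M, N)\<close> are represented by functions that vanish outside \<open>vecs M\<close>,
  so that distinct functions are distinct homomorphisms.\<close>

definition gmod_hom ::
  "('g, 'b) monoid_scheme \<Rightarrow> ('k, 'g, 'v::ab_group_add) gmod \<Rightarrow> ('k, 'g, 'w::ab_group_add) gmod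
   \<Rightarrow> ('v \<Rightarrow> 'w) set" where
  "gmod_hom G M N = {\<phi>.
     (\<forall>x\<in>vecs M. \<phi> x \<in> vecs N) \<and>
     (\<forall>x\<in>vecs M. \<forall>y\<in>vecs M. \<phi> (x + y) = \<phi> x + \<phi> y) \<and>
     (\<forall>c. \<forall>x\<in>vecs M. \<phi> (smul M c x) = smul N c (\<phi> x)) \<and>
     (\<forall>g\<in>carrier G. \<forall>x\<in>vecs M. \<phi> (act M g x) = act N g (\<phi> x)) \<and>
     (\<forall>x. x \<notin> vecs M \<longrightarrow> \<phi> x = 0)}"


section \<open>Ext groups\<close>

text \<open>The \<open>n\<close>-th cohomology of \<open>Hom\<^sub>k\<^sub>G(P, N)\<close> for a chain complex \<open>P\<close> of \<open>kG\<close>-modules, where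
  \<open>D n\<close> is the differential \<open>P (Suc n) \<rightarrow> P n\<close>.\<close>

definition hom_cocycles ::
  "('g, 'b) monoid_scheme \<Rightarrow> (nat \<Rightarrow> ('k, 'g, 'v::ab_group_add) gmod) \<Rightarrow> (nat \<Rightarrow> 'v \<Rightarrow> 'v)
   \<Rightarrow> ('k, 'g, 'w::ab_group_add) gmod \<Rightarrow> nat \<Rightarrow> ('v \<Rightarrow> 'w) set" where
  "hom_cocycles G P D N n =
     {\<phi> \<in> gmod_hom G (P n) N. \<forall>x\<in>vecs (P (Suc n)). \<phi> (D n x) = 0}"

fun hom_coboundaries ::
  "('g, 'b) monoid_scheme \<Rightarrow> (nat \<Rightarrow> ('k, 'g, 'v::ab_group_add) gmod) \<Rightarrow> (nat \<Rightarrow> 'v \<Rightarrow> 'v)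
   \<Rightarrow> ('k, 'g, 'w::ab_group_add) gmod \<Rightarrow> nat \<Rightarrow> ('v \<Rightarrow> 'w) set" where
  "hom_coboundaries G P D N 0 = {\<lambda>_. 0}"
| "hom_coboundaries G P D N (Suc n) =
     {(\<lambda>x. if x \<in> vecs (P (Suc n)) then \<psi> (D n x) else 0) | \<psi>. \<psi> \<in> gmod_hom G (P n) N}"

text \<open>The dimension over \<open>k\<close> of the quotient of cocycles by coboundaries: the supremum of the
  cardinalities of finite sets of cocycles that are linearly independent modulo coboundaries.
  It is \<open>\<infinity>\<close> when the quotient is infinite-dimensional.\<close>

definition hom_cohomology_dim ::
  "('g, 'b) monoid_scheme \<Rightarrow> (nat \<Rightarrow> ('k::field, 'g, 'v::ab_group_add) gmod)
   \<Rightarrow> (nat \<Rightarrow> 'v \<Rightarrow> 'v) \<Rightarrow> ('k, 'g, 'w::ab_group_add) gmod \<Rightarrow> nat \<Rightarrow> enat" where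
  "hom_cohomology_dim G P D N n =
     Sup {enat (card X) | X. finite X \<and> X \<subseteq> hom_cocycles G P D N n \<and>
       (\<forall>c. (\<lambda>x. \<Sum>\<phi>\<in>X. smul N (c \<phi>) (\<phi> x)) \<in> hom_coboundaries G P D N n
            \<longrightarrow> (\<forall>\<phi>\<in>X. c \<phi> = 0))}"

text \<open>\<open>bar_mod G M n\<close> is the \<open>n\<close>-th term \<open>kG \<otimes> (kG)\<^bsup>\<otimes>n\<^esup> \<otimes> M\<close> of the (unnormalized) bar resolution
  of \<open>M\<close>. The element \<open>g\<^sub>0 \<otimes> g\<^sub>1 \<otimes> \<dots> \<otimes> g\<^sub>n \<otimes> m\<close> is
  \<open>Poly_Mapping.single [g\<^sub>0, \<dots>, g\<^sub>n] m\<close>, and \<open>G\<close> acts by left multiplication on \<open>g\<^sub>0\<close>.\<close>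

definition bar_mod ::
  "('g, 'b) monoid_scheme \<Rightarrow> ('k::field, 'g, 'v::ab_group_add) gmod
   \<Rightarrow> nat \<Rightarrow> ('k, 'g, 'g list \<Rightarrow>\<^sub>0 'v) gmod" where
  "bar_mod G M n =
     \<lparr>vecs = {x. (\<forall>w\<in>Poly_Mapping.keys x. length w = Suc n \<and> set w \<subseteq> carrier G) \<and>
                 (\<forall>w. Poly_Mapping.lookup x w \<in> vecs M)},
      smul = (\<lambda>c. Poly_Mapping.map (smul M c)),
      act = (\<lambda>g x. \<Sum>w\<in>Poly_Mapping.keys x. Poly_Mapping.single ((g \<otimes>\<^bsub>G\<^esub> hd w) # tl w) (Poly_Mapping.lookup x w))\<rparr>"

text \<open>The differential
  \<open>g\<^sub>0 \<otimes> \<dots> \<otimes> g\<^sub>n \<otimes> m \<mapsto> (\<Sum>i<n. (-1)\<^bsup>i\<^esup> g\<^sub>0 \<otimes> \<dots> \<otimes> g\<^sub>i g\<^bsub>i+1\<^esub> \<otimes> \<dots> \<otimes> m) + (-1)\<^bsup>n\<^esup> g\<^sub>0 \<otimes> \<dots> \<otimes> g\<^bsub>n-1\<^esub> \<otimes> g\<^sub>n m\<close>\<close>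

definition alt :: "nat \<Rightarrow> 'a::ab_group_add \<Rightarrow> 'a" where
  "alt i x = (if even i then x else - x)"

definition bar_diff_elem ::
  "('g, 'b) monoid_scheme \<Rightarrow> ('k, 'g, 'v::ab_group_add) gmod
   \<Rightarrow> 'g list \<Rightarrow> 'v \<Rightarrow> ('g list \<Rightarrow>\<^sub>0 'v)" where
  "bar_diff_elem G M w m =
     (\<Sum>i<length w - 1.
        alt i (Poly_Mapping.single (take i w @ (w ! i \<otimes>\<^bsub>G\<^esub> w ! Suc i) # drop (Suc (Suc i)) w) m)) +
     alt (length w - 1) (Poly_Mapping.single (butlast w) (act M (last w) m))"

definition bar_diff ::
  "('g, 'b) monoid_scheme \<Rightarrow> ('k, 'g, 'v::ab_group_add) gmod
   \<Rightarrow> ('g list \<Rightarrow>\<^sub>0 'v) \<Rightarrow> ('g list \<Rightarrow>\<^sub>0 'v)" where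
  "bar_diff G M x = (\<Sum>w\<in>Poly_Mapping.keys x. bar_diff_elem G M w (Poly_Mapping.lookup x w))"

text \<open>The dimension over \<open>k\<close> of \<open>Ext\<^bsup>n\<^esup>\<^sub>k\<^sub>G(M, N)\<close>: the bar complex, augmented by
  \<open>P 0 \<rightarrow> M\<close>, \<open>g\<^sub>0 \<otimes> m \<mapsto> g\<^sub>0 m\<close>, is a resolution of \<open>M\<close> by free \<open>kG\<close>-modules.\<close>

definition ext_dim ::
  "('g, 'b) monoid_scheme \<Rightarrow> ('k::field, 'g, 'v::ab_group_add) gmod
   \<Rightarrow> ('k, 'g, 'w::ab_group_add) gmod \<Rightarrow> nat \<Rightarrow> enat" where
  "ext_dim G M N n = hom_cohomology_dim G (bar_mod G M) (\<lambda>_. bar_diff G M) N n"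

definition group_cohomology_dim ::
  "('g, 'b) monoid_scheme \<Rightarrow> ('k::field, 'g, 'w::ab_group_add) gmod \<Rightarrow> nat \<Rightarrow> enat" where
  "group_cohomology_dim G N n = ext_dim G trivial_gmod N n"


section \<open>\<open>SL\<^sub>2\<close> and its simple modules\<close>

definition SL2_over :: "'k::field set \<Rightarrow> ('k^2^2) monoid" where
  "SL2_over F =
     \<lparr>carrier = {A. det A = 1 \<and> (\<forall>i j. A $ i $ j \<in> F)}, mult = (**), one = mat 1\<rparr>"

text \<open>For \<open>k\<close> algebraically closed of characteristic \<open>p\<close>, the roots of \<open>X\<^bsup>q\<^esup> - X\<close> with \<open>q = p\<^bsup>s\<^esup>\<close>
  form the unique subfield of \<open>k\<close> with \<open>q\<close> elements.\<close>

definition SL2_Fq :: "nat \<Rightarrow> ('k::field^2^2) monoid" where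
  "SL2_Fq q = SL2_over {x. x ^ q = x}"

text \<open>The coordinate ring of \<open>SL\<^sub>2\<close> (over an infinite field), as functions on matrices.\<close>

inductive_set regular_fun :: "('k::field^2^2 \<Rightarrow> 'k) set" where
  const: "(\<lambda>_. c) \<in> regular_fun"
| entry: "(\<lambda>A. A $ i $ j) \<in> regular_fun"
| add: "f \<in> regular_fun \<Longrightarrow> h \<in> regular_fun \<Longrightarrow> (\<lambda>A. f A + h A) \<in> regular_fun"
| mult: "f \<in> regular_fun \<Longrightarrow> h \<in> regular_fun \<Longrightarrow> (\<lambda>A. f A * h A) \<in> regular_fun"

text \<open>A module is rational if its action is given by a map \<open>V \<rightarrow> V \<otimes> k[SL\<^sub>2]\<close>.\<close>

definition rational_SL2_mod :: "('k::field, 'k^2^2, 'v::ab_group_add) gmod \<Rightarrow> bool" where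
  "rational_SL2_mod V \<longleftrightarrow>
     is_gmod (SL2_over UNIV) V \<and>
     (\<forall>v\<in>vecs V. \<exists>(r::nat) u f. (\<forall>i<r. u i \<in> vecs V \<and> f i \<in> regular_fun) \<and>
        (\<forall>A\<in>carrier (SL2_over UNIV). act V A v = (\<Sum>i<r. smul V (f i A) (u i))))"

definition torus :: "'k::field \<Rightarrow> 'k^2^2" where
  "torus t = vector [vector [t, 0], vector [0, inverse t]]"

definition is_weight :: "('k::field, 'k^2^2, 'v::ab_group_add) gmod \<Rightarrow> int \<Rightarrow> bool" where
  "is_weight V \<mu> \<longleftrightarrow>
     (\<exists>v\<in>vecs V. v \<noteq> 0 \<and> (\<forall>t. t \<noteq> 0 \<longrightarrow> act V (torus t) v = smul V (t powi \<mu>) v))"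

text \<open>\<open>V\<close> is (isomorphic to) \<open>L(m)\<close>. Weights are compared in the dominance order, in which the
  positive root of \<open>SL\<^sub>2\<close> is \<open>2\<close>.\<close>

definition simple_SL2_mod :: "nat \<Rightarrow> ('k::field, 'k^2^2, 'v::ab_group_add) gmod \<Rightarrow> bool" where
  "simple_SL2_mod m V \<longleftrightarrow>
     rational_SL2_mod V \<and> simple_gmod (SL2_over UNIV) V \<and>
     is_weight V (int m) \<and> (\<forall>\<mu>. is_weight V \<mu> \<longrightarrow> (\<exists>j::nat. \<mu> = int m - 2 * int j))"

definition p_digits :: "nat \<Rightarrow> nat \<Rightarrow> (nat \<Rightarrow> nat) \<Rightarrow> bool" where
  "p_digits p s d \<longleftrightarrow> (\<forall>i\<in>{1..s}. d i \<le> p - 1)"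

text \<open>\<open>V\<close> is \<open>L(m)\<close> with \<open>m\<close> having base-\<open>p\<close> digits \<open>d 1, \<dots>, d s\<close>. Its restriction to
  \<open>SL\<^sub>2(p\<^bsup>s\<^esup>)\<close> is the same record, regarded as a module over \<open>SL2_Fq (p ^ s)\<close>.\<close>

definition simple_digits_mod ::
  "nat \<Rightarrow> nat \<Rightarrow> (nat \<Rightarrow> nat) \<Rightarrow> ('k::field, 'k^2^2, 'v::ab_group_add) gmod \<Rightarrow> bool" where
  "simple_digits_mod p s d V \<longleftrightarrow> simple_SL2_mod (\<Sum>i=1..s. d i * p ^ (i - 1)) V"

definition C_bound :: "nat \<Rightarrow> real" where
  "C_bound n = real n * 4 ^ n * exp (2 * pi * real n / sqrt 3)"

end

theory Submission
  imports Defs "HOL-Library.Function_Algebras" "HOL-Computational_Algebra.Primes" "HOL-Algebra.Coset"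
begin

text \<open>Restricting to the Borel subgroup \<open>B\<close> is injective on cohomology, because its index \<open>q + 1\<close> is
  prime to \<open>p\<close>. Over \<open>B\<close> the simple module \<open>L\<^sub>f\<close> is a tensor product, over the base \<open>p\<close> digits, of
  truncated polynomial modules with divided powers, and it has an explicit relatively injective
  resolution: in each digit \<open>j\<close> the maps alternate between shifts by \<open>f\<^sub>j + 1\<close> and \<open>p - 1 - f\<^sub>j\<close>. A
  homomorphism of \<open>B\<close>-modules from \<open>L\<^sub>d\<close> into a term of the resolution is a combination of cells
  whose weight is divisible by \<open>q - 1\<close>, and a contracting homotopy, one digit at a time, leaves only
  the critical cells. The divisibility makes the digits of a critical cell an orbit of the map
  \<open>e \<mapsto> p e - z\<close> on carries; since this map is expanding, a critical cell is nearly determined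
  by its degrees, and their number is at most \<open>(2 n + 2) 4\<^sup>n \<Prod>(min {d\<^sub>j, f\<^sub>j} + 1)\<close> for \<open>n \<ge> 1\<close>.\<close>

section \<open>Digits and the finite field\<close>

text \<open>The unipotent radical of \<open>B\<close> is the additive group of \<open>F\<close>, and
  the \<open>q\<close> divided powers \<open>dp \<mu>\<close> with digits below p form a basis of
  the functions on \<open>F\<close>. Each term of the resolution is therefore a sum of copies of
  that function space, which makes it relatively injective. In a single digit the raising operator E
  satisfies E^p = 0 on a string of length p, the kernel of E^a is the image of E^(p-a), and the
  kernel of E^(f_j+1) is the digit factor of L_f: hence the alternating shifts. The torus of
  \<open>B\<close> has order q - 1, prime to p, and contributes only a congruence of weights modulo
  q - 1. The obstacle is uniformity in s: for large s there are many multidegrees of sum n, and only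
  this congruence keeps their number from growing with s. A further difficulty is that the simple
  modules are given abstractly by their highest weight; their digit bases have to be extracted from
  matrix coefficients of a highest weight vector, which amounts to Steinberg's tensor product
  theorem. The count of critical cells is compared with C_n through 4^n \<le> C_n for n \<ge>
  1.\<close>

definition box :: "nat \<Rightarrow> (nat \<Rightarrow> nat) \<Rightarrow> (nat \<Rightarrow> nat) set" where
  "box s d = {\<mu>. \<forall>j. if j \<in> {1..s} then \<mu> j \<le> d j else \<mu> j = 0}"

lemma box_0: "box 0 d = {0}"
  by (auto simp: box_def fun_eq_iff)

text \<open>Since digits outside \<open>{1..s}\<close> are required to be 0, a member of
  \<open>box s d\<close> carries no information at \<open>Suc s\<close>, and overwriting that digit
  loses nothing.\<close>

lemma box_Suc:
  "bij_betw (\<lambda>(\<mu>, i). \<mu>(Suc s := i)) (box s d \<times> {..d (Suc s)}) (box (Suc s) d)"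
proof (rule bij_betwI')
  fix x y :: "(nat \<Rightarrow> nat) \<times> nat"
  assume xy: "x \<in> box s d \<times> {..d (Suc s)}" "y \<in> box s d \<times> {..d (Suc s)}"
  obtain \<mu> i \<mu>' i' where [simp]: "x = (\<mu>, i)" "y = (\<mu>', i')" by (cases x, cases y)
  have z: "\<mu> (Suc s) = 0" "\<mu>' (Suc s) = 0" using xy by (auto simp: box_def)
  show "((case x of (\<mu>, i) \<Rightarrow> \<mu>(Suc s := i)) = (case y of (\<mu>, i) \<Rightarrow> \<mu>(Suc s := i))) = (x = y)"
  proof
    assume "(case x of (\<mu>, i) \<Rightarrow> \<mu>(Suc s := i)) = (case y of (\<mu>, i) \<Rightarrow> \<mu>(Suc s := i))"
    then have e: "\<mu>(Suc s := i) = \<mu>'(Suc s := i')" by simp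
    then have "i = i'" by (metis fun_upd_same)
    moreover have "\<mu> = \<mu>'"
    proof
      fix j show "\<mu> j = \<mu>' j" using fun_cong[OF e, of j] z by (cases "j = Suc s") auto
    qed
    ultimately show "x = y" by simp
  qed simp
next
  fix x :: "(nat \<Rightarrow> nat) \<times> nat"
  assume "x \<in> box s d \<times> {..d (Suc s)}"
  then show "(case x of (\<mu>, i) \<Rightarrow> \<mu>(Suc s := i)) \<in> box (Suc s) d"
    by (auto simp: box_def)
next
  fix y assume y: "y \<in> box (Suc s) d"
  show "\<exists>x\<in>box s d \<times> {..d (Suc s)}. y = (case x of (\<mu>, i) \<Rightarrow> \<mu>(Suc s := i))"
  proof
    have a: "y j = 0" if "j > Suc s" for j using y that by (auto simp: box_def)
    have b: "y j \<le> d j" if "1 \<le> j" "j \<le> Suc s" for j using y that by (auto simp: box_def)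
    have c: "y 0 = 0" using y by (auto simp: box_def)
    show "(y(Suc s := 0), y (Suc s)) \<in> box s d \<times> {..d (Suc s)}"
      using a b c by (auto simp: box_def not_le Suc_le_eq)
  qed auto
qed

lemma finite_box [simp]: "finite (box s d)"
proof (induction s)
  case (Suc s)
  then show ?case using bij_betw_finite[OF box_Suc[of s d]] by simp
qed (simp add: box_0)

lemma sum_box_prod:
  fixes g :: "nat \<Rightarrow> nat \<Rightarrow> 'a::comm_semiring_1"
  shows "(\<Sum>\<mu>\<in>box s d. \<Prod>j=1..s. g j (\<mu> j)) = (\<Prod>j=1..s. \<Sum>i\<le>d j. g j i)"
proof (induction s)
  case (Suc s)
  have "(\<Sum>\<mu>\<in>box (Suc s) d. \<Prod>j=1..Suc s. g j (\<mu> j))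
      = (\<Sum>(\<mu>, i)\<in>box s d \<times> {..d (Suc s)}. \<Prod>j=1..Suc s. g j ((\<mu>(Suc s := i)) j))"
    by (subst sum.reindex_bij_betw[OF box_Suc, symmetric]) (simp add: case_prod_unfold)
  also have "\<dots> = (\<Sum>(\<mu>, i)\<in>box s d \<times> {..d (Suc s)}. (\<Prod>j=1..s. g j (\<mu> j)) * g (Suc s) i)"
    by (intro sum.cong) auto
  also have "\<dots> = (\<Sum>\<mu>\<in>box s d. \<Prod>j=1..s. g j (\<mu> j)) * (\<Sum>i\<le>d (Suc s). g (Suc s) i)"
    by (simp add: sum.cartesian_product[symmetric] sum_product)
  finally show ?case using Suc by simp
qed (simp add: box_0)

lemma card_box: "card (box s d) = (\<Prod>j=1..s. d j + 1)"
  using sum_box_prod[where g = "\<lambda>_ _. 1 :: nat"] by simp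

lemma box_add_iff:
  assumes "\<mu> + \<tau> \<in> box s \<delta>"
  shows "\<mu> \<in> box s \<delta>" "\<tau> \<in> box s \<delta>"
proof -
  have "if j \<in> {1..s} then \<mu> j + \<tau> j \<le> \<delta> j else \<mu> j + \<tau> j = 0" for j
    using assms unfolding box_def by (auto dest: spec[of _ j])
  then have "if j \<in> {1..s} then \<mu> j \<le> \<delta> j \<and> \<tau> j \<le> \<delta> j else \<mu> j = 0 \<and> \<tau> j = 0" for j
    by (meson add_eq_0_iff_both_eq_0 add_leD1 add_leD2)
  then show "\<mu> \<in> box s \<delta>" "\<tau> \<in> box s \<delta>"
    unfolding box_def by (auto split: if_splits)
qed

definition val :: "nat \<Rightarrow> nat \<Rightarrow> (nat \<Rightarrow> nat) \<Rightarrow> nat" where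
  "val p s \<mu> = (\<Sum>j=1..s. \<mu> j * p ^ (j - 1))"

lemma val_add: "val p s (\<mu> + \<nu>) = val p s \<mu> + val p s \<nu>"
  by (simp add: val_def algebra_simps sum.distrib)

lemma val_zero [simp]: "val p s 0 = 0"
  by (simp add: val_def)

lemma box_mono: "(\<And>j. j \<in> {1..s} \<Longrightarrow> d j \<le> d' j) \<Longrightarrow> box s d \<subseteq> box s d'"
  unfolding box_def by (intro Collect_mono impI) (metis le_trans)

lemma zero_in_box [simp]: "0 \<in> box s d"
  by (simp add: box_def)

lemma val_less:
  assumes "p \<ge> 1" "\<mu> \<in> box s (\<lambda>_. p - 1)"
  shows "val p s \<mu> < p ^ s"
proof -
  have m: "\<mu> j \<le> p - 1" if "1 \<le> j" "j \<le> s" for j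
    using assms(2) that by (auto simp: box_def)
  have "t \<le> s \<Longrightarrow> val p t \<mu> < p ^ t" for t
  proof (induction t)
    case (Suc t)
    then have "val p t \<mu> + 1 \<le> p ^ t" by simp
    moreover have "\<mu> (Suc t) * p ^ t \<le> (p - 1) * p ^ t" using m[of "Suc t"] Suc by simp
    moreover have "val p (Suc t) \<mu> = val p t \<mu> + \<mu> (Suc t) * p ^ t" by (simp add: val_def)
    moreover have "p ^ Suc t = (p - 1) * p ^ t + p ^ t" using assms(1) by (cases p) auto
    ultimately show ?case by linarith
  qed (simp add: val_def)
  then show ?thesis by blast
qed

lemma val_inj:
  assumes "p \<ge> 1" "\<mu> \<in> box s (\<lambda>_. p - 1)" "\<mu>' \<in> box s (\<lambda>_. p - 1)" "val p s \<mu> = val p s \<mu>'"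
  shows "\<mu> = \<mu>'"
  using assms(2-4)
proof (induction s arbitrary: \<mu> \<mu>')
  case 0
  then show ?case by (simp add: box_0)
next
  case (Suc s)
  let ?m = "\<mu>(Suc s := 0)" and ?m' = "\<mu>'(Suc s := 0)"
  have b: "?m \<in> box s (\<lambda>_. p - 1)" "?m' \<in> box s (\<lambda>_. p - 1)"
    using Suc.prems by (auto simp: box_def not_le Suc_le_eq)
  have v: "val p (Suc s) \<mu> = val p s ?m + \<mu> (Suc s) * p ^ s"
       "val p (Suc s) \<mu>' = val p s ?m' + \<mu>' (Suc s) * p ^ s"
    by (simp_all add: val_def)
  have l: "val p s ?m < p ^ s" "val p s ?m' < p ^ s"
    using val_less[OF assms(1)] b by auto
  have e: "val p s ?m + \<mu> (Suc s) * p ^ s = val p s ?m' + \<mu>' (Suc s) * p ^ s"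
    using Suc.prems(3) v by simp
  have dv: "(v + n * p ^ s) div p ^ s = n" if "v < p ^ s" for v n :: nat
    using that assms(1) by simp
  have "\<mu> (Suc s) = (val p s ?m + \<mu> (Suc s) * p ^ s) div p ^ s" using dv[OF l(1)] by simp
  also have "\<dots> = \<mu>' (Suc s)" unfolding e by (rule dv[OF l(2)])
  finally have h: "\<mu> (Suc s) = \<mu>' (Suc s)" .
  with e have "val p s ?m = val p s ?m'" by simp
  from Suc.IH[OF b this] h show ?case
    by (metis fun_upd_triv fun_upd_upd)
qed

lemma val_max: "p \<ge> 1 \<Longrightarrow> val p s (\<lambda>j. if j \<in> {1..s} then p - 1 else 0) = p ^ s - 1"
proof (induction s)
  case (Suc s)
  have "val p (Suc s) (\<lambda>j. if j \<in> {1..Suc s} then p - 1 else 0)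
      = val p s (\<lambda>j. if j \<in> {1..s} then p - 1 else 0) + (p - 1) * p ^ s"
    by (simp add: val_def)
  also have "\<dots> = p ^ s - 1 + (p - 1) * p ^ s" using Suc by simp
  also have "\<dots> = p ^ Suc s - 1"
    using Suc.prems by (cases p) (auto simp: algebra_simps)
  finally show ?case .
qed (simp add: val_def)

section \<open>Arithmetic of the subfield with q elements\<close>

locale char_p =
  fixes p s :: nat and F :: "'k::alg_closed_field set"
  assumes prime_p: "prime p" and p_ge: "p \<ge> 3" and char_p: "CHAR('k) = p" and s_ge: "s \<ge> 1"
    and F_def: "F = {x. x ^ (p ^ s) = x}"
begin

abbreviation "q \<equiv> p ^ s"
abbreviation "full \<equiv> (\<lambda>_::nat. p - 1)"

lemma p_pos: "p \<ge> 1" using p_ge by simp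

lemma q_ge: "q \<ge> 3"
  using self_le_power[of p s] p_ge s_ge by linarith

lemma of_nat_p [simp]: "of_nat p = (0 :: 'k)"
  using of_nat_CHAR[where 'a = 'k] by (simp add: char_p)

lemma of_nat_q [simp]: "of_nat q = (0 :: 'k)"
  using s_ge by (simp add: power_0_left)

lemma fact_nonzero: "n \<le> p - 1 \<Longrightarrow> of_nat (fact n) \<noteq> (0 :: 'k)"
proof -
  assume n: "n \<le> p - 1"
  have "\<not> p dvd fact n" using prime_dvd_fact_iff[OF prime_p, of n] n p_ge by linarith
  then show ?thesis
    by (simp add: of_nat_eq_0_iff_char_dvd char_p del: of_nat_fact)
qed

lemma frob_add: "((x::'k) + y) ^ (p ^ n) = x ^ (p ^ n) + y ^ (p ^ n)"
  by (rule freshmans_dream') (simp_all add: char_p prime_p)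

lemma F_0 [simp]: "0 \<in> F" and F_1 [simp]: "1 \<in> F"
  using p_ge by (auto simp: F_def power_0_left)

lemma F_add: "a \<in> F \<Longrightarrow> b \<in> F \<Longrightarrow> a + b \<in> F"
  by (simp add: F_def frob_add)

lemma F_mult: "a \<in> F \<Longrightarrow> b \<in> F \<Longrightarrow> a * b \<in> F"
  by (simp add: F_def power_mult_distrib)

lemma F_minus: "a \<in> F \<Longrightarrow> - a \<in> F"
proof -
  assume a: "a \<in> F"
  have "odd p" using prime_p p_ge prime_odd_nat by fastforce
  then have "odd q" by simp
  with a show ?thesis by (simp add: F_def)
qed

lemma F_inverse: "a \<in> F \<Longrightarrow> inverse a \<in> F"
  by (simp add: F_def power_inverse)

lemma F_divide: "a \<in> F \<Longrightarrow> b \<in> F \<Longrightarrow> a / b \<in> F"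
  by (simp add: divide_inverse F_mult F_inverse)

text \<open>The derivative of X^(p^m) - X is the constant -1, so all roots are simple; over an
  algebraically closed field the p^m roots counted with multiplicity are then distinct. The case m =
  s counts \<open>F\<close>, large m shows that the field is infinite.\<close>

lemma card_roots_frob: "m \<ge> 1 \<Longrightarrow> finite {x::'k. x ^ (p ^ m) = x} \<and> card {x::'k. x ^ (p ^ m) = x} = p ^ m"
proof -
  assume m: "m \<ge> 1"
  define P where "P = monom (1::'k) (p ^ m) - monom 1 1"
  have pm: "p ^ m > 1" using p_ge m by (intro one_less_power) auto
  have deg: "degree P = p ^ m"
    unfolding P_def diff_conv_add_uminus
    by (subst degree_add_eq_left) (use pm in \<open>auto simp: degree_monom_eq\<close>)
  have P0: "P \<noteq> 0" using deg pm p_ge by auto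
  have set: "{x. poly P x = 0} = {x. x ^ (p ^ m) = x}"
    by (auto simp: P_def poly_monom)
  have pd: "poly (pderiv P) x = -1" for x
    using m by (simp add: P_def pderiv_diff pderiv_monom poly_monom power_0_left)
  have ord: "Polynomial.order x P = 1" if x: "poly P x = 0" for x
  proof (rule ccontr)
    assume "Polynomial.order x P \<noteq> 1"
    moreover have "Polynomial.order x P \<noteq> 0" using x P0 by (simp add: order_root)
    ultimately have "2 \<le> Polynomial.order x P" by linarith
    then have "[:-x, 1:] ^ 2 dvd P" using order_1[of x P] le_imp_power_dvd dvd_trans by blast
    then obtain R where R: "P = [:-x, 1:] ^ 2 * R" by (elim dvdE)
    have "poly (pderiv P) x = 0"
      unfolding R power2_eq_square by (simp only: pderiv_mult poly_add poly_mult) simp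
    then show False using pd by simp
  qed
  obtain A where A: "size A = degree P" "P = smult (lead_coeff P) (\<Prod>x\<in>#A. [:-x, 1:])"
    using alg_closed_imp_factorization[OF P0] by (elim exE conjE) (rule that; assumption)
  have "proots P = A"
  proof -
    have "proots P = proots (smult (lead_coeff P) (\<Prod>x\<in>#A. [:-x, 1:]))" by (rule arg_cong[OF A(2)])
    also have "\<dots> = proots (\<Prod>x\<in>#A. [:-x, 1:])" using P0 by (intro proots_smult) simp
    also have "\<dots> = A" 
    proof (induction A)
      case (add x A)
      have "(\<Prod>x\<in>#A. [:-x, 1:]) \<noteq> 0" by (auto simp: prod_mset_zero_iff)
      then have "proots ([:-x, 1:] * (\<Prod>x\<in>#A. [:-x, 1:])) = {#x#} + A"
        using add proots_mult[of "[:-x, 1:]" "\<Prod>x\<in>#A. [:-x, 1:]"] by (simp del: mult_pCons_left)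
      then show ?case by (simp del: mult_pCons_left)
    qed simp
    finally show ?thesis .
  qed
  then have "size (proots P) = p ^ m" using A(1) deg by metis
  moreover have "size (proots P) = (\<Sum>x\<in>{x. poly P x = 0}. count (proots P) x)"
    unfolding size_multiset_overloaded_eq set_count_proots[OF P0] ..
  moreover have "(\<Sum>x\<in>{x. poly P x = 0}. count (proots P) x) = (\<Sum>x\<in>{x. poly P x = 0}. 1)"
    by (rule sum.cong) (auto simp: count_proots[OF P0] ord)
  ultimately show ?thesis using poly_roots_finite[OF P0] by (simp add: set)
qed

lemma card_F: "card F = q" and finite_F [simp]: "finite F"
  using card_roots_frob[OF s_ge] by (auto simp: F_def)

text \<open>A finite field of cardinality m would contain p^(m+1) roots of X^(p^(m+1)) - X.\<close>

lemma infinite_UNIV_k: "infinite (UNIV :: 'k set)"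
proof
  assume fin: "finite (UNIV :: 'k set)"
  let ?m = "card (UNIV :: 'k set)"
  have "p ^ Suc ?m \<le> ?m"
    using card_roots_frob[of "Suc ?m"] card_mono[OF fin, of "{x. x ^ (p ^ Suc ?m) = x}"] by simp
  moreover have "Suc ?m < p ^ Suc ?m" by (rule less_exp[THEN order_less_le_trans]) (use p_ge in \<open>intro power_mono, auto\<close>)
  ultimately show False by simp
qed

lemma F_power: "a \<in> F \<Longrightarrow> a \<noteq> 0 \<Longrightarrow> a ^ (q - 1) = 1"
proof -
  assume a: "a \<in> F" "a \<noteq> 0"
  have "a * a ^ (q - 1) = a ^ q" using q_ge by (metis One_nat_def Suc_pred gr0I not_numeral_le_zero power_Suc)
  also have "\<dots> = a" using a by (simp add: F_def)
  finally show ?thesis using a by simp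
qed

text \<open>The two alternatives serve the two groups: an infinite \<open>A\<close> is used for the
  algebraic group, \<open>A = F\<close> or \<open>F - {0}\<close> for the finite one.\<close>

lemma poly_vanish_on:
  fixes c :: "nat \<Rightarrow> 'k"
  assumes A: "infinite A \<or> M \<le> card A" and z: "\<And>a. a \<in> A \<Longrightarrow> (\<Sum>N<M. c N * a ^ N) = 0" and N: "N < M"
  shows "c N = 0"
proof -
  define P where "P = (\<Sum>N<M. monom (c N) N)"
  have cf: "coeff P N = (if N < M then c N else 0)" for N
    by (simp add: P_def coeff_sum)
  have "P = 0"
  proof (rule ccontr)
    assume P: "P \<noteq> 0"
    have "degree P < M"
      by (rule degree_lessI) (use P N cf in auto)
    moreover have sub: "A \<subseteq> {x. poly P x = 0}" using z by (auto simp: P_def poly_sum poly_monom)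
    moreover have f: "finite {x. poly P x = 0}" using P poly_roots_finite by blast
    moreover have "card A \<le> degree P"
      using card_mono[OF f sub] card_poly_roots_bound[OF P] by linarith
    moreover have "finite A" using sub f finite_subset by blast
    ultimately show False using A by linarith
  qed
  then show ?thesis using cf[of N] N by simp
qed

text \<open>No generator of the multiplicative group is chosen. If r is the residue of m, then X^r -
  1 has degree below q - 1 but vanishes at all q - 1 nonzero elements of \<open>F\<close>, which
  forces r = 0.\<close>

lemma dvd_of_power_eq_1:
  fixes m :: int
  assumes "\<And>t. t \<in> F \<Longrightarrow> t \<noteq> 0 \<Longrightarrow> t powi m = 1"
  shows "int (q - 1) dvd m"
proof -
  define r where "r = nat (m mod int (q - 1))"
  have q1: "int (q - 1) > 0" using q_ge by linarith
  have r: "int r = m mod int (q - 1)" and rl: "r < q - 1"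
    using q1 pos_mod_bound[OF q1, of m] pos_mod_sign[OF q1, of m] unfolding r_def by linarith+
  have t: "t ^ r = 1" if "t \<in> F - {0}" for t
  proof -
    have "m = int (q - 1) * (m div int (q - 1)) + int r" using r by simp
    then have "t powi m = (t powi int (q - 1)) powi (m div int (q - 1)) * t powi int r"
      using that by (metis DiffE power_int_add power_int_mult singletonI)
    also have "t powi int (q - 1) = 1" using that F_power by simp
    finally show ?thesis using assms that by simp
  qed
  have "r = 0"
  proof (rule ccontr)
    assume r0: "r \<noteq> 0"
    define c where "c N = (if N = 0 then -1 else if N = r then 1 else (0::'k))" for N
    have "c r = 0"
    proof (rule poly_vanish_on[of "F - {0}" "q - 1"])
      fix a assume a: "a \<in> F - {0}"
      have "(\<Sum>N<q - 1. c N * a ^ N) = (\<Sum>N\<in>{0, r}. c N * a ^ N)"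
        by (rule sum.mono_neutral_right) (use rl in \<open>auto simp: c_def\<close>)
      also have "\<dots> = 0" using r0 t[OF a] by (simp add: c_def)
      finally show "(\<Sum>N<q - 1. c N * a ^ N) = 0" .
    qed (use rl card_F in auto)
    then show False using r0 by (simp add: c_def)
  qed
  then show ?thesis using r by (simp add: dvd_eq_mod_eq_0)
qed

lemma powi_dvd: "int (q - 1) dvd m \<Longrightarrow> t \<in> F \<Longrightarrow> t \<noteq> 0 \<Longrightarrow> t powi m = 1"
proof -
  assume "int (q - 1) dvd m" and t: "t \<in> F" "t \<noteq> 0"
  then obtain k where "m = int (q - 1) * k" by auto
  then have "t powi m = (t powi int (q - 1)) powi k" by (simp add: power_int_mult)
  then show ?thesis using F_power[OF t] by simp
qed

text \<open>Divided powers in which the factorial, which vanishes in \<open>k\<close>, is replaced by its digit-wise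
  version.\<close>

definition mfact :: "(nat \<Rightarrow> nat) \<Rightarrow> 'k" where
  "mfact \<mu> = (\<Prod>j=1..s. of_nat (fact (\<mu> j)))"

definition dp :: "(nat \<Rightarrow> nat) \<Rightarrow> 'k \<Rightarrow> 'k" where
  "dp \<mu> a = a ^ val p s \<mu> / mfact \<mu>"

lemma mfact_0 [simp]: "mfact 0 = 1" by (simp add: mfact_def)

lemma dp_0 [simp]: "dp 0 a = 1" by (simp add: dp_def)

lemma mfact_nonzero: "\<mu> \<in> box s full \<Longrightarrow> mfact \<mu> \<noteq> 0"
  using fact_nonzero by (auto simp: mfact_def box_def)

lemma dp_mult: "dp \<mu> (a * b) = a ^ val p s \<mu> * dp \<mu> b"
  by (simp add: dp_def power_mult_distrib)

lemma val_pos: "\<mu> \<in> box s d \<Longrightarrow> \<mu> \<noteq> 0 \<Longrightarrow> val p s \<mu> > 0"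
proof -
  assume b: "\<mu> \<in> box s d" "\<mu> \<noteq> 0"
  then obtain j where j: "j \<in> {1..s}" "\<mu> j > 0"
    by (auto simp: box_def fun_eq_iff split: if_splits) (metis not_gr0)
  have "0 < \<mu> j * p ^ (j - 1)" using j p_ge by simp
  also have "\<dots> \<le> val p s \<mu>" unfolding val_def by (rule member_le_sum) (use j in auto)
  finally show ?thesis .
qed

lemma dp_at_0: "\<mu> \<in> box s d \<Longrightarrow> dp \<mu> 0 = (if \<mu> = 0 then 1 else 0)"
  using val_pos[of \<mu> d] by (auto simp: dp_def power_0_left mfact_def)

text \<open>Binomial theorem digit by digit: the base \<open>p\<close> digits keep Frobenius powers apart.\<close>

lemma dp_add:
  assumes d: "d \<in> box s full"
  shows "dp d (x + y) = (\<Sum>\<mu>\<in>box s d. dp \<mu> x * dp (d - \<mu>) y)"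
proof -
  let ?X = "\<lambda>j. x ^ p ^ (j - 1)" and ?Y = "\<lambda>j. y ^ p ^ (j - 1)"
  have dj: "d j \<le> p - 1" if "j \<in> {1..s}" for j using d that by (auto simp: box_def)
  have "(x + y) ^ val p s d = (\<Prod>j=1..s. (?X j + ?Y j) ^ d j)"
    by (simp add: val_def power_sum frob_add[symmetric] mult.commute flip: power_mult)
  also have "\<dots> = (\<Prod>j=1..s. \<Sum>i\<le>d j. of_nat (d j choose i) * ?X j ^ i * ?Y j ^ (d j - i))"
    by (simp add: binomial_ring)
  finally have e: "dp d (x + y) = (\<Prod>j=1..s. (\<Sum>i\<le>d j. of_nat (d j choose i) * ?X j ^ i * ?Y j ^ (d j - i)) / of_nat (fact (d j)))"
    by (simp add: dp_def mfact_def prod_dividef)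
  also have "\<dots> = (\<Prod>j=1..s. \<Sum>i\<le>d j. (?X j ^ i / of_nat (fact i)) * (?Y j ^ (d j - i) / of_nat (fact (d j - i))))"
  proof (rule prod.cong[OF refl])
    fix j assume j: "j \<in> {1..s}"
    show "(\<Sum>i\<le>d j. of_nat (d j choose i) * ?X j ^ i * ?Y j ^ (d j - i)) / of_nat (fact (d j))
        = (\<Sum>i\<le>d j. (?X j ^ i / of_nat (fact i)) * (?Y j ^ (d j - i) / of_nat (fact (d j - i))))"
      unfolding sum_divide_distrib
    proof (rule sum.cong[OF refl])
      fix i assume i: "i \<in> {..d j}"
      have "of_nat (fact i) * of_nat (fact (d j - i)) * of_nat (d j choose i) = (of_nat (fact (d j)) :: 'k)"
        using binomial_fact_lemma[of i "d j"] i
        by (metis atMost_iff of_nat_mult)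
      moreover have "of_nat (fact i) \<noteq> (0::'k)" "of_nat (fact (d j - i)) \<noteq> (0::'k)" "of_nat (fact (d j)) \<noteq> (0::'k)"
        using dj[OF j] i by (auto intro!: fact_nonzero)
      ultimately show "of_nat (d j choose i) * ?X j ^ i * ?Y j ^ (d j - i) / of_nat (fact (d j))
          = (?X j ^ i / of_nat (fact i)) * (?Y j ^ (d j - i) / of_nat (fact (d j - i)))"
        by (simp add: field_simps)
    qed
  qed
  also have "\<dots> = (\<Sum>\<mu>\<in>box s d. \<Prod>j=1..s. (?X j ^ \<mu> j / of_nat (fact (\<mu> j))) * (?Y j ^ (d j - \<mu> j) / of_nat (fact (d j - \<mu> j))))"
    by (rule sum_box_prod[symmetric])
  also have "\<dots> = (\<Sum>\<mu>\<in>box s d. dp \<mu> x * dp (d - \<mu>) y)"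
    by (simp add: dp_def val_def mfact_def power_sum prod.distrib prod_dividef fun_diff_def
        mult.commute flip: power_mult)
  finally show ?thesis .
qed

text \<open>The exponents \<open>val p s \<mu>\<close> are distinct and below q, so the combination
  is a polynomial of degree below q with at least q zeros. This is the device by which coefficients
  are read off from the action of the unipotent group.\<close>

lemma dp_independent:
  assumes A: "infinite A \<or> q \<le> card A" and z: "\<And>a. a \<in> A \<Longrightarrow> (\<Sum>\<mu>\<in>box s full. y \<mu> * dp \<mu> a) = 0"
    and \<mu>: "\<mu> \<in> box s full"
  shows "y \<mu> = 0"
proof -
  define c where "c N = (\<Sum>\<mu>\<in>{\<mu> \<in> box s full. val p s \<mu> = N}. y \<mu> / mfact \<mu>)" for N
  have "c (val p s \<mu>) = 0"
  proof (rule poly_vanish_on[OF A])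
    fix a assume a: "a \<in> A"
    have "(\<Sum>N<q. c N * a ^ N) = (\<Sum>N<q. \<Sum>\<mu>\<in>{\<mu> \<in> box s full. val p s \<mu> = N}. y \<mu> * dp \<mu> a)"
      unfolding c_def sum_distrib_right by (intro sum.cong) (auto simp: dp_def)
    also have "\<dots> = (\<Sum>\<mu>\<in>box s full. y \<mu> * dp \<mu> a)"
      by (rule sum.group) (auto intro: val_less p_pos)
    finally show "(\<Sum>N<q. c N * a ^ N) = 0" using z[OF a] by simp
  qed (rule val_less[OF p_pos \<mu>])
  moreover have "{\<mu>' \<in> box s full. val p s \<mu>' = val p s \<mu>} = {\<mu>}"
    using val_inj[OF p_pos _ \<mu>] \<mu> by blast
  ultimately show ?thesis using mfact_nonzero[OF \<mu>] by (simp add: c_def)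
qed

end

section \<open>Cochains of the bar resolution\<close>

text \<open>A linear map on the \<open>m\<close>-th bar module is encoded by its values on the elements \<open>w \<otimes> x\<close>, where
  \<open>w\<close> is a word of length \<open>m + 1\<close>; equivariance is only required under a subset \<open>H\<close> of \<open>G\<close>.\<close>

definition words :: "('g, 'b) monoid_scheme \<Rightarrow> nat \<Rightarrow> 'g list set" where
  "words G m = {w. length w = Suc m \<and> set w \<subseteq> carrier G}"

definition lmult :: "('g, 'b) monoid_scheme \<Rightarrow> 'g \<Rightarrow> 'g list \<Rightarrow> 'g list" where
  "lmult G g w = (g \<otimes>\<^bsub>G\<^esub> hd w) # tl w"

definition merge :: "('g, 'b) monoid_scheme \<Rightarrow> nat \<Rightarrow> 'g list \<Rightarrow> 'g list" where
  "merge G i w = take i w @ (w ! i \<otimes>\<^bsub>G\<^esub> w ! Suc i) # drop (Suc (Suc i)) w"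

text \<open>The old first letter is corrected by the inverse of \<open>b\<close>, so that merging
  the first two letters returns \<open>w\<close>, and a left multiplication of both \<open>b\<close>
  and \<open>w\<close> by y becomes left multiplication of the prefixed word by y.\<close>

definition prefix_word :: "('g, 'b) monoid_scheme \<Rightarrow> 'g \<Rightarrow> 'g list \<Rightarrow> 'g list" where
  "prefix_word G b w = b # lmult G (inv\<^bsub>G\<^esub> b) w"

definition lin_on :: "('k, 'g, 'v::ab_group_add) gmod \<Rightarrow> ('k \<Rightarrow> 'i::ab_group_add \<Rightarrow> 'i) \<Rightarrow> ('v \<Rightarrow> 'i) \<Rightarrow> bool" where
  "lin_on L sc f \<longleftrightarrow> (\<forall>x\<in>vecs L. \<forall>y\<in>vecs L. f (x + y) = f x + f y) \<and>
     (\<forall>a. \<forall>x\<in>vecs L. f (smul L a x) = sc a (f x))"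

text \<open>Nothing is demanded away from words of length m + 1 and vectors of \<open>L\<close>.
  Identities between cochains are accordingly stated only for such arguments.\<close>

definition cochains :: "('g, 'b) monoid_scheme \<Rightarrow> 'g set \<Rightarrow> ('k, 'g, 'v::ab_group_add) gmod \<Rightarrow>
    ('k \<Rightarrow> 'i::ab_group_add \<Rightarrow> 'i) \<Rightarrow> ('g \<Rightarrow> 'i \<Rightarrow> 'i) \<Rightarrow> 'i set \<Rightarrow> nat \<Rightarrow> ('g list \<Rightarrow> 'v \<Rightarrow> 'i) set" where
  "cochains G H L sc \<beta> X m = {c. \<forall>w\<in>words G m. (\<forall>x\<in>vecs L. c w x \<in> X) \<and> lin_on L sc (c w) \<and>
     (\<forall>h\<in>H. \<forall>x\<in>vecs L. c (lmult G h w) x = \<beta> h (c w x))}"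

definition cobd :: "('g, 'b) monoid_scheme \<Rightarrow> ('k, 'g, 'v::ab_group_add) gmod \<Rightarrow>
    ('g list \<Rightarrow> 'v \<Rightarrow> 'i::ab_group_add) \<Rightarrow> 'g list \<Rightarrow> 'v \<Rightarrow> 'i" where
  "cobd G L c w x = (\<Sum>i<length w - 1. alt i (c (merge G i w) x)) +
     alt (length w - 1) (c (butlast w) (act L (last w) x))"

lemma alt_simps: "alt (Suc i) x = - alt i x" "alt i (x + y) = alt i x + alt i y"
  "alt i (- x) = - alt i x" "alt i (x - y) = alt i x - alt i y" "alt i 0 = 0" "alt 0 x = x"
  by (auto simp: alt_def)

lemma alt_additive:
  assumes f: "\<And>x y. x \<in> X \<Longrightarrow> y \<in> X \<Longrightarrow> f (x + y) = f x + f y" and X: "0 \<in> X" "\<And>x. x \<in> X \<Longrightarrow> - x \<in> X" "x \<in> X"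
  shows "f (alt i x) = alt i (f x :: 'b::ab_group_add)"
proof -
  have "f 0 = 0" using f[of 0 0] X by simp
  then have "f x + f (- x) = 0" using f[of x "- x"] X by simp
  then have "f (- x) = - f x" by (simp add: add_eq_0_iff)
  then show ?thesis by (simp add: alt_def)
qed

lemma is_gmodD:
  assumes "is_gmod G M"
  shows "vector_space (smul M)" "module.subspace (smul M) (vecs M)"
    "\<And>g v. g \<in> carrier G \<Longrightarrow> v \<in> vecs M \<Longrightarrow> act M g v \<in> vecs M"
    "\<And>g u v. g \<in> carrier G \<Longrightarrow> u \<in> vecs M \<Longrightarrow> v \<in> vecs M \<Longrightarrow> act M g (u + v) = act M g u + act M g v"
    "\<And>g c v. g \<in> carrier G \<Longrightarrow> v \<in> vecs M \<Longrightarrow> act M g (smul M c v) = smul M c (act M g v)"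
    "\<And>v. v \<in> vecs M \<Longrightarrow> act M \<one>\<^bsub>G\<^esub> v = v"
    "\<And>g h v. g \<in> carrier G \<Longrightarrow> h \<in> carrier G \<Longrightarrow> v \<in> vecs M \<Longrightarrow> act M (g \<otimes>\<^bsub>G\<^esub> h) v = act M g (act M h v)"
  using assms unfolding is_gmod_def by blast+

lemma subspaceD:
  assumes "vector_space sc" "module.subspace sc X"
  shows "0 \<in> X" "\<And>x y. x \<in> X \<Longrightarrow> y \<in> X \<Longrightarrow> x + y \<in> X" "\<And>c x. x \<in> X \<Longrightarrow> sc c x \<in> X"
    "\<And>x. x \<in> X \<Longrightarrow> - x \<in> X" "\<And>x y. x \<in> X \<Longrightarrow> y \<in> X \<Longrightarrow> x - y \<in> X"
    "\<And>A f. (\<And>a. a \<in> A \<Longrightarrow> f a \<in> X) \<Longrightarrow> sum f A \<in> X"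
    "\<And>i x. x \<in> X \<Longrightarrow> alt i x \<in> X"
proof -
  interpret vector_space sc by fact
  show "0 \<in> X" "\<And>x y. x \<in> X \<Longrightarrow> y \<in> X \<Longrightarrow> x + y \<in> X" "\<And>c x. x \<in> X \<Longrightarrow> sc c x \<in> X"
    "\<And>x. x \<in> X \<Longrightarrow> - x \<in> X" "\<And>x y. x \<in> X \<Longrightarrow> y \<in> X \<Longrightarrow> x - y \<in> X"
    "\<And>A f. (\<And>a. a \<in> A \<Longrightarrow> f a \<in> X) \<Longrightarrow> sum f A \<in> X"
    using assms(2) by (simp_all add: subspace_0 subspace_add subspace_scale subspace_neg subspace_diff subspace_sum)
  then show "\<And>i x. x \<in> X \<Longrightarrow> alt i x \<in> X" by (simp add: alt_def)
qed

context
  fixes G :: "('g, 'b) monoid_scheme" (structure) and L :: "('k::field, 'g, 'v::ab_group_add) gmod"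
  assumes G: "group G" and L: "is_gmod G L"
begin

interpretation group G by (rule G)

lemmas LD = is_gmodD[OF L]

lemma merge_words: "w \<in> words G (Suc m) \<Longrightarrow> i < Suc m \<Longrightarrow> merge G i w \<in> words G m"
  unfolding words_def merge_def
  by (auto dest!: set_take_subset[THEN subsetD] set_drop_subset[THEN subsetD]
      intro!: m_closed nth_mem[THEN subsetD[rotated]])

lemma butlast_words: "w \<in> words G (Suc m) \<Longrightarrow> butlast w \<in> words G m"
  unfolding words_def by (auto dest: in_set_butlastD)

lemma last_words: "w \<in> words G m \<Longrightarrow> last w \<in> carrier G"
  unfolding words_def by (cases w rule: rev_cases) auto

lemma hd_words: "w \<in> words G m \<Longrightarrow> hd w \<in> carrier G"
  unfolding words_def by (cases w) auto

lemma lmult_words: "w \<in> words G m \<Longrightarrow> g \<in> carrier G \<Longrightarrow> lmult G g w \<in> words G m"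
  unfolding words_def lmult_def by (cases w) auto

lemma prefix_words: "w \<in> words G m \<Longrightarrow> g \<in> carrier G \<Longrightarrow> prefix_word G g w \<in> words G (Suc m)"
  using lmult_words[of w m "inv g"] unfolding prefix_word_def by (auto simp: words_def)

lemma lmult_lmult: "w \<in> words G m \<Longrightarrow> g \<in> carrier G \<Longrightarrow> h \<in> carrier G \<Longrightarrow>
    lmult G g (lmult G h w) = lmult G (g \<otimes> h) w"
  unfolding words_def lmult_def by (cases w) (auto simp: m_assoc)

lemma merge_lmult: "w \<in> words G (Suc m) \<Longrightarrow> i < Suc m \<Longrightarrow> g \<in> carrier G \<Longrightarrow>
    merge G i (lmult G g w) = lmult G g (merge G i w)"
proof -
  assume a: "w \<in> words G (Suc m)" "i < Suc m" "g \<in> carrier G"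
  then obtain x y v where w: "w = x # y # v"
    by (auto simp: words_def length_Suc_conv)
  show ?thesis using a by (cases i) (auto simp: w merge_def lmult_def words_def m_assoc)
qed

lemma butlast_lmult: "w \<in> words G (Suc m) \<Longrightarrow> butlast (lmult G g w) = lmult G g (butlast w)"
  by (auto simp: words_def length_Suc_conv lmult_def)

lemma last_lmult: "w \<in> words G (Suc m) \<Longrightarrow> last (lmult G g w) = last w"
  by (auto simp: words_def length_Suc_conv lmult_def)

lemma length_words: "w \<in> words G m \<Longrightarrow> length w = Suc m"
  by (simp add: words_def)

lemma act_last: "w \<in> words G m \<Longrightarrow> x \<in> vecs L \<Longrightarrow> act L (last w) x \<in> vecs L"
  using LD(3) last_words by blast

lemma cobd_cong:
  assumes "\<And>w x. w \<in> words G m \<Longrightarrow> x \<in> vecs L \<Longrightarrow> c w x = c' w x" "w \<in> words G (Suc m)" "x \<in> vecs L"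
  shows "cobd G L c w x = cobd G L c' w x"
  using assms(2,3) unfolding cobd_def
  by (auto intro!: sum.cong arg_cong2[where f = "(+)"] arg_cong2[where f = alt]
      simp: assms(1) merge_words butlast_words act_last length_words)

text \<open>Additivity on \<open>X\<close> alone suffices, so the lemma covers the group action, the
  maps of a resolution and the identification of a module with a kernel.\<close>

lemma cobd_comp:
  assumes f: "\<And>x y. x \<in> X \<Longrightarrow> y \<in> X \<Longrightarrow> f (x + y) = f x + f y"
    and X: "vector_space sc" "module.subspace sc X"
    and c: "\<And>w x. w \<in> words G m \<Longrightarrow> x \<in> vecs L \<Longrightarrow> c w x \<in> X" and w: "w \<in> words G (Suc m)" and x: "x \<in> vecs L"
  shows "cobd G L (\<lambda>w x. f (c w x)) w x = f (cobd G L c w x)"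
proof -
  note XD = subspaceD[OF X]
  have f0: "f 0 = 0" using f[of 0 0] XD(1) by simp
  have fs: "f (\<Sum>i<k. y i) = (\<Sum>i<k. f (y i))" if "\<And>i. i < k \<Longrightarrow> y i \<in> X" for y and k :: nat
    using that
  proof (induction k)
    case (Suc k)
    have "f (sum y {..<k} + y k) = f (sum y {..<k}) + f (y k)"
      by (rule f) (use Suc.prems in \<open>auto intro!: XD(6)\<close>)
    then show ?case using Suc by simp
  qed (simp add: f0)
  have fa: "f (alt i y) = alt i (f y)" if "y \<in> X" for i y
    by (rule alt_additive[where X = X]) (use f XD that in auto)
  have m: "c (merge G i w) x \<in> X" if "i < Suc m" for i using c merge_words[OF w that] x by blast
  have b: "c (butlast w) (act L (last w) x) \<in> X"
    using c butlast_words[OF w] act_last[OF w x] by blast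
  have "f (cobd G L c w x) = f (\<Sum>i<Suc m. alt i (c (merge G i w) x)) + f (alt (Suc m) (c (butlast w) (act L (last w) x)))"
    unfolding cobd_def length_words[OF w] diff_Suc_1
    by (rule f) (use XD(6,7) m b in \<open>auto simp del: sum.lessThan_Suc intro!: XD(6)\<close>)
  also have "\<dots> = (\<Sum>i<Suc m. f (alt i (c (merge G i w) x))) + f (alt (Suc m) (c (butlast w) (act L (last w) x)))"
    by (subst fs) (use XD m in auto)
  also have "\<dots> = (\<Sum>i<Suc m. alt i (f (c (merge G i w) x))) + alt (Suc m) (f (c (butlast w) (act L (last w) x)))"
    using fa m b by (intro arg_cong2[where f = "(+)"] sum.cong) auto
  finally show ?thesis unfolding cobd_def length_words[OF w] diff_Suc_1 by simp
qed

lemma cobd_add: "cobd G L (\<lambda>w x. c w x + c' w x) w x = cobd G L c w x + cobd G L c' w x"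
  by (simp add: cobd_def alt_simps sum.distrib algebra_simps)

lemma cobd_diff: "cobd G L (\<lambda>w x. c w x - c' w x) w x = cobd G L c w x - cobd G L c' w x"
  by (simp add: cobd_def alt_simps sum_subtractf algebra_simps)

lemma cobd_zero: "cobd G L (\<lambda>w x. 0) w x = 0"
  by (simp add: cobd_def alt_simps)

lemma cobd_sum: "cobd G L (\<lambda>w x. \<Sum>k\<in>A. c k w x) w x = (\<Sum>k\<in>A. cobd G L (c k) w x)"
  by (induction A rule: infinite_finite_induct) (simp_all add: cobd_add cobd_zero)

lemma cobd_scale:
  assumes "vector_space sc"
  shows "cobd G L (\<lambda>w x. sc a (c w x)) w x = sc a (cobd G L c w x)"
proof -
  interpret vector_space sc by fact
  have "sc a (alt i y) = alt i (sc a y)" for i y by (simp add: alt_def)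
  then show ?thesis by (simp add: cobd_def scale_right_distrib scale_sum_right)
qed

lemma cochainsD:
  assumes "c \<in> cochains G H L sc \<beta> X m" "w \<in> words G m"
  shows "x \<in> vecs L \<Longrightarrow> c w x \<in> X"
    "x \<in> vecs L \<Longrightarrow> y \<in> vecs L \<Longrightarrow> c w (x + y) = c w x + c w y"
    "x \<in> vecs L \<Longrightarrow> c w (smul L a x) = sc a (c w x)"
    "h \<in> H \<Longrightarrow> x \<in> vecs L \<Longrightarrow> c (lmult G h w) x = \<beta> h (c w x)"
  using assms unfolding cochains_def lin_on_def by auto

lemma cochainsI:
  assumes "\<And>w x. w \<in> words G m \<Longrightarrow> x \<in> vecs L \<Longrightarrow> c w x \<in> X"
    "\<And>w x y. w \<in> words G m \<Longrightarrow> x \<in> vecs L \<Longrightarrow> y \<in> vecs L \<Longrightarrow> c w (x + y) = c w x + c w y"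
    "\<And>w x a. w \<in> words G m \<Longrightarrow> x \<in> vecs L \<Longrightarrow> c w (smul L a x) = sc a (c w x)"
    "\<And>w h x. w \<in> words G m \<Longrightarrow> h \<in> H \<Longrightarrow> x \<in> vecs L \<Longrightarrow> c (lmult G h w) x = \<beta> h (c w x)"
  shows "c \<in> cochains G H L sc \<beta> X m"
  using assms unfolding cochains_def lin_on_def by auto

lemma cobd_cochains:
  assumes c: "c \<in> cochains G H L sc \<beta> X m" and X: "vector_space sc" "module.subspace sc X"
    and \<beta>: "\<And>h x y. h \<in> H \<Longrightarrow> x \<in> X \<Longrightarrow> y \<in> X \<Longrightarrow> \<beta> h (x + y) = \<beta> h x + \<beta> h y"
    and H: "H \<subseteq> carrier G"
  shows "cobd G L c \<in> cochains G H L sc \<beta> X (Suc m)"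
proof (rule cochainsI)
  note XD = subspaceD[OF X]
  note cD = cochainsD[OF c]
  interpret vector_space sc by (rule X)
  fix w x assume w: "w \<in> words G (Suc m)" and x: "x \<in> vecs L"
  have ml: "merge G i w \<in> words G m" if "i < Suc m" for i using merge_words[OF w that] .
  show "cobd G L c w x \<in> X" unfolding cobd_def length_words[OF w] diff_Suc_1
    using ml butlast_words[OF w] act_last[OF w] x by (intro XD) (auto intro!: XD cD)
  show "cobd G L c w (x + y) = cobd G L c w x + cobd G L c w y" if y: "y \<in> vecs L" for y
  proof -
    have "act L (last w) (x + y) = act L (last w) x + act L (last w) y"
      using LD(4) last_words[OF w] x y by blast
    then show ?thesis unfolding cobd_def length_words[OF w] diff_Suc_1
      using ml cD(2) butlast_words[OF w] act_last[OF w] x y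
      by (simp add: alt_simps sum.distrib algebra_simps)
  qed
  show "cobd G L c w (smul L a x) = sc a (cobd G L c w x)" for a
  proof -
    have "act L (last w) (smul L a x) = smul L a (act L (last w) x)"
      using LD(5) last_words[OF w] x by blast
    moreover have "sc a (alt i y) = alt i (sc a y)" for i y by (simp add: alt_def)
    ultimately show ?thesis unfolding cobd_def length_words[OF w] diff_Suc_1
      using ml cD(3) butlast_words[OF w] act_last[OF w] x
      by (simp add: scale_right_distrib scale_sum_right)
  qed
  show "cobd G L c (lmult G h w) x = \<beta> h (cobd G L c w x)" if h: "h \<in> H" for h
  proof -
    have hG: "h \<in> carrier G" using h H by blast
    have "cobd G L c (lmult G h w) x = cobd G L (\<lambda>w x. \<beta> h (c w x)) w x"
      unfolding cobd_def length_words[OF w] length_words[OF lmult_words[OF w hG]] diff_Suc_1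
      using ml cD(4)[OF _ h] butlast_words[OF w] act_last[OF w] x
      by (simp add: merge_lmult[OF w _ hG] butlast_lmult[OF w] last_lmult[OF w])
    also have "\<dots> = \<beta> h (cobd G L c w x)"
      by (rule cobd_comp[where X = X]) (use \<beta> h X cD w x in auto)
    finally show ?thesis .
  qed
qed

text \<open>Prefixing by \<open>b\<close> is a contracting homotopy of the bar complex.\<close>

lemma cobd_prefix:
  assumes w: "w \<in> words G (Suc m)" and b: "b \<in> carrier G"
  shows "cobd G L c (prefix_word G b w) x = c w x - cobd G L (\<lambda>w. c (prefix_word G b w)) w x"
proof -
  obtain y z v where wv: "w = y # z # v" and yz: "y \<in> carrier G" "z \<in> carrier G"
    using w by (auto simp: words_def length_Suc_conv)
  have l: "length v = m" using w by (simp add: words_def wv)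
  have m0: "merge G 0 (prefix_word G b w) = w"
    using yz b by (simp add: wv merge_def prefix_word_def lmult_def m_assoc[symmetric])
  have mS: "merge G (Suc i) (prefix_word G b w) = prefix_word G b (merge G i w)" if "i < Suc m" for i
    using yz b by (cases i) (auto simp: wv merge_def prefix_word_def lmult_def m_assoc)
  have bl: "butlast (prefix_word G b w) = prefix_word G b (butlast w)"
    "last (prefix_word G b w) = last w"
    by (auto simp: wv prefix_word_def lmult_def)
  have len: "length (prefix_word G b w) = Suc (Suc (Suc m))" "length w = Suc (Suc m)"
    by (auto simp: wv prefix_word_def lmult_def l)
  show ?thesis
    unfolding cobd_def len diff_Suc_1 bl sum.lessThan_Suc_shift[where n = "Suc m"] m0
    by (simp add: alt_simps mS sum_negf)
qed

text \<open>A word \<open>y # z # v\<close> is the prefixed word of (y z) # v by y. Applying the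
  homotopy formula twice reduces the claim to shorter words, so that no double sum over pairs of
  merged positions has to be cancelled; only words of three letters are computed directly.\<close>

lemma cobd_cobd:
  assumes "w \<in> words G (Suc (Suc m))" and x: "x \<in> vecs L"
  shows "cobd G L (cobd G L c) w x = 0"
  using assms(1)
proof (induction m arbitrary: w c)
  case 0
  then obtain g h k where w: "w = [g, h, k]" "g \<in> carrier G" "h \<in> carrier G" "k \<in> carrier G"
    by (auto simp: words_def length_Suc_conv)
  have "act L h (act L k x) = act L (h \<otimes> k) x" using LD(7) w x by simp
  then show ?case using w by (simp add: cobd_def merge_def alt_simps lessThan_Suc m_assoc)
next
  case (Suc m)
  then obtain y z v where wv: "w = y # z # v" and yz: "y \<in> carrier G" "z \<in> carrier G"
    by (auto simp: words_def length_Suc_conv)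
  define u where "u = (y \<otimes> z) # v"
  have u: "u \<in> words G (Suc (Suc m))" using Suc.prems yz by (auto simp: words_def u_def wv)
  have w: "w = prefix_word G y u"
    using yz by (simp add: wv u_def prefix_word_def lmult_def m_assoc[symmetric])
  have "cobd G L (cobd G L c) w x
      = cobd G L c u x - cobd G L (\<lambda>w. cobd G L c (prefix_word G y w)) u x"
    unfolding w by (rule cobd_prefix[OF u yz(1)])
  also have "cobd G L (\<lambda>w. cobd G L c (prefix_word G y w)) u x
      = cobd G L (\<lambda>w x. c w x - cobd G L (\<lambda>w. c (prefix_word G y w)) w x) u x"
    by (rule cobd_cong[OF _ u x]) (rule cobd_prefix[OF _ yz(1)])
  also have "\<dots> = cobd G L c u x"
    using Suc.IH[OF u] by (simp add: cobd_diff)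
  finally show ?case by simp
qed

end

section \<open>A spanning criterion for \<open>Ext\<close>\<close>

text \<open>Gaussian elimination: an unknown \<open>z\<close> that occurs in the last equation is
  eliminated from the others, and its value is recovered from the last equation at the end.\<close>

lemma linear_system_nontrivial_solution:
  fixes a :: "'x \<Rightarrow> nat \<Rightarrow> 'k::field"
  assumes "finite X" "r < card X"
  shows "\<exists>c. (\<exists>x\<in>X. c x \<noteq> 0) \<and> (\<forall>k<r. (\<Sum>x\<in>X. c x * a x k) = 0)"
  using assms
proof (induction r arbitrary: X a)
  case 0
  then show ?case by (intro exI[of _ "\<lambda>_. 1"]) (auto simp: card_gt_0_iff)
next
  case (Suc r)
  show ?case
  proof (cases "\<forall>x\<in>X. a x r = 0")
    case True
    from Suc.IH[of X a] Suc.prems obtain c where c: "\<exists>x\<in>X. c x \<noteq> 0" "\<forall>k<r. (\<Sum>x\<in>X. c x * a x k) = 0"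
      by auto
    with True show ?thesis by (intro exI[of _ c]) (auto simp: less_Suc_eq)
  next
    case False
    then obtain z where z: "z \<in> X" "a z r \<noteq> 0" by blast
    define a' where "a' x k = a x k - a x r / a z r * a z k" for x k
    have "r < card (X - {z})" using Suc.prems z by (simp add: card_Diff_singleton)
    with Suc.IH[of "X - {z}" a'] Suc.prems obtain c where
      c: "\<exists>x\<in>X - {z}. c x \<noteq> 0" "\<And>k. k < r \<Longrightarrow> (\<Sum>x\<in>X - {z}. c x * a' x k) = 0"
      by auto
    define e where "e = - (\<Sum>x\<in>X - {z}. c x * a x r) / a z r"
    define C where "C = c(z := e)"
    have s: "(\<Sum>x\<in>X. C x * a x k) = (\<Sum>x\<in>X - {z}. c x * a x k) + e * a z k" for k
      using Suc.prems(1) z by (subst sum.remove[of X z]) (auto simp: C_def)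
    have "(\<Sum>x\<in>X - {z}. c x * a' x k)
        = (\<Sum>x\<in>X - {z}. c x * a x k) - (\<Sum>x\<in>X - {z}. c x * a x r) * (a z k / a z r)" for k
      unfolding a'_def sum_distrib_right sum_subtractf[symmetric] by (simp add: algebra_simps)
    then have t: "(\<Sum>x\<in>X. C x * a x k) = (\<Sum>x\<in>X - {z}. c x * a' x k)" for k
      unfolding s by (simp add: e_def)
    have "(\<Sum>x\<in>X. C x * a x k) = 0" if "k < Suc r" for k
    proof (cases "k = r")
      case True
      then show ?thesis using s[of r] z by (simp add: e_def)
    next
      case False
      then show ?thesis using t c(2) that by simp
    qed
    moreover have "\<exists>x\<in>X. C x \<noteq> 0" using c(1) by (auto simp: C_def)
    ultimately show ?thesis by blast
  qed
qed

lemma poly_mapping_eq_sum_single: "x = (\<Sum>w\<in>Poly_Mapping.keys x. Poly_Mapping.single w (Poly_Mapping.lookup x w))"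
  by (rule poly_mapping_eqI)
    (simp add: lookup_sum lookup_single when_def sum.delta' in_keys_iff)

context
  fixes G :: "('g, 'b) monoid_scheme" (structure) and L :: "('k::field, 'g, 'v::ab_group_add) gmod"
    and N :: "('k::field, 'g, 'w::ab_group_add) gmod"
  assumes G: "group G" and L: "is_gmod G L" and N: "is_gmod G N"
begin

interpretation group G by (rule G)
interpretation vN: vector_space "smul N" by (rule is_gmodD(1)[OF N])
interpretation vL: vector_space "smul L" by (rule is_gmodD(1)[OF L])

lemmas LDx = is_gmodD[OF L] and NDx = is_gmodD[OF N]
lemmas LSx = subspaceD[OF LDx(1,2)] and NSx = subspaceD[OF NDx(1,2)]

abbreviation "barN \<equiv> bar_mod G L"
abbreviation "Nco \<equiv> cochains G (carrier G) L (smul N) (act N) (vecs N)"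

lemma vecs_bar: "x \<in> vecs (barN m) \<longleftrightarrow> Poly_Mapping.keys x \<subseteq> words G m \<and> (\<forall>w. Poly_Mapping.lookup x w \<in> vecs L)"
  by (auto simp: bar_mod_def words_def)

lemma single_bar: "w \<in> words G m \<Longrightarrow> x \<in> vecs L \<Longrightarrow> Poly_Mapping.single w x \<in> vecs (barN m)"
  using LSx(1) by (auto simp: vecs_bar lookup_single when_def split: if_splits)

lemma vecs_bar_closed:
  "0 \<in> vecs (barN m)" "x \<in> vecs (barN m) \<Longrightarrow> y \<in> vecs (barN m) \<Longrightarrow> x + y \<in> vecs (barN m)"
  "x \<in> vecs (barN m) \<Longrightarrow> - x \<in> vecs (barN m)"
  "(\<And>a. a \<in> A \<Longrightarrow> f a \<in> vecs (barN m)) \<Longrightarrow> sum f A \<in> vecs (barN m)"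
proof -
  show 0: "0 \<in> vecs (barN m)" using LSx(1) by (simp add: vecs_bar)
  show p: "x \<in> vecs (barN m) \<Longrightarrow> y \<in> vecs (barN m) \<Longrightarrow> x + y \<in> vecs (barN m)" for x y
    using LSx(2) Poly_Mapping.keys_add[of x y] by (auto simp: vecs_bar lookup_add)
  show "x \<in> vecs (barN m) \<Longrightarrow> - x \<in> vecs (barN m)"
    using LSx(4) by (auto simp: vecs_bar)
  show "(\<And>a. a \<in> A \<Longrightarrow> f a \<in> vecs (barN m)) \<Longrightarrow> sum f A \<in> vecs (barN m)"
    by (induction A rule: infinite_finite_induct) (use 0 p in auto)
qed

lemma smul_bar_single: "smul (barN m) a (Poly_Mapping.single w x) = Poly_Mapping.single w (smul L a x)"
  by (rule poly_mapping_eqI) (simp add: bar_mod_def Poly_Mapping.map.rep_eq lookup_single when_def)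

lemma act_bar_single: "act (barN m) g (Poly_Mapping.single w x) = Poly_Mapping.single (lmult G g w) x"
  by (cases "x = 0") (simp_all add: bar_mod_def lmult_def)

lemma bar_diff_single:
  assumes "w \<in> words G m"
  shows "bar_diff G L (Poly_Mapping.single w x) = bar_diff_elem G L w x"
proof (cases "x = 0")
  case True
  have "act L g 0 = 0" if "g \<in> carrier G" for g using LDx(5)[OF that LSx(1), of 0] by simp
  then have "act L (last w) 0 = 0" using last_words[OF G L assms] by blast
  with True show ?thesis by (simp add: bar_diff_def bar_diff_elem_def alt_simps)
qed (simp add: bar_diff_def)

lemma bar_diff_elem_alt: "bar_diff_elem G L w x = (\<Sum>i<length w - 1. alt i (Poly_Mapping.single (merge G i w) x)) +
     alt (length w - 1) (Poly_Mapping.single (butlast w) (act L (last w) x))"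
  by (simp add: bar_diff_elem_def merge_def)

lemma vecs_bar_alt: "x \<in> vecs (barN m) \<Longrightarrow> alt i x \<in> vecs (barN m)"
  using vecs_bar_closed(3) by (simp add: alt_def)

lemma bar_diff_elem_vecs: "w \<in> words G (Suc m) \<Longrightarrow> x \<in> vecs L \<Longrightarrow> bar_diff_elem G L w x \<in> vecs (barN m)"
  unfolding bar_diff_elem_alt
  by (intro vecs_bar_closed vecs_bar_alt single_bar)
    (auto simp: length_words[OF G L] intro: merge_words[OF G L] butlast_words[OF G L] act_last[OF G L])

lemma additive_sum:
  assumes add: "\<And>x y. x \<in> vecs (barN m) \<Longrightarrow> y \<in> vecs (barN m) \<Longrightarrow> \<phi> (x + y) = \<phi> x + \<phi> y"
    and f: "\<And>a. a \<in> A \<Longrightarrow> f a \<in> vecs (barN m)"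
  shows "(\<phi> (sum f A) :: 'w) = (\<Sum>a\<in>A. \<phi> (f a))"
proof -
  have 0: "\<phi> 0 = 0" using add[of 0 0] vecs_bar_closed(1) by simp
  show ?thesis using f
  proof (induction A rule: infinite_finite_induct)
    case (insert a A)
    have "\<phi> (f a + sum f A) = \<phi> (f a) + \<phi> (sum f A)"
      by (rule add) (use insert in \<open>auto intro!: vecs_bar_closed(4)\<close>)
    then show ?case using insert by simp
  qed (simp_all add: 0)
qed

lemma additive_bar_diff_elem:
  assumes add: "\<And>x y. x \<in> vecs (barN m) \<Longrightarrow> y \<in> vecs (barN m) \<Longrightarrow> \<phi> (x + y) = \<phi> x + \<phi> y"
    and w: "w \<in> words G (Suc m)" and x: "x \<in> vecs L"
  shows "(\<phi> (bar_diff_elem G L w x) :: 'w) = cobd G L (\<lambda>w x. \<phi> (Poly_Mapping.single w x)) w x"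
proof -
  have al: "\<phi> (alt i y) = alt i (\<phi> y)" if "y \<in> vecs (barN m)" for i y
    by (rule alt_additive[where X = "vecs (barN m)"]) (use add vecs_bar_closed that in auto)
  have m: "Poly_Mapping.single (merge G i w) x \<in> vecs (barN m)" if "i < Suc m" for i
    using single_bar merge_words[OF G L w that] x by blast
  have b: "Poly_Mapping.single (butlast w) (act L (last w) x) \<in> vecs (barN m)"
    using single_bar butlast_words[OF G L w] act_last[OF G L w x] by blast
  have "\<phi> (bar_diff_elem G L w x) = \<phi> (\<Sum>i<Suc m. alt i (Poly_Mapping.single (merge G i w) x)) +
      \<phi> (alt (Suc m) (Poly_Mapping.single (butlast w) (act L (last w) x)))"
    unfolding bar_diff_elem_alt length_words[OF G L w] diff_Suc_1
    by (rule add) (auto intro!: vecs_bar_closed(4) vecs_bar_alt m b simp del: sum.lessThan_Suc)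
  also have "\<phi> (\<Sum>i<Suc m. alt i (Poly_Mapping.single (merge G i w) x))
      = (\<Sum>i<Suc m. \<phi> (alt i (Poly_Mapping.single (merge G i w) x)))"
    by (rule additive_sum[OF add]) (auto intro!: vecs_bar_alt m)
  finally show ?thesis unfolding cobd_def length_words[OF G L w] diff_Suc_1
    using al m b by (simp del: sum.lessThan_Suc)
qed

section \<open>Translation between homomorphisms of bar modules and cochains\<close>

definition coch_of :: "(('g list \<Rightarrow>\<^sub>0 'v) \<Rightarrow> 'w) \<Rightarrow> 'g list \<Rightarrow> 'v \<Rightarrow> 'w" where
  "coch_of \<phi> w x = \<phi> (Poly_Mapping.single w x)"

text \<open>The value 0 off the bar module is what \<open>gmod_hom\<close> demands of its
  members.\<close>

definition hom_of :: "nat \<Rightarrow> ('g list \<Rightarrow> 'v \<Rightarrow> 'w) \<Rightarrow> ('g list \<Rightarrow>\<^sub>0 'v) \<Rightarrow> 'w" where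
  "hom_of m c x = (if x \<in> vecs (barN m) then \<Sum>w\<in>Poly_Mapping.keys x. c w (Poly_Mapping.lookup x w) else 0)"

lemma coch_of_cochains:
  assumes "\<phi> \<in> gmod_hom G (barN m) N"
  shows "coch_of \<phi> \<in> Nco m"
proof (rule cochainsI[OF G L])
  fix w x assume w: "w \<in> words G m" and x: "x \<in> vecs L"
  note s = single_bar[OF w]
  show "coch_of \<phi> w x \<in> vecs N" using s[OF x] assms by (auto simp: gmod_hom_def coch_of_def)
  show "coch_of \<phi> w (x + y) = coch_of \<phi> w x + coch_of \<phi> w y" if "y \<in> vecs L" for y
    using s[OF x] s[OF that] assms by (auto simp: gmod_hom_def coch_of_def single_add)
  show "coch_of \<phi> w (smul L a x) = smul N a (coch_of \<phi> w x)" for a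
    using s[OF x] assms by (auto simp: gmod_hom_def coch_of_def smul_bar_single[of m, symmetric])
  show "coch_of \<phi> (lmult G h w) x = act N h (coch_of \<phi> w x)" if "h \<in> carrier G" for h
    using s[OF x] assms that by (auto simp: gmod_hom_def coch_of_def act_bar_single[of m, symmetric])
qed

lemma hom_eq_sum:
  assumes "\<phi> \<in> gmod_hom G (barN m) N" "x \<in> vecs (barN m)"
  shows "\<phi> x = (\<Sum>w\<in>Poly_Mapping.keys x. coch_of \<phi> w (Poly_Mapping.lookup x w))"
proof -
  have kw: "w \<in> Poly_Mapping.keys x \<Longrightarrow> w \<in> words G m" and l: "Poly_Mapping.lookup x w \<in> vecs L" for w
    using assms(2) by (auto simp: vecs_bar)
  have "\<phi> x = \<phi> (\<Sum>w\<in>Poly_Mapping.keys x. Poly_Mapping.single w (Poly_Mapping.lookup x w))"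
    using poly_mapping_eq_sum_single by metis
  also have "\<dots> = (\<Sum>w\<in>Poly_Mapping.keys x. \<phi> (Poly_Mapping.single w (Poly_Mapping.lookup x w)))"
    by (rule additive_sum) (use assms(1) in \<open>auto simp: gmod_hom_def intro!: single_bar kw l\<close>)
  finally show ?thesis by (simp add: coch_of_def)
qed

lemma cochain_at_0: "c \<in> Nco m \<Longrightarrow> w \<in> words G m \<Longrightarrow> c w 0 = 0"
  using cochainsD(2)[OF G L, of c _ _ _ _ m w 0 0] LSx(1) by fastforce

text \<open>Cancellation may remove keys from a sum, so additivity is checked over a common finite
  set of words that contains the keys of both summands.\<close>

lemma hom_of_superset:
  assumes c: "c \<in> Nco m" and x: "x \<in> vecs (barN m)" and A: "finite A" "Poly_Mapping.keys x \<subseteq> A" "A \<subseteq> words G m"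
  shows "hom_of m c x = (\<Sum>w\<in>A. c w (Poly_Mapping.lookup x w))"
  using x unfolding hom_of_def
  by (auto intro!: sum.mono_neutral_left A simp: in_keys_iff) (use cochain_at_0[OF c] A in blast)

lemma hom_of_add:
  assumes c: "c \<in> Nco m" and x: "x \<in> vecs (barN m)" "y \<in> vecs (barN m)"
  shows "hom_of m c (x + y) = hom_of m c x + hom_of m c y"
proof -
  let ?A = "Poly_Mapping.keys x \<union> Poly_Mapping.keys y"
  have A: "finite ?A" "?A \<subseteq> words G m" using x by (auto simp: vecs_bar)
  have l: "Poly_Mapping.lookup x w \<in> vecs L" "Poly_Mapping.lookup y w \<in> vecs L" for w using x by (auto simp: vecs_bar)
  have "hom_of m c (x + y) = (\<Sum>w\<in>?A. c w (Poly_Mapping.lookup (x + y) w))"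
    by (rule hom_of_superset[OF c vecs_bar_closed(2)[OF x] A(1) Poly_Mapping.keys_add A(2)])
  also have "\<dots> = (\<Sum>w\<in>?A. c w (Poly_Mapping.lookup x w)) + (\<Sum>w\<in>?A. c w (Poly_Mapping.lookup y w))"
    unfolding sum.distrib[symmetric] lookup_add
    by (rule sum.cong[OF refl]) (use A l in \<open>auto intro!: cochainsD(2)[OF G L c]\<close>)
  also have "\<dots> = hom_of m c x + hom_of m c y"
    using hom_of_superset[OF c x(1) A(1) _ A(2)] hom_of_superset[OF c x(2) A(1) _ A(2)] by simp
  finally show ?thesis .
qed

lemma hom_of_single:
  assumes c: "c \<in> Nco m" and w: "w \<in> words G m" and x: "x \<in> vecs L"
  shows "hom_of m c (Poly_Mapping.single w x) = c w x"
  using hom_of_superset[OF c single_bar[OF w x], of "{w}"] w by simp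

lemma hom_of_hom:
  assumes c: "c \<in> Nco m"
  shows "hom_of m c \<in> gmod_hom G (barN m) N"
  unfolding gmod_hom_def
proof (intro CollectI conjI ballI allI impI)
  fix x assume x: "x \<in> vecs (barN m)"
  have kw: "w \<in> Poly_Mapping.keys x \<Longrightarrow> w \<in> words G m" and l: "Poly_Mapping.lookup x w \<in> vecs L" for w
    using x by (auto simp: vecs_bar)
  show "hom_of m c x \<in> vecs N"
    unfolding hom_of_def using x by (auto intro!: NSx(6) NSx(1) cochainsD(1)[OF G L c] kw l)
  show "hom_of m c (x + y) = hom_of m c x + hom_of m c y" if "y \<in> vecs (barN m)" for y
    by (rule hom_of_add[OF c x that])
  show "hom_of m c (smul (barN m) a x) = smul N a (hom_of m c x)" for a
  proof -
    have lk: "Poly_Mapping.lookup (smul (barN m) a x) w = smul L a (Poly_Mapping.lookup x w)" for w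
      by (simp add: bar_mod_def Poly_Mapping.map.rep_eq when_def)
    have ks: "Poly_Mapping.keys (smul (barN m) a x) \<subseteq> Poly_Mapping.keys x"
      by (auto simp: in_keys_iff lk)
    have v: "smul (barN m) a x \<in> vecs (barN m)"
      using ks kw l LSx(3) by (auto simp: vecs_bar lk)
    have "hom_of m c (smul (barN m) a x) = (\<Sum>w\<in>Poly_Mapping.keys x. c w (Poly_Mapping.lookup (smul (barN m) a x) w))"
      by (rule hom_of_superset[OF c v _ ks]) (use kw in auto)
    also have "\<dots> = (\<Sum>w\<in>Poly_Mapping.keys x. smul N a (c w (Poly_Mapping.lookup x w)))"
      by (rule sum.cong[OF refl]) (simp add: lk cochainsD(3)[OF G L c kw l])
    finally show ?thesis using x by (simp add: hom_of_def vN.scale_sum_right)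
  qed
  show "hom_of m c (act (barN m) g x) = act N g (hom_of m c x)" if g: "g \<in> carrier G" for g
  proof -
    have "hom_of m c (act (barN m) g x)
        = (\<Sum>w\<in>Poly_Mapping.keys x. hom_of m c (Poly_Mapping.single (lmult G g w) (Poly_Mapping.lookup x w)))"
      unfolding bar_mod_def gmod.simps lmult_def[symmetric]
      by (rule additive_sum) (auto intro!: hom_of_add[OF c] single_bar lmult_words[OF G L] kw l g)
    also have "\<dots> = (\<Sum>w\<in>Poly_Mapping.keys x. act N g (c w (Poly_Mapping.lookup x w)))"
      by (rule sum.cong[OF refl])
        (simp add: hom_of_single[OF c lmult_words[OF G L]] kw l g cochainsD(4)[OF G L c])
    also have "\<dots> = act N g (\<Sum>w\<in>Poly_Mapping.keys x. c w (Poly_Mapping.lookup x w))"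
    proof -
      have "act N g 0 = 0" using NDx(5)[OF g NSx(1), of 0] by simp
      moreover have "act N g (sum f A) = (\<Sum>a\<in>A. act N g (f a))" if "finite A" "\<And>a. a \<in> A \<Longrightarrow> f a \<in> vecs N" for f and A :: "'g list set"
        using that by (induction A rule: finite_induct) (auto simp: calculation NDx(4)[OF g] NSx(6))
      ultimately show ?thesis using cochainsD(1)[OF G L c kw l] by simp
    qed
    finally show ?thesis using x by (simp add: hom_of_def)
  qed
qed (simp add: hom_of_def)

lemma hom_of_bar_diff:
  assumes c: "c \<in> Nco m" and x: "x \<in> vecs (barN (Suc m))"
  shows "hom_of m c (bar_diff G L x) = (\<Sum>w\<in>Poly_Mapping.keys x. cobd G L c w (Poly_Mapping.lookup x w))"
proof -
  have kw: "w \<in> Poly_Mapping.keys x \<Longrightarrow> w \<in> words G (Suc m)" and l: "Poly_Mapping.lookup x w \<in> vecs L" for w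
    using x by (auto simp: vecs_bar)
  have "hom_of m c (bar_diff G L x) = (\<Sum>w\<in>Poly_Mapping.keys x. hom_of m c (bar_diff_elem G L w (Poly_Mapping.lookup x w)))"
    unfolding bar_diff_def by (rule additive_sum) (auto intro!: hom_of_add[OF c] bar_diff_elem_vecs kw l)
  also have "\<dots> = (\<Sum>w\<in>Poly_Mapping.keys x. cobd G L c w (Poly_Mapping.lookup x w))"
  proof (rule sum.cong[OF refl])
    fix w assume "w \<in> Poly_Mapping.keys x"
    note w = kw[OF this]
    have "hom_of m c (bar_diff_elem G L w (Poly_Mapping.lookup x w))
        = cobd G L (\<lambda>w x. hom_of m c (Poly_Mapping.single w x)) w (Poly_Mapping.lookup x w)"
      by (rule additive_bar_diff_elem[OF hom_of_add[OF c] w l])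
    also have "\<dots> = cobd G L c w (Poly_Mapping.lookup x w)"
      by (rule cobd_cong[OF G L _ w l]) (rule hom_of_single[OF c])
    finally show "hom_of m c (bar_diff_elem G L w (Poly_Mapping.lookup x w)) = cobd G L c w (Poly_Mapping.lookup x w)" .
  qed
  finally show ?thesis .
qed

lemma cocycle_cobd:
  assumes "\<phi> \<in> hom_cocycles G barN (\<lambda>_. bar_diff G L) N m" "w \<in> words G (Suc m)" "x \<in> vecs L"
  shows "cobd G L (coch_of \<phi>) w x = 0"
proof -
  have \<phi>: "\<phi> \<in> gmod_hom G (barN m) N" using assms by (simp add: hom_cocycles_def)
  have "cobd G L (coch_of \<phi>) w x = \<phi> (bar_diff_elem G L w x)"
    unfolding coch_of_def
    by (rule additive_bar_diff_elem[symmetric]) (use \<phi> assms in \<open>auto simp: gmod_hom_def\<close>)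
  also have "\<dots> = \<phi> (bar_diff G L (Poly_Mapping.single w x))" using bar_diff_single[OF assms(2)] by simp
  also have "\<dots> = 0" using assms(1) single_bar[OF assms(2,3)] by (simp add: hom_cocycles_def)
  finally show ?thesis .
qed

text \<open>More than r cocycles admit a nontrivial combination in which the coefficients of all
  \<zeta> k cancel, and what remains is a coboundary. The \<zeta> k enter as mere functions. Degree
  0 is singled out because there 0 is the only coboundary.\<close>

lemma ext_dim_leI:
  fixes \<zeta> :: "nat \<Rightarrow> 'g list \<Rightarrow> 'v \<Rightarrow> 'w"
  assumes span: "\<And>c. c \<in> Nco n \<Longrightarrow> (\<And>w x. w \<in> words G (Suc n) \<Longrightarrow> x \<in> vecs L \<Longrightarrow> cobd G L c w x = 0) \<Longrightarrow>
    \<exists>y a. (n > 0 \<longrightarrow> y \<in> Nco (n - 1)) \<and> (\<forall>w\<in>words G n. \<forall>x\<in>vecs L.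
      c w x = (if n = 0 then 0 else cobd G L y w x) + (\<Sum>k<r. smul N (a k) (\<zeta> k w x)))"
  shows "ext_dim G L N n \<le> enat r"
  unfolding ext_dim_def hom_cohomology_dim_def
proof (rule Sup_least, safe)
  fix X :: "(('g list \<Rightarrow>\<^sub>0 'v) \<Rightarrow> 'w) set"
  let ?B = "hom_coboundaries G barN (\<lambda>_. bar_diff G L) N n"
  assume fin: "finite X" and X: "X \<subseteq> hom_cocycles G barN (\<lambda>_. bar_diff G L) N n"
    and ind: "\<forall>c. (\<lambda>x. \<Sum>\<phi>\<in>X. smul N (c \<phi>) (\<phi> x)) \<in> ?B \<longrightarrow> (\<forall>\<phi>\<in>X. c \<phi> = 0)"
  have hom: "\<phi> \<in> gmod_hom G (barN n) N" if "\<phi> \<in> X" for \<phi> using X that by (auto simp: hom_cocycles_def)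
  have "\<exists>y a. (n > 0 \<longrightarrow> y \<in> Nco (n - 1)) \<and> (\<forall>w\<in>words G n. \<forall>x\<in>vecs L.
      coch_of \<phi> w x = (if n = 0 then 0 else cobd G L y w x) + (\<Sum>k<r. smul N (a k) (\<zeta> k w x)))" if "\<phi> \<in> X" for \<phi>
    using span[OF coch_of_cochains[OF hom[OF that]] cocycle_cobd[OF subsetD[OF X that]]] .
  then have "\<forall>\<phi>\<in>X. \<exists>y a. (n > 0 \<longrightarrow> y \<in> Nco (n - 1)) \<and> (\<forall>w\<in>words G n. \<forall>x\<in>vecs L.
      coch_of \<phi> w x = (if n = 0 then 0 else cobd G L y w x) + (\<Sum>k<r. smul N (a k) (\<zeta> k w x)))" ..
  from bchoice[OF this] obtain y where "\<forall>\<phi>\<in>X. \<exists>a. (n > 0 \<longrightarrow> y \<phi> \<in> Nco (n - 1)) \<and> (\<forall>w\<in>words G n. \<forall>x\<in>vecs L.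
      coch_of \<phi> w x = (if n = 0 then 0 else cobd G L (y \<phi>) w x) + (\<Sum>k<r. smul N (a k) (\<zeta> k w x)))" ..
  from bchoice[OF this] obtain a where ya': "\<forall>\<phi>\<in>X. (n > 0 \<longrightarrow> y \<phi> \<in> Nco (n - 1)) \<and> (\<forall>w\<in>words G n. \<forall>x\<in>vecs L.
      coch_of \<phi> w x = (if n = 0 then 0 else cobd G L (y \<phi>) w x) + (\<Sum>k<r. smul N (a \<phi> k) (\<zeta> k w x)))" ..
  have ya: "\<And>\<phi>. \<phi> \<in> X \<Longrightarrow> n > 0 \<Longrightarrow> y \<phi> \<in> Nco (n - 1)"
    "\<And>\<phi> w x. \<phi> \<in> X \<Longrightarrow> w \<in> words G n \<Longrightarrow> x \<in> vecs L \<Longrightarrow> coch_of \<phi> w x = (if n = 0 then 0 else cobd G L (y \<phi>) w x) + (\<Sum>k<r. smul N (a \<phi> k) (\<zeta> k w x))"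
    using ya' by blast+
  show "enat (card X) \<le> enat r"
  proof (rule ccontr)
    assume "\<not> enat (card X) \<le> enat r"
    then have "r < card X" by simp
    \<comment> \<open>The cancellation of the \<zeta> k is a system of r homogeneous equations in
      \<open>card X\<close> unknowns.\<close>
    from linear_system_nontrivial_solution[OF fin this, of a] obtain c where
      c: "\<exists>\<phi>\<in>X. c \<phi> \<noteq> 0" "\<And>k. k < r \<Longrightarrow> (\<Sum>\<phi>\<in>X. c \<phi> * a \<phi> k) = 0" by blast
    define Y where "Y w x = (\<Sum>\<phi>\<in>X. smul N (c \<phi>) (y \<phi> w x))" for w x
    have comb: "(\<Sum>\<phi>\<in>X. smul N (c \<phi>) (coch_of \<phi> w x)) = (if n = 0 then 0 else cobd G L Y w x)"
      if w: "w \<in> words G n" and x: "x \<in> vecs L" for w x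
    proof -
      have "(\<Sum>\<phi>\<in>X. smul N (c \<phi>) (\<Sum>k<r. smul N (a \<phi> k) (\<zeta> k w x)))
          = (\<Sum>k<r. \<Sum>\<phi>\<in>X. smul N (c \<phi> * a \<phi> k) (\<zeta> k w x))"
        by (simp add: vN.scale_sum_right sum.swap[of _ X])
      also have "\<dots> = 0" by (rule sum.neutral) (auto simp: vN.scale_sum_left[symmetric] c(2))
      finally have z: "(\<Sum>\<phi>\<in>X. smul N (c \<phi>) (\<Sum>k<r. smul N (a \<phi> k) (\<zeta> k w x))) = 0" .
      have "(\<Sum>\<phi>\<in>X. smul N (c \<phi>) (coch_of \<phi> w x))
          = (\<Sum>\<phi>\<in>X. smul N (c \<phi>) (if n = 0 then 0 else cobd G L (y \<phi>) w x))"
        using z by (simp add: ya(2) w x vN.scale_right_distrib sum.distrib)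
      also have "\<dots> = (if n = 0 then 0 else cobd G L Y w x)"
        unfolding Y_def cobd_sum[OF G L] cobd_scale[OF G L is_gmodD(1)[OF N]] by auto
      finally show ?thesis .
    qed
    have "(\<lambda>x. \<Sum>\<phi>\<in>X. smul N (c \<phi>) (\<phi> x)) \<in> ?B"
    proof -
      have val: "(\<Sum>\<phi>\<in>X. smul N (c \<phi>) (\<phi> x)) = (if x \<in> vecs (barN n) then
          \<Sum>w\<in>Poly_Mapping.keys x. (if n = 0 then 0 else cobd G L Y w (Poly_Mapping.lookup x w)) else 0)" for x
      proof (cases "x \<in> vecs (barN n)")
        case True
        have "(\<Sum>\<phi>\<in>X. smul N (c \<phi>) (\<phi> x))
            = (\<Sum>\<phi>\<in>X. smul N (c \<phi>) (\<Sum>w\<in>Poly_Mapping.keys x. coch_of \<phi> w (Poly_Mapping.lookup x w)))"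
          by (rule sum.cong[OF refl]) (simp add: hom_eq_sum[OF hom True])
        also have "\<dots> = (\<Sum>w\<in>Poly_Mapping.keys x. \<Sum>\<phi>\<in>X. smul N (c \<phi>) (coch_of \<phi> w (Poly_Mapping.lookup x w)))"
          by (simp add: vN.scale_sum_right sum.swap[of _ X])
        also have "\<dots> = (\<Sum>w\<in>Poly_Mapping.keys x. (if n = 0 then 0 else cobd G L Y w (Poly_Mapping.lookup x w)))"
          by (rule sum.cong[OF refl], rule comb) (use True in \<open>auto simp: vecs_bar\<close>)
        finally show ?thesis using True by simp
      next
        case False
        then show ?thesis using hom by (auto simp: gmod_hom_def intro!: sum.neutral)
      qed
      show ?thesis
      proof (cases n)
        case 0
        then have "(\<lambda>x. \<Sum>\<phi>\<in>X. smul N (c \<phi>) (\<phi> x)) = (\<lambda>_. 0)" by (intro ext) (simp add: val)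
        then show ?thesis using 0 by simp
      next
        case (Suc m)
        have Y: "Y \<in> Nco m"
        proof (rule cochainsI[OF G L])
          fix w x assume w: "w \<in> words G m" and x: "x \<in> vecs L"
          have yc: "y \<phi> \<in> Nco m" if "\<phi> \<in> X" for \<phi> using ya(1)[OF that] Suc by simp
          note yD = cochainsD[OF G L yc w]
          show "Y w x \<in> vecs N" unfolding Y_def by (intro NSx yD x)
          show "Y w (x + z) = Y w x + Y w z" if "z \<in> vecs L" for z
            unfolding Y_def by (simp add: yD(2)[OF _ x that] vN.scale_right_distrib sum.distrib)
          show "Y w (smul L e x) = smul N e (Y w x)" for e
            unfolding Y_def by (simp add: yD(3)[OF _ x] vN.scale_sum_right mult.commute)
          show "Y (lmult G h w) x = act N h (Y w x)" if h: "h \<in> carrier G" for h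
          proof -
            have "act N h (\<Sum>\<phi>\<in>A. smul N (c \<phi>) (y \<phi> w x)) = (\<Sum>\<phi>\<in>A. smul N (c \<phi>) (act N h (y \<phi> w x)))"
              if "finite A" "A \<subseteq> X" for A
              using that
            proof (induction A rule: finite_induct)
              case empty
              show ?case using NDx(5)[OF h NSx(1), of 0] by simp
            next
              case (insert z A)
              have 1: "y \<phi> w x \<in> vecs N" if "\<phi> \<in> insert z A" for \<phi>
                using insert.prems that x by (intro yD(1)) auto
              have 2: "(\<Sum>\<phi>\<in>A. smul N (c \<phi>) (y \<phi> w x)) \<in> vecs N" by (intro NSx 1) auto
              show ?case using insert NDx(4)[OF h NSx(3)[OF 1] 2] NDx(5)[OF h 1] by simp
            qed
            then show ?thesis unfolding Y_def using fin by (simp add: yD(4)[OF _ h x])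
          qed
        qed
        have "(\<lambda>x. \<Sum>\<phi>\<in>X. smul N (c \<phi>) (\<phi> x))
            = (\<lambda>x. if x \<in> vecs (barN (Suc m)) then hom_of m Y (bar_diff G L x) else 0)"
          by (rule ext) (simp add: val Suc hom_of_bar_diff[OF Y])
        then show ?thesis using hom_of_hom[OF Y] Suc by auto
      qed
    qed
    then show False using ind c(1) by blast
  qed
qed

end

section \<open>Dimension shifting along a relatively injective resolution\<close>

text \<open>The map \<open>h\<close> is only k-linear and expresses exactness over k. Relative
  injectivity is the trace identity for \<theta>, which is Higman's criterion relative to the
  trivial subgroup. All terms are subspaces of one ambient space, so that a single \<open>D\<close>,
  \<open>h\<close> and \<theta> serve every degree.\<close>

locale resolution = group G for G (structure) +
  fixes B :: "'g set" and L :: "('k::field, 'g, 'v::ab_group_add) gmod"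
    and sc :: "'k \<Rightarrow> 'i::ab_group_add \<Rightarrow> 'i" and \<beta> :: "'g \<Rightarrow> 'i \<Rightarrow> 'i" and I :: "nat \<Rightarrow> 'i set"
    and D h \<theta> :: "'i \<Rightarrow> 'i"
  assumes B: "subgroup B G" and fin_B: "finite B"
    and L: "is_gmod G L"
    and vs: "vector_space sc" and I_sub: "module.subspace sc (I i)"
    and \<beta>_lin: "b \<in> B \<Longrightarrow> Vector_Spaces.linear sc sc (\<beta> b)"
    and \<beta>_I: "b \<in> B \<Longrightarrow> x \<in> I i \<Longrightarrow> \<beta> b x \<in> I i"
    and \<beta>_mult: "b \<in> B \<Longrightarrow> b' \<in> B \<Longrightarrow> x \<in> I i \<Longrightarrow> \<beta> (b \<otimes> b') x = \<beta> b (\<beta> b' x)"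
    and \<beta>_one: "x \<in> I i \<Longrightarrow> \<beta> \<one> x = x"
    and D_lin: "Vector_Spaces.linear sc sc D" and D_I: "x \<in> I i \<Longrightarrow> D x \<in> I (Suc i)"
    and D_D: "x \<in> I i \<Longrightarrow> D (D x) = 0"
    and D_\<beta>: "b \<in> B \<Longrightarrow> x \<in> I i \<Longrightarrow> D (\<beta> b x) = \<beta> b (D x)"
    and h_lin: "Vector_Spaces.linear sc sc h" and h_I: "x \<in> I (Suc i) \<Longrightarrow> h x \<in> I i"
    and D_h: "x \<in> I (Suc i) \<Longrightarrow> D x = 0 \<Longrightarrow> D (h x) = x"
    and \<theta>_lin: "Vector_Spaces.linear sc sc \<theta>" and \<theta>_I: "x \<in> I i \<Longrightarrow> \<theta> x \<in> I i"
    and trace_\<theta>: "x \<in> I i \<Longrightarrow> (\<Sum>b\<in>B. \<beta> b (\<theta> (\<beta> (inv b) x))) = x"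
begin

sublocale V: vector_space sc by (rule vs)

lemma linD:
  assumes "Vector_Spaces.linear sc sc f"
  shows "f (x + y) = f x + f y" "f (sc a x) = sc a (f x)" "f 0 = 0" "f (x - y) = f x - f y"
    "f (sum g A) = (\<Sum>a\<in>A. f (g a))"
proof -
  interpret Vector_Spaces.linear sc sc f by fact
  show "f (x + y) = f x + f y" "f (sc a x) = sc a (f x)" "f 0 = 0" "f (x - y) = f x - f y"
    "f (sum g A) = (\<Sum>a\<in>A. f (g a))"
    by (rule add scale zero diff sum)+
qed

lemmas \<beta>D = linD[OF \<beta>_lin] and DD = linD[OF D_lin] and hD = linD[OF h_lin] and \<theta>D = linD[OF \<theta>_lin]
lemmas I_D = subspaceD[OF vs I_sub]

lemma B_carrier: "b \<in> B \<Longrightarrow> b \<in> carrier G"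
  using subgroup.mem_carrier[OF B] .

lemma B_inv: "b \<in> B \<Longrightarrow> inv b \<in> B"
  using subgroup.m_inv_closed[OF B] .

lemma B_mult: "b \<in> B \<Longrightarrow> b' \<in> B \<Longrightarrow> b \<otimes> b' \<in> B"
  using subgroup.m_closed[OF B] .

text \<open>The kernel in degree i; by \<open>D_h\<close> the map \<open>D\<close> sends
  \<open>I i\<close> onto \<open>N (Suc i)\<close>. The short exact sequences with terms N i, I i, N
  (i + 1) drive the dimension shift.\<close>

definition N :: "nat \<Rightarrow> 'i set" where
  "N i = {x \<in> I i. D x = 0}"

lemma N_sub: "module.subspace sc (N i)"
  unfolding V.subspace_def N_def using I_D DD by auto

lemmas N_D = subspaceD[OF vs N_sub]

abbreviation "BC \<equiv> cochains G B L sc \<beta>"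

abbreviation cocycle :: "nat \<Rightarrow> ('g list \<Rightarrow> 'v \<Rightarrow> 'i) \<Rightarrow> bool" where
  "cocycle m c \<equiv> (\<forall>w\<in>words G (Suc m). \<forall>x\<in>vecs L. cobd G L c w x = 0)"

lemma BC_mono: "c \<in> BC X m \<Longrightarrow> X \<subseteq> Y \<Longrightarrow> c \<in> BC Y m"
  unfolding cochains_def by auto

lemma N_subset: "N i \<subseteq> I i"
  by (auto simp: N_def)

lemma cobd_BC:
  assumes "c \<in> BC X m" "module.subspace sc X"
  shows "cobd G L c \<in> BC X (Suc m)"
  by (rule cobd_cochains[OF is_group L assms(1) vs assms(2)]) (use \<beta>D(1) B_carrier in auto)

lemma comp_BC:
  assumes c: "c \<in> BC (I i) m" and f: "Vector_Spaces.linear sc sc f"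
    and X: "\<And>x. x \<in> I i \<Longrightarrow> f x \<in> X" and \<beta>: "\<And>b x. b \<in> B \<Longrightarrow> x \<in> I i \<Longrightarrow> f (\<beta> b x) = \<beta> b (f x)"
  shows "(\<lambda>w x. f (c w x)) \<in> BC X m"
  by (rule cochainsI[OF is_group L]) (auto simp: cochainsD[OF is_group L c] X linD[OF f] \<beta>)

lemma cobd_linear:
  assumes c: "c \<in> BC (I i) m" and f: "Vector_Spaces.linear sc sc f" and w: "w \<in> words G (Suc m)" and x: "x \<in> vecs L"
  shows "cobd G L (\<lambda>w x. f (c w x)) w x = f (cobd G L c w x)"
  by (rule cobd_comp[OF is_group L _ vs I_sub[of i] _ w x]) (auto simp: linD[OF f] cochainsD(1)[OF is_group L c])

text \<open>The factor b in g = b r, where r is the chosen representative of the right coset of g.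
  It exhibits the bar modules as free over \<open>B\<close>, with the words whose first letter is a
  representative as basis.\<close>

definition bpart :: "'g \<Rightarrow> 'g" where
  "bpart g = g \<otimes> inv (SOME r. r \<in> B #> g)"

lemma bpart_B: "g \<in> carrier G \<Longrightarrow> bpart g \<in> B"
proof -
  assume g: "g \<in> carrier G"
  have "(SOME r. r \<in> B #> g) \<in> B #> g" using rcos_self[OF g B] by (rule someI)
  then obtain b where b: "b \<in> B" "(SOME r. r \<in> B #> g) = b \<otimes> g" by (auto simp: r_coset_def)
  then have "bpart g = inv b"
    using g B_carrier[OF b(1)] by (simp add: bpart_def inv_mult_group m_assoc[symmetric])
  then show ?thesis using B_inv b by simp
qed

lemma bpart_mult: "g \<in> carrier G \<Longrightarrow> b \<in> B \<Longrightarrow> bpart (b \<otimes> g) = b \<otimes> bpart g"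
proof -
  assume g: "g \<in> carrier G" and b: "b \<in> B"
  have "b \<otimes> g \<in> B #> g" using b by (auto simp: r_coset_def)
  then have e: "B #> (b \<otimes> g) = B #> g" using repr_independence[OF _ g B] by metis
  have "(SOME r. r \<in> B #> g) \<in> B #> g" using rcos_self[OF g B] by (rule someI)
  then have "(SOME r. r \<in> B #> g) \<in> carrier G"
    using r_coset_subset_G[OF _ g] subgroup.subset[OF B] by blast
  then show ?thesis using e g B_carrier[OF b] by (simp add: bpart_def m_assoc)
qed

lemma hd_lmult: "hd (lmult G g w) = g \<otimes> hd w"
  by (simp add: lmult_def)

text \<open>On a word that begins with a coset representative \<open>h\<close> gives a preimage
  under \<open>D\<close>; equivariance transports it to all other words. This is the projectivity of
  the bar modules over \<open>B\<close>, and it makes up for the lack of equivariance of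
  \<open>h\<close>.\<close>

lemma lift_cochain:
  assumes c: "c \<in> BC (N (Suc i)) m"
  obtains g where "g \<in> BC (I i) m" "\<And>w x. w \<in> words G m \<Longrightarrow> x \<in> vecs L \<Longrightarrow> D (g w x) = c w x"
proof -
  note cD = cochainsD[OF is_group L c]
  define g where "g w x = \<beta> (bpart (hd w)) (h (\<beta> (inv (bpart (hd w))) (c w x)))" for w x
  have bp: "bpart (hd w) \<in> B" if "w \<in> words G m" for w
    using bpart_B hd_words[OF is_group L that] by blast
  have cI: "c w x \<in> I (Suc i)" "D (c w x) = 0" if "w \<in> words G m" "x \<in> vecs L" for w x
    using cD(1)[OF that] by (auto simp: N_def)
  have "g \<in> BC (I i) m"
  proof (rule cochainsI[OF is_group L])
    fix w x assume w: "w \<in> words G m" and x: "x \<in> vecs L"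
    note b = bp[OF w] B_inv[OF bp[OF w]]
    show "g w x \<in> I i" unfolding g_def using b cI[OF w x] by (intro \<beta>_I h_I)
    show "g w (x + y) = g w x + g w y" if "y \<in> vecs L" for y
      unfolding g_def using b by (simp add: cD(2)[OF w x that] \<beta>D hD)
    show "g w (smul L a x) = sc a (g w x)" for a
      unfolding g_def using b by (simp add: cD(3)[OF w x] \<beta>D hD)
    show "g (lmult G y w) x = \<beta> y (g w x)" if y: "y \<in> B" for y
    proof -
      have e: "bpart (hd (lmult G y w)) = y \<otimes> bpart (hd w)"
        unfolding hd_lmult using bpart_mult hd_words[OF is_group L w] y by blast
      have i: "inv (y \<otimes> bpart (hd w)) = inv (bpart (hd w)) \<otimes> inv y"
        using y b by (simp add: inv_mult_group B_carrier)
      have "\<beta> (inv (y \<otimes> bpart (hd w))) (\<beta> y (c w x)) = \<beta> (inv (bpart (hd w))) (c w x)"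
      proof -
        have "\<beta> (inv (y \<otimes> bpart (hd w))) (\<beta> y (c w x)) = \<beta> (inv (y \<otimes> bpart (hd w)) \<otimes> y) (c w x)"
          using \<beta>_mult[OF _ y cI(1)[OF w x], of "inv (y \<otimes> bpart (hd w))"] y b B_inv B_mult by simp
        also have "inv (y \<otimes> bpart (hd w)) \<otimes> y = inv (bpart (hd w))"
          unfolding i using y b by (simp add: B_carrier m_assoc)
        finally show ?thesis .
      qed
      moreover have "h (\<beta> (inv (bpart (hd w))) (c w x)) \<in> I i"
        using b cI[OF w x] by (intro \<beta>_I h_I)
      ultimately show ?thesis unfolding g_def e using \<beta>_mult[OF y b(1)] cD(4)[OF w y x] by simp
    qed
  qed
  moreover have "D (g w x) = c w x" if w: "w \<in> words G m" and x: "x \<in> vecs L" for w x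
  proof -
    note b = bp[OF w] B_inv[OF bp[OF w]]
    have 1: "\<beta> (inv (bpart (hd w))) (c w x) \<in> I (Suc i)" using b cI[OF w x] by (intro \<beta>_I)
    have 2: "D (\<beta> (inv (bpart (hd w))) (c w x)) = 0"
      using D_\<beta>[OF b(2) cI(1)[OF w x]] cI(2)[OF w x] \<beta>D(3)[OF b(2)] by simp
    have "D (g w x) = \<beta> (bpart (hd w)) (\<beta> (inv (bpart (hd w))) (c w x))"
      unfolding g_def using D_\<beta>[OF b(1) h_I[OF 1]] D_h[OF 1 2] by simp
    also have "\<dots> = c w x"
      using \<beta>_mult[OF b cI(1)[OF w x]] \<beta>_one[OF cI(1)[OF w x]] b(1) B_carrier by simp
    finally show ?thesis .
  qed
  ultimately show ?thesis using that by blast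
qed

text \<open>Averaging the contraction \<open>prefix_word\<close> over \<open>B\<close> with weights \<open>\<theta>\<close> makes it equivariant.\<close>

lemma contract_cochain:
  assumes c: "c \<in> BC (I i) (Suc m)" and z: "cocycle (Suc m) c"
  obtains g where "g \<in> BC (I i) m" "\<And>w x. w \<in> words G (Suc m) \<Longrightarrow> x \<in> vecs L \<Longrightarrow> cobd G L g w x = c w x"
proof -
  note cD = cochainsD[OF is_group L c]
  define g where "g w x = (\<Sum>b\<in>B. \<beta> b (\<theta> (\<beta> (inv b) (c (prefix_word G b w) x))))" for w x
  have pw: "prefix_word G b w \<in> words G (Suc k)" if "w \<in> words G k" "b \<in> B" for w b k
    using prefix_words[OF is_group L that(1)] B_carrier[OF that(2)] .
  have "g \<in> BC (I i) m"
  proof (rule cochainsI[OF is_group L])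
    fix w x assume w: "w \<in> words G m" and x: "x \<in> vecs L"
    show "g w x \<in> I i" unfolding g_def
      by (rule I_D(6)) (auto intro!: \<beta>_I \<theta>_I B_inv cD(1) pw w x)
    show "g w (x + y) = g w x + g w y" if "y \<in> vecs L" for y
      unfolding g_def sum.distrib[symmetric]
      by (rule sum.cong[OF refl]) (simp add: cD(2)[OF pw[OF w] x that] \<beta>D[OF B_inv] \<beta>D \<theta>D)
    show "g w (smul L a x) = sc a (g w x)" for a
      unfolding g_def V.scale_sum_right
      by (rule sum.cong[OF refl]) (simp add: cD(3)[OF pw[OF w] x] \<beta>D[OF B_inv] \<beta>D \<theta>D)
    show "g (lmult G y w) x = \<beta> y (g w x)" if y: "y \<in> B" for y
    proof -
      have bij: "bij_betw (\<lambda>b. y \<otimes> b) B B"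
        by (rule bij_betwI[where g = "\<lambda>b. inv y \<otimes> b"])
          (use y in \<open>auto simp: B_mult B_inv B_carrier m_assoc[symmetric]\<close>)
      \<comment> \<open>The summation is translated by \<open>y\<close>, since prefixing y w by y b
        is the same as prefixing w by b and then multiplying by y.\<close>
      have "g (lmult G y w) x = (\<Sum>b\<in>B. \<beta> (y \<otimes> b) (\<theta> (\<beta> (inv (y \<otimes> b)) (c (prefix_word G (y \<otimes> b) (lmult G y w)) x))))"
        unfolding g_def by (rule sum.reindex_bij_betw[OF bij, symmetric])
      also have "\<dots> = (\<Sum>b\<in>B. \<beta> y (\<beta> b (\<theta> (\<beta> (inv b) (c (prefix_word G b w) x)))))"
      proof (rule sum.cong[OF refl])
        fix b assume b: "b \<in> B"
        note BC = B_carrier[OF b] B_carrier[OF y]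
        have "prefix_word G (y \<otimes> b) (lmult G y w) = lmult G y (prefix_word G b w)"
          using w BC by (simp add: prefix_word_def lmult_lmult[OF is_group L] inv_mult_group m_assoc)
            (simp add: lmult_def)
        then have 1: "c (prefix_word G (y \<otimes> b) (lmult G y w)) x = \<beta> y (c (prefix_word G b w) x)"
          using cD(4)[OF pw[OF w b] y x] by simp
        have cx: "c (prefix_word G b w) x \<in> I i" using cD(1)[OF pw[OF w b] x] .
        have "\<beta> (inv (y \<otimes> b)) (\<beta> y (c (prefix_word G b w) x)) = \<beta> (inv (y \<otimes> b) \<otimes> y) (c (prefix_word G b w) x)"
          using \<beta>_mult[OF _ y cx, of "inv (y \<otimes> b)"] y b B_inv B_mult by simp
        also have "inv (y \<otimes> b) \<otimes> y = inv b" using BC by (simp add: inv_mult_group m_assoc)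
        finally have 2: "\<beta> (inv (y \<otimes> b)) (\<beta> y (c (prefix_word G b w) x)) = \<beta> (inv b) (c (prefix_word G b w) x)" .
        have "\<theta> (\<beta> (inv b) (c (prefix_word G b w) x)) \<in> I i" using cx b B_inv by (intro \<theta>_I \<beta>_I)
        then show "\<beta> (y \<otimes> b) (\<theta> (\<beta> (inv (y \<otimes> b)) (c (prefix_word G (y \<otimes> b) (lmult G y w)) x)))
            = \<beta> y (\<beta> b (\<theta> (\<beta> (inv b) (c (prefix_word G b w) x))))"
          unfolding 1 2 using \<beta>_mult[OF y b] by simp
      qed
      also have "\<dots> = \<beta> y (g w x)" unfolding g_def by (simp add: \<beta>D(5)[OF y])
      finally show ?thesis .
    qed
  qed
  moreover have "cobd G L g w x = c w x" if w: "w \<in> words G (Suc m)" and x: "x \<in> vecs L" for w x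
  proof -
    have "cobd G L g w x = (\<Sum>b\<in>B. cobd G L (\<lambda>w x. \<beta> b (\<theta> (\<beta> (inv b) (c (prefix_word G b w) x)))) w x)"
      unfolding g_def by (rule cobd_sum[OF is_group L])
    also have "\<dots> = (\<Sum>b\<in>B. \<beta> b (\<theta> (\<beta> (inv b) (c w x))))"
    proof (rule sum.cong[OF refl])
      fix b assume b: "b \<in> B"
      have "cobd G L (\<lambda>w x. \<beta> b (\<theta> (\<beta> (inv b) (c (prefix_word G b w) x)))) w x
          = \<beta> b (\<theta> (\<beta> (inv b) (cobd G L (\<lambda>w x. c (prefix_word G b w) x) w x)))"
        by (rule cobd_comp[OF is_group L, where f = "\<lambda>u. \<beta> b (\<theta> (\<beta> (inv b) u))", OF _ vs I_sub[of i] _ w x])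
          (auto simp: \<beta>D[OF b] \<beta>D[OF B_inv[OF b]] \<theta>D intro!: cD(1) pw b)
      \<comment> \<open>The other term of the homotopy formula is the coboundary of the cocycle
        \<open>c\<close>, hence 0.\<close>
      also have "cobd G L (\<lambda>w x. c (prefix_word G b w) x) w x = c w x"
        using cobd_prefix[OF is_group L w B_carrier[OF b], of c x] z pw[OF w b] x by simp
      finally show "cobd G L (\<lambda>w x. \<beta> b (\<theta> (\<beta> (inv b) (c (prefix_word G b w) x)))) w x = \<beta> b (\<theta> (\<beta> (inv b) (c w x)))" .
    qed
    also have "\<dots> = c w x" by (rule trace_\<theta>[OF cD(1)[OF w x]])
    finally show ?thesis .
  qed
  ultimately show ?thesis using that by blast
qed

definition lin_comb :: "nat \<Rightarrow> (nat \<Rightarrow> 'k) \<Rightarrow> (nat \<Rightarrow> 'g list \<Rightarrow> 'v \<Rightarrow> 'i) \<Rightarrow> 'g list \<Rightarrow> 'v \<Rightarrow> 'i" where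
  "lin_comb r a \<zeta> w x = (\<Sum>k<r. sc (a k) (\<zeta> k w x))"

lemma diff_BC:
  assumes c: "c \<in> BC X m" and c': "c' \<in> BC X m" and X: "module.subspace sc X"
  shows "(\<lambda>w x. c w x - c' w x) \<in> BC X m"
  by (rule cochainsI[OF is_group L])
    (auto simp: cochainsD[OF is_group L c] cochainsD[OF is_group L c'] subspaceD(5)[OF vs X] V.scale_right_diff_distrib \<beta>D)

lemma lin_comb_BC:
  assumes c: "\<And>k. k < r \<Longrightarrow> \<zeta> k \<in> BC X m" and X: "module.subspace sc X"
  shows "lin_comb r a \<zeta> \<in> BC X m"
proof (rule cochainsI[OF is_group L])
  fix w x assume w: "w \<in> words G m" and x: "x \<in> vecs L"
  note cD = cochainsD[OF is_group L c w]
  show "lin_comb r a \<zeta> w x \<in> X"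
    unfolding lin_comb_def by (rule subspaceD(6)[OF vs X]) (auto intro!: subspaceD(3)[OF vs X] cD(1) x)
  show "lin_comb r a \<zeta> w (x + y) = lin_comb r a \<zeta> w x + lin_comb r a \<zeta> w y" if "y \<in> vecs L" for y
    unfolding lin_comb_def sum.distrib[symmetric]
    by (rule sum.cong[OF refl]) (simp add: cD(2)[OF _ x that] V.scale_right_distrib)
  show "lin_comb r a \<zeta> w (smul L e x) = sc e (lin_comb r a \<zeta> w x)" for e
    unfolding lin_comb_def V.scale_sum_right
    by (rule sum.cong[OF refl]) (simp add: cD(3)[OF _ x] mult.commute)
  show "lin_comb r a \<zeta> (lmult G y w) x = \<beta> y (lin_comb r a \<zeta> w x)" if y: "y \<in> B" for y
    unfolding lin_comb_def \<beta>D(5)[OF y]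
    by (rule sum.cong[OF refl]) (simp add: cD(4)[OF _ y x] \<beta>D(2)[OF y])
qed

lemma lin_comb_linear:
  "Vector_Spaces.linear sc sc f \<Longrightarrow> f (lin_comb r a \<zeta> w x) = lin_comb r a (\<lambda>k w x. f (\<zeta> k w x)) w x"
  by (simp add: lin_comb_def linD)

lemma lin_comb_cong:
  "(\<And>k. k < r \<Longrightarrow> \<zeta> k w x = \<zeta>' k w x) \<Longrightarrow> lin_comb r a \<zeta> w x = lin_comb r a \<zeta>' w x"
  by (simp add: lin_comb_def)

lemma cobd_lin_comb: "cobd G L (lin_comb r a \<zeta>) w x = lin_comb r a (\<lambda>k. cobd G L (\<zeta> k)) w x"
  unfolding lin_comb_def cobd_sum[OF is_group L] cobd_scale[OF is_group L vs] ..

text \<open>Both predicates bound the dimension of a cohomology group by \<open>r\<close>: the first one modulo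
  coboundaries, the second one modulo cocycles that come from \<open>I i\<close>.\<close>

definition ext_bound :: "nat \<Rightarrow> nat \<Rightarrow> nat \<Rightarrow> bool" where
  "ext_bound r i m \<longleftrightarrow> (\<exists>\<zeta>. (\<forall>k<r. \<zeta> k \<in> BC (N i) (Suc m) \<and> cocycle (Suc m) (\<zeta> k)) \<and>
     (\<forall>c\<in>BC (N i) (Suc m). cocycle (Suc m) c \<longrightarrow>
       (\<exists>y\<in>BC (N i) m. \<exists>a. \<forall>w\<in>words G (Suc m). \<forall>x\<in>vecs L. c w x = cobd G L y w x + lin_comb r a \<zeta> w x)))"

definition hom_bound :: "nat \<Rightarrow> nat \<Rightarrow> nat \<Rightarrow> bool" where
  "hom_bound r i m \<longleftrightarrow> (\<exists>\<zeta>. (\<forall>k<r. \<zeta> k \<in> BC (N (Suc i)) m \<and> cocycle m (\<zeta> k)) \<and>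
     (\<forall>c\<in>BC (N (Suc i)) m. cocycle m c \<longrightarrow>
       (\<exists>y\<in>BC (I i) m. cocycle m y \<and> (\<exists>a. \<forall>w\<in>words G m. \<forall>x\<in>vecs L. c w x = D (y w x) + lin_comb r a \<zeta> w x))))"

text \<open>A coboundary of y with values in \<open>N (Suc i)\<close> is \<open>D\<close> applied to
  the coboundary of a lift of y to \<open>I i\<close>, and the latter is a cocycle. So coboundaries
  are among the cocycles that come from \<open>I i\<close>.\<close>

lemma ext_bound_imp_hom_bound:
  assumes "ext_bound r (Suc i) m"
  shows "hom_bound r i (Suc m)"
proof -
  from assms obtain \<zeta> where \<zeta>: "\<forall>k<r. \<zeta> k \<in> BC (N (Suc i)) (Suc m) \<and> cocycle (Suc m) (\<zeta> k)"
    and sp: "\<And>c. c \<in> BC (N (Suc i)) (Suc m) \<Longrightarrow> cocycle (Suc m) c \<Longrightarrow>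
       \<exists>y\<in>BC (N (Suc i)) m. \<exists>a. \<forall>w\<in>words G (Suc m). \<forall>x\<in>vecs L. c w x = cobd G L y w x + lin_comb r a \<zeta> w x"
    unfolding ext_bound_def by blast
  show ?thesis unfolding hom_bound_def
  proof (intro exI[of _ \<zeta>] conjI \<zeta> ballI impI)
    fix c assume c: "c \<in> BC (N (Suc i)) (Suc m)" "cocycle (Suc m) c"
    from sp[OF this] obtain y a where y: "y \<in> BC (N (Suc i)) m"
      and e: "\<forall>w\<in>words G (Suc m). \<forall>x\<in>vecs L. c w x = cobd G L y w x + lin_comb r a \<zeta> w x" by blast
    obtain g where g: "g \<in> BC (I i) m" "\<And>w x. w \<in> words G m \<Longrightarrow> x \<in> vecs L \<Longrightarrow> D (g w x) = y w x"
      using lift_cochain[OF y] by blast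
    have "cobd G L y w x = D (cobd G L g w x)" if w: "w \<in> words G (Suc m)" and x: "x \<in> vecs L" for w x
      using cobd_cong[OF is_group L _ w x, of y "\<lambda>w x. D (g w x)"] g(2) cobd_linear[OF g(1) D_lin w x] by simp
    then have "\<forall>w\<in>words G (Suc m). \<forall>x\<in>vecs L. c w x = D (cobd G L g w x) + lin_comb r a \<zeta> w x"
      using e by simp
    moreover have "cobd G L g \<in> BC (I i) (Suc m)" by (rule cobd_BC[OF g(1) I_sub])
    moreover have "cocycle (Suc m) (cobd G L g)" using cobd_cobd[OF is_group L] by blast
    ultimately show "\<exists>y\<in>BC (I i) (Suc m). cocycle (Suc m) y \<and>
        (\<exists>a. \<forall>w\<in>words G (Suc m). \<forall>x\<in>vecs L. c w x = D (y w x) + lin_comb r a \<zeta> w x)"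
      by blast
  qed
qed

text \<open>The connecting homomorphism of the sequence N i, I i, N (i + 1). A cocycle in
  \<open>N i\<close> bounds a cochain e in \<open>I i\<close>, and \<open>D\<close> of e is a
  cocycle one degree lower; conversely the generators are lifted to \<open>I i\<close> and their
  coboundaries taken.\<close>

lemma hom_bound_imp_ext_bound:
  assumes "hom_bound r i m"
  shows "ext_bound r i m"
proof -
  from assms obtain \<zeta> where \<zeta>: "\<And>k. k < r \<Longrightarrow> \<zeta> k \<in> BC (N (Suc i)) m" "\<And>k. k < r \<Longrightarrow> cocycle m (\<zeta> k)"
    and sp: "\<And>c. c \<in> BC (N (Suc i)) m \<Longrightarrow> cocycle m c \<Longrightarrow>
       \<exists>y\<in>BC (I i) m. cocycle m y \<and> (\<exists>a. \<forall>w\<in>words G m. \<forall>x\<in>vecs L. c w x = D (y w x) + lin_comb r a \<zeta> w x)"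
    unfolding hom_bound_def by blast
  have "\<exists>g. g \<in> BC (I i) m \<and> (\<forall>w\<in>words G m. \<forall>x\<in>vecs L. D (g w x) = \<zeta> k w x)" if "k < r" for k
    using lift_cochain[OF \<zeta>(1)[OF that]] by metis
  then obtain \<xi> where \<xi>: "\<And>k. k < r \<Longrightarrow> \<xi> k \<in> BC (I i) m"
    "\<And>k w x. k < r \<Longrightarrow> w \<in> words G m \<Longrightarrow> x \<in> vecs L \<Longrightarrow> D (\<xi> k w x) = \<zeta> k w x" by metis
  have D_cobd: "D (cobd G L g w x) = cobd G L g' w x"
    if "g \<in> BC (I i) m" "\<And>w x. w \<in> words G m \<Longrightarrow> x \<in> vecs L \<Longrightarrow> D (g w x) = g' w x"
      "w \<in> words G (Suc m)" "x \<in> vecs L" for g g' w x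
    using cobd_cong[OF is_group L _ that(3,4), of "\<lambda>w x. D (g w x)" g'] that(2)
      cobd_linear[OF that(1) D_lin that(3,4)] by simp
  have \<xi>N: "cobd G L (\<xi> k) \<in> BC (N i) (Suc m)" if k: "k < r" for k
  proof (rule cochainsI[OF is_group L])
    note cD = cochainsD[OF is_group L cobd_BC[OF \<xi>(1)[OF k] I_sub]]
    fix w x assume w: "w \<in> words G (Suc m)" and x: "x \<in> vecs L"
    have "D (cobd G L (\<xi> k) w x) = 0" using D_cobd[OF \<xi>(1)[OF k] \<xi>(2)[OF k] w x] \<zeta>(2)[OF k] w x by simp
    then show "cobd G L (\<xi> k) w x \<in> N i" using cD(1)[OF w x] by (simp add: N_def)
  qed (use cochainsD[OF is_group L cobd_BC[OF \<xi>(1)[OF k] I_sub]] in auto)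
  show ?thesis unfolding ext_bound_def
  proof (intro exI[of _ "\<lambda>k. cobd G L (\<xi> k)"] conjI ballI allI impI)
    fix c assume c: "c \<in> BC (N i) (Suc m)" "cocycle (Suc m) c"
    obtain e where e: "e \<in> BC (I i) m" "\<And>w x. w \<in> words G (Suc m) \<Longrightarrow> x \<in> vecs L \<Longrightarrow> cobd G L e w x = c w x"
      using contract_cochain[OF BC_mono[OF c(1) N_subset] c(2)] by blast
    have "D x \<in> N (Suc i)" if "x \<in> I i" for x using D_I[OF that] D_D[OF that] by (simp add: N_def)
    then have 1: "(\<lambda>w x. D (e w x)) \<in> BC (N (Suc i)) m" by (intro comp_BC[OF e(1) D_lin] D_\<beta>)
    have 2: "cocycle m (\<lambda>w x. D (e w x))"
    proof (intro ballI)
      fix w x assume w: "w \<in> words G (Suc m)" and x: "x \<in> vecs L"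
      show "cobd G L (\<lambda>w x. D (e w x)) w x = 0"
        using cobd_linear[OF e(1) D_lin w x] e(2)[OF w x] cochainsD(1)[OF is_group L c(1) w x] by (simp add: N_def)
    qed
    from sp[OF 1 2] obtain y a where y: "y \<in> BC (I i) m" "cocycle m y"
      and eq: "\<And>w x. w \<in> words G m \<Longrightarrow> x \<in> vecs L \<Longrightarrow> D (e w x) = D (y w x) + lin_comb r a \<zeta> w x" by blast
    \<comment> \<open>What remains of e after subtracting the part from \<open>I i\<close> and the
      lifts of the generators is annihilated by \<open>D\<close>, hence takes values in
      \<open>N i\<close>.\<close>
    define u where "u w x = e w x - y w x - lin_comb r a \<xi> w x" for w x
    have uI: "u \<in> BC (I i) m"
      unfolding u_def by (intro diff_BC[OF _ _ I_sub] e y lin_comb_BC[OF _ I_sub] \<xi>)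
    have Du: "D (u w x) = 0" if w: "w \<in> words G m" and x: "x \<in> vecs L" for w x
    proof -
      have "lin_comb r a (\<lambda>k w x. D (\<xi> k w x)) w x = lin_comb r a \<zeta> w x"
        by (rule lin_comb_cong) (rule \<xi>(2)[OF _ w x])
      then show ?thesis unfolding u_def DD lin_comb_linear[OF D_lin] using eq[OF w x] by simp
    qed
    have "u \<in> BC (N i) m"
      by (rule cochainsI[OF is_group L]) (use cochainsD[OF is_group L uI] Du in \<open>auto simp: N_def\<close>)
    moreover have "c w x = cobd G L u w x + lin_comb r a (\<lambda>k. cobd G L (\<xi> k)) w x"
      if "w \<in> words G (Suc m)" "x \<in> vecs L" for w x
      unfolding u_def cobd_diff[OF is_group L] cobd_lin_comb using e(2)[OF that] y(2) that by simp
    ultimately show "\<exists>u\<in>BC (N i) m. \<exists>a. \<forall>w\<in>words G (Suc m). \<forall>x\<in>vecs L.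
        c w x = cobd G L u w x + lin_comb r a (\<lambda>k. cobd G L (\<xi> k)) w x" by blast
  qed (auto intro: \<xi>N cobd_cobd[OF is_group L])
qed

text \<open>One passage through both implications trades a cohomological degree for a degree of the
  resolution, until only homomorphisms of \<open>B\<close>-modules are left.\<close>

lemma hom_bound_shift: "hom_bound r (i + m) 0 \<Longrightarrow> ext_bound r i m"
proof (induction m arbitrary: i)
  case 0
  then show ?case using hom_bound_imp_ext_bound by simp
next
  case (Suc m)
  then have "ext_bound r (Suc i) m" by simp
  then show ?case using ext_bound_imp_hom_bound hom_bound_imp_ext_bound by blast
qed

section \<open>Cocycles of degree zero as homomorphisms of \<open>B\<close>-modules\<close>

definition bhom :: "'i set \<Rightarrow> ('v \<Rightarrow> 'i) \<Rightarrow> bool" where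
  "bhom X \<eta> \<longleftrightarrow> lin_on L sc \<eta> \<and> (\<forall>x\<in>vecs L. \<eta> x \<in> X) \<and> (\<forall>b\<in>B. \<forall>x\<in>vecs L. \<eta> (act L b x) = \<beta> b (\<eta> x))"

lemmas LD0 = is_gmodD[OF L]

lemma words_0: "w \<in> words G 0 \<longleftrightarrow> (\<exists>g\<in>carrier G. w = [g])"
  by (auto simp: words_def length_Suc_conv)

lemma words_1: "w \<in> words G (Suc 0) \<longleftrightarrow> (\<exists>g\<in>carrier G. \<exists>g'\<in>carrier G. w = [g, g'])"
  by (auto simp: words_def length_Suc_conv)

lemma cobd_0: "cobd G L c [g, g'] x = c [g \<otimes> g'] x - c [g] (act L g' x)"
  by (simp add: cobd_def merge_def alt_def)

text \<open>The cocycle condition on the word with letters \<one> and g moves g from the word to the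
  argument.\<close>

lemma bhom_of_cocycle:
  assumes c: "c \<in> BC X 0" and z: "cocycle 0 c"
  shows "bhom X (c [\<one>])" "\<And>g x. g \<in> carrier G \<Longrightarrow> x \<in> vecs L \<Longrightarrow> c [g] x = c [\<one>] (act L g x)"
proof -
  show g: "c [g] x = c [\<one>] (act L g x)" if "g \<in> carrier G" "x \<in> vecs L" for g x
  proof -
    have "cobd G L c [\<one>, g] x = 0" using z that by (auto simp: words_def)
    then show ?thesis using that by (simp add: cobd_0)
  qed
  have w: "[\<one>] \<in> words G 0" by (simp add: words_0)
  note cD = cochainsD[OF is_group L c w]
  show "bhom X (c [\<one>])" unfolding bhom_def lin_on_def
  proof (intro conjI ballI allI)
    fix b x assume b: "b \<in> B" and x: "x \<in> vecs L"
    have "c [\<one>] (act L b x) = c (lmult G b [\<one>]) x"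
      using g[OF B_carrier[OF b] x] B_carrier[OF b] by (simp add: lmult_def)
    then show "c [\<one>] (act L b x) = \<beta> b (c [\<one>] x)" using cD(4)[OF b x] by simp
  qed (use cD in auto)
qed

lemma cocycle_of_bhom:
  assumes "bhom X \<eta>"
  shows "(\<lambda>w x. \<eta> (act L (hd w) x)) \<in> BC X 0" "cocycle 0 (\<lambda>w x. \<eta> (act L (hd w) x))"
proof -
  have \<eta>: "\<And>x y. x \<in> vecs L \<Longrightarrow> y \<in> vecs L \<Longrightarrow> \<eta> (x + y) = \<eta> x + \<eta> y"
    "\<And>a x. x \<in> vecs L \<Longrightarrow> \<eta> (smul L a x) = sc a (\<eta> x)" "\<And>x. x \<in> vecs L \<Longrightarrow> \<eta> x \<in> X"
    "\<And>b x. b \<in> B \<Longrightarrow> x \<in> vecs L \<Longrightarrow> \<eta> (act L b x) = \<beta> b (\<eta> x)"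
    using assms by (auto simp: bhom_def lin_on_def)
  show "(\<lambda>w x. \<eta> (act L (hd w) x)) \<in> BC X 0"
    by (rule cochainsI[OF is_group L])
      (auto simp: words_0 lmult_def LD0 \<eta> B_carrier)
  show "cocycle 0 (\<lambda>w x. \<eta> (act L (hd w) x))"
    by (auto simp: words_1 cobd_0 LD0)
qed

lemma hom_boundI:
  assumes \<eta>: "\<And>k. k < r \<Longrightarrow> bhom (N (Suc i)) (\<eta> k)"
    and sp: "\<And>\<phi>. bhom (N (Suc i)) \<phi> \<Longrightarrow>
      \<exists>y a. bhom (I i) y \<and> (\<forall>x\<in>vecs L. \<phi> x = D (y x) + (\<Sum>k<r. sc (a k) (\<eta> k x)))"
  shows "hom_bound r i 0"
  unfolding hom_bound_def
proof (intro exI[of _ "\<lambda>k w x. \<eta> k (act L (hd w) x)"] conjI ballI allI impI)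
  fix c assume c: "c \<in> BC (N (Suc i)) 0" "cocycle 0 c"
  from sp[OF bhom_of_cocycle(1)[OF c]] obtain y a where y: "bhom (I i) y"
    and e: "\<And>x. x \<in> vecs L \<Longrightarrow> c [\<one>] x = D (y x) + (\<Sum>k<r. sc (a k) (\<eta> k x))" by blast
  show "\<exists>y\<in>BC (I i) 0. cocycle 0 y \<and> (\<exists>a. \<forall>w\<in>words G 0. \<forall>x\<in>vecs L.
      c w x = D (y w x) + lin_comb r a (\<lambda>k w x. \<eta> k (act L (hd w) x)) w x)"
  proof (intro bexI[of _ "\<lambda>w x. y (act L (hd w) x)"] conjI exI[of _ a] ballI)
    fix w x assume "w \<in> words G 0" and x: "x \<in> vecs L"
    then obtain g where g: "g \<in> carrier G" "w = [g]" by (auto simp: words_0)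
    show "c w x = D (y (act L (hd w) x)) + lin_comb r a (\<lambda>k w x. \<eta> k (act L (hd w) x)) w x"
      using bhom_of_cocycle(2)[OF c g(1) x] e[OF LD0(3)[OF g(1) x]] g by (simp add: lin_comb_def)
  qed (use cocycle_of_bhom[OF y] in auto)
qed (use cocycle_of_bhom[OF \<eta>] in auto)

end

text \<open>The coefficient module is identified with the kernel \<open>N 0\<close> of the resolution, as modules
  over the subgroup \<open>B\<close> of invertible index.\<close>

locale coefficient_resolution = resolution G B L sc \<beta> I D h \<theta>
  for G :: "('g, 'b) monoid_scheme" (structure) and B and L :: "('k::field, 'g, 'v::ab_group_add) gmod"
    and sc :: "'k \<Rightarrow> 'i::ab_group_add \<Rightarrow> 'i" and \<beta> I D h \<theta> +
  fixes M :: "('k, 'g, 'w::ab_group_add) gmod" and \<iota> :: "'w \<Rightarrow> 'i" and \<rho> :: "'i \<Rightarrow> 'w"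
  assumes M: "is_gmod G M"
    and \<iota>_N: "u \<in> vecs M \<Longrightarrow> \<iota> u \<in> N 0"
    and \<iota>_add: "u \<in> vecs M \<Longrightarrow> u' \<in> vecs M \<Longrightarrow> \<iota> (u + u') = \<iota> u + \<iota> u'"
    and \<iota>_scale: "u \<in> vecs M \<Longrightarrow> \<iota> (smul M a u) = sc a (\<iota> u)"
    and \<iota>_act: "b \<in> B \<Longrightarrow> u \<in> vecs M \<Longrightarrow> \<iota> (act M b u) = \<beta> b (\<iota> u)"
    and \<rho>_vecs: "y \<in> N 0 \<Longrightarrow> \<rho> y \<in> vecs M" and \<iota>_\<rho>: "y \<in> N 0 \<Longrightarrow> \<iota> (\<rho> y) = y"
    and \<rho>_\<iota>: "u \<in> vecs M \<Longrightarrow> \<rho> (\<iota> u) = u"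
    and index: "of_nat (card (rcosets B)) \<noteq> (0 :: 'k)" and fin_cosets: "finite (rcosets B)"
begin

sublocale vM: vector_space "smul M" by (rule is_gmodD(1)[OF M])

lemmas MD = is_gmodD[OF M]
lemmas MS = subspaceD[OF MD(1,2)]

lemma \<rho>_add: "y \<in> N 0 \<Longrightarrow> z \<in> N 0 \<Longrightarrow> \<rho> (y + z) = \<rho> y + \<rho> z"
  using \<rho>_\<iota>[of "\<rho> y + \<rho> z"] \<iota>_add[of "\<rho> y" "\<rho> z"] by (simp add: \<iota>_\<rho> \<rho>_vecs MS)

lemma \<rho>_scale: "y \<in> N 0 \<Longrightarrow> \<rho> (sc a y) = smul M a (\<rho> y)"
  using \<rho>_\<iota>[of "smul M a (\<rho> y)"] \<iota>_scale[of "\<rho> y" a] by (simp add: \<iota>_\<rho> \<rho>_vecs MS)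

lemma \<rho>_act: "b \<in> B \<Longrightarrow> y \<in> N 0 \<Longrightarrow> \<rho> (\<beta> b y) = act M b (\<rho> y)"
  using \<rho>_\<iota>[of "act M b (\<rho> y)"] \<iota>_act[of b "\<rho> y"] by (simp add: \<iota>_\<rho> \<rho>_vecs MD B_carrier)

lemma \<rho>_sum: "(\<And>k. k \<in> A \<Longrightarrow> y k \<in> N 0) \<Longrightarrow> \<rho> (\<Sum>k\<in>A. y k) = (\<Sum>k\<in>A. \<rho> (y k))"
proof (induction A rule: infinite_finite_induct)
  case (insert k A)
  have "\<rho> (y k + sum y A) = \<rho> (y k) + \<rho> (sum y A)"
    by (rule \<rho>_add) (use insert in \<open>auto intro!: N_D(6)\<close>)
  then show ?case using insert by simp
qed (use \<rho>_scale[OF N_D(1), of 0] in simp_all)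

abbreviation "MB \<equiv> cochains G B L (smul M) (act M) (vecs M)"
abbreviation "MG \<equiv> cochains G (carrier G) L (smul M) (act M) (vecs M)"

section \<open>Transfer from the subgroup to the group\<close>

definition rep :: "'g set \<Rightarrow> 'g" where
  "rep C = (SOME r. r \<in> C)"

lemma rep: assumes "C \<in> rcosets B" shows "rep C \<in> C" "rep C \<in> carrier G" "B #> rep C = C"
proof -
  obtain g where g: "g \<in> carrier G" "C = B #> g" using assms by (auto simp: RCOSETS_def)
  then have "g \<in> C" using rcos_self[OF g(1) B] by simp
  then show r: "rep C \<in> C" unfolding rep_def by (rule someI)
  then show "rep C \<in> carrier G" using g r_coset_subset_G[OF _ g(1)] subgroup.subset[OF B] by blast
  show "B #> rep C = C" using repr_independence[OF _ g(1) B] r g(2) by metis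
qed

definition transfer :: "('g list \<Rightarrow> 'v \<Rightarrow> 'w) \<Rightarrow> 'g list \<Rightarrow> 'v \<Rightarrow> 'w" where
  "transfer c w x = (\<Sum>C\<in>rcosets B. act M (inv (rep C)) (c (lmult G (rep C) w) x))"

text \<open>Independence of the representative: equivariance brings \<open>b\<close> out of the
  cochain, where it cancels against the inverse.\<close>

lemma transfer_term:
  assumes c: "c \<in> MB m" and w: "w \<in> words G m" and x: "x \<in> vecs L" and g: "g \<in> carrier G" and b: "b \<in> B"
  shows "act M (inv (b \<otimes> g)) (c (lmult G (b \<otimes> g) w) x) = act M (inv g) (c (lmult G g w) x)"
proof -
  note bG = B_carrier[OF b]
  have gw: "lmult G g w \<in> words G m" by (rule lmult_words[OF is_group L w g])
  have v: "c (lmult G g w) x \<in> vecs M" by (rule cochainsD(1)[OF is_group L c gw x])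
  have "c (lmult G (b \<otimes> g) w) x = act M b (c (lmult G g w) x)"
    using cochainsD(4)[OF is_group L c gw b x] lmult_lmult[OF is_group L w bG g] by simp
  then have "act M (inv (b \<otimes> g)) (c (lmult G (b \<otimes> g) w) x) = act M (inv (b \<otimes> g) \<otimes> b) (c (lmult G g w) x)"
    using MD(7)[OF _ bG v, of "inv (b \<otimes> g)"] bG g by simp
  also have "inv (b \<otimes> g) \<otimes> b = inv g" using bG g by (simp add: inv_mult_group m_assoc)
  finally show ?thesis .
qed

lemma act_M_sum:
  assumes g: "g \<in> carrier G" and f: "\<And>a. a \<in> A \<Longrightarrow> f a \<in> vecs M"
  shows "act M g (sum f A) = (\<Sum>a\<in>A. act M g (f a))"
  using f
proof (induction A rule: infinite_finite_induct)
  case (insert a A)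
  have "act M g (f a + sum f A) = act M g (f a) + act M g (sum f A)"
    by (rule MD(4)[OF g]) (use insert in \<open>auto intro!: MS(6)\<close>)
  then show ?case using insert by simp
qed (use MD(5)[OF g MS(1), of 0] in simp_all)

text \<open>Right multiplication by g permutes the right cosets of \<open>B\<close>, and by
  \<open>transfer_term\<close> it does not matter that it fails to preserve the chosen
  representatives.\<close>

lemma transfer_MG:
  assumes c: "c \<in> MB m"
  shows "transfer c \<in> MG m"
proof (rule cochainsI[OF is_group L])
  fix w x assume w: "w \<in> words G m" and x: "x \<in> vecs L"
  have lw: "lmult G (rep C) w \<in> words G m" if "C \<in> rcosets B" for C
    using lmult_words[OF is_group L w rep(2)[OF that]] .
  note cD = cochainsD[OF is_group L c lw]
  show "transfer c w x \<in> vecs M"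
    unfolding transfer_def by (intro MS(6) MD(3) cD(1) inv_closed rep(2) x)
  show "transfer c w (x + y) = transfer c w x + transfer c w y" if y: "y \<in> vecs L" for y
    unfolding transfer_def sum.distrib[symmetric]
    by (rule sum.cong[OF refl]) (simp add: cD(1)[OF _ x] cD(1)[OF _ y] cD(2)[OF _ x y] MD(4) rep(2))
  show "transfer c w (smul L a x) = smul M a (transfer c w x)" for a
    unfolding transfer_def vM.scale_sum_right
    by (rule sum.cong[OF refl]) (simp add: cD(1)[OF _ x] cD(3)[OF _ x] MD(5) rep(2))
  show "transfer c (lmult G g w) x = act M g (transfer c w x)" if g: "g \<in> carrier G" for g
  proof -
    define F where "F r = act M (inv r) (c (lmult G r w) x)" for r
    have bij: "bij_betw (\<lambda>C. C #> g) (rcosets B) (rcosets B)"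
    proof (rule bij_betwI[where g = "\<lambda>C. C #> inv g"])
      show "(\<lambda>C. C #> g) \<in> rcosets B \<rightarrow> rcosets B" "(\<lambda>C. C #> inv g) \<in> rcosets B \<rightarrow> rcosets B"
        using g by (auto simp: RCOSETS_def coset_mult_assoc subgroup.subset[OF B] intro!: bexI[OF _ m_closed])
      show "C #> g #> inv g = C" "C #> inv g #> g = C" if "C \<in> rcosets B" for C
        using subgroup.rcosets_carrier[OF B is_group that] g by (simp_all add: coset_mult_assoc)
    qed
    have FC: "F (rep C \<otimes> g) = F (rep (C #> g))" if C: "C \<in> rcosets B" for C
    proof -
      have Cg: "C #> g \<in> rcosets B" using bij_betwE[OF bij] C by blast
      have "C #> g = B #> (rep C \<otimes> g)"
        using rep(2,3)[OF C] g coset_mult_assoc[OF subgroup.subset[OF B] rep(2)[OF C] g] by simp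
      then obtain b where b: "b \<in> B" "rep (C #> g) = b \<otimes> (rep C \<otimes> g)"
        using rep(1)[OF Cg] by (auto simp: r_coset_def)
      show ?thesis unfolding b(2) F_def
        by (rule transfer_term[OF c w x _ b(1), symmetric]) (use rep(2)[OF C] g in simp)
    qed
    have Fv: "F r \<in> vecs M" if "r \<in> carrier G" for r
      unfolding F_def using cochainsD(1)[OF is_group L c lmult_words[OF is_group L w that] x] that by (intro MD(3)) auto
    have "transfer c (lmult G g w) x = (\<Sum>C\<in>rcosets B. act M g (F (rep C \<otimes> g)))"
      unfolding transfer_def
    proof (rule sum.cong[OF refl])
      fix C assume C: "C \<in> rcosets B"
      note r = rep(2)[OF C]
      have v: "c (lmult G (rep C \<otimes> g) w) x \<in> vecs M"
        using cochainsD(1)[OF is_group L c lmult_words[OF is_group L w] x] r g by simp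
      have "act M g (F (rep C \<otimes> g)) = act M (g \<otimes> inv (rep C \<otimes> g)) (c (lmult G (rep C \<otimes> g) w) x)"
        unfolding F_def using MD(7)[OF g _ v] r g by simp
      also have "g \<otimes> inv (rep C \<otimes> g) = inv (rep C)"
        using r g by (simp add: inv_mult_group m_assoc[symmetric])
      finally show "act M (inv (rep C)) (c (lmult G (rep C) (lmult G g w)) x) = act M g (F (rep C \<otimes> g))"
        using lmult_lmult[OF is_group L w r g] by simp
    qed
    also have "\<dots> = act M g (\<Sum>C\<in>rcosets B. F (rep (C #> g)))"
      using FC by (subst act_M_sum[OF g]) (auto intro!: Fv rep(2) bij_betwE[OF bij, rule_format])
    also have "(\<Sum>C\<in>rcosets B. F (rep (C #> g))) = (\<Sum>C\<in>rcosets B. F (rep C))"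
      by (rule sum.reindex_bij_betw[OF bij])
    finally show ?thesis by (simp add: transfer_def F_def)
  qed
qed

lemma transfer_cobd:
  assumes c: "c \<in> MB m" and w: "w \<in> words G (Suc m)" and x: "x \<in> vecs L"
  shows "transfer (cobd G L c) w x = cobd G L (transfer c) w x"
proof -
  have "cobd G L (transfer c) w x
      = (\<Sum>C\<in>rcosets B. cobd G L (\<lambda>w x. act M (inv (rep C)) (c (lmult G (rep C) w) x)) w x)"
    unfolding transfer_def[abs_def] by (rule cobd_sum[OF is_group L])
  also have "\<dots> = (\<Sum>C\<in>rcosets B. act M (inv (rep C)) (cobd G L c (lmult G (rep C) w) x))"
  proof (rule sum.cong[OF refl])
    fix C assume C: "C \<in> rcosets B"
    note r = rep(2)[OF C]
    have "cobd G L (\<lambda>w x. act M (inv (rep C)) (c (lmult G (rep C) w) x)) w x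
        = act M (inv (rep C)) (cobd G L (\<lambda>w x. c (lmult G (rep C) w) x) w x)"
      by (rule cobd_comp[OF is_group L _ MD(1,2) _ w x])
        (use r in \<open>auto intro!: MD(4) cochainsD(1)[OF is_group L c] lmult_words[OF is_group L]\<close>)
    also have "cobd G L (\<lambda>w x. c (lmult G (rep C) w) x) w x = cobd G L c (lmult G (rep C) w) x"
      unfolding cobd_def length_words[OF is_group L w] length_words[OF is_group L lmult_words[OF is_group L w r]] diff_Suc_1
      by (simp add: merge_lmult[OF is_group L w _ r] butlast_lmult[OF is_group L w] last_lmult[OF is_group L w])
    finally show "cobd G L (\<lambda>w x. act M (inv (rep C)) (c (lmult G (rep C) w) x)) w x
        = act M (inv (rep C)) (cobd G L c (lmult G (rep C) w) x)" .
  qed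
  finally show ?thesis by (simp add: transfer_def)
qed

text \<open>Restriction followed by transfer multiplies by the index. As the index is invertible in
  k, restriction is injective on cohomology.\<close>

lemma transfer_equivariant:
  assumes c: "c \<in> MG m" and w: "w \<in> words G m" and x: "x \<in> vecs L"
  shows "transfer c w x = smul M (of_nat (card (rcosets B))) (c w x)"
proof -
  have "transfer c w x = (\<Sum>C\<in>rcosets B. c w x)"
    unfolding transfer_def
  proof (rule sum.cong[OF refl])
    fix C assume C: "C \<in> rcosets B"
    note r = rep(2)[OF C]
    have v: "c w x \<in> vecs M" using cochainsD(1)[OF is_group L c w x] .
    show "act M (inv (rep C)) (c (lmult G (rep C) w) x) = c w x"
      using cochainsD(4)[OF is_group L c w r x] MD(7)[OF _ r v, of "inv (rep C)"] r MD(6)[OF v] by simp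
  qed
  also have "\<dots> = smul M (of_nat (card (rcosets B))) (c w x)"
    using vM.sum_constant_scale by blast
  finally show ?thesis .
qed

text \<open>A cocycle of the group is decomposed after restriction to \<open>B\<close>, and the
  decomposition is transferred back and divided by the index. The generators may become dependent in
  this process, which is harmless for an upper bound.\<close>

theorem ext_dim_le_of_ext_bound:
  assumes "ext_bound r 0 m"
  shows "ext_dim G L M (Suc m) \<le> enat r"
proof -
  from assms obtain \<zeta> where \<zeta>: "\<And>k. k < r \<Longrightarrow> \<zeta> k \<in> BC (N 0) (Suc m)"
    and sp: "\<And>c. c \<in> BC (N 0) (Suc m) \<Longrightarrow> cocycle (Suc m) c \<Longrightarrow>
       \<exists>y\<in>BC (N 0) m. \<exists>a. \<forall>w\<in>words G (Suc m). \<forall>x\<in>vecs L. c w x = cobd G L y w x + lin_comb r a \<zeta> w x"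
    unfolding ext_bound_def by blast
  let ?e = "inverse (of_nat (card (rcosets B)) :: 'k)"
  define \<xi> where "\<xi> k w x = smul M ?e (transfer (\<lambda>w x. \<rho> (\<zeta> k w x)) w x)" for k w x
  show ?thesis
  proof (rule ext_dim_leI[OF is_group L M, where \<zeta> = \<xi>])
    fix c assume c: "c \<in> MG (Suc m)" and z: "\<And>w x. w \<in> words G (Suc (Suc m)) \<Longrightarrow> x \<in> vecs L \<Longrightarrow> cobd G L c w x = 0"
    note cD = cochainsD[OF is_group L c]
    have 1: "(\<lambda>w x. \<iota> (c w x)) \<in> BC (N 0) (Suc m)"
      by (rule cochainsI[OF is_group L]) (auto simp: cD \<iota>_N \<iota>_add \<iota>_scale \<iota>_act B_carrier)
    have 2: "cocycle (Suc m) (\<lambda>w x. \<iota> (c w x))"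
    proof (intro ballI)
      fix w x assume w: "w \<in> words G (Suc (Suc m))" and x: "x \<in> vecs L"
      have "cobd G L (\<lambda>w x. \<iota> (c w x)) w x = \<iota> (cobd G L c w x)"
        by (rule cobd_comp[OF is_group L \<iota>_add MD(1,2) cD(1) w x])
      also have "\<dots> = 0" using z[OF w x] \<iota>_scale[OF MS(1), of 0] by simp
      finally show "cobd G L (\<lambda>w x. \<iota> (c w x)) w x = 0" .
    qed
    from sp[OF 1 2] obtain y a where y: "y \<in> BC (N 0) m"
      and e: "\<And>w x. w \<in> words G (Suc m) \<Longrightarrow> x \<in> vecs L \<Longrightarrow> \<iota> (c w x) = cobd G L y w x + lin_comb r a \<zeta> w x" by blast
    note yD = cochainsD[OF is_group L y]
    define y' where "y' w x = \<rho> (y w x)" for w x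
    have y': "y' \<in> MB m"
      unfolding y'_def by (rule cochainsI[OF is_group L]) (auto simp: yD \<rho>_vecs \<rho>_add \<rho>_scale \<rho>_act)
    have eq: "c w x = cobd G L y' w x + (\<Sum>k<r. smul M (a k) (\<rho> (\<zeta> k w x)))"
      if w: "w \<in> words G (Suc m)" and x: "x \<in> vecs L" for w x
    proof -
      have \<zeta>v: "\<zeta> k w x \<in> N 0" if "k < r" for k using cochainsD(1)[OF is_group L \<zeta>[OF that] w x] .
      have yv: "cobd G L y w x \<in> N 0"
        using cochainsD(1)[OF is_group L cobd_BC[OF y N_sub] w x] .
      have "c w x = \<rho> (\<iota> (c w x))" using \<rho>_\<iota> cD(1)[OF w x] by simp
      also have "\<dots> = \<rho> (cobd G L y w x) + \<rho> (\<Sum>k<r. sc (a k) (\<zeta> k w x))"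
        unfolding e[OF w x] lin_comb_def by (rule \<rho>_add) (auto intro!: yv N_D(6) N_D(3) \<zeta>v)
      also have "\<rho> (\<Sum>k<r. sc (a k) (\<zeta> k w x)) = (\<Sum>k<r. smul M (a k) (\<rho> (\<zeta> k w x)))"
        by (subst \<rho>_sum) (auto intro!: N_D(3) \<zeta>v simp: \<rho>_scale[OF \<zeta>v])
      also have "\<rho> (cobd G L y w x) = cobd G L y' w x"
        unfolding y'_def by (rule cobd_comp[OF is_group L \<rho>_add vs N_sub yD(1) w x, symmetric])
      finally show ?thesis .
    qed
    show "\<exists>y a. (0 < Suc m \<longrightarrow> y \<in> MG (Suc m - 1)) \<and> (\<forall>w\<in>words G (Suc m). \<forall>x\<in>vecs L.
        c w x = (if Suc m = 0 then 0 else cobd G L y w x) + (\<Sum>k<r. smul M (a k) (\<xi> k w x)))"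
    proof (intro exI[of _ "\<lambda>w x. smul M ?e (transfer y' w x)"] exI[of _ a] conjI ballI impI)
      note tD = cochainsD[OF is_group L transfer_MG[OF y']]
      show "(\<lambda>w x. smul M ?e (transfer y' w x)) \<in> MG (Suc m - 1)"
        by (rule cochainsI[OF is_group L])
          (auto simp: tD MS MD(5) vM.scale_right_distrib mult.commute)
      fix w x assume w: "w \<in> words G (Suc m)" and x: "x \<in> vecs L"
      have lw: "lmult G (rep C) w \<in> words G (Suc m)" if "C \<in> rcosets B" for C
        using lmult_words[OF is_group L w rep(2)[OF that]] .
      have "transfer c w x = (\<Sum>C\<in>rcosets B. act M (inv (rep C)) (cobd G L y' (lmult G (rep C) w) x)
          + (\<Sum>k<r. smul M (a k) (act M (inv (rep C)) (\<rho> (\<zeta> k (lmult G (rep C) w) x)))))"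
        unfolding transfer_def
      proof (rule sum.cong[OF refl])
        fix C assume C: "C \<in> rcosets B"
        have g: "inv (rep C) \<in> carrier G" using rep(2)[OF C] by simp
        have \<zeta>v: "\<rho> (\<zeta> k (lmult G (rep C) w) x) \<in> vecs M" if "k < r" for k
          using \<rho>_vecs cochainsD(1)[OF is_group L \<zeta>[OF that] lw[OF C] x] .
        have yv: "cobd G L y' (lmult G (rep C) w) x \<in> vecs M"
          by (rule cochainsD(1)[OF is_group L cobd_cochains[OF is_group L y' MD(1,2)] lw[OF C] x])
            (auto simp: MD(4) B_carrier)
        show "act M (inv (rep C)) (c (lmult G (rep C) w) x) = act M (inv (rep C)) (cobd G L y' (lmult G (rep C) w) x)
          + (\<Sum>k<r. smul M (a k) (act M (inv (rep C)) (\<rho> (\<zeta> k (lmult G (rep C) w) x))))"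
          unfolding eq[OF lw[OF C] x]
          by (subst MD(4)[OF g yv], intro MS(6) MS(3) \<zeta>v, simp)
            (subst act_M_sum[OF g], auto intro!: MS(3) \<zeta>v simp: MD(5)[OF g \<zeta>v])
      qed
      also have "\<dots> = transfer (cobd G L y') w x + (\<Sum>k<r. smul M (a k) (transfer (\<lambda>w x. \<rho> (\<zeta> k w x)) w x))"
        unfolding transfer_def sum.distrib vM.scale_sum_right by (subst sum.swap) simp
      finally have t: "smul M (of_nat (card (rcosets B))) (c w x)
          = cobd G L (transfer y') w x + (\<Sum>k<r. smul M (a k) (transfer (\<lambda>w x. \<rho> (\<zeta> k w x)) w x))"
        by (simp add: transfer_equivariant[OF c w x] transfer_cobd[OF y' w x])
      have "c w x = smul M ?e (smul M (of_nat (card (rcosets B))) (c w x))"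
        using index by simp
      also have "\<dots> = smul M ?e (cobd G L (transfer y') w x) + (\<Sum>k<r. smul M (a k) (\<xi> k w x))"
        unfolding t \<xi>_def by (simp add: vM.scale_right_distrib vM.scale_sum_right mult.commute)
      finally show "c w x = (if Suc m = 0 then 0 else cobd G L (\<lambda>w x. smul M ?e (transfer y' w x)) w x)
          + (\<Sum>k<r. smul M (a k) (\<xi> k w x))"
        by (simp add: cobd_scale[OF is_group L MD(1)])
    qed
  qed
qed

theorem ext_dim_le:
  assumes \<eta>: "\<And>k. k < r \<Longrightarrow> bhom (N (Suc m)) (\<eta> k)"
    and "\<And>\<phi>. bhom (N (Suc m)) \<phi> \<Longrightarrow>
      \<exists>y a. bhom (I m) y \<and> (\<forall>x\<in>vecs L. \<phi> x = D (y x) + (\<Sum>k<r. sc (a k) (\<eta> k x)))"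
  shows "ext_dim G L M (Suc m) \<le> enat r"
  by (rule ext_dim_le_of_ext_bound, rule hom_bound_shift) (use hom_boundI[OF assms] in simp)

theorem ext_dim_0_le:
  assumes sp: "\<And>\<phi>. bhom (N 0) \<phi> \<Longrightarrow> \<exists>a. \<forall>x\<in>vecs L. \<phi> x = (\<Sum>k<r. sc (a k) (\<eta> k x))"
    and \<eta>: "\<And>k x. k < r \<Longrightarrow> x \<in> vecs L \<Longrightarrow> \<eta> k x \<in> N 0"
  shows "ext_dim G L M 0 \<le> enat r"
proof (rule ext_dim_leI[OF is_group L M, where \<zeta> = "\<lambda>k w x. \<rho> (\<eta> k (act L (hd w) x))"])
  fix c assume c: "c \<in> MG 0" and z: "\<And>w x. w \<in> words G (Suc 0) \<Longrightarrow> x \<in> vecs L \<Longrightarrow> cobd G L c w x = 0"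
  note cD = cochainsD[OF is_group L c]
  have 1: "(\<lambda>w x. \<iota> (c w x)) \<in> BC (N 0) 0"
    by (rule cochainsI[OF is_group L]) (auto simp: cD \<iota>_N \<iota>_add \<iota>_scale \<iota>_act B_carrier)
  have 2: "cocycle 0 (\<lambda>w x. \<iota> (c w x))"
  proof (intro ballI)
    fix w x assume w: "w \<in> words G (Suc 0)" and x: "x \<in> vecs L"
    have "cobd G L (\<lambda>w x. \<iota> (c w x)) w x = \<iota> (cobd G L c w x)"
      by (rule cobd_comp[OF is_group L \<iota>_add MD(1,2) cD(1) w x])
    also have "\<dots> = 0" using z[OF w x] \<iota>_scale[OF MS(1), of 0] by simp
    finally show "cobd G L (\<lambda>w x. \<iota> (c w x)) w x = 0" .
  qed
  note bh = bhom_of_cocycle[OF 1 2]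
  from sp[OF bh(1)] obtain a where a: "\<And>x. x \<in> vecs L \<Longrightarrow> \<iota> (c [\<one>] x) = (\<Sum>k<r. sc (a k) (\<eta> k x))" by blast
  show "\<exists>y a. (0 < (0::nat) \<longrightarrow> y \<in> MG (0 - 1)) \<and> (\<forall>w\<in>words G 0. \<forall>x\<in>vecs L.
      c w x = (if (0::nat) = 0 then 0 else cobd G L y w x) + (\<Sum>k<r. smul M (a k) (\<rho> (\<eta> k (act L (hd w) x)))))"
  proof (intro exI[of _ "\<lambda>_ _. 0"] exI[of _ a] conjI ballI)
    fix w x assume w: "w \<in> words G 0" and x: "x \<in> vecs L"
    then obtain g where g: "g \<in> carrier G" "w = [g]" by (auto simp: words_0)
    note gx = LD0(3)[OF g(1) x]
    have "c w x = \<rho> (\<iota> (c w x))" using cD(1)[OF w x] \<rho>_\<iota> by simp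
    also have "\<dots> = \<rho> (\<Sum>k<r. sc (a k) (\<eta> k (act L g x)))" using bh(2)[OF g(1) x] a[OF gx] g by simp
    also have "\<dots> = (\<Sum>k<r. smul M (a k) (\<rho> (\<eta> k (act L g x))))"
      by (subst \<rho>_sum) (auto intro!: N_D(3) \<eta> gx simp: \<rho>_scale[OF \<eta>[OF _ gx]])
    finally show "c w x = (if (0::nat) = 0 then 0 else cobd G L (\<lambda>_ _. 0) w x) + (\<Sum>k<r. smul M (a k) (\<rho> (\<eta> k (act L (hd w) x))))"
      using g by simp
  qed simp
qed

end

section \<open>The model of a resolution\<close>

type_synonym 'k cells = "(nat \<Rightarrow> nat) \<times> (nat \<Rightarrow> nat) \<Rightarrow> 'k"

text \<open>Cells \<open>(\<nu>, \<mu>)\<close> index a basis of the tensor product over the digits \<open>j\<close>: \<open>\<nu> j\<close> is the degree in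
  the \<open>j\<close>-th factor and \<open>\<mu> j\<close> the position in the truncated polynomial module.\<close>

locale model = char_p p s F for p s :: nat and F :: "'k::alg_closed_field set" +
  fixes f :: "nat \<Rightarrow> nat"
  assumes f: "f \<in> box s (\<lambda>_. p - 1)"
begin

text \<open>The steps of the 2-periodic resolution of one digit factor. The step f_j + 1 comes first
  because the kernel of the corresponding shift consists of the functions supported on the positions
  0, ..., f_j.\<close>

definition cstep :: "nat \<Rightarrow> nat \<Rightarrow> nat" where
  "cstep j n = (if even n then f j + 1 else p - 1 - f j)"

lemma f_le: "f j \<le> p - 1"
  using f by (cases "j \<in> {1..s}") (auto simp: box_def)

lemma cstep_cstep: "cstep j n + cstep j (Suc n) = p"
  using f_le[of j] p_ge by (auto simp: cstep_def)

text \<open>The Koszul sign of a tensor product of complexes; it depends on the degrees in the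
  factors before j only.\<close>

definition sg :: "nat \<Rightarrow> (nat \<Rightarrow> nat) \<Rightarrow> 'k" where
  "sg j \<nu> = (-1) ^ (\<Sum>i\<in>{1..<j}. \<nu> i)"

lemma sg_sg [simp]: "sg j \<nu> * sg j \<nu> = 1"
  by (simp add: sg_def flip: power_add)

lemma sg_upd_ge: "j \<le> k \<Longrightarrow> sg j (\<nu>(k := n)) = sg j \<nu>"
  unfolding sg_def by (intro arg_cong2[where f = power] sum.cong) auto

lemma sg_upd_Suc: "1 \<le> k \<Longrightarrow> k < j \<Longrightarrow> sg j (\<nu>(k := Suc n)) = - sg j (\<nu>(k := n))"
proof -
  assume k: "1 \<le> k" "k < j"
  have "(\<Sum>i\<in>{1..<j}. (\<nu>(k := m)) i) = m + (\<Sum>i\<in>{1..<j} - {k}. \<nu> i)" for m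
    using k by (subst sum.remove[of _ k]) (auto intro!: sum.cong)
  then show ?thesis by (simp add: sg_def)
qed

section \<open>Differential and homotopy in a single digit\<close>

definition Dj :: "nat \<Rightarrow> 'k cells \<Rightarrow> 'k cells" where
  "Dj j x = (\<lambda>(\<nu>, \<mu>). if \<nu> j = 0 then 0
     else sg j \<nu> * x (\<nu>(j := \<nu> j - 1), \<mu>(j := \<mu> j + cstep j (\<nu> j - 1))))"

text \<open>Elements are coefficient functions: on basis cells \<open>Dj\<close> raises the degree
  and lowers the position by the step, and \<open>hj\<close> undoes this inside the box \<delta>.
  The box \<open>full\<close> serves the exactness of the resolution, the box d the homomorphisms
  from L_d.\<close>

definition hj :: "(nat \<Rightarrow> nat) \<Rightarrow> nat \<Rightarrow> 'k cells \<Rightarrow> 'k cells" where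
  "hj \<delta> j x = (\<lambda>(\<nu>, \<mu>). if cstep j (\<nu> j) \<le> \<mu> j \<and> \<mu> j \<le> \<delta> j
     then sg j \<nu> * x (\<nu>(j := \<nu> j + 1), \<mu>(j := \<mu> j - cstep j (\<nu> j))) else 0)"

text \<open>The cells on which \<open>hj \<delta> j\<close> fails to be a contracting homotopy for \<open>Dj j\<close>.\<close>

definition crit :: "(nat \<Rightarrow> nat) \<Rightarrow> nat \<Rightarrow> nat \<Rightarrow> nat \<Rightarrow> bool" where
  "crit \<delta> j n m \<longleftrightarrow> m < cstep j n \<and> (n > 0 \<longrightarrow> \<delta> j < m + cstep j (n - 1))"

definition I :: "(nat \<Rightarrow> nat) \<Rightarrow> nat \<Rightarrow> 'k cells set" where
  "I \<delta> i = {x. \<forall>\<nu> \<mu>. x (\<nu>, \<mu>) \<noteq> 0 \<longrightarrow>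
     \<mu> \<in> box s \<delta> \<and> (\<forall>j. j \<notin> {1..s} \<longrightarrow> \<nu> j = 0) \<and> (\<Sum>j=1..s. \<nu> j) = i}"

definition D :: "'k cells \<Rightarrow> 'k cells" where
  "D x = (\<lambda>\<kappa>. \<Sum>j=1..s. Dj j x \<kappa>)"

lemma I_D: "x \<in> I \<delta> i \<Longrightarrow> x (\<nu>, \<mu>) \<noteq> 0 \<Longrightarrow> \<mu> \<in> box s \<delta> \<and> (\<forall>j. j \<notin> {1..s} \<longrightarrow> \<nu> j = 0) \<and> (\<Sum>j=1..s. \<nu> j) = i"
  by (auto simp: I_def)

lemma boxD: "\<mu> \<in> box s \<delta> \<Longrightarrow> j \<in> {1..s} \<Longrightarrow> \<mu> j \<le> \<delta> j"
  by (auto simp: box_def)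

text \<open>The conditions under which the two summands return x exclude each other, because two
  successive steps add up to p, which exceeds \<delta> j. If both fail, the cell is
  critical.\<close>

lemma Dj_hj:
  assumes x: "x \<in> I \<delta> i" and \<delta>: "\<delta> j \<le> p - 1" and j: "j \<in> {1..s}"
  shows "Dj j (hj \<delta> j x) (\<nu>, \<mu>) + hj \<delta> j (Dj j x) (\<nu>, \<mu>) = x (\<nu>, \<mu>) - (if crit \<delta> j (\<nu> j) (\<mu> j) then x (\<nu>, \<mu>) else 0)"
proof -
  have 1: "Dj j (hj \<delta> j x) (\<nu>, \<mu>) = (if \<nu> j > 0 \<and> \<mu> j + cstep j (\<nu> j - 1) \<le> \<delta> j then x (\<nu>, \<mu>) else 0)"
    by (auto simp: Dj_def hj_def sg_upd_ge mult.assoc[symmetric])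
  have 2: "hj \<delta> j (Dj j x) (\<nu>, \<mu>) = (if cstep j (\<nu> j) \<le> \<mu> j \<and> \<mu> j \<le> \<delta> j then x (\<nu>, \<mu>) else 0)"
    by (auto simp: Dj_def hj_def sg_upd_ge mult.assoc[symmetric])
  have b: "\<mu> j \<le> \<delta> j" if "x (\<nu>, \<mu>) \<noteq> 0" using I_D[OF x that] boxD j by blast
  have c: "cstep j (\<nu> j - 1) + cstep j (\<nu> j) = p" if "\<nu> j > 0" using cstep_cstep[of j "\<nu> j - 1"] that by simp
  show ?thesis
  proof (cases "x (\<nu>, \<mu>) = 0")
    case True
    then show ?thesis by (simp add: 1 2)
  next
    case False
    then show ?thesis using b c \<delta> p_ge unfolding 1 2 crit_def by (cases "\<nu> j = 0") auto
  qed
qed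

lemma Dj_Dj_anti:
  assumes "j \<in> {1..s}" "k \<in> {1..s}" "j < k"
  shows "Dj j (Dj k x) \<kappa> = - Dj k (Dj j x) \<kappa>"
proof -
  obtain \<nu> \<mu> where \<kappa>: "\<kappa> = (\<nu>, \<mu>)" by fastforce
  have "sg k \<nu> = - sg k (\<nu>(j := \<nu> j - Suc 0))" if "\<nu> j > 0"
    using sg_upd_Suc[of j k \<nu> "\<nu> j - 1"] that assms by simp
  then show ?thesis using assms
    by (auto simp: \<kappa> Dj_def sg_upd_ge fun_upd_twist[of j k])
qed

lemma Dj_hj_anti:
  assumes "j \<in> {1..s}" "k \<in> {1..s}" "j \<noteq> k"
  shows "Dj k (hj \<delta> j x) \<kappa> = - hj \<delta> j (Dj k x) \<kappa>"
proof -
  obtain \<nu> \<mu> where \<kappa>: "\<kappa> = (\<nu>, \<mu>)" by fastforce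
  show ?thesis
  proof (cases "j < k")
    case True
    have "sg k (\<nu>(j := Suc (\<nu> j))) = - sg k \<nu>"
      using sg_upd_Suc[of j k \<nu> "\<nu> j"] True assms by simp
    then show ?thesis using assms True
      by (auto simp: \<kappa> Dj_def hj_def sg_upd_ge fun_upd_twist[of j k])
  next
    case False
    then have kj: "k < j" using assms by simp
    show ?thesis
    proof (cases "\<nu> k")
      case (Suc n)
      have "sg j \<nu> = - sg j (\<nu>(k := n))"
        using sg_upd_Suc[of k j \<nu> n] kj assms Suc by (metis atLeastAtMost_iff fun_upd_triv)
      then have "sg j (\<nu>(k := n)) = - sg j \<nu>" by simp
      moreover have "sg k (\<nu>(j := Suc (\<nu> j))) = sg k \<nu>" using kj by (simp add: sg_upd_ge)
      moreover have "\<nu>(k := n, j := Suc (\<nu> j)) = \<nu>(j := Suc (\<nu> j), k := n)"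
        "\<mu>(k := a, j := b) = \<mu>(j := b, k := a)" for a b using kj by (auto intro: fun_upd_twist)
      ultimately show ?thesis using kj by (simp add: \<kappa> Dj_def hj_def Suc)
    qed (use kj in \<open>simp add: \<kappa> Dj_def hj_def\<close>)
  qed
qed

lemma Dj_sum: "Dj j (\<lambda>\<kappa>. \<Sum>k\<in>A. y k \<kappa>) \<kappa> = (\<Sum>k\<in>A. Dj j (y k) \<kappa>)"
  by (cases \<kappa>) (simp add: Dj_def sum_distrib_left)

lemma hj_sum: "hj \<delta> j (\<lambda>\<kappa>. \<Sum>k\<in>A. y k \<kappa>) \<kappa> = (\<Sum>k\<in>A. hj \<delta> j (y k) \<kappa>)"
  by (cases \<kappa>, cases "cstep j (fst \<kappa> j) \<le> snd \<kappa> j \<and> snd \<kappa> j \<le> \<delta> j") (auto simp: hj_def sum_distrib_left)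

text \<open>Two successive moves in the same digit shift the position by p and so leave every box
  with \<delta> j \<le> p - 1.\<close>

lemma Dj_Dj:
  assumes x: "x \<in> I \<delta> i" and \<delta>: "\<delta> j \<le> p - 1" and j: "j \<in> {1..s}"
  shows "Dj j (Dj j x) \<kappa> = 0"
proof -
  obtain \<nu> \<mu> where \<kappa>: "\<kappa> = (\<nu>, \<mu>)" by fastforce
  show ?thesis
  proof (cases "\<nu> j \<ge> 2")
    case True
    have c: "cstep j (\<nu> j - Suc (Suc 0)) + cstep j (\<nu> j - Suc 0) = p"
      using cstep_cstep[of j "\<nu> j - 2"] True by (simp add: numeral_2_eq_2 Suc_diff_Suc)
    have "x (\<nu>(j := \<nu> j - Suc (Suc 0)), \<mu>(j := \<mu> j + cstep j (\<nu> j - Suc 0) + cstep j (\<nu> j - Suc (Suc 0)))) = 0"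
    proof (rule ccontr)
      assume "\<not> ?thesis"
      from I_D[OF x this] boxD[OF _ j] have "\<mu> j + cstep j (\<nu> j - Suc 0) + cstep j (\<nu> j - Suc (Suc 0)) \<le> \<delta> j"
        by fastforce
      then show False using c \<delta> p_ge by linarith
    qed
    then show ?thesis by (simp add: \<kappa> Dj_def)
  qed (auto simp: \<kappa> Dj_def)
qed

text \<open>Anticommutation, which on the diagonal holds because squares vanish, yields D D = - D D,
  and 2 is invertible as p \<ge> 3.\<close>

lemma D_D:
  assumes x: "x \<in> I \<delta> i" and \<delta>: "\<And>j. j \<in> {1..s} \<Longrightarrow> \<delta> j \<le> p - 1"
  shows "D (D x) \<kappa> = 0"
proof -
  have two: "(2 :: 'k) \<noteq> 0"
    using of_nat_eq_0_iff_char_dvd[of 2, where 'a = 'k] char_p p_ge by (auto dest: dvd_imp_le)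
  let ?a = "\<lambda>j k. Dj j (Dj k x) \<kappa>"
  have anti: "?a j k = - ?a k j" if "j \<in> {1..s}" "k \<in> {1..s}" for j k
    using Dj_Dj_anti[OF that] Dj_Dj_anti[OF that(2,1)] Dj_Dj[OF x \<delta> that(1)] that
    by (cases j k rule: linorder_cases) auto
  have e: "D (D x) \<kappa> = (\<Sum>j=1..s. \<Sum>k=1..s. ?a j k)"
    unfolding D_def Dj_sum ..
  also have "\<dots> = (\<Sum>j=1..s. \<Sum>k=1..s. - ?a k j)"
    by (intro sum.cong refl) (rule anti)
  also have "\<dots> = - (\<Sum>j=1..s. \<Sum>k=1..s. ?a k j)" by (simp add: sum_negf)
  also have "\<dots> = - (\<Sum>k=1..s. \<Sum>j=1..s. ?a k j)" by (subst sum.swap) simp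
  finally have "D (D x) \<kappa> = - D (D x) \<kappa>" using e by simp
  then have "2 * D (D x) \<kappa> = 0" by (simp add: eq_neg_iff_add_eq_0)
  then show ?thesis using two by simp
qed

section \<open>Combining the digits\<close>

definition proj :: "(nat \<Rightarrow> nat) \<Rightarrow> nat \<Rightarrow> 'k cells \<Rightarrow> 'k cells" where
  "proj \<delta> t x = (\<lambda>(\<nu>, \<mu>). if \<forall>j\<in>{1..t}. crit \<delta> j (\<nu> j) (\<mu> j) then x (\<nu>, \<mu>) else 0)"

lemma I_closed:
  "0 \<in> I \<delta> i" "x \<in> I \<delta> i \<Longrightarrow> y \<in> I \<delta> i \<Longrightarrow> x + y \<in> I \<delta> i"
  "x \<in> I \<delta> i \<Longrightarrow> (\<lambda>\<kappa>. c * x \<kappa>) \<in> I \<delta> i"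
proof -
  show "x + y \<in> I \<delta> i" if "x \<in> I \<delta> i" "y \<in> I \<delta> i"
    unfolding I_def
  proof (intro CollectI allI impI)
    fix \<nu> \<mu> assume "(x + y) (\<nu>, \<mu>) \<noteq> 0"
    then have "x (\<nu>, \<mu>) \<noteq> 0 \<or> y (\<nu>, \<mu>) \<noteq> 0" by auto
    then show "\<mu> \<in> box s \<delta> \<and> (\<forall>j. j \<notin> {1..s} \<longrightarrow> \<nu> j = 0) \<and> (\<Sum>j=1..s. \<nu> j) = i"
      using I_D[OF that(1)] I_D[OF that(2)] by blast
  qed
qed (auto simp: I_def)

lemma I_sum:
  assumes "\<And>k. k \<in> A \<Longrightarrow> y k \<in> I \<delta> i"
  shows "(\<lambda>\<kappa>. \<Sum>k\<in>A. y k \<kappa>) \<in> I \<delta> i"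
  unfolding I_def
proof (intro CollectI allI impI)
  fix \<nu> \<mu> assume "(\<Sum>k\<in>A. y k (\<nu>, \<mu>)) \<noteq> 0"
  then obtain k where "k \<in> A" "y k (\<nu>, \<mu>) \<noteq> 0" by (meson sum.neutral)
  then show "\<mu> \<in> box s \<delta> \<and> (\<forall>j. j \<notin> {1..s} \<longrightarrow> \<nu> j = 0) \<and> (\<Sum>j=1..s. \<nu> j) = i"
    using I_D[OF assms] by blast
qed

lemma proj_I: "x \<in> I \<delta> i \<Longrightarrow> proj \<delta> t x \<in> I \<delta> i"
  by (auto simp: I_def proj_def)

lemma sum_upd: "j \<in> {1..s} \<Longrightarrow> (\<Sum>k=1..s. (\<nu>(j := m)) k) + \<nu> j = (\<Sum>k=1..s. \<nu> k) + (m::nat)"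
  by (subst (1 2) sum.remove[of _ j]) auto

lemma Dj_I:
  assumes x: "x \<in> I \<delta> i" and j: "j \<in> {1..s}"
  shows "Dj j x \<in> I \<delta> (Suc i)"
  unfolding I_def
proof (intro CollectI allI impI)
  fix \<nu> \<mu> assume "Dj j x (\<nu>, \<mu>) \<noteq> 0"
  then have n: "\<nu> j > 0" and "x (\<nu>(j := \<nu> j - 1), \<mu>(j := \<mu> j + cstep j (\<nu> j - 1))) \<noteq> 0"
    by (auto simp: Dj_def split: if_splits)
  note r = I_D[OF x this(2)]
  have "\<mu> \<in> box s \<delta>" unfolding box_def
  proof (intro CollectI allI)
    fix k
    have "if k \<in> {1..s} then (\<mu>(j := \<mu> j + cstep j (\<nu> j - 1))) k \<le> \<delta> k else (\<mu>(j := \<mu> j + cstep j (\<nu> j - 1))) k = 0"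
      using r[THEN conjunct1] unfolding box_def by blast
    then show "if k \<in> {1..s} then \<mu> k \<le> \<delta> k else \<mu> k = 0"
      by (cases "k = j") (simp_all split: if_splits)
  qed
  moreover have "\<forall>k. k \<notin> {1..s} \<longrightarrow> \<nu> k = 0" using r j by (metis fun_upd_other)
  moreover have "(\<Sum>k=1..s. \<nu> k) = Suc i" using sum_upd[OF j, of \<nu> "\<nu> j - 1"] r[THEN conjunct2, THEN conjunct2] n by linarith
  ultimately show "\<mu> \<in> box s \<delta> \<and> (\<forall>j. j \<notin> {1..s} \<longrightarrow> \<nu> j = 0) \<and> (\<Sum>j=1..s. \<nu> j) = Suc i" by blast
qed

lemma hj_I:
  assumes x: "x \<in> I \<delta> i" and j: "j \<in> {1..s}"
  shows "hj \<delta> j x \<in> I \<delta> (i - 1)"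
  unfolding I_def
proof (intro CollectI allI impI)
  fix \<nu> \<mu> assume "hj \<delta> j x (\<nu>, \<mu>) \<noteq> 0"
  then have n: "cstep j (\<nu> j) \<le> \<mu> j" "\<mu> j \<le> \<delta> j" and "x (\<nu>(j := \<nu> j + 1), \<mu>(j := \<mu> j - cstep j (\<nu> j))) \<noteq> 0"
    by (auto simp: hj_def split: if_splits)
  note r = I_D[OF x this(3)]
  have "\<mu> \<in> box s \<delta>" unfolding box_def
  proof (intro CollectI allI)
    fix k
    have "if k \<in> {1..s} then (\<mu>(j := \<mu> j - cstep j (\<nu> j))) k \<le> \<delta> k else (\<mu>(j := \<mu> j - cstep j (\<nu> j))) k = 0"
      using r[THEN conjunct1] unfolding box_def by blast
    then show "if k \<in> {1..s} then \<mu> k \<le> \<delta> k else \<mu> k = 0"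
      using n j by (cases "k = j") (simp_all split: if_splits)
  qed
  moreover have "\<forall>k. k \<notin> {1..s} \<longrightarrow> \<nu> k = 0" using r j by (metis fun_upd_other)
  moreover have "(\<Sum>k=1..s. \<nu> k) = i - 1" using sum_upd[OF j, of \<nu> "\<nu> j + 1"] r[THEN conjunct2, THEN conjunct2] by linarith
  ultimately show "\<mu> \<in> box s \<delta> \<and> (\<forall>j. j \<notin> {1..s} \<longrightarrow> \<nu> j = 0) \<and> (\<Sum>j=1..s. \<nu> j) = i - 1" by blast
qed

lemma D_I: "x \<in> I \<delta> i \<Longrightarrow> D x \<in> I \<delta> (Suc i)"
  unfolding D_def by (intro I_sum Dj_I) auto

lemma D_add: "D (x + y) = D x + D y"
  by (rule ext) (auto simp: D_def Dj_def algebra_simps sum.distrib split: prod.splits intro!: sum.cong simp flip: sum.distrib)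

lemma D_scale: "D (\<lambda>\<kappa>. c * x \<kappa>) = (\<lambda>\<kappa>. c * D x \<kappa>)"
  by (rule ext) (auto simp: D_def Dj_def sum_distrib_left split: prod.splits intro!: sum.cong)

lemma D_sum: "D (\<lambda>\<kappa>. \<Sum>k\<in>A. y k \<kappa>) \<kappa> = (\<Sum>k\<in>A. D (y k) \<kappa>)"
  unfolding D_def Dj_sum by (rule sum.swap)

lemma D_hj:
  assumes x: "x \<in> I \<delta> i" and \<delta>: "\<And>j. j \<in> {1..s} \<Longrightarrow> \<delta> j \<le> p - 1" and j: "j \<in> {1..s}"
  shows "D (hj \<delta> j x) (\<nu>, \<mu>) + hj \<delta> j (D x) (\<nu>, \<mu>) = x (\<nu>, \<mu>) - (if crit \<delta> j (\<nu> j) (\<mu> j) then x (\<nu>, \<mu>) else 0)"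
proof -
  have "D (hj \<delta> j x) (\<nu>, \<mu>) + hj \<delta> j (D x) (\<nu>, \<mu>)
      = (\<Sum>k=1..s. Dj k (hj \<delta> j x) (\<nu>, \<mu>) + hj \<delta> j (Dj k x) (\<nu>, \<mu>))"
    unfolding D_def hj_sum sum.distrib ..
  also have "\<dots> = (\<Sum>k\<in>{j}. Dj k (hj \<delta> j x) (\<nu>, \<mu>) + hj \<delta> j (Dj k x) (\<nu>, \<mu>))"
    by (rule sum.mono_neutral_right) (use j Dj_hj_anti[OF j] in auto)
  finally show ?thesis using Dj_hj[OF x \<delta>[OF j] j] by simp
qed

text \<open>Digit j is contracted only on the part that is already critical in the digits before it,
  so that the errors of the successive homotopies telescope.\<close>

definition H :: "(nat \<Rightarrow> nat) \<Rightarrow> nat \<Rightarrow> 'k cells \<Rightarrow> 'k cells" where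
  "H \<delta> t x = (\<lambda>\<kappa>. \<Sum>j=1..t. hj \<delta> j (proj \<delta> (j - 1) x) \<kappa>)"

lemma H_I: "x \<in> I \<delta> i \<Longrightarrow> t \<le> s \<Longrightarrow> H \<delta> t x \<in> I \<delta> (i - 1)"
  unfolding H_def by (intro I_sum hj_I proj_I) auto

text \<open>The part that is critical in the first t digits is closed, being the difference of the
  closed x and a boundary. Hence the homotopy of the next digit applies to it without a second error
  term.\<close>

lemma D_H:
  assumes x: "x \<in> I \<delta> i" and \<delta>: "\<And>j. j \<in> {1..s} \<Longrightarrow> \<delta> j \<le> p - 1" and z: "D x = 0" and t: "t \<le> s"
  shows "x = D (H \<delta> t x) + proj \<delta> t x"
  using t
proof (induction t)
  case 0
  have "H \<delta> 0 x = 0" "proj \<delta> 0 x = x" by (auto simp: H_def proj_def fun_eq_iff)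
  moreover have "D 0 = 0" by (rule ext) (auto simp: D_def Dj_def case_prod_unfold intro!: sum.neutral)
  ultimately show ?case by (simp only: add_0)
next
  case (Suc t)
  let ?x = "proj \<delta> t x" and ?j = "Suc t"
  have j: "?j \<in> {1..s}" using Suc.prems by simp
  have IH: "x = D (H \<delta> t x) + ?x" by (rule Suc.IH) (use Suc.prems in linarith)
  have xI: "?x \<in> I \<delta> i" by (rule proj_I[OF x])
  have "D x = D (D (H \<delta> t x)) + D ?x" using IH D_add by metis
  moreover have "D (D (H \<delta> t x)) = 0"
    using D_D[OF H_I[OF x] \<delta>] Suc.prems by (intro ext) auto
  ultimately have Dx: "D ?x = 0" using z by (metis add_0)
  have hz: "hj \<delta> ?j 0 \<kappa> = 0" for \<kappa> by (cases \<kappa>) (simp add: hj_def)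
  have e: "?x \<kappa> = D (hj \<delta> ?j ?x) \<kappa> + proj \<delta> ?j x \<kappa>" for \<kappa>
  proof -
    obtain \<nu> \<mu> where \<kappa>: "\<kappa> = (\<nu>, \<mu>)" by fastforce
    have "(if crit \<delta> ?j (\<nu> ?j) (\<mu> ?j) then ?x (\<nu>, \<mu>) else 0) = proj \<delta> ?j x (\<nu>, \<mu>)"
      by (auto simp: proj_def atLeastAtMostSuc_conv)
    then show ?thesis using D_hj[OF xI \<delta> j, of \<nu> \<mu>] by (simp add: \<kappa> Dx hz)
  qed
  have "H \<delta> ?j x = H \<delta> t x + hj \<delta> ?j ?x" by (simp add: H_def fun_eq_iff)
  then have "D (H \<delta> ?j x) + proj \<delta> ?j x = D (H \<delta> t x) + (D (hj \<delta> ?j ?x) + proj \<delta> ?j x)"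
    by (simp only: D_add add.assoc)
  also have "D (hj \<delta> ?j ?x) + proj \<delta> ?j x = ?x" using e by (simp add: fun_eq_iff)
  finally show ?case using IH by metis
qed

text \<open>In positive degree the two inequalities of criticality contradict the fact that
  successive steps add up to p. The critical cells of the full box are thus exactly a basis of L_f
  placed in degree 0.\<close>

lemma crit_full: "crit (\<lambda>_. p - 1) j n m \<longleftrightarrow> n = 0 \<and> m \<le> f j"
proof (cases "n = 0")
  case False
  then have "cstep j (n - 1) + cstep j n = p" using cstep_cstep[of j "n - 1"] by simp
  then show ?thesis using False by (auto simp: crit_def)
qed (auto simp: crit_def cstep_def)

section \<open>The action of the Borel subgroup on cells\<close>

definition shift :: "(nat \<Rightarrow> nat) \<Rightarrow> 'k cells \<Rightarrow> 'k cells" where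
  "shift \<tau> x = (\<lambda>(\<nu>, \<mu>). x (\<nu>, \<mu> + \<tau>))"

lemma D_shift: "D (shift \<tau> x) = shift \<tau> (D x)"
proof (rule ext)
  fix \<kappa> :: "(nat \<Rightarrow> nat) \<times> (nat \<Rightarrow> nat)"
  have "(\<mu> + \<tau>)(j := \<mu> j + \<tau> j + c) = \<mu>(j := \<mu> j + c) + \<tau>" for \<mu> j c
    by (auto simp: fun_eq_iff)
  then show "D (shift \<tau> x) \<kappa> = shift \<tau> (D x) \<kappa>"
    by (cases \<kappa>) (auto simp: D_def Dj_def shift_def intro!: sum.cong)
qed

text \<open>The exponential of the raising operators, in the same form in which
  \<open>upper a\<close> acts on coordinates of a simple module in \<open>co_upper\<close>.\<close>

definition uI :: "'k \<Rightarrow> 'k cells \<Rightarrow> 'k cells" where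
  "uI a x = (\<lambda>\<kappa>. \<Sum>\<tau>\<in>box s full. dp \<tau> a * shift \<tau> x \<kappa>)"

text \<open>The steps already used are charged together with the position, so that a move of
  \<open>D\<close>, which trades one for the other, preserves the weight.\<close>

definition wt :: "(nat \<Rightarrow> nat) \<Rightarrow> (nat \<Rightarrow> nat) \<Rightarrow> int" where
  "wt \<nu> \<mu> = (\<Sum>j=1..s. (int (f j) - 2 * int (\<mu> j) - 2 * (\<Sum>i<\<nu> j. int (cstep j i))) * int p ^ (j - 1))"

definition tI :: "'k \<Rightarrow> 'k cells \<Rightarrow> 'k cells" where
  "tI t x = (\<lambda>(\<nu>, \<mu>). t powi wt \<nu> \<mu> * x (\<nu>, \<mu>))"

lemma D_uI: "D (uI a x) = uI a (D x)"
proof (rule ext)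
  fix \<kappa>
  have "D (uI a x) \<kappa> = (\<Sum>\<tau>\<in>box s full. D (\<lambda>\<kappa>. dp \<tau> a * shift \<tau> x \<kappa>) \<kappa>)"
    unfolding uI_def by (rule D_sum)
  then show "D (uI a x) \<kappa> = uI a (D x) \<kappa>" by (simp add: D_scale D_shift uI_def)
qed

lemma wt_step:
  assumes j: "j \<in> {1..s}" and n: "\<nu> j > 0"
  shows "wt (\<nu>(j := \<nu> j - 1)) (\<mu>(j := \<mu> j + cstep j (\<nu> j - 1))) = wt \<nu> \<mu>"
proof -
  obtain n where n: "\<nu> j = Suc n" using n by (cases "\<nu> j") auto
  show ?thesis unfolding wt_def
    by (rule sum.cong[OF refl]) (auto simp: n)
qed

lemma D_tI: "D (tI t x) = tI t (D x)"
proof (rule ext)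
  fix \<kappa> :: "(nat \<Rightarrow> nat) \<times> (nat \<Rightarrow> nat)"
  obtain \<nu> \<mu> where \<kappa>: "\<kappa> = (\<nu>, \<mu>)" by fastforce
  show "D (tI t x) \<kappa> = tI t (D x) \<kappa>"
    using wt_step by (auto simp: \<kappa> D_def Dj_def tI_def sum_distrib_left intro!: sum.cong)
qed

lemma shift_I: "x \<in> I \<delta> i \<Longrightarrow> shift \<tau> x \<in> I \<delta> i"
proof -
  assume x: "x \<in> I \<delta> i"
  show ?thesis unfolding I_def
  proof (intro CollectI allI impI)
    fix \<nu> \<mu> assume "shift \<tau> x (\<nu>, \<mu>) \<noteq> 0"
    then have "x (\<nu>, \<mu> + \<tau>) \<noteq> 0" by (simp add: shift_def)
    from I_D[OF x this] show "\<mu> \<in> box s \<delta> \<and> (\<forall>j. j \<notin> {1..s} \<longrightarrow> \<nu> j = 0) \<and> (\<Sum>j=1..s. \<nu> j) = i"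
      using box_add_iff(1) by blast
  qed
qed

lemma uI_I: "x \<in> I \<delta> i \<Longrightarrow> uI a x \<in> I \<delta> i"
  unfolding uI_def by (intro I_sum I_closed shift_I)

lemma tI_I: "x \<in> I \<delta> i \<Longrightarrow> tI t x \<in> I \<delta> i"
  by (auto simp: I_def tI_def)

text \<open>Pairs of shifts are regrouped by their sum \<sigma>, and \<open>dp_add\<close> evaluates
  each group. Pairs whose sum leaves the full box drop out because x vanishes there; for such sums
  the exponential law would not be available.\<close>

lemma uI_uI:
  assumes x: "x \<in> I full i"
  shows "uI a (uI b x) = uI (a + b) x"
proof (rule ext)
  fix \<kappa> :: "(nat \<Rightarrow> nat) \<times> (nat \<Rightarrow> nat)"
  obtain \<nu> \<mu> where \<kappa>: "\<kappa> = (\<nu>, \<mu>)" by fastforce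
  let ?X = "box s full"
  let ?g = "\<lambda>\<tau> \<kappa>. dp \<tau> a * dp \<kappa> b * x (\<nu>, \<mu> + (\<tau> + \<kappa>))"
  have z: "x (\<nu>, \<mu> + \<sigma>) = 0" if "\<sigma> \<notin> ?X" for \<sigma>
    using I_D[OF x] box_add_iff(2) that by blast
  have "uI a (uI b x) \<kappa> = (\<Sum>\<tau>\<in>?X. \<Sum>\<kappa>\<in>?X. ?g \<tau> \<kappa>)"
    by (simp add: uI_def shift_def \<kappa> sum_distrib_left mult_ac add_ac)
  also have "\<dots> = (\<Sum>(\<tau>, \<kappa>)\<in>?X \<times> ?X. ?g \<tau> \<kappa>)" by (rule sum.cartesian_product)
  also have "\<dots> = (\<Sum>(\<tau>, \<kappa>)\<in>{(\<tau>, \<kappa>). \<tau> + \<kappa> \<in> ?X}. ?g \<tau> \<kappa>)"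
  proof (rule sum.mono_neutral_right)
    show "{(\<tau>, \<kappa>). \<tau> + \<kappa> \<in> ?X} \<subseteq> ?X \<times> ?X"
    proof safe
      fix \<tau> \<kappa> assume "\<tau> + \<kappa> \<in> ?X"
      then show "\<tau> \<in> ?X" "\<kappa> \<in> ?X" by (rule box_add_iff)+
    qed
    show "\<forall>y\<in>?X \<times> ?X - {(\<tau>, \<kappa>). \<tau> + \<kappa> \<in> ?X}. (case y of (\<tau>, \<kappa>) \<Rightarrow> ?g \<tau> \<kappa>) = 0"
    proof
      fix y assume "y \<in> ?X \<times> ?X - {(\<tau>, \<kappa>). \<tau> + \<kappa> \<in> ?X}"
      then have "fst y + snd y \<notin> ?X" by (auto simp: case_prod_unfold)
      from z[OF this] show "(case y of (\<tau>, \<kappa>) \<Rightarrow> ?g \<tau> \<kappa>) = 0" by (simp add: case_prod_unfold)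
    qed
  qed simp
  also have "\<dots> = (\<Sum>(\<sigma>, \<tau>)\<in>Sigma ?X (box s). dp \<tau> a * dp (\<sigma> - \<tau>) b * x (\<nu>, \<mu> + \<sigma>))"
  proof (rule sum.reindex_bij_witness[where i = "\<lambda>(\<sigma>, \<tau>). (\<tau>, \<sigma> - \<tau>)" and j = "\<lambda>(\<tau>, \<kappa>). (\<tau> + \<kappa>, \<tau>)"])
    have le: "\<tau> + (\<sigma> - \<tau>) = \<sigma>" if \<tau>: "\<tau> \<in> box s \<sigma>" and \<sigma>: "\<sigma> \<in> ?X" for \<tau> \<sigma>
    proof (rule ext)
      fix j
      show "(\<tau> + (\<sigma> - \<tau>)) j = \<sigma> j"
        using \<tau>[unfolded box_def, THEN CollectD, THEN spec, of j] \<sigma>[unfolded box_def, THEN CollectD, THEN spec, of j]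
        by (simp split: if_splits)
    qed
    fix y assume "y \<in> Sigma ?X (box s)"
    then show "(case case y of (\<sigma>, \<tau>) \<Rightarrow> (\<tau>, \<sigma> - \<tau>) of (\<tau>, \<kappa>) \<Rightarrow> (\<tau> + \<kappa>, \<tau>)) = y"
      "(case y of (\<sigma>, \<tau>) \<Rightarrow> (\<tau>, \<sigma> - \<tau>)) \<in> {(\<tau>, \<kappa>). \<tau> + \<kappa> \<in> ?X}"
      using le by auto
  next
    fix y :: "(nat \<Rightarrow> nat) \<times> (nat \<Rightarrow> nat)"
    assume "y \<in> {(\<tau>, \<kappa>). \<tau> + \<kappa> \<in> ?X}"
    then show "(case y of (\<tau>, \<kappa>) \<Rightarrow> (\<tau> + \<kappa>, \<tau>)) \<in> Sigma ?X (box s)"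
      "(case case y of (\<tau>, \<kappa>) \<Rightarrow> (\<tau> + \<kappa>, \<tau>) of (\<sigma>, \<tau>) \<Rightarrow> (\<tau>, \<sigma> - \<tau>)) = y"
      "(case case y of (\<tau>, \<kappa>) \<Rightarrow> (\<tau> + \<kappa>, \<tau>) of (\<sigma>, \<tau>) \<Rightarrow> dp \<tau> a * dp (\<sigma> - \<tau>) b * x (\<nu>, \<mu> + \<sigma>)) = (case y of (\<tau>, \<kappa>) \<Rightarrow> ?g \<tau> \<kappa>)"
      by (auto simp: box_def split: if_splits)
  qed
  also have "\<dots> = (\<Sum>\<sigma>\<in>?X. \<Sum>\<tau>\<in>box s \<sigma>. dp \<tau> a * dp (\<sigma> - \<tau>) b * x (\<nu>, \<mu> + \<sigma>))"
    by (rule sum.Sigma[symmetric]) auto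
  also have "\<dots> = (\<Sum>\<sigma>\<in>?X. dp \<sigma> (a + b) * x (\<nu>, \<mu> + \<sigma>))"
    by (rule sum.cong[OF refl]) (simp add: dp_add sum_distrib_right)
  finally show "uI a (uI b x) \<kappa> = uI (a + b) x \<kappa>" by (simp add: uI_def shift_def \<kappa>)
qed

lemma uI_0: "uI 0 x = x"
proof (rule ext)
  fix \<kappa> :: "(nat \<Rightarrow> nat) \<times> (nat \<Rightarrow> nat)"
  have "uI 0 x \<kappa> = (\<Sum>\<tau>\<in>{0}. dp \<tau> 0 * shift \<tau> x \<kappa>)"
    unfolding uI_def by (rule sum.mono_neutral_right) (auto simp: dp_at_0)
  then show "uI 0 x \<kappa> = x \<kappa>" by (cases \<kappa>) (simp add: shift_def)
qed

lemma wt_add: "wt \<nu> (\<mu> + \<tau>) = wt \<nu> \<mu> - 2 * int (val p s \<tau>)"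
  by (simp add: wt_def val_def algebra_simps sum.distrib sum_subtractf sum_distrib_left)

text \<open>The torus scales the root subgroup by a square, since a shift by \<tau> changes the
  weight by twice its value.\<close>

lemma uI_tI: "t \<noteq> 0 \<Longrightarrow> uI a (tI t x) = tI t (uI (a / t\<^sup>2) x)"
proof (rule ext)
  fix \<kappa> :: "(nat \<Rightarrow> nat) \<times> (nat \<Rightarrow> nat)"
  assume t: "t \<noteq> 0"
  obtain \<nu> \<mu> where \<kappa>: "\<kappa> = (\<nu>, \<mu>)" by fastforce
  have "dp \<tau> a * t powi wt \<nu> (\<mu> + \<tau>) = t powi wt \<nu> \<mu> * dp \<tau> (a / t\<^sup>2)" for \<tau>
    using t by (simp add: wt_add dp_def power_int_diff power_divide power_int_mult)
      (simp add: power_int_def nat_mult_distrib mult_ac flip: power_mult)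
  then show "uI a (tI t x) \<kappa> = tI t (uI (a / t\<^sup>2) x) \<kappa>"
    by (simp add: uI_def tI_def shift_def \<kappa> sum_distrib_left mult.assoc[symmetric])
qed

lemma tI_tI: "t \<noteq> 0 \<Longrightarrow> t' \<noteq> 0 \<Longrightarrow> tI t (tI t' x) = tI (t * t') x"
  by (auto simp: tI_def fun_eq_iff power_int_mult_distrib)

lemma tI_1: "tI 1 x = x"
  by (auto simp: tI_def)

lemma uI_linear: "uI a (x + y) = uI a x + uI a y" "uI a (\<lambda>\<kappa>. c * x \<kappa>) = (\<lambda>\<kappa>. c * uI a x \<kappa>)"
  "uI a (\<lambda>\<kappa>. \<Sum>k\<in>A. z k \<kappa>) = (\<lambda>\<kappa>. \<Sum>k\<in>A. uI a (z k) \<kappa>)"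
proof -
  show "uI a (x + y) = uI a x + uI a y" "uI a (\<lambda>\<kappa>. c * x \<kappa>) = (\<lambda>\<kappa>. c * uI a x \<kappa>)"
    by (auto simp: uI_def shift_def fun_eq_iff algebra_simps sum.distrib sum_distrib_left)
  show "uI a (\<lambda>\<kappa>. \<Sum>k\<in>A. z k \<kappa>) = (\<lambda>\<kappa>. \<Sum>k\<in>A. uI a (z k) \<kappa>)"
  proof (rule ext)
    fix \<kappa> :: "(nat \<Rightarrow> nat) \<times> (nat \<Rightarrow> nat)"
    show "uI a (\<lambda>\<kappa>. \<Sum>k\<in>A. z k \<kappa>) \<kappa> = (\<Sum>k\<in>A. uI a (z k) \<kappa>)"
      unfolding uI_def by (subst sum.swap) (cases \<kappa>, simp add: shift_def sum_distrib_left)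
  qed
qed

section \<open>Relative injectivity of the terms\<close>

definition top_digits :: "nat \<Rightarrow> nat" where
  "top_digits = (\<lambda>j. if j \<in> {1..s} then p - 1 else 0)"

text \<open>If \<open>x (\<nu>, _)\<close> is viewed as the function \<open>a \<mapsto> uI a x (\<nu>, 0)\<close> on \<open>F\<close>, then \<open>\<theta>\<close> multiplies it with
  \<open>1 - a\<^bsup>q-1\<^esup>\<close>, the indicator function of \<open>0\<close>. The translates of the latter add up to \<open>1\<close>.\<close>

definition \<theta> :: "'k cells \<Rightarrow> 'k cells" where
  "\<theta> x = (\<lambda>(\<nu>, \<mu>). x (\<nu>, 0) * (if \<mu> = 0 then 1 else if \<mu> = top_digits then - mfact top_digits else 0))"

lemma top_digits: "top_digits \<in> box s full" "top_digits \<noteq> 0" "val p s top_digits = q - 1"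
proof -
  have "top_digits 1 \<noteq> 0" using s_ge p_ge by (auto simp: top_digits_def)
  then show "top_digits \<noteq> 0" by (metis zero_fun_apply)
  show "top_digits \<in> box s full" unfolding top_digits_def box_def by simp
  show "val p s top_digits = q - 1" unfolding top_digits_def by (rule val_max[OF p_pos])
qed

lemma \<theta>_I: "x \<in> I full i \<Longrightarrow> \<theta> x \<in> I full i"
  unfolding I_def \<theta>_def using top_digits(1) by (auto split: if_splits)

lemma ev_\<theta>:
  assumes c: "c \<in> F"
  shows "uI c (\<theta> x) (\<nu>, 0) = (if c = 0 then x (\<nu>, 0) else 0)"
proof -
  have "uI c (\<theta> x) (\<nu>, 0) = (\<Sum>\<tau>\<in>{0, top_digits}. dp \<tau> c * \<theta> x (\<nu>, \<tau>))"
    unfolding uI_def shift_def split_conv add_0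
    by (rule sum.mono_neutral_right) (use top_digits(1) in \<open>auto simp: \<theta>_def\<close>)
  also have "\<dots> = x (\<nu>, 0) - c ^ (q - 1) * x (\<nu>, 0)"
    using top_digits mfact_nonzero[OF top_digits(1)] by (simp add: \<theta>_def dp_def[of top_digits])
  finally show ?thesis using F_power[OF c] q_ge by (auto simp: power_0_left)
qed

text \<open>An element is determined by its evaluations at all b in \<open>F\<close>, by
  \<open>dp_independent\<close> and \<open>card_F\<close>. At b only the summand a = -b survives,
  since \<theta> has cut everything else off.\<close>

lemma uI_trace:
  assumes x: "x \<in> I full i"
  shows "(\<lambda>\<kappa>. \<Sum>a\<in>F. uI a (\<theta> (uI (- a) x)) \<kappa>) = x"
proof (rule ext)
  fix \<kappa> :: "(nat \<Rightarrow> nat) \<times> (nat \<Rightarrow> nat)"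
  let ?y = "\<lambda>\<kappa>. \<Sum>a\<in>F. uI a (\<theta> (uI (- a) x)) \<kappa>"
  have yI: "?y \<in> I full i" by (intro I_sum uI_I \<theta>_I x)
  obtain \<nu> \<mu> where \<kappa>: "\<kappa> = (\<nu>, \<mu>)" by fastforce
  show "?y \<kappa> = x \<kappa>"
  proof (cases "\<mu> \<in> box s full")
    case True
    have "?y (\<nu>, \<mu>) - x (\<nu>, \<mu>) = 0"
    proof (rule dp_independent[OF _ _ True, where A = F])
      fix b assume b: "b \<in> F"
      have 1: "(\<Sum>\<mu>\<in>box s full. (?y (\<nu>, \<mu>) - x (\<nu>, \<mu>)) * dp \<mu> b) = uI b ?y (\<nu>, 0) - uI b x (\<nu>, 0)"
        by (simp add: uI_def shift_def algebra_simps sum_subtractf)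
      have "uI b ?y (\<nu>, 0) = (\<Sum>a\<in>F. uI (b + a) (\<theta> (uI (- a) x)) (\<nu>, 0))"
        unfolding uI_linear(3) by (intro sum.cong refl) (simp add: uI_uI[OF \<theta>_I[OF uI_I[OF x]]])
      also have "\<dots> = (\<Sum>a\<in>F. if b + a = 0 then uI (- a) x (\<nu>, 0) else 0)"
        by (intro sum.cong refl) (simp add: ev_\<theta> F_add b)
      also have "\<dots> = (\<Sum>a\<in>{- b}. uI (- a) x (\<nu>, 0))"
        by (rule sum.mono_neutral_cong_right) (auto simp: F_minus b add_eq_0_iff)
      finally show "(\<Sum>\<mu>\<in>box s full. (?y (\<nu>, \<mu>) - x (\<nu>, \<mu>)) * dp \<mu> b) = 0"
        unfolding 1 by simp
    qed (simp add: card_F)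
    then show ?thesis by (simp add: \<kappa>)
  next
    case False
    then have "?y (\<nu>, \<mu>) = 0" "x (\<nu>, \<mu>) = 0" using I_D[OF yI] I_D[OF x] by blast+
    then show ?thesis by (simp add: \<kappa>)
  qed
qed

end

section \<open>Counting critical cells\<close>

text \<open>A cell whose weight is divisible by \<open>p\<^sup>s - 1\<close> determines a cyclic sequence of carries. Read
  from the top digit down, the carry \<open>e\<close> is replaced by \<open>p * e - z\<close>, which moves it away from
  \<open>0\<close> exponentially fast unless the degrees compensate; this bounds the number of sequences
  independently of \<open>s\<close>.\<close>

locale carries =
  fixes p :: nat and A :: "nat \<Rightarrow> (nat \<times> nat) set" and z :: "nat \<Rightarrow> nat \<times> nat \<Rightarrow> int" and K :: "nat \<Rightarrow> nat"
  assumes p_ge: "p \<ge> 3"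
    and A_fin: "finite {m. (n, m) \<in> A j}" and A_card: "card {m. (n, m) \<in> A j} \<le> K j"
    and z_0: "(0, m) \<in> A j \<Longrightarrow> 0 \<le> z j (0, m) \<and> z j (0, m) \<le> 2 * int p - 2"
    and z_pos: "(n, m) \<in> A j \<Longrightarrow> n > 0 \<Longrightarrow>
      - (int p * int n) \<le> z j (n, m) \<and> z j (n, m) \<le> - (int p * int n) + int p - 2"
begin

text \<open>The carry e enters above the top digit and e' leaves below the bottom digit. They are
  kept apart, although only e = e' is counted in the end, because splitting off the top digit
  changes e and keeps e'.\<close>

definition paths :: "nat \<Rightarrow> int \<Rightarrow> int \<Rightarrow> nat \<Rightarrow> ((nat \<Rightarrow> nat) \<times> (nat \<Rightarrow> nat)) set" where
  "paths s e e' n = {(\<nu>, \<mu>). (\<forall>j. j \<notin> {1..s} \<longrightarrow> \<nu> j = 0 \<and> \<mu> j = 0) \<and> (\<forall>j\<in>{1..s}. (\<nu> j, \<mu> j) \<in> A j) \<and>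
     (\<Sum>j=1..s. \<nu> j) = n \<and> int p ^ s * e - (\<Sum>j=1..s. z j (\<nu> j, \<mu> j) * int p ^ (j - 1)) = e'}"

lemma paths_Suc_subset:
  "paths (Suc s) e e' n \<subseteq> (\<Union>i\<in>{..n}. \<Union>m\<in>{m. (i, m) \<in> A (Suc s)}.
     (\<lambda>(\<nu>, \<mu>). (\<nu>(Suc s := i), \<mu>(Suc s := m))) ` paths s (int p * e - z (Suc s) (i, m)) e' (n - i))"
proof
  fix c assume c: "c \<in> paths (Suc s) e e' n"
  obtain \<nu> \<mu> where [simp]: "c = (\<nu>, \<mu>)" by fastforce
  let ?\<nu> = "\<nu>(Suc s := 0)" and ?\<mu> = "\<mu>(Suc s := 0)"
  have c': "\<And>j. j \<notin> {1..Suc s} \<Longrightarrow> \<nu> j = 0 \<and> \<mu> j = 0" "\<And>j. j \<in> {1..Suc s} \<Longrightarrow> (\<nu> j, \<mu> j) \<in> A j"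
    "(\<Sum>j=1..s. \<nu> j) + \<nu> (Suc s) = n"
    "int p ^ Suc s * e - ((\<Sum>j=1..s. z j (\<nu> j, \<mu> j) * int p ^ (j - 1)) + z (Suc s) (\<nu> (Suc s), \<mu> (Suc s)) * int p ^ s) = e'"
    using c by (auto simp: paths_def)
  have "(?\<nu>, ?\<mu>) \<in> paths s (int p * e - z (Suc s) (\<nu> (Suc s), \<mu> (Suc s))) e' (n - \<nu> (Suc s))"
    unfolding paths_def
  proof (intro CollectI, unfold split_conv, intro conjI)
    show "\<forall>j. j \<notin> {1..s} \<longrightarrow> ?\<nu> j = 0 \<and> ?\<mu> j = 0"
    proof (intro allI impI)
      fix j assume "j \<notin> {1..s}"
      then show "?\<nu> j = 0 \<and> ?\<mu> j = 0" using c'(1)[of j] by (cases "j = Suc s") auto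
    qed
    show "\<forall>j\<in>{1..s}. (?\<nu> j, ?\<mu> j) \<in> A j" using c'(2) by auto
    show "(\<Sum>j=1..s. ?\<nu> j) = n - \<nu> (Suc s)" using c'(3) by simp
    show "int p ^ s * (int p * e - z (Suc s) (\<nu> (Suc s), \<mu> (Suc s))) - (\<Sum>j=1..s. z j (?\<nu> j, ?\<mu> j) * int p ^ (j - 1)) = e'"
      using c'(4) by (simp add: algebra_simps)
  qed
  moreover have "c = (\<lambda>(\<nu>', \<mu>'). (\<nu>'(Suc s := \<nu> (Suc s)), \<mu>'(Suc s := \<mu> (Suc s)))) (?\<nu>, ?\<mu>)" by simp
  moreover have "\<nu> (Suc s) \<in> {..n}" "\<mu> (Suc s) \<in> {m. (\<nu> (Suc s), m) \<in> A (Suc s)}" using c' by auto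
  ultimately show "c \<in> (\<Union>i\<in>{..n}. \<Union>m\<in>{m. (i, m) \<in> A (Suc s)}.
     (\<lambda>(\<nu>, \<mu>). (\<nu>(Suc s := i), \<mu>(Suc s := m))) ` paths s (int p * e - z (Suc s) (i, m)) e' (n - i))"
    by blast
qed

lemma finite_paths: "finite (paths s e e' n)"
proof (induction s arbitrary: e n)
  case 0
  have "paths 0 e e' n \<subseteq> {(\<lambda>_. 0, \<lambda>_. 0)}" by (auto simp: paths_def)
  then show ?case using finite_subset by blast
next
  case (Suc s)
  show ?case by (rule finite_subset[OF paths_Suc_subset]) (use Suc A_fin in auto)
qed

text \<open>Carries e \<ge> 2 stay there and never reach an e' \<le> 1, hence the value 0. A carry
  -k runs away to minus infinity unless degree is spent on it; the factor 2^(-k) measures this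
  against the final carry.\<close>

definition potential :: "int \<Rightarrow> real" where
  "potential e = (if e \<ge> 2 then 0 else (1 / 2) ^ nat (- e))"

lemma potential_nonneg [simp]: "potential e \<ge> 0"
  by (simp add: potential_def)

text \<open>From a carry e \<ge> 0 any positive degree leads to a carry of at least 2. From -k a
  degree i > k does the same, while i \<le> k leaves at most -p (k - i) \<le> -3 (k - i): this is
  the origin of 1/8 = 2^(-3).\<close>

lemma potential_step:
  assumes "(i, m) \<in> A j"
  shows "potential (int p * e - z j (i, m)) \<le>
    (if e \<ge> 0 then if i = 0 then potential e else 0 else if i \<le> nat (- e) then (1 / 8) ^ (nat (- e) - i) else 0)"
proof -
  let ?e = "int p * e - z j (i, m)"
  have pot: "potential ?e \<le> (1 / 2) ^ k" if "?e \<le> - int k" for k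
    using that by (auto simp: potential_def intro!: power_decreasing)
  consider "e \<ge> 2" | "0 \<le> e" "e < 2" | "e < 0" by linarith
  then show ?thesis
  proof cases
    case 1
    have "int p * 2 \<le> int p * e" using 1 by (intro mult_left_mono) auto
    moreover have "z j (i, m) \<le> 2 * int p - 2"
    proof (cases "i = 0")
      case False
      have "int p * 1 \<le> int p * int i" using False by (intro mult_left_mono) auto
      then show ?thesis using z_pos[OF assms] False p_ge by linarith
    qed (use z_0 assms in auto)
    ultimately have "?e \<ge> 2" by linarith
    then show ?thesis using 1 by (simp add: potential_def)
  next
    case 2
    show ?thesis
    proof (cases "i = 0")
      case True
      have "potential e = 1" using 2 by (simp add: potential_def)
      moreover have "potential ?e \<le> 1" by (auto simp: potential_def power_le_one)
      ultimately show ?thesis using True 2 by simp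
    next
      case False
      have "int p * 1 \<le> int p * int i" using False by (intro mult_left_mono) auto
      moreover have "0 \<le> int p * e" using 2 by simp
      ultimately have "?e \<ge> 2" using z_pos[OF assms] False by linarith
      then show ?thesis using 2 by (simp add: potential_def)
    qed
  next
    case 3
    define k where "k = nat (- e)"
    have e: "e = - int k" using 3 by (simp add: k_def)
    show ?thesis
    proof (cases "i \<le> k")
      case True
      have "z j (i, m) \<ge> - (int p * int i)"
        using z_0 z_pos assms by (cases "i = 0") auto
      then have "?e \<le> - int (p * (k - i))"
        unfolding e using True by (simp add: of_nat_diff algebra_simps)
      then have "potential ?e \<le> (1 / 2) ^ (p * (k - i))" by (rule pot)
      also have "\<dots> \<le> (1 / 2) ^ (3 * (k - i))"
        by (rule power_decreasing) (use p_ge in auto)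
      also have "\<dots> = (1 / 8) ^ (k - i)" by (simp add: power_mult power3_eq_cube)
      finally show ?thesis using 3 True by (simp add: k_def)
    next
      case False
      have "int p * (int k + 1) \<le> int p * int i" using False by (intro mult_left_mono) auto
      then have "?e \<ge> 2" unfolding e using z_pos[OF assms] False by (simp add: algebra_simps)
      then show ?thesis using 3 False by (simp add: potential_def k_def)
    qed
  qed
qed

text \<open>The base 4 makes the induction close: 4^(-i) 8^(-(k-i)) = 4^(-k) 2^(-(k-i)), the
  geometric sum over i is at most 2, and 2 * 4^(-k) \<le> 2^(-k) for k \<ge> 1. This is where 4^n in
  the final bound comes from.\<close>

lemma potential_sum:
  "(\<Sum>i\<le>n. 4 ^ (n - i) * (if e \<ge> 0 then if i = 0 then potential e else 0
     else if i \<le> nat (- e) then (1 / 8) ^ (nat (- e) - i) else 0)) \<le> 4 ^ n * potential e"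
proof (cases "e \<ge> 0")
  case True
  have "(\<Sum>i\<le>n. 4 ^ (n - i) * (if i = 0 then potential e else 0)) = (\<Sum>i\<in>{0}. 4 ^ (n - i) * (if i = 0 then potential e else 0))"
    by (rule sum.mono_neutral_right) auto
  then show ?thesis using True by simp
next
  case False
  define k where "k = nat (- e)"
  have k: "k \<ge> 1" using False by (simp add: k_def)
  have geo: "(\<Sum>i\<le>k. (1 / 2 :: real) ^ (k - i)) \<le> 2"
  proof -
    have "(\<Sum>i\<le>k. (1 / 2 :: real) ^ (k - i)) = (\<Sum>i\<le>k. (1 / 2) ^ i)"
      by (rule sum.reindex_bij_witness[of _ "\<lambda>i. k - i" "\<lambda>i. k - i"]) auto
    also have "\<dots> = 2 - (1 / 2) ^ k" by (induction k) (auto simp: field_simps)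
    finally show ?thesis by simp
  qed
  have "(\<Sum>i\<le>n. 4 ^ (n - i) * (if i \<le> k then (1 / 8) ^ (k - i) else (0::real)))
      \<le> (\<Sum>i\<le>n. if i \<le> k then 4 ^ n * (1 / 4) ^ k * (1 / 2) ^ (k - i) else 0)"
  proof (rule sum_mono)
    fix i assume i: "i \<in> {..n}"
    show "4 ^ (n - i) * (if i \<le> k then (1 / 8) ^ (k - i) else (0::real)) \<le> (if i \<le> k then 4 ^ n * (1 / 4) ^ k * (1 / 2) ^ (k - i) else 0)"
    proof (cases "i \<le> k")
      case True
      have "(1 / 4 :: real) ^ k = (1 / 4) ^ i * (1 / 4) ^ (k - i)" using True by (simp flip: power_add)
      moreover have "(4 :: real) ^ n = 4 ^ (n - i) * 4 ^ i" using i by (simp flip: power_add)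
      moreover have "(1 / 4 :: real) ^ (k - i) * (1 / 2) ^ (k - i) = (1 / 8) ^ (k - i)" by (simp flip: power_mult_distrib)
      moreover have "(4 :: real) ^ i * (1 / 4) ^ i = 1" by (simp flip: power_mult_distrib)
      ultimately have "4 ^ n * (1 / 4) ^ k * (1 / 2) ^ (k - i) = (4 ^ (n - i) * (1 / 8) ^ (k - i) :: real)"
        by (metis (no_types, opaque_lifting) mult.assoc mult.right_neutral)
      then show ?thesis using True by simp
    qed simp
  qed
  also have "\<dots> \<le> (\<Sum>i\<le>k. 4 ^ n * (1 / 4) ^ k * (1 / 2) ^ (k - i))"
  proof -
    have "(\<Sum>i\<le>n. if i \<le> k then 4 ^ n * (1 / 4) ^ k * (1 / 2) ^ (k - i) else (0::real))
        = (\<Sum>i\<in>{..n} \<inter> {..k}. 4 ^ n * (1 / 4) ^ k * (1 / 2) ^ (k - i))"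
      by (rule sum.mono_neutral_cong_right) auto
    also have "\<dots> \<le> (\<Sum>i\<le>k. 4 ^ n * (1 / 4) ^ k * (1 / 2) ^ (k - i))"
      by (rule sum_mono2) auto
    finally show ?thesis .
  qed
  also have "\<dots> = 4 ^ n * (1 / 4) ^ k * (\<Sum>i\<le>k. (1 / 2) ^ (k - i))" by (simp add: sum_distrib_left)
  also have "\<dots> \<le> 4 ^ n * (1 / 4) ^ k * 2" by (rule mult_left_mono[OF geo]) simp
  also have "\<dots> \<le> 4 ^ n * (1 / 2) ^ k"
  proof -
    have "(1 / 4 :: real) ^ k = (1 / 2) ^ k * (1 / 2) ^ k" by (simp flip: power_mult_distrib)
    moreover have "(1 / 2 :: real) ^ k \<le> (1 / 2) ^ 1" by (rule power_decreasing) (use k in auto)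
    ultimately show ?thesis by simp
  qed
  finally show ?thesis using False unfolding k_def by (simp add: potential_def)
qed

text \<open>The power of 2 normalises the potential at the end of a path: for s = 0, n = 0 and e =
  e' the bound is exactly 1. The start e has to vary in the induction.\<close>

lemma card_paths:
  assumes e': "e' \<le> 1"
  shows "real (card (paths s e e' n)) \<le> 4 ^ n * 2 ^ nat (- e') * potential e * (\<Prod>j=1..s. real (K j))"
proof (induction s arbitrary: e n)
  case 0
  have sub: "paths 0 e e' n \<subseteq> {(\<lambda>_. 0, \<lambda>_. 0)}" by (auto simp: paths_def)
  show ?case
  proof (cases "n = 0 \<and> e = e'")
    case True
    have "real (card (paths 0 e e' n)) \<le> 1" using card_mono[OF _ sub] by simp
    also have "\<dots> = 4 ^ n * 2 ^ nat (- e') * potential e * 1"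
      using True e' by (simp add: potential_def flip: power_mult_distrib)
    finally show ?thesis by simp
  next
    case False
    then have "paths 0 e e' n = {}" by (auto simp: paths_def)
    then show ?thesis by simp
  qed
next
  case (Suc s)
  let ?P = "\<Prod>j=1..s. real (K j)" and ?c = "2 ^ nat (- e') :: real"
  let ?g = "\<lambda>i. if e \<ge> 0 then if i = 0 then potential e else 0
     else if i \<le> nat (- e) then (1 / 8) ^ (nat (- e) - i) else 0"
  let ?M = "\<lambda>i. {m. (i, m) \<in> A (Suc s)}"
  have P0: "0 \<le> ?P" by (simp add: prod_nonneg)
  have "card (paths (Suc s) e e' n) \<le> card (\<Union>i\<in>{..n}. \<Union>m\<in>?M i.
     (\<lambda>(\<nu>, \<mu>). (\<nu>(Suc s := i), \<mu>(Suc s := m))) ` paths s (int p * e - z (Suc s) (i, m)) e' (n - i))"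
    by (rule card_mono[OF _ paths_Suc_subset]) (use A_fin finite_paths in auto)
  also have "\<dots> \<le> (\<Sum>i\<le>n. \<Sum>m\<in>?M i. card (paths s (int p * e - z (Suc s) (i, m)) e' (n - i)))"
    by (intro order_trans[OF card_UN_le] sum_mono card_image_le finite_paths A_fin) auto
  finally have "real (card (paths (Suc s) e e' n))
      \<le> real (\<Sum>i\<le>n. \<Sum>m\<in>?M i. card (paths s (int p * e - z (Suc s) (i, m)) e' (n - i)))"
    by (rule of_nat_mono)
  also have "\<dots> = (\<Sum>i\<le>n. \<Sum>m\<in>?M i. real (card (paths s (int p * e - z (Suc s) (i, m)) e' (n - i))))"
    by (simp only: of_nat_sum)
  also have "\<dots> \<le> (\<Sum>i\<le>n. \<Sum>m\<in>?M i. 4 ^ (n - i) * ?c * ?g i * ?P)"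
  proof (intro sum_mono)
    fix i m assume "m \<in> ?M i"
    then have "potential (int p * e - z (Suc s) (i, m)) \<le> ?g i" by (intro potential_step) simp
    then have "4 ^ (n - i) * ?c * potential (int p * e - z (Suc s) (i, m)) * ?P \<le> 4 ^ (n - i) * ?c * ?g i * ?P"
      by (intro mult_right_mono mult_left_mono P0) auto
    then show "real (card (paths s (int p * e - z (Suc s) (i, m)) e' (n - i))) \<le> 4 ^ (n - i) * ?c * ?g i * ?P"
      using Suc.IH[of "int p * e - z (Suc s) (i, m)" "n - i"] by linarith
  qed
  also have "\<dots> \<le> (\<Sum>i\<le>n. real (K (Suc s)) * (4 ^ (n - i) * ?c * ?g i * ?P))"
  proof (rule sum_mono)
    fix i
    have "real (card (?M i)) * (4 ^ (n - i) * ?c * ?g i * ?P) \<le> real (K (Suc s)) * (4 ^ (n - i) * ?c * ?g i * ?P)"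
      using A_card P0 by (intro mult_right_mono mult_nonneg_nonneg) auto
    then show "(\<Sum>m\<in>?M i. 4 ^ (n - i) * ?c * ?g i * ?P) \<le> real (K (Suc s)) * (4 ^ (n - i) * ?c * ?g i * ?P)"
      by simp
  qed
  also have "\<dots> = ?c * real (K (Suc s)) * ?P * (\<Sum>i\<le>n. 4 ^ (n - i) * ?g i)"
    unfolding sum_distrib_left by (intro sum.cong refl) (simp only: mult_ac)
  also have "\<dots> \<le> ?c * real (K (Suc s)) * ?P * (4 ^ n * potential e)"
    by (intro mult_left_mono potential_sum mult_nonneg_nonneg P0) auto
  finally show ?case by (simp add: mult_ac)
qed

text \<open>If the sum equals (p^s - 1) e, then p^s e minus the sum is e again. Divisibility
  therefore says that the sequence of carries closes up.\<close>

definition cyclic :: "nat \<Rightarrow> nat \<Rightarrow> ((nat \<Rightarrow> nat) \<times> (nat \<Rightarrow> nat)) set" where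
  "cyclic s n = {(\<nu>, \<mu>). (\<forall>j. j \<notin> {1..s} \<longrightarrow> \<nu> j = 0 \<and> \<mu> j = 0) \<and> (\<forall>j\<in>{1..s}. (\<nu> j, \<mu> j) \<in> A j) \<and>
     (\<Sum>j=1..s. \<nu> j) = n \<and> int p ^ s - 1 dvd (\<Sum>j=1..s. z j (\<nu> j, \<mu> j) * int p ^ (j - 1))}"

lemma geometric: "(int p - 1) * (\<Sum>j=1..s. int p ^ (j - 1)) = int p ^ s - 1"
  by (induction s) (auto simp: algebra_simps)

text \<open>Some digit has positive degree, so the sum is strictly below 2 (p^s - 1) and e \<le> 1.
  In degree 0 the bounds on \<open>z\<close> would also allow e = 2. The lower bound follows from z
  \<ge> - p n and p \<le> 2 (p - 1).\<close>

lemma cyclic_subset: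
  assumes n: "n > 0" and s: "s \<ge> 1"
  shows "cyclic s n \<subseteq> (\<Union>e\<in>{- 2 * int n..1}. paths s e e n)"
proof
  fix c assume c: "c \<in> cyclic s n"
  obtain \<nu> \<mu> where [simp]: "c = (\<nu>, \<mu>)" by fastforce
  have A: "\<And>j. j \<in> {1..s} \<Longrightarrow> (\<nu> j, \<mu> j) \<in> A j" and sn: "(\<Sum>j=1..s. \<nu> j) = n" using c by (auto simp: cyclic_def)
  let ?z = "\<lambda>j. z j (\<nu> j, \<mu> j)" and ?g = "\<Sum>j=1..s. int p ^ (j - 1)"
  obtain e where e: "(\<Sum>j=1..s. ?z j * int p ^ (j - 1)) = (int p ^ s - 1) * e"
    using c by (auto simp: cyclic_def dvd_def)
  have q: "int p ^ s - 1 > 0" using p_ge s by (simp add: one_less_power)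
  have g: "?g > 0" by (rule sum_pos) (use s p_ge in auto)
  have \<nu>n: "\<nu> j \<le> n" if "j \<in> {1..s}" for j unfolding sn[symmetric] by (rule member_le_sum) (use that in auto)
  have up: "?z j \<le> 2 * int p - 2" and up': "\<nu> j > 0 \<Longrightarrow> ?z j < 2 * int p - 2" and low: "- (int p * int n) \<le> ?z j"
    if j: "j \<in> {1..s}" for j
  proof -
    have np: "int p * int (\<nu> j) \<le> int p * int n" using \<nu>n[OF j] by (intro mult_left_mono) auto
    have 0: "0 \<le> int p * int n" by simp
    show "- (int p * int n) \<le> ?z j"
    proof (cases "\<nu> j = 0")
      case True
      then have "0 \<le> ?z j" using z_0 A[OF j] by metis
      then show ?thesis using 0 by linarith
    next
      case False
      then show ?thesis using z_pos[OF A[OF j]] np by linarith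
    qed
    show l: "?z j < 2 * int p - 2" if nz: "\<nu> j > 0"
    proof -
      have "int p * 1 \<le> int p * int (\<nu> j)" using nz by (intro mult_left_mono) auto
      then show ?thesis using z_pos[OF A[OF j] nz] p_ge by linarith
    qed
    show "?z j \<le> 2 * int p - 2"
    proof (cases "\<nu> j = 0")
      case True
      then show ?thesis using z_0 A[OF j] by metis
    qed (use l in auto)
  qed
  have "\<exists>k\<in>{1..s}. \<nu> k > 0"
  proof (rule ccontr)
    assume "\<not> ?thesis"
    then have "(\<Sum>j=1..s. \<nu> j) = 0" by simp
    then show False using n sn by simp
  qed
  then obtain k where k: "k \<in> {1..s}" "\<nu> k > 0" by blast
  have "(\<Sum>j=1..s. ?z j * int p ^ (j - 1)) < (\<Sum>j=1..s. (2 * int p - 2) * int p ^ (j - 1))"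
  proof (rule sum_strict_mono_ex1)
    show "\<forall>j\<in>{1..s}. ?z j * int p ^ (j - 1) \<le> (2 * int p - 2) * int p ^ (j - 1)"
      using up by (intro ballI mult_right_mono) auto
    show "\<exists>j\<in>{1..s}. ?z j * int p ^ (j - 1) < (2 * int p - 2) * int p ^ (j - 1)"
      using k up' p_ge by (intro bexI[of _ k] mult_strict_right_mono) auto
  qed simp
  also have "\<dots> = 2 * ((int p - 1) * ?g)" by (simp add: sum_distrib_left algebra_simps)
  also have "\<dots> = (int p ^ s - 1) * 2" unfolding geometric by simp
  finally have "e < 2" unfolding e by (rule mult_left_less_imp_less) (use q in linarith)
  moreover have "- 2 * int n \<le> e"
  proof -
    have "(\<Sum>j=1..s. - (int p * int n) * int p ^ (j - 1)) \<le> (\<Sum>j=1..s. ?z j * int p ^ (j - 1))"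
      by (intro sum_mono mult_right_mono low) auto
    then have "- (int p * int n) * ?g \<le> (int p - 1) * ?g * e"
      unfolding e geometric by (simp add: sum_distrib_left)
    then have "- (int p * int n) * ?g \<le> ((int p - 1) * e) * ?g" by (simp only: mult_ac)
    then have "- (int p * int n) \<le> (int p - 1) * e" by (rule mult_right_le_imp_le[OF _ g])
    moreover have "int p * int n \<le> (int p - 1) * (2 * int n)"
    proof -
      have "int p * int n \<le> (2 * (int p - 1)) * int n" using p_ge by (intro mult_right_mono) auto
      then show ?thesis by (simp add: algebra_simps)
    qed
    ultimately have "(int p - 1) * (- 2 * int n) \<le> (int p - 1) * e" by simp
    then show ?thesis by (rule mult_left_le_imp_le) (use p_ge in auto)
  qed
  moreover have "c \<in> paths s e e n"
    using c e by (auto simp: cyclic_def paths_def algebra_simps)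
  ultimately show "c \<in> (\<Union>e\<in>{- 2 * int n..1}. paths s e e n)" by auto
qed

theorem card_cyclic:
  assumes n: "n > 0" and s: "s \<ge> 1"
  shows "finite (cyclic s n)" "real (card (cyclic s n)) \<le> (2 * real n + 2) * 4 ^ n * (\<Prod>j=1..s. real (K j))"
proof -
  show "finite (cyclic s n)"
    by (rule finite_subset[OF cyclic_subset[OF assms]]) (auto simp: finite_paths)
  have b: "real (card (paths s e e n)) \<le> 4 ^ n * (\<Prod>j=1..s. real (K j))" if "e \<le> 1" for e
  proof -
    \<comment> \<open>On a closed sequence the potential at the start cancels the normalisation at
      the end, so each of the 2 n + 2 possible carries contributes the same bound.\<close>
    have "2 ^ nat (- e) * potential e = 1" using that by (simp add: potential_def flip: power_mult_distrib)
    then have "4 ^ n * 2 ^ nat (- e) * potential e * (\<Prod>j=1..s. real (K j)) = 4 ^ n * (\<Prod>j=1..s. real (K j))"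
      by (metis mult.assoc mult.right_neutral)
    then show ?thesis using card_paths[OF that, of s e n] by (simp only:)
  qed
  have "card (cyclic s n) \<le> card (\<Union>e\<in>{- 2 * int n..1}. paths s e e n)"
    by (rule card_mono[OF _ cyclic_subset[OF assms]]) (auto simp: finite_paths)
  also have "\<dots> \<le> (\<Sum>e\<in>{- 2 * int n..1}. card (paths s e e n))" by (rule card_UN_le) simp
  finally have "real (card (cyclic s n)) \<le> real (\<Sum>e\<in>{- 2 * int n..1}. card (paths s e e n))" by (rule of_nat_mono)
  also have "\<dots> = (\<Sum>e\<in>{- 2 * int n..1}. real (card (paths s e e n)))" by simp
  also have "\<dots> \<le> (\<Sum>e\<in>{- 2 * int n..1}. 4 ^ n * (\<Prod>j=1..s. real (K j)))"
    by (intro sum_mono b) auto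
  also have "\<dots> = (2 * real n + 2) * 4 ^ n * (\<Prod>j=1..s. real (K j))"
    by (simp add: algebra_simps)
  finally show "real (card (cyclic s n)) \<le> (2 * real n + 2) * 4 ^ n * (\<Prod>j=1..s. real (K j))" .
qed

end

section \<open>Application of the count to critical cells\<close>

context model
begin

text \<open>The congruence compares the weight of the cell with the weight -
  \<open>val p s d\<close> of the lowest weight vector of L_d, over the torus of
  \<open>F\<close>.\<close>

definition critical_cells :: "(nat \<Rightarrow> nat) \<Rightarrow> nat \<Rightarrow> ((nat \<Rightarrow> nat) \<times> (nat \<Rightarrow> nat)) set" where
  "critical_cells d n = {(\<nu>, \<mu>). \<mu> \<in> box s d \<and> (\<forall>j. j \<notin> {1..s} \<longrightarrow> \<nu> j = 0) \<and> (\<Sum>j=1..s. \<nu> j) = n \<and>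
     (\<forall>j\<in>{1..s}. crit d j (\<nu> j) (\<mu> j)) \<and> int (q - 1) dvd wt \<nu> \<mu> + int (val p s d)}"

lemma sum_cstep: "(\<Sum>i<2 * k. cstep j i) = k * p" "(\<Sum>i<Suc (2 * k). cstep j i) = k * p + (f j + 1)"
proof -
  show e: "(\<Sum>i<2 * k. cstep j i) = k * p" for k
  proof (induction k)
    case (Suc k)
    have "(\<Sum>i<2 * Suc k. cstep j i) = k * p + (cstep j (2 * k) + cstep j (Suc (2 * k)))"
      using Suc by simp
    then show ?case using cstep_cstep by simp
  qed simp
  show "(\<Sum>i<Suc (2 * k). cstep j i) = k * p + (f j + 1)"
    by (simp only: sum.lessThan_Suc e) (simp add: cstep_def)
qed

text \<open>Here \<open>z\<close> is the share of digit j in the weight of the cell plus the value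
  of d. For even n > 0 criticality means m \<le> f_j and d_j + f_j + 2 \<le> m + p, for odd n it
  means d_j - f_j \<le> m \<le> p - 2 - f_j. These inequalities give both the bounds on
  \<open>z\<close> and, with m \<le> d_j, the number of positions.\<close>

lemma carries_crit:
  assumes d: "\<And>j. d j \<le> p - 1"
  shows "carries p (\<lambda>j. {(n, m). m \<le> d j \<and> crit d j n m})
    (\<lambda>j (n, m). int (f j) + int (d j) - 2 * int m - 2 * int (\<Sum>i<n. cstep j i)) (\<lambda>j. min (d j) (f j) + 1)"
proof
  show "p \<ge> 3" by (rule p_ge)
next
  fix n j
  have fin: "finite {m. m \<le> d j \<and> crit d j n m}" by (rule finite_subset[of _ "{..d j}"]) auto
  then show "finite {m. (n, m) \<in> {(n, m). m \<le> d j \<and> crit d j n m}}" by simp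
  have "card {m. m \<le> d j \<and> crit d j n m} \<le> min (d j) (f j) + 1"
  proof (cases "even n")
    case True
    then have "{m. m \<le> d j \<and> crit d j n m} \<subseteq> {..min (d j) (f j)}"
      by (auto simp: crit_def cstep_def)
    from card_mono[OF _ this] show ?thesis by simp
  next
    case False
    then have "{m. m \<le> d j \<and> crit d j n m} \<subseteq> {d j - f j..d j}"
      by (auto simp: crit_def cstep_def elim: oddE)
    from card_mono[OF _ this] show ?thesis by simp
  qed
  then show "card {m. (n, m) \<in> {(n, m). m \<le> d j \<and> crit d j n m}} \<le> min (d j) (f j) + 1" by simp
next
  fix m j assume "(0, m) \<in> {(n, m). m \<le> d j \<and> crit d j n m}"
  then have "m \<le> d j" "m \<le> f j" by (auto simp: crit_def cstep_def)
  then show "0 \<le> (case (0, m) of (n, m) \<Rightarrow> int (f j) + int (d j) - 2 * int m - 2 * int (\<Sum>i<n. cstep j i)) \<and>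
      (case (0, m) of (n, m) \<Rightarrow> int (f j) + int (d j) - 2 * int m - 2 * int (\<Sum>i<n. cstep j i)) \<le> 2 * int p - 2"
    using d[of j] f_le[of j] p_ge by simp
next
  fix n m j assume a: "(n, m) \<in> {(n, m). m \<le> d j \<and> crit d j n m}" and n: "n > (0::nat)"
  have md: "m \<le> d j" and c: "m < cstep j n" "d j < m + cstep j (n - 1)" using a n by (auto simp: crit_def)
  have "- (int p * int n) \<le> int (f j) + int (d j) - 2 * int m - 2 * int (\<Sum>i<n. cstep j i) \<and>
    int (f j) + int (d j) - 2 * int m - 2 * int (\<Sum>i<n. cstep j i) \<le> - (int p * int n) + int p - 2"
  proof (cases "even n")
    case True
    then obtain k where k: "n = 2 * k" by auto
    have "m \<le> f j" "d j + f j + 2 \<le> m + p"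
      using c n True f_le[of j] p_ge unfolding cstep_def by (auto split: if_splits)
    then show ?thesis using md unfolding k sum_cstep by (simp add: algebra_simps)
  next
    case False
    then obtain k where k: "n = Suc (2 * k)" by (auto elim: oddE)
    have "m + f j + 2 \<le> p" "d j \<le> m + f j"
      using c False f_le[of j] p_ge unfolding k cstep_def by auto
    then show ?thesis using md unfolding k sum_cstep by (simp add: algebra_simps)
  qed
  then show "- (int p * int n) \<le> (case (n, m) of (n, m) \<Rightarrow> int (f j) + int (d j) - 2 * int m - 2 * int (\<Sum>i<n. cstep j i)) \<and>
      (case (n, m) of (n, m) \<Rightarrow> int (f j) + int (d j) - 2 * int m - 2 * int (\<Sum>i<n. cstep j i)) \<le> - (int p * int n) + int p - 2"
    by simp
qed

lemma card_critical_cells: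
  assumes d: "\<And>j. d j \<le> p - 1" and n: "n > 0"
  shows "finite (critical_cells d n)"
    "real (card (critical_cells d n)) \<le> (2 * real n + 2) * 4 ^ n * (\<Prod>j=1..s. real (min (d j) (f j)) + 1)"
proof -
  interpret C: carries p "\<lambda>j. {(n, m). m \<le> d j \<and> crit d j n m}"
    "\<lambda>j (n, m). int (f j) + int (d j) - 2 * int m - 2 * int (\<Sum>i<n. cstep j i)" "\<lambda>j. min (d j) (f j) + 1"
    by (rule carries_crit[OF d])
  have w: "wt \<nu> \<mu> + int (val p s d) = (\<Sum>j=1..s. (int (f j) + int (d j) - 2 * int (\<mu> j) - 2 * int (\<Sum>i<\<nu> j. cstep j i)) * int p ^ (j - 1))" for \<nu> \<mu>
    unfolding wt_def val_def of_nat_sum sum.distrib[symmetric] by (intro sum.cong) (auto simp: algebra_simps)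
  have q: "int (q - 1) = int p ^ s - 1" using q_ge by (simp add: of_nat_diff)
  have sub: "critical_cells d n \<subseteq> C.cyclic s n"
  proof
    fix c assume c: "c \<in> critical_cells d n"
    obtain \<nu> \<mu> where [simp]: "c = (\<nu>, \<mu>)" by fastforce
    have "\<mu> j = 0" if "j \<notin> {1..s}" for j using c that by (auto simp: critical_cells_def box_def split: if_splits)
    moreover have "\<mu> j \<le> d j" if "j \<in> {1..s}" for j using c that boxD by (auto simp: critical_cells_def)
    ultimately show "c \<in> C.cyclic s n"
      using c unfolding critical_cells_def C.cyclic_def w q by auto
  qed
  show "finite (critical_cells d n)" by (rule finite_subset[OF sub C.card_cyclic(1)[OF n s_ge]])
  have "real (card (critical_cells d n)) \<le> real (card (C.cyclic s n))"
    using card_mono[OF C.card_cyclic(1)[OF n s_ge] sub] by simp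
  also have "\<dots> \<le> (2 * real n + 2) * 4 ^ n * (\<Prod>j=1..s. real (min (d j) (f j) + 1))"
    by (rule C.card_cyclic(2)[OF n s_ge])
  finally show "real (card (critical_cells d n)) \<le> (2 * real n + 2) * 4 ^ n * (\<Prod>j=1..s. real (min (d j) (f j)) + 1)"
    by (simp add: add.commute)
qed

lemma card_critical_cells_0:
  shows "finite (critical_cells d 0)" "card (critical_cells d 0) \<le> (\<Prod>j=1..s. min (d j) (f j) + 1)"
proof -
  have sub: "critical_cells d 0 \<subseteq> {0} \<times> box s (\<lambda>j. min (d j) (f j))"
  proof
    fix c assume c: "c \<in> critical_cells d 0"
    obtain \<nu> \<mu> where [simp]: "c = (\<nu>, \<mu>)" by fastforce
    have \<nu>: "\<nu> j = 0" for j using c by (cases "j \<in> {1..s}") (auto simp: critical_cells_def)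
    have "\<mu> j \<le> f j" if "j \<in> {1..s}" for j
    proof -
      have "crit d j (\<nu> j) (\<mu> j)" using c that by (auto simp: critical_cells_def)
      then show ?thesis by (simp add: \<nu> crit_def cstep_def)
    qed
    then have "\<mu> \<in> box s (\<lambda>j. min (d j) (f j))"
      using c by (auto simp: critical_cells_def box_def)
    moreover have "\<nu> = 0" using \<nu> by (simp add: fun_eq_iff)
    ultimately show "c \<in> {0} \<times> box s (\<lambda>j. min (d j) (f j))" by simp
  qed
  show "finite (critical_cells d 0)" by (rule finite_subset[OF sub]) simp
  have "card (critical_cells d 0) \<le> card ({0 :: nat \<Rightarrow> nat} \<times> box s (\<lambda>j. min (d j) (f j)))"
    by (rule card_mono[OF _ sub]) simp
  then show "card (critical_cells d 0) \<le> (\<Prod>j=1..s. min (d j) (f j) + 1)"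
    by (simp add: card_cartesian_product card_box)
qed

end

section \<open>Explicit bases of the simple modules\<close>

definition mat2 :: "'k \<Rightarrow> 'k \<Rightarrow> 'k \<Rightarrow> 'k \<Rightarrow> 'k::field^2^2" where
  "mat2 a b c d = vector [vector [a, b], vector [c, d]]"

lemma mat2_nth [simp]: "mat2 a b c d $ 1 $ 1 = a" "mat2 a b c d $ 1 $ 2 = b"
  "mat2 a b c d $ 2 $ 1 = c" "mat2 a b c d $ 2 $ 2 = d"
  by (simp_all add: mat2_def)

lemma mat2_eq_iff: "A = B \<longleftrightarrow> A $ 1 $ 1 = B $ 1 $ 1 \<and> A $ 1 $ 2 = B $ 1 $ 2 \<and> A $ 2 $ 1 = B $ 2 $ 1 \<and> A $ 2 $ 2 = B $ 2 $ 2"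
  for A B :: "'k::field^2^2"
  by (auto simp: vec_eq_iff forall_2)

lemma mat2_mult_nth: "(A ** B) $ i $ j = A $ i $ 1 * B $ 1 $ j + A $ i $ 2 * B $ 2 $ j"
  for A B :: "'k::field^2^2"
  by (simp add: matrix_matrix_mult_def sum_2)

lemma mat_1_nth [simp]: "(mat 1 :: 'k::field^2^2) $ 1 $ 1 = 1" "(mat 1 :: 'k::field^2^2) $ 1 $ 2 = 0"
  "(mat 1 :: 'k::field^2^2) $ 2 $ 1 = 0" "(mat 1 :: 'k::field^2^2) $ 2 $ 2 = 1"
  by (simp_all add: mat_def)

lemma torus_mat2: "torus t = mat2 t 0 0 (inverse t)"
  by (simp add: torus_def mat2_def)

abbreviation "upper a \<equiv> mat2 1 a 0 1"
abbreviation "lower b \<equiv> mat2 1 0 b 1"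
abbreviation "weyl \<equiv> mat2 0 1 (- 1) 0"

lemma SL2_UNIV_carrier [simp]: "A \<in> carrier (SL2_over UNIV) \<longleftrightarrow> det A = 1"
  by (simp add: SL2_over_def)

lemma SL2_mult [simp]: "A \<otimes>\<^bsub>SL2_over S\<^esub> B = A ** B" and SL2_one [simp]: "\<one>\<^bsub>SL2_over S\<^esub> = mat 1"
  by (simp_all add: SL2_over_def)

lemma det_mult_1: "det A = 1 \<Longrightarrow> det B = 1 \<Longrightarrow> det (A ** B) = 1" for A B :: "'k::field^2^2"
  by (simp add: det_mul)

lemma det_simple [simp]: "det (upper a) = 1" "det (lower a) = 1" "det (weyl :: 'k::field^2^2) = 1"
  "t \<noteq> 0 \<Longrightarrow> det (torus t) = 1"
  by (simp_all add: det_2 torus_mat2)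

lemma exists_functional:
  fixes scale :: "'k::field \<Rightarrow> 'v::ab_group_add \<Rightarrow> 'v"
  assumes "vector_space scale" and x: "x \<notin> module.span scale S"
  shows "\<exists>g. Vector_Spaces.linear scale (*) g \<and> g x = 1 \<and> (\<forall>y\<in>S. g y = 0)"
proof -
  interpret V: vector_space scale by fact
  interpret K: vector_space "(*) :: 'k \<Rightarrow> 'k \<Rightarrow> 'k" by standard (auto simp: algebra_simps)
  interpret P: vector_space_pair scale "(*) :: 'k \<Rightarrow> 'k \<Rightarrow> 'k" ..
  obtain B where B: "B \<subseteq> S" "V.independent B" "S \<subseteq> V.span B"
    using V.maximal_independent_subset by blast
  have xB: "x \<notin> V.span B" using x V.span_mono[OF B(1)] by blast
  then have "V.independent (insert x B)" using B(2) by (simp add: V.independent_insert)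
  from P.linear_independent_extend[OF this, of "\<lambda>y. if y = x then 1 else 0"]
  obtain g where g: "Vector_Spaces.linear scale (*) g" "\<forall>y\<in>insert x B. g y = (if y = x then 1 else 0)" by blast
  interpret g: Vector_Spaces.linear scale "(*)" g by (rule g(1))
  have "g y = 0" if "y \<in> V.span B" for y
    using that
  proof (induction rule: V.span_induct_alt)
    case base
    show ?case by (rule g.zero)
  next
    case (step c b y)
    have "b \<noteq> x" using step(1) xB V.span_base by blast
    then have "g b = 0" using g(2) step(1) by simp
    then show ?case using step by (simp add: g.add g.scale)
  qed
  then show ?thesis using g B(3) by auto
qed

lemma in_span_image:
  fixes scale :: "'k::field \<Rightarrow> 'v::ab_group_add \<Rightarrow> 'v"
  assumes "vector_space scale" and A: "finite A" and x: "x \<in> module.span scale (f ` A)"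
  shows "\<exists>c. x = (\<Sum>a\<in>A. scale (c a) (f a))"
proof -
  interpret V: vector_space scale by fact
  show ?thesis using x
  proof (induction rule: V.span_induct_alt)
    case base
    show ?case by (intro exI[of _ "\<lambda>_. 0"]) simp
  next
    case (step c b y)
    then obtain a e where a: "a \<in> A" "b = f a" and e: "y = (\<Sum>a\<in>A. scale (e a) (f a))" by blast
    have "scale c b + y = (\<Sum>x\<in>A. scale (if x = a then c else 0) (f x)) + (\<Sum>a\<in>A. scale (e a) (f a))"
    proof -
      have "(\<Sum>x\<in>A. scale (if x = a then c else 0) (f x)) = (\<Sum>x\<in>{a}. scale (if x = a then c else 0) (f x))"
        by (rule sum.mono_neutral_right) (use a A in auto)
      then show ?thesis using a e by simp
    qed
    then show ?case
      by (intro exI[of _ "\<lambda>x. (if x = a then c else 0) + e x"]) (simp add: V.scale_left_distrib sum.distrib)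
  qed
qed

context char_p
begin

text \<open>The vector valued form of \<open>poly_vanish_on\<close>, obtained by testing with linear
  functionals.\<close>

lemma poly_coeffs_unique:
  fixes w :: "nat \<Rightarrow> 'v::ab_group_add" and scale :: "'k \<Rightarrow> 'v \<Rightarrow> 'v"
  assumes vs: "vector_space scale" and A: "infinite A"
    and z: "\<And>t. t \<in> A \<Longrightarrow> (\<Sum>N<n. scale (t ^ N) (w N)) = 0" and N: "N < n"
  shows "w N = 0"
proof (rule ccontr)
  assume "w N \<noteq> 0"
  interpret V: vector_space scale by fact
  have "w N \<notin> V.span {}" using \<open>w N \<noteq> 0\<close> by simp
  from exists_functional[OF vs this] obtain g where g: "Vector_Spaces.linear scale (*) g" "g (w N) = 1" by blast
  interpret g: Vector_Spaces.linear scale "(*)" g by (rule g(1))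
  have "g (w N) = 0"
  proof (rule poly_vanish_on[of A n "\<lambda>N. g (w N)", OF _ _ N])
    fix t assume "t \<in> A"
    have "(\<Sum>N<n. g (w N) * t ^ N) = g (\<Sum>N<n. scale (t ^ N) (w N))"
      by (simp add: g.sum g.scale mult.commute)
    also have "\<dots> = 0" using z[OF \<open>t \<in> A\<close>] by (simp add: g.zero)
    finally show "(\<Sum>N<n. g (w N) * t ^ N) = 0" .
  qed (use A in simp)
  then show False using g(2) by simp
qed

lemma infinite_nonzero: "infinite (UNIV - {0 :: 'k})"
  using infinite_UNIV_k by simp

lemma regular_along_curve:
  assumes "f \<in> regular_fun" and M: "\<And>i j. \<exists>P. \<forall>t. M t $ i $ j = poly P (t :: 'k)"
  shows "\<exists>P. \<forall>t. f (M t) = poly P t"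
  using assms(1)
proof induction
  case (const c)
  show ?case by (rule exI[of _ "[:c:]"]) simp
next
  case (entry i j)
  show ?case by (rule M)
next
  case (add f h)
  then obtain P Q where "\<forall>t. f (M t) = poly P t" "\<forall>t. h (M t) = poly Q t" by blast
  then show ?case by (intro exI[of _ "P + Q"]) simp
next
  case (mult f h)
  then obtain P Q where "\<forall>t. f (M t) = poly P t" "\<forall>t. h (M t) = poly Q t" by blast
  then show ?case by (intro exI[of _ "P * Q"]) simp
qed

lemma curve_upper: "\<exists>P. \<forall>t. upper t $ i $ j = poly P (t :: 'k)"
  using exhaust_2[of i] exhaust_2[of j]
  by (auto intro: exI[of _ "[:1:]"] exI[of _ "[:0:]"] exI[of _ "[:0, 1:]"])

lemma curve_lower: "\<exists>P. \<forall>t. lower t $ i $ j = poly P (t :: 'k)"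
  using exhaust_2[of i] exhaust_2[of j]
  by (auto intro: exI[of _ "[:1:]"] exI[of _ "[:0:]"] exI[of _ "[:0, 1:]"])

text \<open>Polynomial dependence on the matrix is exploited only along one-parameter unipotent
  subgroups, where orbit maps become polynomials with coefficients in the module. Coefficients
  beyond the degree bound are set to 0 so that they may be indexed by all N.\<close>

lemma rational_along_curve:
  fixes V :: "('k, 'k^2^2, 'v::ab_group_add) gmod"
  assumes V: "rational_SL2_mod V" and x: "x \<in> vecs V"
    and M: "\<And>i j. \<exists>P. \<forall>t. M t $ i $ j = poly P t" and det: "\<And>t. det (M t) = 1"
  shows "\<exists>n w. (\<forall>N. w N \<in> vecs V) \<and> (\<forall>N\<ge>n. w N = 0) \<and> (\<forall>t. act V (M t) x = (\<Sum>N<n. smul V (t ^ N) (w N)))"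
proof -
  have gm: "is_gmod (SL2_over UNIV) V" using V by (simp add: rational_SL2_mod_def)
  interpret V: vector_space "smul V" by (rule is_gmodD(1)[OF gm])
  note VS = subspaceD[OF is_gmodD(1,2)[OF gm]]
  have "\<exists>(r::nat) u f. (\<forall>i<r. u i \<in> vecs V \<and> f i \<in> regular_fun) \<and>
        (\<forall>A\<in>carrier (SL2_over UNIV). act V A x = (\<Sum>i<r. smul V (f i A) (u i)))"
    using V x unfolding rational_SL2_mod_def by blast
  then obtain r :: nat and u f where uf: "\<forall>i<r. u i \<in> vecs V \<and> f i \<in> regular_fun"
    and a': "\<forall>A\<in>carrier (SL2_over UNIV). act V A x = (\<Sum>i<r. smul V (f i A) (u i))"
    by (elim exE conjE) (rule that)
  have u: "\<And>i. i < r \<Longrightarrow> u i \<in> vecs V" and f: "\<And>i. i < r \<Longrightarrow> f i \<in> regular_fun" using uf by blast+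
  have a: "\<And>A. det A = 1 \<Longrightarrow> act V A x = (\<Sum>i<r. smul V (f i A) (u i))" using a' by simp
  have "\<forall>i. \<exists>P. i < r \<longrightarrow> (\<forall>t. f i (M t) = poly P t)"
    using regular_along_curve[OF f M] by blast
  then obtain P where P: "\<And>i t. i < r \<Longrightarrow> f i (M t) = poly (P i) t" by metis
  define n where "n = Suc (\<Sum>i<r. degree (P i))"
  define w where "w N = (\<Sum>i<r. smul V (coeff (P i) N) (u i))" for N
  have dn: "degree (P i) < n" if "i < r" for i
  proof -
    have "degree (P i) \<le> (\<Sum>i<r. degree (P i))" by (rule member_le_sum) (use that in auto)
    then show ?thesis by (simp add: n_def)
  qed
  have pe: "poly (P i) t = (\<Sum>N<n. coeff (P i) N * t ^ N)" if "i < r" for i t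
    unfolding poly_altdef
    by (rule sum.mono_neutral_left) (use dn[OF that] in \<open>auto simp: not_le coeff_eq_0\<close>)
  have "act V (M t) x = (\<Sum>N<n. smul V (t ^ N) (w N))" for t
  proof -
    have "act V (M t) x = (\<Sum>i<r. smul V (\<Sum>N<n. coeff (P i) N * t ^ N) (u i))"
      unfolding a[OF det] by (rule sum.cong[OF refl]) (simp add: P pe)
    also have "\<dots> = (\<Sum>N<n. \<Sum>i<r. smul V (coeff (P i) N * t ^ N) (u i))"
      unfolding V.scale_sum_left by (rule sum.swap)
    also have "\<dots> = (\<Sum>N<n. smul V (t ^ N) (w N))"
      by (simp add: w_def V.scale_sum_right mult.commute)
    finally show ?thesis .
  qed
  moreover have "w N \<in> vecs V" for N unfolding w_def by (intro VS(6) VS(3) u) simp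
  moreover have "w N = 0" if "N \<ge> n" for N
    unfolding w_def
  proof (rule sum.neutral, intro ballI)
    fix i assume "i \<in> {..<r}"
    then have "coeff (P i) N = 0" using dn[of i] that by (intro coeff_eq_0) simp
    then show "smul V (coeff (P i) N) (u i) = 0" by simp
  qed
  ultimately show ?thesis by blast
qed

text \<open>All that the cohomology computation knows about a simple module: an explicit action of
  the Borel subgroup over \<open>F\<close>, with highest weight vector e 0 and lowest weight vector
  e d. The single value of the Weyl element is what later distinguishes simple modules.\<close>

definition digit_basis :: "(nat \<Rightarrow> nat) \<Rightarrow> ('k, 'k^2^2, 'v::ab_group_add) gmod \<Rightarrow> ((nat \<Rightarrow> nat) \<Rightarrow> 'v) \<Rightarrow> bool" where
  "digit_basis d V e \<longleftrightarrow>
     (\<forall>\<mu>\<in>box s d. e \<mu> \<in> vecs V) \<and>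
     (\<forall>x\<in>vecs V. \<exists>c. x = (\<Sum>\<mu>\<in>box s d. smul V (c \<mu>) (e \<mu>))) \<and>
     (\<forall>c. (\<Sum>\<mu>\<in>box s d. smul V (c \<mu>) (e \<mu>)) = 0 \<longrightarrow> (\<forall>\<mu>\<in>box s d. c \<mu> = 0)) \<and>
     (\<forall>a\<in>F. \<forall>\<mu>\<in>box s d. act V (upper a) (e \<mu>) = (\<Sum>\<tau>\<in>box s \<mu>. smul V (dp \<tau> a) (e (\<mu> - \<tau>)))) \<and>
     (\<forall>t\<in>F - {0}. \<forall>\<mu>\<in>box s d. act V (torus t) (e \<mu>) = smul V (t powi (int (val p s d) - 2 * int (val p s \<mu>))) (e \<mu>)) \<and>
     (\<exists>c. c \<noteq> 0 \<and> act V weyl (e 0) = smul V c (e d))"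

end

section \<open>The highest weight vector and its orbit\<close>

locale simple_digits = char_p p s F for p s and F :: "'k::alg_closed_field set" +
  fixes d :: "nat \<Rightarrow> nat" and V :: "('k, 'k^2^2, 'v::ab_group_add) gmod"
  assumes d: "d \<in> box s (\<lambda>_. p - 1)" and V: "simple_SL2_mod (val p s d) V"
begin

abbreviation "m \<equiv> val p s d"

lemma V_rat: "rational_SL2_mod V" and V_simple: "simple_gmod (SL2_over UNIV) V"
  and V_weight: "is_weight V (int m)" and V_max: "is_weight V \<mu> \<Longrightarrow> \<exists>j::nat. \<mu> = int m - 2 * int j"
  using V by (auto simp: simple_SL2_mod_def)

lemma V_gmod: "is_gmod (SL2_over UNIV) V"
  using V_rat by (simp add: rational_SL2_mod_def)

sublocale V: vector_space "smul V" by (rule is_gmodD(1)[OF V_gmod])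

lemma act_V: "det g = 1 \<Longrightarrow> v \<in> vecs V \<Longrightarrow> act V g v \<in> vecs V"
  and act_add: "det g = 1 \<Longrightarrow> u \<in> vecs V \<Longrightarrow> v \<in> vecs V \<Longrightarrow> act V g (u + v) = act V g u + act V g v"
  and act_scale: "det g = 1 \<Longrightarrow> v \<in> vecs V \<Longrightarrow> act V g (smul V c v) = smul V c (act V g v)"
  and act_one: "v \<in> vecs V \<Longrightarrow> act V (mat 1) v = v"
  and act_mult: "det g = 1 \<Longrightarrow> det h = 1 \<Longrightarrow> v \<in> vecs V \<Longrightarrow> act V (g ** h) v = act V g (act V h v)"
  using is_gmodD[OF V_gmod] by auto

lemmas VS = subspaceD[OF is_gmodD(1,2)[OF V_gmod]]

lemma act_0: "det g = 1 \<Longrightarrow> act V g 0 = 0"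
  using act_scale[of g 0 0] VS(1) by simp

lemma act_sum: "det g = 1 \<Longrightarrow> (\<And>i. i \<in> A \<Longrightarrow> w i \<in> vecs V) \<Longrightarrow>
    act V g (\<Sum>i\<in>A. smul V (c i) (w i)) = (\<Sum>i\<in>A. smul V (c i) (act V g (w i)))"
proof (induction A rule: infinite_finite_induct)
  case (insert a A)
  have "act V g (smul V (c a) (w a) + (\<Sum>i\<in>A. smul V (c i) (w i)))
      = act V g (smul V (c a) (w a)) + act V g (\<Sum>i\<in>A. smul V (c i) (w i))"
    by (rule act_add) (use insert.prems in \<open>auto intro!: VS(3) VS(6)\<close>)
  then show ?case using insert act_scale by simp
qed (simp_all add: act_0)

definition v :: 'v where
  "v = (SOME v. v \<in> vecs V \<and> v \<noteq> 0 \<and> (\<forall>t. t \<noteq> 0 \<longrightarrow> act V (torus t) v = smul V (t powi int m) v))"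

lemma v: "v \<in> vecs V" "v \<noteq> 0" "t \<noteq> 0 \<Longrightarrow> act V (torus t) v = smul V (t powi int m) v"
proof -
  have "\<exists>v. v \<in> vecs V \<and> v \<noteq> 0 \<and> (\<forall>t. t \<noteq> 0 \<longrightarrow> act V (torus t) v = smul V (t powi int m) v)"
    using V_weight unfolding is_weight_def by blast
  from someI_ex[OF this] show "v \<in> vecs V" "v \<noteq> 0" "t \<noteq> 0 \<Longrightarrow> act V (torus t) v = smul V (t powi int m) v"
    unfolding v_def by blast+
qed

text \<open>Conjugation by the torus rescales the parameter of the one-parameter group by t^k;
  comparing the coefficients of a^N gives the weight of the N-th coefficient vector. The upper root
  group has k = 2, the lower one k = -2.\<close>

lemma weight_coeffs:
  fixes k :: int
  assumes w: "\<And>N. w N \<in> vecs V" and ww: "\<And>a. act V (M a) v = (\<Sum>N<n. smul V (a ^ N) (w N))"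
    and M: "\<And>a. det (M a) = 1" and conj: "\<And>t a. t \<noteq> 0 \<Longrightarrow> torus t ** M a = M (t powi k * a) ** torus t"
    and t: "t \<noteq> 0" and N: "N < n"
  shows "act V (torus t) (w N) = smul V (t powi (int m + k * int N)) (w N)"
proof -
  let ?u = "\<lambda>N. act V (torus t) (w N) - smul V (t powi (int m + k * int N)) (w N)"
  have "?u N = 0"
  proof (rule poly_coeffs_unique[OF V.vector_space_axioms infinite_UNIV_k _ N])
    fix a
    have "(\<Sum>N<n. smul V (a ^ N) (act V (torus t) (w N))) = act V (torus t) (act V (M a) v)"
      unfolding ww using t w by (simp add: act_sum)
    also have "\<dots> = act V (M (t powi k * a)) (act V (torus t) v)"
      using t M v(1) by (simp add: act_mult[symmetric] conj)
    also have "\<dots> = smul V (t powi int m) (\<Sum>N<n. smul V ((t powi k * a) ^ N) (w N))"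
      using t M v(1) by (simp add: v(3) act_scale ww)
    also have "\<dots> = (\<Sum>N<n. smul V (a ^ N) (smul V (t powi (int m + k * int N)) (w N)))"
      using t by (simp add: V.scale_sum_right power_mult_distrib power_int_add power_int_mult mult_ac)
    finally show "(\<Sum>N<n. smul V (a ^ N) (?u N)) = 0"
      by (simp add: V.scale_right_diff_distrib sum_subtractf)
  qed
  then show ?thesis by simp
qed

text \<open>A nonzero coefficient of positive index N would have weight m + 2 N, which lies above
  the highest weight. The orbit map is therefore constant.\<close>

lemma upper_v: "act V (upper a) v = v"
proof -
  obtain n w where w: "\<And>N. w N \<in> vecs V" and ww: "\<And>a. act V (upper a) v = (\<Sum>N<n. smul V (a ^ N) (w N))"
    using rational_along_curve[OF V_rat v(1) curve_upper] by auto
  have conj: "torus t ** upper a = upper (t powi 2 * a) ** torus t" if "t \<noteq> 0" for t a :: 'k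
    using that by (simp add: mat2_eq_iff mat2_mult_nth torus_mat2 power2_eq_square)
  have z: "w N = 0" if N: "0 < N" "N < n" for N
  proof (rule ccontr)
    assume nz: "w N \<noteq> 0"
    have "is_weight V (int m + 2 * int N)"
      unfolding is_weight_def using weight_coeffs[OF w ww _ conj _ N(2)] w nz by auto
    from V_max[OF this] obtain j :: nat where "int m + 2 * int N = int m - 2 * int j" by blast
    then show False using N by simp
  qed
  have c: "act V (upper a) v = (if n > 0 then w 0 else 0)" for a
  proof -
    have "(\<Sum>N<n. smul V (a ^ N) (w N)) = (\<Sum>N\<in>{0} \<inter> {..<n}. smul V (a ^ N) (w N))"
      by (rule sum.mono_neutral_right) (use z in auto)
    then show ?thesis by (auto simp: ww)
  qed
  have "upper 0 = (mat 1 :: 'k^2^2)" by (simp add: mat2_eq_iff)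
  then have "act V (upper 0) v = v" using act_one[OF v(1)] by simp
  then show ?thesis using c by metis
qed

text \<open>The vectors \<open>Fc N\<close> are the divided powers of the lowering operator applied
  to v, obtained as coefficients of the orbit map without introducing a Lie algebra.\<close>

definition low :: "nat \<times> (nat \<Rightarrow> 'v)" where
  "low = (SOME (n, w). (\<forall>N. w N \<in> vecs V) \<and> (\<forall>N\<ge>n. w N = 0) \<and>
     (\<forall>t. act V (lower t) v = (\<Sum>N<n. smul V (t ^ N) (w N))))"

abbreviation "dg \<equiv> fst low"
abbreviation "Fc \<equiv> snd low"

lemma low: "Fc N \<in> vecs V" "N \<ge> dg \<Longrightarrow> Fc N = 0" "act V (lower t) v = (\<Sum>N<dg. smul V (t ^ N) (Fc N))"
proof -
  have "\<exists>n w. (\<forall>N. w N \<in> vecs V) \<and> (\<forall>N\<ge>n. w N = 0) \<and> (\<forall>t. act V (lower t) v = (\<Sum>N<n. smul V (t ^ N) (w N)))"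
    by (rule rational_along_curve[OF V_rat v(1) curve_lower]) simp
  then have "\<exists>y. case y of (n, w) \<Rightarrow> (\<forall>N. w N \<in> vecs V) \<and> (\<forall>N\<ge>n. w N = 0) \<and>
      (\<forall>t. act V (lower t) v = (\<Sum>N<n. smul V (t ^ N) (w N)))" by simp
  from someI_ex[OF this] show "Fc N \<in> vecs V" "N \<ge> dg \<Longrightarrow> Fc N = 0" "act V (lower t) v = (\<Sum>N<dg. smul V (t ^ N) (Fc N))"
    unfolding low_def[symmetric] by (simp_all add: case_prod_unfold)
qed

lemma n_pos: "dg > 0" and Fc_0: "Fc 0 = v"
proof -
  have "lower 0 = (mat 1 :: 'k^2^2)" by (simp add: mat2_eq_iff)
  then have e: "v = (\<Sum>N<dg. smul V (0 ^ N) (Fc N))" using act_one[OF v(1)] low(3)[of 0] by simp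
  show n: "dg > 0"
  proof (rule ccontr)
    assume "\<not> ?thesis"
    then show False using e v(2) by simp
  qed
  have "(\<Sum>N<dg. smul V (0 ^ N) (Fc N)) = (\<Sum>N\<in>{0}. smul V (0 ^ N) (Fc N))"
    by (rule sum.mono_neutral_right) (use n in \<open>auto simp: power_0_left\<close>)
  then show "Fc 0 = v" using e by simp
qed

lemma torus_Fc: "t \<noteq> 0 \<Longrightarrow> N < dg \<Longrightarrow> act V (torus t) (Fc N) = smul V (t powi (int m - 2 * int N)) (Fc N)"
  using weight_coeffs[OF low(1) low(3), of "- 2" t N]
  by (simp add: mat2_eq_iff mat2_mult_nth torus_mat2 power_int_minus field_simps power2_eq_square)

text \<open>The weights m - 2 N with N \<ge> 1 differ from m. Applying the torus to a relation and
  multiplying by t^(2 dg - m) clears negative exponents and gives a polynomial in t whose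
  coefficient at 2 dg is v.\<close>

lemma v_notin_span: "v \<notin> V.span (Fc ` {1..<dg})"
proof
  assume "v \<in> V.span (Fc ` {1..<dg})"
  then obtain c where c: "v = (\<Sum>N=1..<dg. smul V (c N) (Fc N))"
    using in_span_image[OF V.vector_space_axioms, of "{1..<dg}" v Fc] by auto
  \<comment> \<open>Coefficients of that polynomial: v at exponent 2 dg, and the negated N-th
    summand at exponent 2 (dg - N).\<close>
  define w where "w k = (if k = 2 * dg then v else if even k \<and> k < 2 * dg then - smul V (c (dg - k div 2)) (Fc (dg - k div 2)) else 0)" for k
  have "w (2 * dg) = 0"
  proof (rule poly_coeffs_unique[OF V.vector_space_axioms infinite_nonzero, where n = "Suc (2 * dg)"])
    fix t :: 'k assume "t \<in> UNIV - {0}"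
    then have t: "t \<noteq> 0" by simp
    have "smul V (t powi int m) v = act V (torus t) (\<Sum>N=1..<dg. smul V (c N) (Fc N))"
      using v(3)[OF t] c by simp
    also have "\<dots> = (\<Sum>N=1..<dg. smul V (c N) (act V (torus t) (Fc N)))"
      by (rule act_sum) (use t low(1) in auto)
    also have "\<dots> = (\<Sum>N=1..<dg. smul V (c N) (smul V (t powi (int m - 2 * int N)) (Fc N)))"
      by (rule sum.cong[OF refl]) (simp add: torus_Fc[OF t])
    finally have "smul V (t powi (2 * int dg - int m)) (smul V (t powi int m) v)
        = smul V (t powi (2 * int dg - int m)) (\<Sum>N=1..<dg. smul V (c N) (smul V (t powi (int m - 2 * int N)) (Fc N)))"
      by simp
    moreover have "t powi (2 * int dg - int m) * t powi int m = t powi (2 * int dg)"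
      "t powi (2 * int dg - int m) * t powi (int m - 2 * int N) = t powi (2 * int dg - 2 * int N)" for N
      by (simp_all only: power_int_add[OF disjI1[OF t], symmetric]) (simp_all add: algebra_simps)
    ultimately have "smul V (t powi (2 * int dg)) v = (\<Sum>N=1..<dg. smul V (c N * t powi (2 * int dg - 2 * int N)) (Fc N))"
      by (simp add: V.scale_sum_right mult.left_commute[of _ "c _"] del: power_int_of_nat)
    moreover have "t powi (2 * int dg) = t ^ (2 * dg)" by (metis of_nat_mult of_nat_numeral power_int_of_nat)
    moreover have "(\<Sum>N=1..<dg. smul V (c N * t powi (2 * int dg - 2 * int N)) (Fc N))
        = (\<Sum>N=1..<dg. smul V (t ^ (2 * (dg - N))) (smul V (c N) (Fc N)))"
    proof (rule sum.cong[OF refl])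
      fix N assume "N \<in> {1..<dg}"
      then have "2 * int dg - 2 * int N = int (2 * (dg - N))" by (simp add: of_nat_diff)
      then have "t powi (2 * int dg - 2 * int N) = t ^ (2 * (dg - N))" by (metis power_int_of_nat)
      then show "smul V (c N * t powi (2 * int dg - 2 * int N)) (Fc N) = smul V (t ^ (2 * (dg - N))) (smul V (c N) (Fc N))"
        by (simp add: mult.commute)
    qed
    ultimately have e: "smul V (t ^ (2 * dg)) v = (\<Sum>N=1..<dg. smul V (t ^ (2 * (dg - N))) (smul V (c N) (Fc N)))" by simp
    have "(\<Sum>k<2 * dg. smul V (t ^ k) (w k)) = (\<Sum>k\<in>(\<lambda>N. 2 * (dg - N)) ` {1..<dg} \<union> {0}. smul V (t ^ k) (w k))"
    proof (rule sum.mono_neutral_right)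
      show "\<forall>k\<in>{..<2 * dg} - ((\<lambda>N. 2 * (dg - N)) ` {1..<dg} \<union> {0}). smul V (t ^ k) (w k) = 0"
      proof
        fix k assume k: "k \<in> {..<2 * dg} - ((\<lambda>N. 2 * (dg - N)) ` {1..<dg} \<union> {0})"
        have "odd k"
        proof
          assume "even k"
          then obtain l where l: "k = 2 * l" by auto
          have "k = 2 * (dg - (dg - l))" "dg - l \<in> {1..<dg}" using k l by auto
          then show False using k by blast
        qed
        then show "smul V (t ^ k) (w k) = 0" using k by (auto simp: w_def)
      qed
    qed (use n_pos in auto)
    also have "\<dots> = (\<Sum>k\<in>(\<lambda>N. 2 * (dg - N)) ` {1..<dg}. smul V (t ^ k) (w k)) + smul V (t ^ 0) (w 0)"
      by (subst sum.union_disjoint) auto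
    also have "w 0 = 0" using low(2)[of dg] n_pos by (simp add: w_def)
    also have "(\<Sum>k\<in>(\<lambda>N. 2 * (dg - N)) ` {1..<dg}. smul V (t ^ k) (w k)) = (\<Sum>N=1..<dg. smul V (t ^ (2 * (dg - N))) (w (2 * (dg - N))))"
      by (subst sum.reindex) (auto simp: inj_on_def)
    also have "\<dots> = (\<Sum>N=1..<dg. - smul V (t ^ (2 * (dg - N))) (smul V (c N) (Fc N)))"
      by (rule sum.cong[OF refl]) (auto simp: w_def)
    finally have "(\<Sum>k<2 * dg. smul V (t ^ k) (w k)) = - smul V (t ^ (2 * dg)) v"
      unfolding e by (simp add: sum_negf)
    then show "(\<Sum>k<Suc (2 * dg). smul V (t ^ k) (w k)) = 0" by (simp add: w_def)
  qed simp
  then show False using v(2) by (simp add: w_def)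
qed

text \<open>The matrix coefficients \<open>X \<mapsto> \<Lambda> (X x)\<close> separate the vectors of \<open>V\<close>, so that identities in \<open>V\<close>
  reduce to polynomial identities.\<close>

definition \<Lambda> :: "'v \<Rightarrow> 'k" where
  "\<Lambda> = (SOME g. Vector_Spaces.linear (smul V) (*) g \<and> g v = 1 \<and> (\<forall>y\<in>Fc ` {1..<dg}. g y = 0))"

lemma \<Lambda>: "Vector_Spaces.linear (smul V) (*) \<Lambda>" "\<Lambda> v = 1" "1 \<le> N \<Longrightarrow> \<Lambda> (Fc N) = 0"
proof -
  have l: "Vector_Spaces.linear (smul V) (*) \<Lambda> \<and> \<Lambda> v = 1 \<and> (\<forall>y\<in>Fc ` {1..<dg}. \<Lambda> y = 0)"
    unfolding \<Lambda>_def by (rule someI_ex[OF exists_functional[OF V.vector_space_axioms v_notin_span]])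
  then show L: "Vector_Spaces.linear (smul V) (*) \<Lambda>" and "\<Lambda> v = 1" by blast+
  interpret g: Vector_Spaces.linear "smul V" "(*)" \<Lambda> by (rule L)
  show "1 \<le> N \<Longrightarrow> \<Lambda> (Fc N) = 0"
    using l low(2)[of N] g.zero by (cases "N < dg") auto
qed

sublocale \<Lambda>: Vector_Spaces.linear "smul V" "(*)" \<Lambda> by (rule \<Lambda>(1))

lemma \<Lambda>_lower: "\<Lambda> (act V (lower b) v) = 1"
proof -
  have "\<Lambda> (act V (lower b) v) = (\<Sum>N<dg. b ^ N * \<Lambda> (Fc N))" by (simp add: low(3) \<Lambda>.sum \<Lambda>.scale)
  also have "\<dots> = (\<Sum>N\<in>{0}. b ^ N * \<Lambda> (Fc N))"
    by (rule sum.mono_neutral_right) (use n_pos \<Lambda>(3) in auto)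
  finally show ?thesis by (simp add: Fc_0 \<Lambda>(2))
qed

section \<open>Matrix coefficients\<close>

lemma \<Lambda>_act_v:
  assumes A: "det A = 1"
  shows "\<Lambda> (act V A v) = (A $ 1 $ 1) ^ m"
proof -
  have big_cell: "\<Lambda> (act V A v) = (A $ 1 $ 1) ^ m" if A: "det A = 1" and nz: "A $ 1 $ 1 \<noteq> 0" for A
  proof -
    let ?t = "A $ 1 $ 1" and ?b = "A $ 2 $ 1 / A $ 1 $ 1" and ?a = "A $ 1 $ 2 / A $ 1 $ 1"
    have "A $ 2 $ 2 = (1 + A $ 1 $ 2 * A $ 2 $ 1) / ?t" using A nz by (simp add: det_2 field_simps)
    \<comment> \<open>Big cell factorisation; \<open>upper\<close> fixes v, the torus scales it, and
      \<Lambda> does not notice \<open>lower\<close>.\<close>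
    then have e: "A = lower ?b ** (torus ?t ** upper ?a)"
      using nz by (simp add: mat2_eq_iff mat2_mult_nth torus_mat2 field_simps)
    have "act V A v = act V (lower ?b) (act V (torus ?t) (act V (upper ?a) v))"
      by (subst e) (use nz v(1) in \<open>simp add: act_mult det_mult_1 act_V\<close>)
    also have "\<dots> = smul V (?t ^ m) (act V (lower ?b) v)"
      using nz v(1) by (simp add: upper_v v(3) act_scale)
    finally show ?thesis by (simp add: \<Lambda>.scale \<Lambda>_lower)
  qed
  show ?thesis
  proof (cases "A $ 1 $ 1 = 0")
    case True
    have g: "A $ 2 $ 1 \<noteq> 0" using A True by (auto simp: det_2)
    obtain k w where ww: "\<And>t. act V (upper t) (act V A v) = (\<Sum>N<k. smul V (t ^ N) (w N))"
      using rational_along_curve[OF V_rat act_V[OF A v(1)] curve_upper] by auto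
    \<comment> \<open>Matrices outside the big cell are reached along \<open>upper t ** A\<close>,
      which lies in the cell for t \<noteq> 0. Both sides are polynomial in t, so agreement extends
      to t = 0.\<close>
    define P where "P = (\<Sum>N<k. monom (\<Lambda> (w N)) N) - monom ((A $ 2 $ 1) ^ m) m"
    have Pt: "poly P t = \<Lambda> (act V (upper t) (act V A v)) - (t * A $ 2 $ 1) ^ m" for t
      by (simp add: P_def poly_sum poly_monom ww \<Lambda>.sum \<Lambda>.scale power_mult_distrib mult.commute)
    have "poly P t = 0" if "t \<noteq> 0" for t
    proof -
      have "act V (upper t) (act V A v) = act V (upper t ** A) v" using A v(1) by (simp add: act_mult)
      moreover have "(upper t ** A) $ 1 $ 1 = t * A $ 2 $ 1" using True by (simp add: mat2_mult_nth)
      ultimately show ?thesis using big_cell[of "upper t ** A"] A that g by (simp add: Pt det_mult_1)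
    qed
    then have "UNIV - {0} \<subseteq> {t. poly P t = 0}" by auto
    then have "P = 0" using infinite_nonzero poly_roots_finite[of P] finite_subset by blast
    then have "\<Lambda> (act V (upper 0) (act V A v)) = 0 ^ m" using Pt[of 0] by simp
    moreover have "upper 0 = (mat 1 :: 'k^2^2)" by (simp add: mat2_eq_iff)
    ultimately show ?thesis using True act_one[OF act_V[OF A v(1)]] by simp
  qed (use big_cell A in blast)
qed

lemma simple_submodule:
  assumes "V.subspace U" "U \<subseteq> vecs V" "\<And>g u. det g = 1 \<Longrightarrow> u \<in> U \<Longrightarrow> act V g u \<in> U" "u \<in> U" "u \<noteq> 0"
  shows "U = vecs V"
  using V_simple assms unfolding simple_gmod_def by (metis SL2_UNIV_carrier singletonD)

lemma vecs_eq_span: "vecs V = V.span {act V A v | A. det A = 1}"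
proof (rule sym, rule simple_submodule)
  let ?S = "{act V A v | A. det A = 1}"
  have sub: "V.subspace (vecs V)" by (rule is_gmodD(2)[OF V_gmod])
  show sV: "V.span ?S \<subseteq> vecs V" by (rule V.span_minimal[OF _ sub]) (auto intro: act_V v(1))
  show "act V g u \<in> V.span ?S" if g: "det g = 1" and u: "u \<in> V.span ?S" for g u
  proof -
    have "u \<in> vecs V \<and> act V g u \<in> V.span ?S"
      using u
    proof (induction rule: V.span_induct_alt)
      case base
      show ?case using act_0[OF g] V.span_zero VS(1) by simp
    next
      case (step c b y)
      then obtain A where A: "det A = 1" "b = act V A v" by blast
      have bv: "b \<in> vecs V" using A act_V v(1) by auto
      have "act V g b = act V (g ** A) v" using A g v(1) by (simp add: act_mult)
      then have "act V g b \<in> V.span ?S" using A g by (auto intro!: V.span_base exI[of _ "g ** A"] simp: det_mult_1)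
      then show ?case using step bv g by (simp add: act_add act_scale VS V.span_add V.span_scale)
    qed
    then show ?thesis ..
  qed
  show "v \<in> V.span ?S" by (rule V.span_base) (auto intro!: exI[of _ "mat 1"] simp: act_one v(1))
qed (use v(2) in auto)

text \<open>The vectors with vanishing matrix coefficients form a submodule. It does not contain v,
  because \<Lambda> v = 1, so by simplicity it is 0.\<close>

lemma separation:
  assumes x: "x \<in> vecs V" "y \<in> vecs V" and e: "\<And>X. det X = 1 \<Longrightarrow> \<Lambda> (act V X x) = \<Lambda> (act V X y)"
  shows "x = y"
proof (rule ccontr)
  assume ne: "x \<noteq> y"
  define U where "U = {u \<in> vecs V. \<forall>X. det X = 1 \<longrightarrow> \<Lambda> (act V X u) = 0}"
  have act_diff: "act V X (x - y) = act V X x - act V X y" if "det X = 1" for X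
    using act_add[OF that x(1), of "smul V (- 1) y"] act_scale[OF that x(2), of "- 1"] VS(3)[OF x(2), of "- 1"] by simp
  have "U = vecs V"
  proof (rule simple_submodule)
    show "V.subspace U" unfolding V.subspace_def U_def
      by (auto simp: VS act_0 act_add act_scale \<Lambda>.zero \<Lambda>.add \<Lambda>.scale)
    show "act V g u \<in> U" if "det g = 1" "u \<in> U" for g u
      using that by (auto simp: U_def act_V act_mult[symmetric] det_mult_1)
    show "x - y \<in> U" using x e by (auto simp: U_def VS act_diff \<Lambda>.diff)
  qed (use ne in \<open>auto simp: U_def\<close>)
  then have "v \<in> U" using v(1) by simp
  then have "\<Lambda> (act V (mat 1) v) = 0" unfolding U_def by simp
  then show False using act_one[OF v(1)] \<Lambda>(2) by simp
qed

lemma d_sub: "\<mu> \<in> box s d \<Longrightarrow> \<mu> \<in> box s full" "\<mu> \<in> box s d \<Longrightarrow> d - \<mu> \<in> box s full"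
proof -
  have "box s d \<subseteq> box s full" by (rule box_mono) (use d in \<open>auto simp: box_def\<close>)
  then show "\<mu> \<in> box s d \<Longrightarrow> \<mu> \<in> box s full" by blast
  show "\<mu> \<in> box s d \<Longrightarrow> d - \<mu> \<in> box s full"
    using d unfolding box_def by (auto split: if_splits intro: diff_le_mono2 le_trans[OF diff_le_self])
qed

lemma power_val: "\<mu> \<in> box s full \<Longrightarrow> x ^ val p s \<mu> = mfact \<mu> * dp \<mu> x"
  using mfact_nonzero by (simp add: dp_def)

text \<open>A generating function in \<gamma>: the value at \<open>X ** lower \<gamma>\<close> is
  the m-th power of \<gamma> X_12 + X_11, and \<open>dp_add\<close> expands it digit by digit. Only
  exponents \<open>val p s \<mu>\<close> with \<mu> in \<open>box s d\<close> occur, which is the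
  form Steinberg's theorem takes here.\<close>

lemma \<Lambda>_act_Fc:
  assumes X: "det X = 1" and \<mu>: "\<mu> \<in> box s d"
  shows "\<Lambda> (act V X (Fc (val p s \<mu>))) = mfact d * dp \<mu> (X $ 1 $ 2) * dp (d - \<mu>) (X $ 1 $ 1)"
proof -
  \<comment> \<open>Room for both expansions: \<open>dg\<close> bounds the degree of the orbit map
    and q bounds \<open>val\<close>.\<close>
  define k where "k = max dg q"
  let ?r = "\<lambda>\<mu>. mfact d * dp \<mu> (X $ 1 $ 2) * dp (d - \<mu>) (X $ 1 $ 1)"
  define c where "c N = \<Lambda> (act V X (Fc N)) - (\<Sum>\<mu>\<in>{\<mu> \<in> box s d. val p s \<mu> = N}. ?r \<mu>)" for N
  have vl: "val p s \<mu> < k" if "\<mu> \<in> box s d" for \<mu>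
    using val_less[OF p_pos d_sub(1)[OF that]] by (simp add: k_def)
  have "c (val p s \<mu>) = 0"
  proof (rule poly_vanish_on[of UNIV])
    fix \<gamma> :: 'k
    have "(\<Sum>N<k. \<Lambda> (act V X (Fc N)) * \<gamma> ^ N) = (\<Sum>N<dg. \<Lambda> (act V X (Fc N)) * \<gamma> ^ N)"
      by (rule sum.mono_neutral_right) (auto simp: k_def low(2) act_0[OF X] \<Lambda>.zero)
    also have "\<dots> = \<Lambda> (act V X (act V (lower \<gamma>) v))"
      by (simp add: low(3) act_sum[OF X low(1)] \<Lambda>.sum \<Lambda>.scale mult.commute)
    also have "act V X (act V (lower \<gamma>) v) = act V (X ** lower \<gamma>) v"
      using X v(1) by (simp add: act_mult)
    also have "\<Lambda> \<dots> = (\<gamma> * X $ 1 $ 2 + X $ 1 $ 1) ^ m"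
      using X by (simp add: \<Lambda>_act_v det_mult_1 mat2_mult_nth algebra_simps)
    also have "\<dots> = mfact d * dp d (\<gamma> * X $ 1 $ 2 + X $ 1 $ 1)" by (rule power_val[OF d])
    also have "\<dots> = (\<Sum>\<mu>\<in>box s d. ?r \<mu> * \<gamma> ^ val p s \<mu>)"
      by (simp add: dp_add[OF d] dp_mult sum_distrib_left mult_ac)
    also have "\<dots> = (\<Sum>N<k. \<Sum>\<mu>\<in>{\<mu> \<in> box s d. val p s \<mu> = N}. ?r \<mu> * \<gamma> ^ val p s \<mu>)"
      by (rule sum.group[symmetric]) (auto simp: vl)
    also have "\<dots> = (\<Sum>N<k. (\<Sum>\<mu>\<in>{\<mu> \<in> box s d. val p s \<mu> = N}. ?r \<mu>) * \<gamma> ^ N)"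
      unfolding sum_distrib_right by (intro sum.cong) auto
    finally show "(\<Sum>N<k. c N * \<gamma> ^ N) = 0"
      unfolding c_def left_diff_distrib sum_subtractf by simp
  qed (use infinite_UNIV_k vl[OF \<mu>] in auto)
  moreover have "{\<mu>' \<in> box s d. val p s \<mu>' = val p s \<mu>} = {\<mu>}"
    using val_inj[OF p_pos d_sub(1) d_sub(1)[OF \<mu>]] \<mu> by blast
  ultimately show ?thesis by (simp add: c_def)
qed

text \<open>Normalised so that the matrix coefficient is a divided power of X_12 times a pure power
  of X_11. With this choice \<open>upper a\<close> acts through divided powers of a with no further
  constants.\<close>

definition e :: "(nat \<Rightarrow> nat) \<Rightarrow> 'v" where
  "e \<mu> = smul V (mfact (d - \<mu>) / mfact d) (Fc (val p s \<mu>))"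

lemma e_vecs: "e \<mu> \<in> vecs V"
  unfolding e_def by (intro VS low(1))

lemma \<Lambda>_e:
  assumes X: "det X = 1" and \<mu>: "\<mu> \<in> box s d"
  shows "\<Lambda> (act V X (e \<mu>)) = dp \<mu> (X $ 1 $ 2) * X $ 1 $ 1 ^ val p s (d - \<mu>)"
  unfolding e_def act_scale[OF X low(1)] \<Lambda>.scale \<Lambda>_act_Fc[OF X \<mu>] power_val[OF d_sub(2)[OF \<mu>]]
  using mfact_nonzero[OF d] by simp

lemma \<Lambda>_sum_e:
  assumes X: "det X = 1" and A: "\<And>i. i \<in> A \<Longrightarrow> g i \<in> box s d"
  shows "\<Lambda> (act V X (\<Sum>i\<in>A. smul V (c i) (e (g i)))) = (\<Sum>i\<in>A. c i * (dp (g i) (X $ 1 $ 2) * X $ 1 $ 1 ^ val p s (d - g i)))"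
  by (subst act_sum[OF X e_vecs]) (simp add: \<Lambda>.sum \<Lambda>.scale \<Lambda>_e[OF X A])

lemma e_sum_vecs: "(\<Sum>i\<in>A. smul V (c i) (e (g i))) \<in> vecs V"
  by (intro VS e_vecs)

lemma box_diff: "\<mu> \<in> box s d \<Longrightarrow> \<tau> \<in> box s \<mu> \<Longrightarrow> \<mu> - \<tau> \<in> box s d"
  "\<mu> \<in> box s d \<Longrightarrow> \<tau> \<in> box s \<mu> \<Longrightarrow> d - (\<mu> - \<tau>) = (d - \<mu>) + \<tau>"
  "\<mu> \<in> box s d \<Longrightarrow> d - \<mu> + \<mu> = d"
proof -
  assume \<mu>: "\<mu> \<in> box s d"
  note \<mu>' = \<mu>[unfolded box_def, THEN CollectD, THEN spec]
  note d' = d[unfolded box_def, THEN CollectD, THEN spec]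
  show "d - \<mu> + \<mu> = d"
  proof (rule ext)
    fix j show "(d - \<mu> + \<mu>) j = d j" using \<mu>'[of j] d'[of j] by (simp split: if_splits)
  qed
  assume \<tau>: "\<tau> \<in> box s \<mu>"
  note \<tau>' = \<tau>[unfolded box_def, THEN CollectD, THEN spec]
  show "\<mu> - \<tau> \<in> box s d" unfolding box_def
  proof (intro CollectI allI)
    fix j show "if j \<in> {1..s} then (\<mu> - \<tau>) j \<le> d j else (\<mu> - \<tau>) j = 0"
      using \<mu>'[of j] by (simp split: if_splits)
  qed
  show "d - (\<mu> - \<tau>) = (d - \<mu>) + \<tau>"
  proof (rule ext)
    fix j show "(d - (\<mu> - \<tau>)) j = (d - \<mu> + \<tau>) j" using \<mu>'[of j] d'[of j] \<tau>'[of j] by (simp split: if_splits)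
  qed
qed

text \<open>Right multiplication by \<open>upper a\<close> replaces X_12 by X_12 + a X_11;
  \<open>dp_add\<close> splits this, and the powers of X_11 recombine to those belonging to \<mu> -
  \<tau>.\<close>

lemma upper_e:
  assumes \<mu>: "\<mu> \<in> box s d"
  shows "act V (upper a) (e \<mu>) = (\<Sum>\<tau>\<in>box s \<mu>. smul V (dp \<tau> a) (e (\<mu> - \<tau>)))"
proof (rule separation[OF act_V[OF _ e_vecs] e_sum_vecs])
  fix X :: "'k^2^2" assume X: "det X = 1"
  have "\<Lambda> (act V X (act V (upper a) (e \<mu>))) = \<Lambda> (act V (X ** upper a) (e \<mu>))"
    using X e_vecs by (simp add: act_mult)
  also have "\<dots> = dp \<mu> (a * X $ 1 $ 1 + X $ 1 $ 2) * X $ 1 $ 1 ^ val p s (d - \<mu>)"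
    using X by (simp add: \<Lambda>_e[OF _ \<mu>] det_mult_1 mat2_mult_nth mult.commute)
  also have "\<dots> = (\<Sum>\<tau>\<in>box s \<mu>. dp \<tau> a * (dp (\<mu> - \<tau>) (X $ 1 $ 2) * X $ 1 $ 1 ^ val p s (d - (\<mu> - \<tau>))))"
    unfolding dp_add[OF d_sub(1)[OF \<mu>]] sum_distrib_right
  proof (rule sum.cong[OF refl])
    fix \<tau> assume \<tau>: "\<tau> \<in> box s \<mu>"
    have "dp \<tau> (a * X $ 1 $ 1) = X $ 1 $ 1 ^ val p s \<tau> * dp \<tau> a"
      using dp_mult[of \<tau> "X $ 1 $ 1" a] by (simp add: mult.commute)
    then show "dp \<tau> (a * X $ 1 $ 1) * dp (\<mu> - \<tau>) (X $ 1 $ 2) * X $ 1 $ 1 ^ val p s (d - \<mu>)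
        = dp \<tau> a * (dp (\<mu> - \<tau>) (X $ 1 $ 2) * X $ 1 $ 1 ^ val p s (d - (\<mu> - \<tau>)))"
      by (simp add: box_diff(2)[OF \<mu> \<tau>] val_add power_add mult_ac)
  qed
  also have "\<dots> = \<Lambda> (act V X (\<Sum>\<tau>\<in>box s \<mu>. smul V (dp \<tau> a) (e (\<mu> - \<tau>))))"
    by (rule \<Lambda>_sum_e[OF X box_diff(1)[OF \<mu>], symmetric])
  finally show "\<Lambda> (act V X (act V (upper a) (e \<mu>))) = \<Lambda> (act V X (\<Sum>\<tau>\<in>box s \<mu>. smul V (dp \<tau> a) (e (\<mu> - \<tau>))))" .
qed simp

lemma torus_e:
  assumes \<mu>: "\<mu> \<in> box s d" and t: "t \<noteq> 0"
  shows "act V (torus t) (e \<mu>) = smul V (t powi (int m - 2 * int (val p s \<mu>))) (e \<mu>)"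
proof (rule separation[OF act_V[OF _ e_vecs] VS(3)[OF e_vecs]])
  fix X :: "'k^2^2" assume X: "det X = 1"
  have vd: "val p s (d - \<mu>) + val p s \<mu> = m" using box_diff(3)[OF \<mu>] val_add by metis
  have "\<Lambda> (act V X (act V (torus t) (e \<mu>))) = \<Lambda> (act V (X ** torus t) (e \<mu>))"
    using X e_vecs t by (simp add: act_mult)
  also have "\<dots> = dp \<mu> (inverse t * X $ 1 $ 2) * (t * X $ 1 $ 1) ^ val p s (d - \<mu>)"
  proof -
    have "(X ** torus t) $ 1 $ 1 = t * X $ 1 $ 1" "(X ** torus t) $ 1 $ 2 = inverse t * X $ 1 $ 2"
      by (simp_all add: mat2_mult_nth torus_mat2)
    then show ?thesis using \<Lambda>_e[OF det_mult_1[OF X det_simple(4)[OF t]] \<mu>] by simp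
  qed
  also have "\<dots> = t ^ val p s (d - \<mu>) * inverse t ^ val p s \<mu> * (dp \<mu> (X $ 1 $ 2) * X $ 1 $ 1 ^ val p s (d - \<mu>))"
    by (simp add: dp_mult power_mult_distrib mult_ac)
  finally have 1: "\<Lambda> (act V X (act V (torus t) (e \<mu>)))
      = t ^ val p s (d - \<mu>) * inverse t ^ val p s \<mu> * (dp \<mu> (X $ 1 $ 2) * X $ 1 $ 1 ^ val p s (d - \<mu>))" .
  have "int m - 2 * int (val p s \<mu>) = int (val p s (d - \<mu>)) - int (val p s \<mu>)" using vd by linarith
  then have 2: "t powi (int m - 2 * int (val p s \<mu>)) = t ^ val p s (d - \<mu>) * inverse t ^ val p s \<mu>"
    using power_int_diff[OF disjI1[OF t], of "int (val p s (d - \<mu>))" "int (val p s \<mu>)"]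
    by (simp only: power_int_of_nat divide_inverse power_inverse)
  show "\<Lambda> (act V X (act V (torus t) (e \<mu>))) = \<Lambda> (act V X (smul V (t powi (int m - 2 * int (val p s \<mu>))) (e \<mu>)))"
    unfolding 1 2 act_scale[OF X e_vecs] \<Lambda>.scale \<Lambda>_e[OF X \<mu>] ..
qed (use t in simp)

lemma weyl_e: "act V weyl (e 0) = smul V ((- 1) ^ m * mfact d) (e d)"
proof (rule separation[OF act_V[OF _ e_vecs] VS(3)[OF e_vecs]])
  have dd: "d \<in> box s d" using d by (auto simp: box_def)
  fix X :: "'k^2^2" assume X: "det X = 1"
  have "\<Lambda> (act V X (act V weyl (e 0))) = \<Lambda> (act V (X ** weyl) (e 0))"
    using X e_vecs by (simp add: act_mult)
  also have "\<dots> = (- X $ 1 $ 2) ^ m"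
    using X by (simp add: \<Lambda>_e det_mult_1 mat2_mult_nth)
  also have "\<dots> = (- 1) ^ m * (mfact d * dp d (X $ 1 $ 2))"
    unfolding power_val[OF d, symmetric] by (simp flip: power_mult_distrib)
  finally show "\<Lambda> (act V X (act V weyl (e 0))) = \<Lambda> (act V X (smul V ((- 1) ^ m * mfact d) (e d)))"
    by (simp add: act_scale[OF X e_vecs] \<Lambda>.scale \<Lambda>_e[OF X dd])
qed simp

text \<open>Since the orbit of v spans the module, this expansion shows that the vectors e \<mu>
  span it.\<close>

lemma act_v_e:
  assumes A: "det A = 1"
  shows "act V A v = (\<Sum>\<mu>\<in>box s d. smul V (mfact d * dp (d - \<mu>) (A $ 1 $ 1) * A $ 2 $ 1 ^ val p s \<mu>) (e \<mu>))"
proof (rule separation[OF act_V[OF A v(1)] e_sum_vecs])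
  fix X :: "'k^2^2" assume X: "det X = 1"
  have "\<Lambda> (act V X (act V A v)) = \<Lambda> (act V (X ** A) v)"
    using X A v(1) by (simp add: act_mult)
  also have "\<dots> = (A $ 2 $ 1 * X $ 1 $ 2 + X $ 1 $ 1 * A $ 1 $ 1) ^ m"
    using X A by (simp add: \<Lambda>_act_v det_mult_1 mat2_mult_nth algebra_simps)
  also have "\<dots> = mfact d * dp d (A $ 2 $ 1 * X $ 1 $ 2 + X $ 1 $ 1 * A $ 1 $ 1)" by (rule power_val[OF d])
  also have "\<dots> = (\<Sum>\<mu>\<in>box s d. (mfact d * dp (d - \<mu>) (A $ 1 $ 1) * A $ 2 $ 1 ^ val p s \<mu>) *
      (dp \<mu> (X $ 1 $ 2) * X $ 1 $ 1 ^ val p s (d - \<mu>)))"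
    unfolding dp_add[OF d] dp_mult sum_distrib_left by (simp add: mult_ac)
  also have "\<dots> = \<Lambda> (act V X (\<Sum>\<mu>\<in>box s d. smul V (mfact d * dp (d - \<mu>) (A $ 1 $ 1) * A $ 2 $ 1 ^ val p s \<mu>) (e \<mu>)))"
    by (rule \<Lambda>_sum_e[OF X, where g = "\<lambda>\<mu>. \<mu>", symmetric])
  finally show "\<Lambda> (act V X (act V A v)) = \<Lambda> (act V X (\<Sum>\<mu>\<in>box s d. smul V (mfact d * dp (d - \<mu>) (A $ 1 $ 1) * A $ 2 $ 1 ^ val p s \<mu>) (e \<mu>)))" .
qed

theorem digit_basis_e: "digit_basis d V e"
  unfolding digit_basis_def
proof (intro conjI ballI allI impI)
  fix x assume x: "x \<in> vecs V"
  have "vecs V \<subseteq> V.span (e ` box s d)"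
    unfolding vecs_eq_span
  proof (rule V.span_minimal)
    show "{act V A v |A. det A = 1} \<subseteq> V.span (e ` box s d)"
    proof clarify
      fix A :: "'k^2^2" assume "det A = 1"
      then show "act V A v \<in> V.span (e ` box s d)"
        unfolding act_v_e[OF \<open>det A = 1\<close>] by (intro V.span_sum V.span_scale V.span_base imageI)
    qed
  qed simp
  then show "\<exists>c. x = (\<Sum>\<mu>\<in>box s d. smul V (c \<mu>) (e \<mu>))"
    using in_span_image[OF V.vector_space_axioms finite_box] x by blast
next
  fix c \<mu> assume z: "(\<Sum>\<mu>\<in>box s d. smul V (c \<mu>) (e \<mu>)) = 0" and \<mu>: "\<mu> \<in> box s d"
  have "(if \<mu> \<in> box s d then c \<mu> else 0) = 0"
  \<comment> \<open>Independence is tested on the matrices \<open>upper y\<close>, at which the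
    matrix coefficient of e \<mu> is \<open>dp \<mu> y\<close>.\<close>
  proof (rule dp_independent[of UNIV "\<lambda>\<mu>. if \<mu> \<in> box s d then c \<mu> else 0"])
    fix y :: 'k
    have "(\<Sum>\<mu>\<in>box s full. (if \<mu> \<in> box s d then c \<mu> else 0) * dp \<mu> y) = (\<Sum>\<mu>\<in>box s d. c \<mu> * dp \<mu> y)"
      by (rule sum.mono_neutral_cong_right) (use d_sub(1) in auto)
    also have "\<dots> = \<Lambda> (act V (upper y) (\<Sum>\<mu>\<in>box s d. smul V (c \<mu>) (e \<mu>)))"
      by (subst \<Lambda>_sum_e) auto
    also have "\<dots> = 0" unfolding z by (simp add: act_0 \<Lambda>.zero)
    finally show "(\<Sum>\<mu>\<in>box s full. (if \<mu> \<in> box s d then c \<mu> else 0) * dp \<mu> y) = 0" .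
  qed (use infinite_UNIV_k d_sub(1)[OF \<mu>] in auto)
  then show "c \<mu> = 0" using \<mu> by simp
next
  show "\<exists>c. c \<noteq> 0 \<and> act V weyl (e 0) = smul V c (e d)"
    using weyl_e mfact_nonzero[OF d] by (intro exI[of _ "(- 1) ^ m * mfact d"]) simp
qed (auto simp: e_vecs upper_e torus_e)

end

section \<open>The finite group and its Borel subgroup\<close>

definition borel :: "'k::field set \<Rightarrow> ('k^2^2) set" where
  "borel S = {A \<in> carrier (SL2_over S). A $ 2 $ 1 = 0}"

context char_p
begin

abbreviation "G \<equiv> SL2_over F"

lemma G_eq: "SL2_Fq q = G"
  by (simp add: SL2_Fq_def F_def)

lemma carrier_G: "A \<in> carrier G \<longleftrightarrow> det A = 1 \<and> A $ 1 $ 1 \<in> F \<and> A $ 1 $ 2 \<in> F \<and> A $ 2 $ 1 \<in> F \<and> A $ 2 $ 2 \<in> F"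
  by (auto simp: SL2_over_def forall_2)

definition adj :: "'k^2^2 \<Rightarrow> 'k^2^2" where
  "adj A = mat2 (A $ 2 $ 2) (- A $ 1 $ 2) (- A $ 2 $ 1) (A $ 1 $ 1)"

lemma adj_mult: "det A = 1 \<Longrightarrow> adj A ** A = mat 1"
  by (auto simp: mat2_eq_iff mat2_mult_nth adj_def det_2 algebra_simps)

lemma adj_G: "A \<in> carrier G \<Longrightarrow> adj A \<in> carrier G"
  unfolding carrier_G adj_def det_2 mat2_nth by (simp add: F_minus algebra_simps)

lemma G_group: "group G"
proof (rule groupI)
  fix A B assume "A \<in> carrier G" "B \<in> carrier G"
  then show "A \<otimes>\<^bsub>G\<^esub> B \<in> carrier G"
    by (auto simp: carrier_G det_mult_1 mat2_mult_nth intro!: F_add F_mult)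
next
  show "\<one>\<^bsub>G\<^esub> \<in> carrier G" by (auto simp: carrier_G)
next
  fix A assume "A \<in> carrier G"
  then show "\<exists>B\<in>carrier G. B \<otimes>\<^bsub>G\<^esub> A = \<one>\<^bsub>G\<^esub>"
    using adj_mult[of A] adj_G[of A] by (intro bexI[of _ "adj A"]) (simp_all add: carrier_G[of A])
qed (simp_all add: matrix_mul_assoc)

sublocale G: group G by (rule G_group)

lemma G_inv: "A \<in> carrier G \<Longrightarrow> inv\<^bsub>G\<^esub> A = adj A"
  using adj_mult[of A] adj_G[of A] by (intro G.inv_equality) (simp_all add: carrier_G[of A])

abbreviation "B \<equiv> borel F"

lemma finite_G: "finite (carrier G)"
proof (rule finite_subset)
  show "carrier G \<subseteq> (\<lambda>(a, b, c, d). mat2 a b c d) ` (F \<times> F \<times> F \<times> F)"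
  proof
    fix A assume "A \<in> carrier G"
    then show "A \<in> (\<lambda>(a, b, c, d). mat2 a b c d) ` (F \<times> F \<times> F \<times> F)"
      by (intro image_eqI[of _ _ "(A $ 1 $ 1, A $ 1 $ 2, A $ 2 $ 1, A $ 2 $ 2)"]) (auto simp: carrier_G mat2_eq_iff)
  qed
qed simp

lemma finite_B: "finite B"
  by (rule finite_subset[OF _ finite_G]) (auto simp: borel_def)

lemma B_subgroup: "subgroup B G"
proof (rule G.subgroupI)
  show "B \<subseteq> carrier G" by (auto simp: borel_def)
  have "mat 1 \<in> B" using G.one_closed by (simp add: borel_def)
  then show "B \<noteq> {}" by blast
  fix b assume b: "b \<in> B"
  then show "inv\<^bsub>G\<^esub> b \<in> B" using adj_G[of b] G_inv[of b] by (simp add: borel_def) (simp add: adj_def)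
  fix c assume "c \<in> B"
  then show "b \<otimes>\<^bsub>G\<^esub> c \<in> B" using b G.m_closed[of b c] by (simp add: borel_def mat2_mult_nth)
qed

lemma B_D:
  assumes "b \<in> B"
  shows "b $ 2 $ 1 = 0" "b $ 1 $ 1 * b $ 2 $ 2 = 1" "b $ 1 $ 1 \<noteq> 0" "b $ 2 $ 2 = inverse (b $ 1 $ 1)"
    "b $ 1 $ 1 \<in> F" "b $ 1 $ 2 \<in> F" "b = torus (b $ 1 $ 1) ** upper (b $ 1 $ 2 / b $ 1 $ 1)"
proof -
  show 0: "b $ 2 $ 1 = 0" and 1: "b $ 1 $ 1 * b $ 2 $ 2 = 1" and "b $ 1 $ 1 \<in> F" "b $ 1 $ 2 \<in> F"
    using assms by (auto simp: borel_def carrier_G det_2)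
  show n: "b $ 1 $ 1 \<noteq> 0" using 1 by auto
  show i: "b $ 2 $ 2 = inverse (b $ 1 $ 1)" using 1 n by (simp add: field_simps)
  show "b = torus (b $ 1 $ 1) ** upper (b $ 1 $ 2 / b $ 1 $ 1)"
    using 0 n i by (simp add: mat2_eq_iff mat2_mult_nth torus_mat2)
qed

lemma upper_B: "a \<in> F \<Longrightarrow> upper a \<in> B" and torus_B: "t \<in> F \<Longrightarrow> t \<noteq> 0 \<Longrightarrow> torus t \<in> B"
  by (auto simp: borel_def carrier_G det_2 torus_mat2 F_inverse)

lemma weyl_G: "weyl \<in> carrier G"
  by (auto simp: carrier_G det_2 F_minus)

lemma B_bij: "bij_betw (\<lambda>(t, a). torus t ** upper a) ((F - {0}) \<times> F) B"
proof (rule bij_betwI[where g = "\<lambda>b. (b $ 1 $ 1, b $ 1 $ 2 / b $ 1 $ 1)"])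
  show "(\<lambda>(t, a). torus t ** upper a) \<in> (F - {0}) \<times> F \<rightarrow> B"
    using subgroup.m_closed[OF B_subgroup torus_B upper_B] by auto
  show "(\<lambda>b. (b $ 1 $ 1, b $ 1 $ 2 / b $ 1 $ 1)) \<in> B \<rightarrow> (F - {0}) \<times> F"
    using B_D F_divide by auto
  show "(\<lambda>b. (b $ 1 $ 1, b $ 1 $ 2 / b $ 1 $ 1)) ((\<lambda>(t, a). torus t ** upper a) y) = y"
    if "y \<in> (F - {0}) \<times> F" for y
    using that by (auto simp: mat2_mult_nth torus_mat2)
  show "(\<lambda>(t, a). torus t ** upper a) (b $ 1 $ 1, b $ 1 $ 2 / b $ 1 $ 1) = b" if "b \<in> B" for b
    using B_D(7)[OF that] by simp
qed

text \<open>The coset space is the projective line over \<open>F\<close>: a coset is determined by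
  the second row up to a scalar.\<close>

lemma coset_eq_iff:
  assumes g: "g \<in> carrier G" and h: "h \<in> carrier G"
  shows "B #>\<^bsub>G\<^esub> g = B #>\<^bsub>G\<^esub> h \<longleftrightarrow> g $ 2 $ 1 * h $ 2 $ 2 = g $ 2 $ 2 * h $ 2 $ 1"
proof -
  have "B #>\<^bsub>G\<^esub> g = B #>\<^bsub>G\<^esub> h \<longleftrightarrow> g \<in> B #>\<^bsub>G\<^esub> h"
    using G.repr_independence[OF _ h B_subgroup] G.rcos_self[OF g B_subgroup] by metis
  also have "\<dots> \<longleftrightarrow> g \<otimes>\<^bsub>G\<^esub> inv\<^bsub>G\<^esub> h \<in> B"
    using subgroup.rcos_module[OF B_subgroup G_group h g] .
  also have "\<dots> \<longleftrightarrow> (g ** adj h) $ 2 $ 1 = 0"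
    using G.m_closed[OF g adj_G[OF h]] by (simp add: borel_def G_inv[OF h])
  also have "\<dots> \<longleftrightarrow> g $ 2 $ 1 * h $ 2 $ 2 = g $ 2 $ 2 * h $ 2 $ 1"
    by (simp add: mat2_mult_nth adj_def)
  finally show ?thesis .
qed

text \<open>The representatives 1 and \<open>weyl ** upper y\<close> with y in \<open>F\<close>
  stand for the q + 1 points of the projective line, and q + 1 = 1 in k.\<close>

lemma card_cosets: "finite (rcosets\<^bsub>G\<^esub> B)" "of_nat (card (rcosets\<^bsub>G\<^esub> B)) \<noteq> (0 :: 'k)"
proof -
  define R where "R = insert (mat 1) ((\<lambda>y. weyl ** upper y) ` F)"
  have RG: "R \<subseteq> carrier G"
    using G.m_closed[OF weyl_G] upper_B by (auto simp: R_def borel_def G.one_closed[simplified])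
  have img: "rcosets\<^bsub>G\<^esub> B = (\<lambda>r. B #>\<^bsub>G\<^esub> r) ` R"
  proof
    show "(\<lambda>r. B #>\<^bsub>G\<^esub> r) ` R \<subseteq> rcosets\<^bsub>G\<^esub> B" using RG by (auto simp: RCOSETS_def)
    show "rcosets\<^bsub>G\<^esub> B \<subseteq> (\<lambda>r. B #>\<^bsub>G\<^esub> r) ` R"
    proof
      fix C assume "C \<in> rcosets\<^bsub>G\<^esub> B"
      then obtain g where g: "g \<in> carrier G" "C = B #>\<^bsub>G\<^esub> g" by (auto simp: RCOSETS_def)
      show "C \<in> (\<lambda>r. B #>\<^bsub>G\<^esub> r) ` R"
      proof (cases "g $ 2 $ 1 = 0")
        case True
        then have "C = B #>\<^bsub>G\<^esub> mat 1"
          unfolding g(2) using coset_eq_iff[OF g(1) G.one_closed] by simp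
        then show ?thesis by (auto simp: R_def)
      next
        case False
        let ?y = "g $ 2 $ 2 / g $ 2 $ 1"
        have y: "?y \<in> F" using g by (auto simp: carrier_G F_divide)
        then have r: "weyl ** upper ?y \<in> R" by (auto simp: R_def)
        have "C = B #>\<^bsub>G\<^esub> (weyl ** upper ?y)"
          unfolding g(2) using coset_eq_iff[OF g(1) subsetD[OF RG r]] False by (simp add: mat2_mult_nth)
        then show ?thesis using r by blast
      qed
    qed
  qed
  have inj: "inj_on (\<lambda>r. B #>\<^bsub>G\<^esub> r) R"
  proof (rule inj_onI)
    fix g h assume gh: "g \<in> R" "h \<in> R" and "B #>\<^bsub>G\<^esub> g = B #>\<^bsub>G\<^esub> h"
    then have "g $ 2 $ 1 * h $ 2 $ 2 = g $ 2 $ 2 * h $ 2 $ 1"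
      using coset_eq_iff RG by blast
    then show "g = h" using gh by (auto simp: R_def mat2_mult_nth mat2_eq_iff)
  qed
  show "finite (rcosets\<^bsub>G\<^esub> B)" unfolding img by (simp add: R_def)
  have "inj_on (\<lambda>y. weyl ** upper y) F"
    by (auto simp: inj_on_def mat2_eq_iff mat2_mult_nth)
  then have "card ((\<lambda>y. weyl ** upper y) ` F) = q" by (simp add: card_image card_F)
  moreover have "mat 1 \<notin> (\<lambda>y. weyl ** upper y) ` F"
    by (auto simp: mat2_eq_iff mat2_mult_nth)
  ultimately have "card R = Suc q" by (simp add: R_def)
  then have "card (rcosets\<^bsub>G\<^esub> B) = Suc q" unfolding img by (simp add: card_image[OF inj])
  then show "of_nat (card (rcosets\<^bsub>G\<^esub> B)) \<noteq> (0 :: 'k)" by (simp del: of_nat_power)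
qed

end

section \<open>Coordinates\<close>

text \<open>Simplicity is replaced by the basis it provides, so that the trivial module of group
  cohomology can be treated in the same way.\<close>

locale digit_module = char_p p s F for p s and F :: "'k::alg_closed_field set" +
  fixes d :: "nat \<Rightarrow> nat" and L :: "('k, 'k^2^2, 'v::ab_group_add) gmod" and e :: "(nat \<Rightarrow> nat) \<Rightarrow> 'v"
  assumes d: "d \<in> box s (\<lambda>_. p - 1)" and L: "is_gmod (SL2_over F) L" and basis: "digit_basis d L e"
begin

sublocale V: vector_space "smul L" by (rule is_gmodD(1)[OF L])

lemmas LD = is_gmodD[OF L]
lemmas LS = subspaceD[OF LD(1,2)]

lemma e: "\<mu> \<in> box s d \<Longrightarrow> e \<mu> \<in> vecs L"
  and e_span: "x \<in> vecs L \<Longrightarrow> \<exists>c. x = (\<Sum>\<mu>\<in>box s d. smul L (c \<mu>) (e \<mu>))"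
  and e_indep: "(\<Sum>\<mu>\<in>box s d. smul L (c \<mu>) (e \<mu>)) = 0 \<Longrightarrow> \<mu> \<in> box s d \<Longrightarrow> c \<mu> = 0"
  and upper_e: "a \<in> F \<Longrightarrow> \<mu> \<in> box s d \<Longrightarrow> act L (upper a) (e \<mu>) = (\<Sum>\<tau>\<in>box s \<mu>. smul L (dp \<tau> a) (e (\<mu> - \<tau>)))"
  and torus_e: "t \<in> F \<Longrightarrow> t \<noteq> 0 \<Longrightarrow> \<mu> \<in> box s d \<Longrightarrow>
    act L (torus t) (e \<mu>) = smul L (t powi (int (val p s d) - 2 * int (val p s \<mu>))) (e \<mu>)"
  and weyl_e: "\<exists>c. c \<noteq> 0 \<and> act L weyl (e 0) = smul L c (e d)"
  using basis unfolding digit_basis_def by auto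

lemma d_box: "d \<in> box s d" and box_d_full: "\<mu> \<in> box s d \<Longrightarrow> \<mu> \<in> box s full"
proof -
  show "d \<in> box s d" using d by (auto simp: box_def)
  have "box s d \<subseteq> box s full" by (rule box_mono) (use d in \<open>auto simp: box_def\<close>)
  then show "\<mu> \<in> box s d \<Longrightarrow> \<mu> \<in> box s full" by blast
qed

definition vec :: "((nat \<Rightarrow> nat) \<Rightarrow> 'k) \<Rightarrow> 'v" where
  "vec c = (\<Sum>\<mu>\<in>box s d. smul L (c \<mu>) (e \<mu>))"

text \<open>The extension by 0 outside \<open>box s d\<close> allows sums over shifted indices to
  run over the whole full box.\<close>

definition co :: "'v \<Rightarrow> (nat \<Rightarrow> nat) \<Rightarrow> 'k" where
  "co x = (\<lambda>\<mu>. if \<mu> \<in> box s d then (SOME c. x = vec c) \<mu> else 0)"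

lemma vec_vecs: "vec c \<in> vecs L"
  unfolding vec_def by (intro LS e)

lemma vec_co: "x \<in> vecs L \<Longrightarrow> vec (co x) = x"
proof -
  assume "x \<in> vecs L"
  then have "\<exists>c. x = vec c" using e_span by (simp add: vec_def)
  then have "x = vec (SOME c. x = vec c)" by (rule someI_ex)
  also have "\<dots> = vec (co x)" unfolding vec_def co_def by (rule sum.cong) auto
  finally show ?thesis ..
qed

lemma vec_inj: "vec c = vec c' \<Longrightarrow> \<mu> \<in> box s d \<Longrightarrow> c \<mu> = c' \<mu>"
  using e_indep[of "\<lambda>\<mu>. c \<mu> - c' \<mu>" \<mu>]
  by (simp add: vec_def V.scale_left_diff_distrib sum_subtractf)

lemma co_unique: "x = vec c \<Longrightarrow> (\<And>\<mu>. \<mu> \<notin> box s d \<Longrightarrow> c \<mu> = 0) \<Longrightarrow> co x = c"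
proof (rule ext)
  fix \<mu> assume x: "x = vec c" and z: "\<And>\<mu>. \<mu> \<notin> box s d \<Longrightarrow> c \<mu> = 0"
  have "vec (co x) = vec c" using x vec_co vec_vecs by metis
  then show "co x \<mu> = c \<mu>"
    using vec_inj[of "co x" c \<mu>] z[of \<mu>] by (cases "\<mu> \<in> box s d") (auto simp: co_def)
qed

lemma co_out: "\<mu> \<notin> box s d \<Longrightarrow> co x \<mu> = 0"
  by (simp add: co_def)

lemma co_add: "x \<in> vecs L \<Longrightarrow> y \<in> vecs L \<Longrightarrow> co (x + y) = (\<lambda>\<mu>. co x \<mu> + co y \<mu>)"
proof (rule co_unique)
  assume "x \<in> vecs L" "y \<in> vecs L"
  then have "x + y = vec (co x) + vec (co y)" by (simp add: vec_co)
  then show "x + y = vec (\<lambda>\<mu>. co x \<mu> + co y \<mu>)" by (simp add: vec_def V.scale_left_distrib sum.distrib)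
qed (simp add: co_out)

lemma co_scale: "x \<in> vecs L \<Longrightarrow> co (smul L a x) = (\<lambda>\<mu>. a * co x \<mu>)"
proof (rule co_unique)
  assume "x \<in> vecs L"
  then have "smul L a x = smul L a (vec (co x))" by (simp add: vec_co)
  then show "smul L a x = vec (\<lambda>\<mu>. a * co x \<mu>)" by (simp add: vec_def V.scale_sum_right)
qed (simp add: co_out)

lemma co_e: "\<mu> \<in> box s d \<Longrightarrow> co (e \<mu>) = (\<lambda>\<sigma>. if \<sigma> = \<mu> then 1 else 0)"
proof (rule co_unique)
  assume \<mu>: "\<mu> \<in> box s d"
  have "vec (\<lambda>\<sigma>. if \<sigma> = \<mu> then 1 else 0) = (\<Sum>\<sigma>\<in>{\<mu>}. smul L (if \<sigma> = \<mu> then 1 else 0) (e \<sigma>))"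
    unfolding vec_def by (rule sum.mono_neutral_right) (use \<mu> in auto)
  then show "e \<mu> = vec (\<lambda>\<sigma>. if \<sigma> = \<mu> then 1 else 0)" by simp
qed auto

lemma act_vec:
  assumes g: "g \<in> carrier G"
  shows "act L g (vec c) = (\<Sum>\<mu>\<in>box s d. smul L (c \<mu>) (act L g (e \<mu>)))"
proof -
  have z: "act L g 0 = 0" using LD(5)[OF g LS(1), of 0] by simp
  have "act L g (\<Sum>\<mu>\<in>A. smul L (c \<mu>) (e \<mu>)) = (\<Sum>\<mu>\<in>A. smul L (c \<mu>) (act L g (e \<mu>)))"
    if "finite A" "A \<subseteq> box s d" for A
    using that
  proof (induction A rule: finite_induct)
    case (insert a A)
    have "act L g (smul L (c a) (e a) + (\<Sum>\<mu>\<in>A. smul L (c \<mu>) (e \<mu>)))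
        = act L g (smul L (c a) (e a)) + act L g (\<Sum>\<mu>\<in>A. smul L (c \<mu>) (e \<mu>))"
      by (rule LD(4)[OF g]) (use insert.prems in \<open>auto intro!: LS e\<close>)
    then show ?case using insert LD(5)[OF g e] by simp
  qed (simp add: z)
  then show ?thesis by (simp add: vec_def)
qed

lemma carrier_B: "b \<in> B \<Longrightarrow> b \<in> carrier G"
  by (simp add: borel_def)

lemma co_torus:
  assumes t: "t \<in> F" "t \<noteq> 0" and x: "x \<in> vecs L"
  shows "co (act L (torus t) x) = (\<lambda>\<mu>. t powi (int (val p s d) - 2 * int (val p s \<mu>)) * co x \<mu>)"
proof (rule co_unique)
  have "act L (torus t) x = act L (torus t) (vec (co x))" by (simp add: vec_co x)
  also have "\<dots> = vec (\<lambda>\<mu>. t powi (int (val p s d) - 2 * int (val p s \<mu>)) * co x \<mu>)"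
    unfolding act_vec[OF carrier_B[OF torus_B[OF t]]]
    unfolding vec_def by (rule sum.cong[OF refl]) (simp add: torus_e[OF t] mult.commute)
  finally show "act L (torus t) x = vec (\<lambda>\<mu>. t powi (int (val p s d) - 2 * int (val p s \<mu>)) * co x \<mu>)" .
qed (simp add: co_out)

lemma box_d_D: "\<mu> \<in> box s d \<Longrightarrow> if j \<in> {1..s} then \<mu> j \<le> d j else \<mu> j = 0"
  by (auto simp: box_def)

text \<open>The transpose of the action on basis vectors, after the substitution of \<mu> + \<tau>
  for \<mu>. It is the formula that defines \<open>uI\<close>, and this is why a simple module
  embeds into the cells.\<close>

lemma co_upper:
  assumes a: "a \<in> F" and x: "x \<in> vecs L"
  shows "co (act L (upper a) x) = (\<lambda>\<mu>. \<Sum>\<tau>\<in>box s full. dp \<tau> a * co x (\<mu> + \<tau>))"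
proof (rule co_unique)
  show "(\<Sum>\<tau>\<in>box s full. dp \<tau> a * co x (\<mu> + \<tau>)) = 0" if "\<mu> \<notin> box s d" for \<mu>
  proof (rule sum.neutral, intro ballI)
    fix \<tau>
    have "\<mu> + \<tau> \<notin> box s d" using box_add_iff(1) that by blast
    then show "dp \<tau> a * co x (\<mu> + \<tau>) = 0" by (simp add: co_out)
  qed
  let ?g = "\<lambda>\<tau> \<mu>. smul L (dp \<tau> a * co x (\<mu> + \<tau>)) (e \<mu>)"
  have sub: "\<tau> \<in> box s \<mu> \<Longrightarrow> \<mu> \<in> box s d \<Longrightarrow> (\<mu> - \<tau>) + \<tau> = \<mu>" for \<mu> \<tau>
  proof (rule ext)
    fix j assume "\<tau> \<in> box s \<mu>" "\<mu> \<in> box s d"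
    then show "((\<mu> - \<tau>) + \<tau>) j = \<mu> j" using box_d_D[of \<mu> j] by (auto simp: box_def dest!: spec[of _ j] split: if_splits)
  qed
  have "act L (upper a) x = act L (upper a) (vec (co x))" by (simp add: vec_co x)
  also have "\<dots> = (\<Sum>\<mu>\<in>box s d. \<Sum>\<tau>\<in>box s \<mu>. smul L (dp \<tau> a * co x \<mu>) (e (\<mu> - \<tau>)))"
    unfolding act_vec[OF carrier_B[OF upper_B[OF a]]]
    by (rule sum.cong[OF refl]) (simp add: upper_e[OF a] V.scale_sum_right mult.commute)
  also have "\<dots> = (\<Sum>(\<mu>, \<tau>)\<in>Sigma (box s d) (box s). smul L (dp \<tau> a * co x \<mu>) (e (\<mu> - \<tau>)))"
    by (rule sum.Sigma) auto
  also have "\<dots> = (\<Sum>(\<mu>, \<tau>)\<in>{(\<mu>, \<tau>). \<mu> + \<tau> \<in> box s d}. ?g \<tau> \<mu>)"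
  proof (rule sum.reindex_bij_witness[where i = "\<lambda>(\<mu>, \<tau>). (\<mu> + \<tau>, \<tau>)" and j = "\<lambda>(\<mu>, \<tau>). (\<mu> - \<tau>, \<tau>)"])
    fix y assume "y \<in> Sigma (box s d) (box s)"
    then show "(case case y of (\<mu>, \<tau>) \<Rightarrow> (\<mu> - \<tau>, \<tau>) of (\<mu>, \<tau>) \<Rightarrow> (\<mu> + \<tau>, \<tau>)) = y"
      "(case y of (\<mu>, \<tau>) \<Rightarrow> (\<mu> - \<tau>, \<tau>)) \<in> {(\<mu>, \<tau>). \<mu> + \<tau> \<in> box s d}"
      "(case case y of (\<mu>, \<tau>) \<Rightarrow> (\<mu> - \<tau>, \<tau>) of (\<mu>, \<tau>) \<Rightarrow> ?g \<tau> \<mu>) = (case y of (\<mu>, \<tau>) \<Rightarrow> smul L (dp \<tau> a * co x \<mu>) (e (\<mu> - \<tau>)))"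
      using sub by (auto simp: case_prod_unfold)
  next
    fix y :: "(nat \<Rightarrow> nat) \<times> (nat \<Rightarrow> nat)"
    assume y: "y \<in> {(\<mu>, \<tau>). \<mu> + \<tau> \<in> box s d}"
    obtain \<mu> \<tau> where [simp]: "y = (\<mu>, \<tau>)" by fastforce
    have b: "\<mu> + \<tau> \<in> box s d" using y by simp
    have "(\<mu> + \<tau>) - \<tau> = \<mu>" by (rule ext) simp
    moreover have "\<tau> \<in> box s (\<mu> + \<tau>)"
      using box_add_iff[OF b] by (auto simp: box_def split: if_splits)
    ultimately show "(case case y of (\<mu>, \<tau>) \<Rightarrow> (\<mu> + \<tau>, \<tau>) of (\<mu>, \<tau>) \<Rightarrow> (\<mu> - \<tau>, \<tau>)) = y"
      "(case y of (\<mu>, \<tau>) \<Rightarrow> (\<mu> + \<tau>, \<tau>)) \<in> Sigma (box s d) (box s)"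
      using b by auto
  qed
  also have "\<dots> = (\<Sum>(\<mu>, \<tau>)\<in>box s d \<times> box s full. ?g \<tau> \<mu>)"
  proof (rule sum.mono_neutral_left)
    show "{(\<mu>, \<tau>). \<mu> + \<tau> \<in> box s d} \<subseteq> box s d \<times> box s full"
      using box_add_iff box_d_full by blast
    show "\<forall>y\<in>box s d \<times> box s full - {(\<mu>, \<tau>). \<mu> + \<tau> \<in> box s d}. (case y of (\<mu>, \<tau>) \<Rightarrow> ?g \<tau> \<mu>) = 0"
    proof
      fix y assume "y \<in> box s d \<times> box s full - {(\<mu>, \<tau>). \<mu> + \<tau> \<in> box s d}"
      then have "fst y + snd y \<notin> box s d" by (auto simp: case_prod_unfold)
      from co_out[OF this] show "(case y of (\<mu>, \<tau>) \<Rightarrow> ?g \<tau> \<mu>) = 0" by (simp add: case_prod_unfold)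
    qed
  qed simp
  also have "\<dots> = (\<Sum>\<mu>\<in>box s d. \<Sum>\<tau>\<in>box s full. ?g \<tau> \<mu>)" by (rule sum.cartesian_product[symmetric])
  also have "\<dots> = vec (\<lambda>\<mu>. \<Sum>\<tau>\<in>box s full. dp \<tau> a * co x (\<mu> + \<tau>))"
    unfolding vec_def by (simp add: V.scale_sum_left)
  finally show "act L (upper a) x = vec (\<lambda>\<mu>. \<Sum>\<tau>\<in>box s full. dp \<tau> a * co x (\<mu> + \<tau>))" .
qed

end

section \<open>The resolution of a simple module over the Borel subgroup\<close>

lemma sum_fun_apply: "(\<Sum>a\<in>A. g a) x = (\<Sum>a\<in>A. g a x)"
  by (induction A rule: infinite_finite_induct) auto

definition sc :: "'k::field \<Rightarrow> ('x \<Rightarrow> 'k) \<Rightarrow> 'x \<Rightarrow> 'k" where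
  "sc c x = (\<lambda>\<kappa>. c * x \<kappa>)"

lemma sc_vector_space: "vector_space sc"
  by standard (auto simp: sc_def fun_eq_iff algebra_simps)

lemma sc_linearI:
  assumes "\<And>x y. f (x + y) = f x + f y" "\<And>c x. f (\<lambda>\<kappa>. c * x \<kappa>) = (\<lambda>\<kappa>. c * f x \<kappa>)"
  shows "Vector_Spaces.linear sc sc f"
  unfolding Vector_Spaces.linear_iff using assms by (simp add: sc_vector_space) (simp add: sc_def)

locale ext_model = model p s F f + L: digit_module p s F d L e + M: digit_module p s F f M e'
  for p s and F :: "'k::alg_closed_field set" and f d
    and L :: "('k, 'k^2^2, 'v::ab_group_add) gmod" and e
    and M :: "('k, 'k^2^2, 'w::ab_group_add) gmod" and e'
begin

definition \<beta> :: "'k^2^2 \<Rightarrow> 'k cells \<Rightarrow> 'k cells" where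
  "\<beta> b x = tI (b $ 1 $ 1) (uI (b $ 1 $ 2 / b $ 1 $ 1) x)"

text \<open>The sign compensates the torus: the sum over the q - 1 nonzero elements of
  \<open>F\<close> multiplies by q - 1, which is -1 in k.\<close>

definition \<theta>n :: "'k cells \<Rightarrow> 'k cells" where
  "\<theta>n x = (\<lambda>\<kappa>. - 1 * \<theta> x \<kappa>)"

lemma tI_linear: "tI t (x + y) = tI t x + tI t y" "tI t (\<lambda>\<kappa>. c * x \<kappa>) = (\<lambda>\<kappa>. c * tI t x \<kappa>)"
  by (auto simp: tI_def fun_eq_iff algebra_simps)

lemma \<theta>_linear: "\<theta> (x + y) = \<theta> x + \<theta> y" "\<theta> (\<lambda>\<kappa>. c * x \<kappa>) = (\<lambda>\<kappa>. c * \<theta> x \<kappa>)"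
  by (auto simp: \<theta>_def fun_eq_iff algebra_simps)

lemma H_linear: "H \<delta> t (x + y) = H \<delta> t x + H \<delta> t y" "H \<delta> t (\<lambda>\<kappa>. c * x \<kappa>) = (\<lambda>\<kappa>. c * H \<delta> t x \<kappa>)"
proof -
  have a: "hj \<delta> j (proj \<delta> k (x + y)) \<kappa> = hj \<delta> j (proj \<delta> k x) \<kappa> + hj \<delta> j (proj \<delta> k y) \<kappa>" for j k \<kappa>
    by (cases \<kappa>) (auto simp: hj_def proj_def algebra_simps)
  have m: "hj \<delta> j (proj \<delta> k (\<lambda>\<kappa>. c * x \<kappa>)) \<kappa> = c * hj \<delta> j (proj \<delta> k x) \<kappa>" for j k \<kappa>
    by (cases \<kappa>) (auto simp: hj_def proj_def)
  show "H \<delta> t (x + y) = H \<delta> t x + H \<delta> t y" by (rule ext) (simp add: H_def a sum.distrib)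
  show "H \<delta> t (\<lambda>\<kappa>. c * x \<kappa>) = (\<lambda>\<kappa>. c * H \<delta> t x \<kappa>)" by (rule ext) (simp add: H_def m sum_distrib_left)
qed

lemma linears: "Vector_Spaces.linear sc sc (\<beta> b)" "Vector_Spaces.linear sc sc D"
  "Vector_Spaces.linear sc sc (H \<delta> t)" "Vector_Spaces.linear sc sc \<theta>n"
proof -
  show "Vector_Spaces.linear sc sc (\<beta> b)"
    by (rule sc_linearI) (simp_all only: \<beta>_def tI_linear uI_linear(1,2))
  show "Vector_Spaces.linear sc sc D" by (rule sc_linearI) (rule D_add D_scale)+
  show "Vector_Spaces.linear sc sc (H \<delta> t)" by (rule sc_linearI) (rule H_linear)+
  show "Vector_Spaces.linear sc sc \<theta>n"
    by (rule sc_linearI) (auto simp: \<theta>n_def \<theta>_linear fun_eq_iff)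
qed

lemma \<beta>_product: "t \<noteq> 0 \<Longrightarrow> \<beta> (torus t ** upper a) x = tI t (uI a x)"
  by (simp add: \<beta>_def mat2_mult_nth torus_mat2)

lemma \<beta>_torus: "\<beta> (torus t) x = tI t x"
  by (simp add: \<beta>_def torus_mat2 uI_0)

lemma \<beta>_upper: "\<beta> (upper a) x = uI a x"
  by (simp add: \<beta>_def tI_1)

lemma \<beta>_mult:
  assumes b: "b \<in> B" and b': "b' \<in> B" and x: "x \<in> I full i"
  shows "\<beta> (b ** b') x = \<beta> b (\<beta> b' x)"
proof -
  note D = B_D(1-4)[OF b] and D' = B_D(1-4)[OF b']
  let ?t = "b $ 1 $ 1" and ?t' = "b' $ 1 $ 1" and ?a = "b $ 1 $ 2 / b $ 1 $ 1" and ?a' = "b' $ 1 $ 2 / b' $ 1 $ 1"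
  have "\<beta> b (\<beta> b' x) = tI ?t (tI ?t' (uI (?a / ?t'\<^sup>2) (uI ?a' x)))"
    by (simp add: \<beta>_def uI_tI D')
  also have "\<dots> = tI (?t * ?t') (uI (?a / ?t'\<^sup>2 + ?a') x)"
    by (simp add: tI_tI D D' uI_uI[OF x])
  also have "?a / ?t'\<^sup>2 + ?a' = (b ** b') $ 1 $ 2 / (b ** b') $ 1 $ 1"
    using D D' by (simp add: mat2_mult_nth field_simps power2_eq_square)
  also have "?t * ?t' = (b ** b') $ 1 $ 1" using D' by (simp add: mat2_mult_nth)
  finally show ?thesis by (simp add: \<beta>_def)
qed

text \<open>With \<open>B\<close> parametrised by torus and unipotent part, the sum over the
  unipotent part is \<open>uI_trace\<close> for a torus translate of x, and each torus element then
  contributes -x.\<close>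

lemma \<beta>_trace:
  assumes x: "x \<in> I full i"
  shows "(\<Sum>b\<in>B. \<beta> b (\<theta>n (\<beta> (inv\<^bsub>G\<^esub> b) x))) = x"
proof (rule ext)
  fix \<kappa> :: "(nat \<Rightarrow> nat) \<times> (nat \<Rightarrow> nat)"
  let ?y = "\<lambda>t. tI (inverse t) x"
  have summand: "\<beta> (torus t ** upper a) (\<theta>n (\<beta> (inv\<^bsub>G\<^esub> (torus t ** upper a)) x)) = (\<lambda>\<kappa>. - 1 * tI t (uI a (\<theta> (uI (- a) (?y t)))) \<kappa>)"
    if t: "t \<in> F" "t \<noteq> 0" and a: "a \<in> F" for t a
  proof -
    have c: "torus t ** upper a \<in> B" using subgroup.m_closed[OF B_subgroup torus_B[OF t] upper_B[OF a]] by simp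
    have "inv\<^bsub>G\<^esub> (torus t ** upper a) = adj (torus t ** upper a)" using G_inv c by (simp add: borel_def)
    then have "\<beta> (inv\<^bsub>G\<^esub> (torus t ** upper a)) x = tI (inverse t) (uI (- (t * a) * t) x)"
      using t by (simp add: \<beta>_def adj_def mat2_mult_nth torus_mat2 divide_inverse)
    also have "\<dots> = uI (- a) (?y t)"
      using t by (subst uI_tI) (simp_all add: field_simps power2_eq_square)
    finally have "\<beta> (torus t ** upper a) (\<theta>n (\<beta> (inv\<^bsub>G\<^esub> (torus t ** upper a)) x)) = tI t (uI a (\<theta>n (uI (- a) (?y t))))"
      using \<beta>_product[OF t(2)] by simp
    then show ?thesis unfolding \<theta>n_def uI_linear(2) tI_linear(2) .
  qed
  have "(\<Sum>b\<in>B. \<beta> b (\<theta>n (\<beta> (inv\<^bsub>G\<^esub> b) x))) \<kappa> = (\<Sum>b\<in>B. \<beta> b (\<theta>n (\<beta> (inv\<^bsub>G\<^esub> b) x)) \<kappa>)"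
    by (rule sum_fun_apply)
  also have "\<dots> = (\<Sum>(t, a)\<in>(F - {0}) \<times> F. \<beta> (torus t ** upper a) (\<theta>n (\<beta> (inv\<^bsub>G\<^esub> (torus t ** upper a)) x)) \<kappa>)"
    by (subst sum.reindex_bij_betw[OF B_bij, symmetric]) (simp add: case_prod_unfold)
  also have "\<dots> = (\<Sum>(t, a)\<in>(F - {0}) \<times> F. - tI t (uI a (\<theta> (uI (- a) (?y t)))) \<kappa>)"
  proof (rule sum.cong[OF refl])
    fix y assume "y \<in> (F - {0}) \<times> F"
    then have "fst y \<in> F" "fst y \<noteq> 0" "snd y \<in> F" by auto
    from summand[OF this] show "(case y of (t, a) \<Rightarrow> \<beta> (torus t ** upper a) (\<theta>n (\<beta> (inv\<^bsub>G\<^esub> (torus t ** upper a)) x)) \<kappa>)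
        = (case y of (t, a) \<Rightarrow> - tI t (uI a (\<theta> (uI (- a) (?y t)))) \<kappa>)"
      by (simp add: case_prod_unfold)
  qed
  also have "\<dots> = (\<Sum>t\<in>F - {0}. \<Sum>a\<in>F. - tI t (uI a (\<theta> (uI (- a) (?y t)))) \<kappa>)"
    by (rule sum.cartesian_product[symmetric])
  also have "\<dots> = (\<Sum>t\<in>F - {0}. - x \<kappa>)"
  proof (rule sum.cong[OF refl])
    fix t assume "t \<in> F - {0}"
    then have t: "t \<noteq> 0" by simp
    have "(\<Sum>a\<in>F. - tI t (uI a (\<theta> (uI (- a) (?y t)))) \<kappa>) = - tI t (\<lambda>\<kappa>. \<Sum>a\<in>F. uI a (\<theta> (uI (- a) (?y t))) \<kappa>) \<kappa>"
      by (cases \<kappa>) (simp add: tI_def sum_negf sum_distrib_left)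
    also have "\<dots> = - tI t (?y t) \<kappa>" by (simp add: uI_trace[OF tI_I[OF x]])
    also have "\<dots> = - x \<kappa>" using t by (simp add: tI_tI tI_1)
    finally show "(\<Sum>a\<in>F. - tI t (uI a (\<theta> (uI (- a) (?y t)))) \<kappa>) = - x \<kappa>" .
  qed
  also have "\<dots> = of_nat (card (F - {0})) * (- x \<kappa>)" by simp
  also have "card (F - {0}) = q - 1" by (simp add: card_F)
  also have "of_nat (q - 1) = (- 1 :: 'k)"
    using q_ge by (subst of_nat_diff) (simp_all del: of_nat_power add: of_nat_q)
  finally show "(\<Sum>b\<in>B. \<beta> b (\<theta>n (\<beta> (inv\<^bsub>G\<^esub> b) x))) \<kappa> = x \<kappa>" by simp
qed

lemma I_subspace: "module.subspace sc (I \<delta> i)"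
proof -
  interpret V: vector_space "sc :: 'k \<Rightarrow> 'k cells \<Rightarrow> 'k cells" by (rule sc_vector_space)
  show ?thesis unfolding V.subspace_def by (simp add: I_closed sc_def)
qed

lemma D_zero_I:
  assumes "x \<in> I full i"
  shows "D (D x) = 0"
  by (rule ext) (use D_D[OF assms] in auto)

text \<open>By \<open>crit_full\<close> no cell of positive degree is critical. The error term of
  \<open>D_H\<close> thus disappears, and \<open>H full s\<close> witnesses exactness.\<close>

lemma proj_full:
  assumes "x \<in> I full (Suc i)"
  shows "proj full s x = 0"
proof (rule ext)
  fix \<kappa> :: "(nat \<Rightarrow> nat) \<times> (nat \<Rightarrow> nat)"
  obtain \<nu> \<mu> where [simp]: "\<kappa> = (\<nu>, \<mu>)" by fastforce
  have "x (\<nu>, \<mu>) = 0" if "\<forall>j\<in>{1..s}. crit full j (\<nu> j) (\<mu> j)"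
  proof (rule ccontr)
    assume "x (\<nu>, \<mu>) \<noteq> 0"
    then have "(\<Sum>j=1..s. \<nu> j) = Suc i" using I_D[OF assms] by blast
    moreover have "(\<Sum>j=1..s. \<nu> j) = 0" by (rule sum.neutral) (use that crit_full in blast)
    ultimately show False by simp
  qed
  then show "proj full s x \<kappa> = 0 \<kappa>" by (auto simp: proj_def)
qed

sublocale R: resolution G B L sc \<beta> "I full" D "H full s" \<theta>n
proof (rule resolution.intro, rule G_group, rule resolution_axioms.intro)
  show "subgroup B G" by (rule B_subgroup)
  show "finite B" by (rule finite_B)
  show "is_gmod G L" by (rule L.L)
  show "vector_space sc" by (rule sc_vector_space)
  show "module.subspace sc (I full i)" for i by (rule I_subspace)
  show "Vector_Spaces.linear sc sc (\<beta> b)" for b by (rule linears)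
  show "Vector_Spaces.linear sc sc D" by (rule linears)
  show "Vector_Spaces.linear sc sc (H full s)" by (rule linears)
  show "Vector_Spaces.linear sc sc \<theta>n" by (rule linears)
  show "\<beta> b x \<in> I full i" if "x \<in> I full i" for b x i unfolding \<beta>_def by (intro tI_I uI_I that)
  show "\<beta> (b \<otimes>\<^bsub>G\<^esub> b') x = \<beta> b (\<beta> b' x)" if "b \<in> B" "b' \<in> B" "x \<in> I full i" for b b' x i
    using \<beta>_mult[OF that] by simp
  show "\<beta> \<one>\<^bsub>G\<^esub> x = x" for x by (simp add: \<beta>_def uI_0 tI_1)
  show "D x \<in> I full (Suc i)" if "x \<in> I full i" for x i by (rule D_I[OF that])
  show "D (D x) = 0" if "x \<in> I full i" for x i by (rule D_zero_I[OF that])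
  show "D (\<beta> b x) = \<beta> b (D x)" for b x by (simp add: \<beta>_def D_tI D_uI)
  show "H full s x \<in> I full i" if "x \<in> I full (Suc i)" for x i using H_I[OF that] by simp
  show "D (H full s x) = x" if "x \<in> I full (Suc i)" "D x = 0" for x i
    using D_H[OF that(1) _ that(2), of s] proj_full[OF that(1)] by (metis add_0_right order_refl)
  show "\<theta>n x \<in> I full i" if "x \<in> I full i" for x i
    unfolding \<theta>n_def by (intro I_closed \<theta>_I that)
  show "(\<Sum>b\<in>B. \<beta> b (\<theta>n (\<beta> (inv\<^bsub>G\<^esub> b) x))) = x" if "x \<in> I full i" for x i by (rule \<beta>_trace[OF that])
qed

lemma I_0_D:
  assumes "x \<in> I \<delta> 0" "x (\<nu>, \<mu>) \<noteq> 0"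
  shows "\<nu> = 0"
proof (rule ext)
  fix j
  have z: "j \<notin> {1..s} \<Longrightarrow> \<nu> j = 0" and "(\<Sum>j=1..s. \<nu> j) = 0" using I_D[OF assms] by blast+
  then show "\<nu> j = 0 j" by (cases "j \<in> {1..s}") auto
qed

text \<open>Truncated subtraction keeps \<open>H \<delta> s x\<close> in degree 0, so its image
  under \<open>D\<close> sits in degree 1 and cannot contribute to the cells of x.\<close>

lemma I_0_proj:
  assumes x: "x \<in> I \<delta> 0" and \<delta>: "\<And>j. j \<in> {1..s} \<Longrightarrow> \<delta> j \<le> p - 1" and z: "D x = 0"
  shows "proj \<delta> s x = x"
proof (rule ext)
  fix \<kappa> :: "(nat \<Rightarrow> nat) \<times> (nat \<Rightarrow> nat)"
  obtain \<nu> \<mu> where [simp]: "\<kappa> = (\<nu>, \<mu>)" by fastforce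
  show "proj \<delta> s x \<kappa> = x \<kappa>"
  proof (cases "x \<kappa> = 0")
    case False
    then have "(\<Sum>j=1..s. \<nu> j) = 0" using I_D[OF x] by simp
    moreover have "D (H \<delta> s x) \<in> I \<delta> 1" using D_I[OF H_I[OF x, of s]] by simp
    ultimately have "D (H \<delta> s x) (\<nu>, \<mu>) = 0" using I_D[of "D (H \<delta> s x)" \<delta> 1 \<nu> \<mu>] by fastforce
    moreover have "x = D (H \<delta> s x) + proj \<delta> s x" by (rule D_H[OF x \<delta> z]) auto
    ultimately show ?thesis by (metis \<open>\<kappa> = (\<nu>, \<mu>)\<close> add_0 plus_fun_apply)
  qed (simp add: proj_def)
qed

text \<open>The kernel with which the resolution starts is the copy of L_f: the first step in digit
  j is f_j + 1, just too long for positions up to f_j.\<close>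

lemma N_0_iff: "x \<in> R.N 0 \<longleftrightarrow> x \<in> I full 0 \<and> (\<forall>\<nu> \<mu>. x (\<nu>, \<mu>) \<noteq> 0 \<longrightarrow> \<nu> = 0 \<and> \<mu> \<in> box s f)"
proof
  assume "x \<in> R.N 0"
  then have x: "x \<in> I full 0" and z: "D x = 0" unfolding R.N_def by blast+
  have pr: "proj full s x = x" by (rule I_0_proj[OF x _ z]) simp
  have "\<nu> = 0 \<and> \<mu> \<in> box s f" if nz: "x (\<nu>, \<mu>) \<noteq> 0" for \<nu> \<mu>
  proof
    show "\<nu> = 0" by (rule I_0_D[OF x nz])
    have "proj full s x (\<nu>, \<mu>) \<noteq> 0" using nz pr by simp
    then have "\<forall>j\<in>{1..s}. crit full j (\<nu> j) (\<mu> j)" by (auto simp: proj_def split: if_splits)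
    then have "\<mu> j \<le> f j" if "j \<in> {1..s}" for j using that crit_full by blast
    moreover have "\<mu> \<in> box s full" using I_D[OF x nz] by blast
    ultimately show "\<mu> \<in> box s f" by (auto simp: box_def)
  qed
  then show "x \<in> I full 0 \<and> (\<forall>\<nu> \<mu>. x (\<nu>, \<mu>) \<noteq> 0 \<longrightarrow> \<nu> = 0 \<and> \<mu> \<in> box s f)" using x by blast
next
  assume a: "x \<in> I full 0 \<and> (\<forall>\<nu> \<mu>. x (\<nu>, \<mu>) \<noteq> 0 \<longrightarrow> \<nu> = 0 \<and> \<mu> \<in> box s f)"
  have "Dj j x (\<nu>, \<mu>) = 0" if j: "j \<in> {1..s}" for j \<nu> \<mu>
  proof (rule ccontr)
    assume "Dj j x (\<nu>, \<mu>) \<noteq> 0"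
    then have "x (\<nu>(j := \<nu> j - 1), \<mu>(j := \<mu> j + cstep j (\<nu> j - 1))) \<noteq> 0" by (auto simp: Dj_def split: if_splits)
    with a have 1: "\<nu>(j := \<nu> j - 1) = 0" and 2: "\<mu>(j := \<mu> j + cstep j (\<nu> j - 1)) \<in> box s f" by blast+
    have "\<nu> j - 1 = 0" using fun_cong[OF 1, of j] by simp
    then show False using boxD[OF 2 j] by (simp add: cstep_def)
  qed
  then have "D x = 0" unfolding D_def by (intro ext) (auto intro!: sum.neutral)
  then show "x \<in> R.N 0" using a unfolding R.N_def by blast
qed

definition \<iota> :: "'w \<Rightarrow> 'k cells" where
  "\<iota> u = (\<lambda>(\<nu>, \<mu>). if \<nu> = 0 then M.co u \<mu> else 0)"

definition \<rho> :: "'k cells \<Rightarrow> 'w" where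
  "\<rho> x = M.vec (\<lambda>\<mu>. x (0, \<mu>))"

lemma wt_0: "wt 0 \<mu> = int (val p s f) - 2 * int (val p s \<mu>)"
  by (simp add: wt_def val_def algebra_simps sum.distrib sum_subtractf sum_distrib_left)

lemma box_f_full: "\<mu> \<in> box s f \<Longrightarrow> \<mu> \<in> box s full"
  by (rule M.box_d_full)

lemma act_B_co:
  assumes b: "b \<in> B" and u: "u \<in> vecs M"
  shows "M.co (act M b u) = (\<lambda>\<mu>. (b $ 1 $ 1) powi (int (val p s f) - 2 * int (val p s \<mu>)) *
    (\<Sum>\<tau>\<in>box s full. dp \<tau> (b $ 1 $ 2 / b $ 1 $ 1) * M.co u (\<mu> + \<tau>)))"
proof -
  note D = B_D[OF b]
  let ?t = "b $ 1 $ 1" and ?a = "b $ 1 $ 2 / b $ 1 $ 1"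
  have a: "?a \<in> F" using D F_divide by blast
  have c: "torus ?t \<in> carrier G" "upper ?a \<in> carrier G"
    using torus_B[OF D(5,3)] upper_B[OF a] by (auto simp: borel_def)
  have "act M b u = act M (torus ?t) (act M (upper ?a) u)"
    using M.LD(7)[OF c u] D(7) by simp
  then show ?thesis
    using M.co_torus[OF D(5,3) M.LD(3)[OF c(2) u]] M.co_upper[OF a u] by simp
qed

sublocale R: coefficient_resolution G B L sc \<beta> "I full" D "H full s" \<theta>n M \<iota> \<rho>
proof (rule coefficient_resolution.intro, rule R.resolution_axioms, rule coefficient_resolution_axioms.intro)
  show "is_gmod G M" by (rule M.L)
  have \<iota>N: "\<iota> u \<in> R.N 0" for u
  proof -
    have nz: "\<nu> = 0 \<and> \<mu> \<in> box s f" if "\<iota> u (\<nu>, \<mu>) \<noteq> 0" for \<nu> \<mu>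
      using that M.co_out[of \<mu> u] by (auto simp: \<iota>_def split: if_splits)
    moreover have "\<iota> u \<in> I full 0" unfolding I_def
    proof (intro CollectI allI impI)
      fix \<nu> \<mu> assume "\<iota> u (\<nu>, \<mu>) \<noteq> 0"
      from nz[OF this] show "\<mu> \<in> box s full \<and> (\<forall>j. j \<notin> {1..s} \<longrightarrow> \<nu> j = 0) \<and> (\<Sum>j=1..s. \<nu> j) = 0"
        using box_f_full by auto
    qed
    ultimately show ?thesis unfolding N_0_iff by blast
  qed
  then show "\<iota> u \<in> R.N 0" for u .
  show "\<iota> (u + u') = \<iota> u + \<iota> u'" if "u \<in> vecs M" "u' \<in> vecs M" for u u'
    by (rule ext) (auto simp: \<iota>_def M.co_add[OF that])
  show "\<iota> (smul M a u) = sc a (\<iota> u)" if "u \<in> vecs M" for a u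
    by (rule ext) (auto simp: \<iota>_def M.co_scale[OF that] sc_def)
  show "\<iota> (act M b u) = \<beta> b (\<iota> u)" if "b \<in> B" "u \<in> vecs M" for b u
    by (rule ext) (auto simp: \<iota>_def act_B_co[OF that] \<beta>_def tI_def uI_def shift_def wt_0)
  show "\<rho> y \<in> vecs M" for y unfolding \<rho>_def by (rule M.vec_vecs)
  show "\<iota> (\<rho> y) = y" if "y \<in> R.N 0" for y
  proof (rule ext)
    fix \<kappa> :: "(nat \<Rightarrow> nat) \<times> (nat \<Rightarrow> nat)"
    have "M.co (\<rho> y) = (\<lambda>\<mu>. y (0, \<mu>))"
      by (rule M.co_unique) (use that[unfolded N_0_iff] in \<open>auto simp: \<rho>_def\<close>)
    then show "\<iota> (\<rho> y) \<kappa> = y \<kappa>" using that[unfolded N_0_iff] by (cases \<kappa>) (auto simp: \<iota>_def)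
  qed
  show "\<rho> (\<iota> u) = u" if "u \<in> vecs M" for u
    using M.vec_co[OF that] by (simp add: \<rho>_def \<iota>_def)
  show "of_nat (card (rcosets\<^bsub>G\<^esub> B)) \<noteq> (0 :: 'k)" "finite (rcosets\<^bsub>G\<^esub> B)" by (rule card_cosets)+
qed

end

section \<open>Homomorphisms into the resolution\<close>

context ext_model
begin

section \<open>Homomorphisms of Borel modules as admissible elements\<close>

definition Adm :: "nat \<Rightarrow> 'k cells set" where
  "Adm i = {y \<in> I d i. \<forall>\<nu> \<mu>. y (\<nu>, \<mu>) \<noteq> 0 \<longrightarrow> int (q - 1) dvd wt \<nu> \<mu> + int (val p s d)}"

text \<open>The homomorphism of Borel modules that sends the lowest weight vector \<open>e d\<close> to \<open>y\<close>.\<close>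

definition eta :: "'k cells \<Rightarrow> 'v \<Rightarrow> 'k cells" where
  "eta y x = (\<lambda>\<kappa>. \<Sum>\<mu>\<in>box s d. L.co x \<mu> * shift (d - \<mu>) y \<kappa>)"

lemma d_le: "d j \<le> p - 1"
  using L.d by (cases "j \<in> {1..s}") (auto simp: box_def)

lemma I_d_full: "y \<in> I d i \<Longrightarrow> y \<in> I full i"
  unfolding I_def using L.box_d_full by blast

lemma box_diff_twice: "\<mu> \<in> box s d \<Longrightarrow> d - \<mu> \<in> box s d" "\<mu> \<in> box s d \<Longrightarrow> d - (d - \<mu>) = \<mu>"
  "\<mu> \<in> box s d \<Longrightarrow> \<mu> + (d - \<mu>) = d"
proof -
  assume \<mu>: "\<mu> \<in> box s d"
  have j: "\<mu> j \<le> d j" "j \<notin> {1..s} \<Longrightarrow> d j = 0" for j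
    using \<mu>[unfolded box_def, THEN CollectD, THEN spec, of j] L.d[unfolded box_def, THEN CollectD, THEN spec, of j]
    by (auto split: if_splits)
  show "d - \<mu> \<in> box s d" unfolding box_def using j(2) by auto
  show "d - (d - \<mu>) = \<mu>" "\<mu> + (d - \<mu>) = d" using j(1) by (auto simp: fun_eq_iff)
qed

lemma eta_sum: "D (eta y x) = eta (D y) x"
proof (rule ext)
  fix \<kappa>
  have "D (eta y x) \<kappa> = (\<Sum>\<mu>\<in>box s d. D (\<lambda>\<kappa>. L.co x \<mu> * shift (d - \<mu>) y \<kappa>) \<kappa>)"
    unfolding eta_def by (rule D_sum)
  then show "D (eta y x) \<kappa> = eta (D y) x \<kappa>" by (simp add: D_scale D_shift eta_def)
qed

text \<open>Both sides are double sums over \<mu> and \<tau>, matched by the substitution of \<mu> +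
  \<tau> for \<mu>. The terms that fall out on either side vanish, because the coordinates of x and
  the coefficients of y are supported on \<open>box s d\<close>.\<close>

lemma eta_upper:
  assumes y: "y \<in> I d i" and x: "x \<in> vecs L" and a: "a \<in> F"
  shows "eta y (act L (upper a) x) = uI a (eta y x)"
proof (rule ext)
  fix \<kappa> :: "(nat \<Rightarrow> nat) \<times> (nat \<Rightarrow> nat)"
  obtain \<nu> \<sigma> where \<kappa>: "\<kappa> = (\<nu>, \<sigma>)" by fastforce
  have yz: "y (\<nu>, \<mu>) = 0" if "\<mu> \<notin> box s d" for \<mu> using I_D[OF y] that by blast
  have inner: "(\<Sum>\<mu>\<in>box s d. L.co x (\<mu> + \<tau>) * y (\<nu>, \<sigma> + (d - \<mu>)))
      = (\<Sum>\<mu>\<in>box s d. L.co x \<mu> * y (\<nu>, \<sigma> + \<tau> + (d - \<mu>)))" for \<tau>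
  proof -
    let ?S = "{\<mu> \<in> box s d. \<mu> + \<tau> \<in> box s d}"
    have inj: "inj_on (\<lambda>\<mu>. \<mu> + \<tau>) ?S" by (simp add: inj_on_def)
    have shift_eq: "d - \<mu> = \<tau> + (d - (\<mu> + \<tau>))" if "\<mu> + \<tau> \<in> box s d" for \<mu>
    proof (rule ext)
      fix j show "(d - \<mu>) j = (\<tau> + (d - (\<mu> + \<tau>))) j"
        using that[unfolded box_def, THEN CollectD, THEN spec, of j] L.d[unfolded box_def, THEN CollectD, THEN spec, of j]
        by (simp split: if_splits)
    qed
    have "(\<Sum>\<mu>\<in>box s d. L.co x (\<mu> + \<tau>) * y (\<nu>, \<sigma> + (d - \<mu>)))
        = (\<Sum>\<mu>\<in>?S. L.co x (\<mu> + \<tau>) * y (\<nu>, \<sigma> + (d - \<mu>)))"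
      by (rule sum.mono_neutral_right) (auto simp: L.co_out)
    also have "\<dots> = (\<Sum>\<mu>\<in>?S. L.co x (\<mu> + \<tau>) * y (\<nu>, \<sigma> + \<tau> + (d - (\<mu> + \<tau>))))"
    proof (rule sum.cong[OF refl])
      fix \<mu> assume "\<mu> \<in> ?S"
      then have "\<sigma> + (d - \<mu>) = \<sigma> + \<tau> + (d - (\<mu> + \<tau>))" using shift_eq[of \<mu>] by (metis (mono_tags, lifting) add.assoc mem_Collect_eq)
      then show "L.co x (\<mu> + \<tau>) * y (\<nu>, \<sigma> + (d - \<mu>)) = L.co x (\<mu> + \<tau>) * y (\<nu>, \<sigma> + \<tau> + (d - (\<mu> + \<tau>)))" by (rule arg_cong)
    qed
    also have "\<dots> = (\<Sum>\<mu>\<in>(\<lambda>\<mu>. \<mu> + \<tau>) ` ?S. L.co x \<mu> * y (\<nu>, \<sigma> + \<tau> + (d - \<mu>)))"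
      by (rule sum.reindex[OF inj, symmetric, unfolded o_def])
    also have "\<dots> = (\<Sum>\<mu>\<in>box s d. L.co x \<mu> * y (\<nu>, \<sigma> + \<tau> + (d - \<mu>)))"
    proof (rule sum.mono_neutral_left)
      show "\<forall>\<mu>\<in>box s d - (\<lambda>\<mu>. \<mu> + \<tau>) ` ?S. L.co x \<mu> * y (\<nu>, \<sigma> + \<tau> + (d - \<mu>)) = 0"
      proof
        fix \<mu> assume \<mu>: "\<mu> \<in> box s d - (\<lambda>\<mu>. \<mu> + \<tau>) ` ?S"
        have "\<sigma> + \<tau> + (d - \<mu>) \<notin> box s d"
        proof
          assume b: "\<sigma> + \<tau> + (d - \<mu>) \<in> box s d"
          have le: "\<tau> j \<le> \<mu> j" for j
            using b[unfolded box_def, THEN CollectD, THEN spec, of j]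
              \<mu>[THEN DiffD1, unfolded box_def, THEN CollectD, THEN spec, of j] by (auto split: if_splits)
          have "\<mu> - \<tau> + \<tau> = \<mu>" using le by (auto simp: fun_eq_iff)
          moreover have "\<mu> - \<tau> \<in> box s d"
            using \<mu> box_add_iff(1)[of "\<mu> - \<tau>" \<tau> s d] calculation by simp
          ultimately have "\<mu> \<in> (\<lambda>\<mu>. \<mu> + \<tau>) ` ?S" using \<mu> by (intro image_eqI[of _ _ "\<mu> - \<tau>"]) auto
          then show False using \<mu> by blast
        qed
        then show "L.co x \<mu> * y (\<nu>, \<sigma> + \<tau> + (d - \<mu>)) = 0" using yz by simp
      qed
    qed auto
    finally show ?thesis .
  qed
  have "eta y (act L (upper a) x) \<kappa> = (\<Sum>\<mu>\<in>box s d. \<Sum>\<tau>\<in>box s full. dp \<tau> a * (L.co x (\<mu> + \<tau>) * y (\<nu>, \<sigma> + (d - \<mu>))))"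
    by (simp add: eta_def L.co_upper[OF a x] shift_def \<kappa> sum_distrib_right mult.assoc)
  also have "\<dots> = (\<Sum>\<tau>\<in>box s full. dp \<tau> a * (\<Sum>\<mu>\<in>box s d. L.co x (\<mu> + \<tau>) * y (\<nu>, \<sigma> + (d - \<mu>))))"
    by (subst sum.swap) (simp add: sum_distrib_left)
  also have "\<dots> = uI a (eta y x) \<kappa>"
    unfolding inner by (simp add: uI_def eta_def shift_def \<kappa>)
  finally show "eta y (act L (upper a) x) \<kappa> = uI a (eta y x) \<kappa>" .
qed

text \<open>The congruence modulo q - 1 in \<open>Adm\<close> is exactly what makes the powers of t
  agree for t in the multiplicative group of \<open>F\<close>.\<close>

lemma eta_torus:
  assumes y: "y \<in> Adm i" and x: "x \<in> vecs L" and t: "t \<in> F" "t \<noteq> 0"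
  shows "eta y (act L (torus t) x) = tI t (eta y x)"
proof (rule ext)
  fix \<kappa> :: "(nat \<Rightarrow> nat) \<times> (nat \<Rightarrow> nat)"
  obtain \<nu> \<sigma> where \<kappa>: "\<kappa> = (\<nu>, \<sigma>)" by fastforce
  let ?w = "\<lambda>\<mu>. int (val p s d) - 2 * int (val p s \<mu>)"
  have "t powi ?w \<mu> * y (\<nu>, \<sigma> + (d - \<mu>)) = t powi wt \<nu> \<sigma> * y (\<nu>, \<sigma> + (d - \<mu>))" if \<mu>: "\<mu> \<in> box s d" for \<mu>
  proof (cases "y (\<nu>, \<sigma> + (d - \<mu>)) = 0")
    case False
    have "val p s (d - \<mu>) + val p s \<mu> = val p s d"
      using box_diff_twice(3)[OF \<mu>] val_add[of p s \<mu> "d - \<mu>"] by simp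
    then have "wt \<nu> (\<sigma> + (d - \<mu>)) + int (val p s d) = wt \<nu> \<sigma> - ?w \<mu>"
      unfolding wt_add by linarith
    then have "int (q - 1) dvd wt \<nu> \<sigma> - ?w \<mu>"
      using y False unfolding Adm_def by (metis (mono_tags, lifting) mem_Collect_eq)
    then have "t powi (wt \<nu> \<sigma> - ?w \<mu>) = 1" by (rule powi_dvd[OF _ t])
    then have "t powi wt \<nu> \<sigma> / t powi ?w \<mu> = 1"
      by (simp only: power_int_diff[OF disjI1[OF t(2)]])
    moreover have "t powi ?w \<mu> \<noteq> 0" using t(2) by (rule power_int_not_zero[OF disjI1])
    ultimately have "t powi wt \<nu> \<sigma> = t powi ?w \<mu>" by (simp only: divide_eq_1_iff)
    then show ?thesis by simp
  qed simp
  then show "eta y (act L (torus t) x) \<kappa> = tI t (eta y x) \<kappa>"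
    by (auto simp: eta_def L.co_torus[OF t x] shift_def \<kappa> tI_def sum_distrib_left mult_ac intro!: sum.cong)
qed

lemma eta_I: "y \<in> I d i \<Longrightarrow> eta y x \<in> I full i"
  unfolding eta_def by (intro I_sum I_closed shift_I I_d_full)

lemma eta_bhom:
  assumes y: "y \<in> Adm i" and X: "\<And>x. x \<in> vecs L \<Longrightarrow> eta y x \<in> X"
  shows "R.bhom X (eta y)"
  unfolding R.bhom_def lin_on_def
proof (intro conjI ballI allI X)
  have yI: "y \<in> I d i" using y by (simp add: Adm_def)
  fix x assume x: "x \<in> vecs L"
  show "eta y (x + z) = eta y x + eta y z" if "z \<in> vecs L" for z
    by (rule ext) (simp add: eta_def L.co_add[OF x that] algebra_simps sum.distrib)
  show "eta y (smul L a x) = sc a (eta y x)" for a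
    by (rule ext) (simp add: eta_def sc_def L.co_scale[OF x] sum_distrib_left mult.assoc)
  fix b assume b: "b \<in> B"
  note D = B_D[OF b]
  let ?t = "b $ 1 $ 1" and ?a = "b $ 1 $ 2 / b $ 1 $ 1"
  have a: "?a \<in> F" using D(5,6) F_divide by blast
  have c: "torus ?t \<in> carrier G" "upper ?a \<in> carrier G"
    using torus_B[OF D(5,3)] upper_B[OF a] by (auto simp: borel_def)
  have "act L b x = act L (torus ?t) (act L (upper ?a) x)"
    using L.LD(7)[OF c x] D(7) by simp
  then show "eta y (act L b x) = \<beta> b (eta y x)"
    using eta_torus[OF y L.LD(3)[OF c(2) x] D(5,3)] eta_upper[OF yI x a] by (simp add: \<beta>_def)
qed

lemma lin_on_sum:
  assumes l: "lin_on L (sc :: 'k \<Rightarrow> ('x \<Rightarrow> 'k) \<Rightarrow> 'x \<Rightarrow> 'k) \<phi>" and g: "\<And>a. a \<in> A \<Longrightarrow> g a \<in> vecs L"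
  shows "\<phi> (\<Sum>a\<in>A. smul L (c a) (g a)) = (\<lambda>\<kappa>. \<Sum>a\<in>A. c a * \<phi> (g a) \<kappa>)"
  using g
proof (induction A rule: infinite_finite_induct)
  case (insert a A)
  have "smul L (c a) (g a) \<in> vecs L" "(\<Sum>a\<in>A. smul L (c a) (g a)) \<in> vecs L"
    by (intro L.LS insert.prems; simp)+
  then have "\<phi> (smul L (c a) (g a) + (\<Sum>a\<in>A. smul L (c a) (g a))) = \<phi> (smul L (c a) (g a)) + \<phi> (\<Sum>a\<in>A. smul L (c a) (g a))"
    using l unfolding lin_on_def by blast
  then show ?case using insert l by (simp add: lin_on_def sc_def fun_eq_iff)
next
  case empty
  have "\<phi> (smul L 0 0) = sc 0 (\<phi> 0)" using l L.LS(1) unfolding lin_on_def by blast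
  then show ?case by (simp add: sc_def fun_eq_iff)
next
  case (infinite A)
  have "\<phi> (smul L 0 0) = sc 0 (\<phi> 0)" using l L.LS(1) unfolding lin_on_def by blast
  then show ?case using infinite by (simp add: sc_def fun_eq_iff)
qed

text \<open>The lowest weight vector e d generates L_d over the unipotent group. Comparing divided
  powers in the image of \<open>upper a\<close> applied to e d gives \<phi> (e (d - \<tau>)) as a
  shift of \<phi> (e d); for \<tau> outside \<open>box s d\<close> the shift must vanish, which
  confines the support. The torus gives the congruence.\<close>

lemma bhom_eta:
  assumes \<phi>: "R.bhom (I full i) \<phi>"
  shows "\<phi> (e d) \<in> Adm i" "\<And>x. x \<in> vecs L \<Longrightarrow> \<phi> x = eta (\<phi> (e d)) x"
proof -
  let ?y = "\<phi> (e d)"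
  have l: "lin_on L sc \<phi>" and \<phi>I: "\<And>x. x \<in> vecs L \<Longrightarrow> \<phi> x \<in> I full i"
    and eq: "\<And>b x. b \<in> B \<Longrightarrow> x \<in> vecs L \<Longrightarrow> \<phi> (act L b x) = \<beta> b (\<phi> x)"
    using \<phi> by (auto simp: R.bhom_def)
  note ed = L.e[OF L.d_box]
  have yI: "?y \<in> I full i" by (rule \<phi>I[OF ed])
  have sh: "(if \<tau> \<in> box s d then \<phi> (e (d - \<tau>)) \<kappa> else 0) = shift \<tau> ?y \<kappa>" if \<tau>: "\<tau> \<in> box s full" for \<tau> \<kappa>
  proof -
    have "(if \<tau> \<in> box s d then \<phi> (e (d - \<tau>)) \<kappa> else 0) - shift \<tau> ?y \<kappa> = 0"
    proof (rule dp_independent[OF _ _ \<tau>, where A = F])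
      fix a assume a: "a \<in> F"
      have "(\<Sum>\<tau>\<in>box s full. (if \<tau> \<in> box s d then \<phi> (e (d - \<tau>)) \<kappa> else 0) * dp \<tau> a)
          = (\<Sum>\<tau>\<in>box s d. dp \<tau> a * \<phi> (e (d - \<tau>)) \<kappa>)"
        by (rule sum.mono_neutral_cong_right) (use L.box_d_full in auto)
      also have "\<dots> = \<phi> (act L (upper a) (e d)) \<kappa>"
        unfolding L.upper_e[OF a L.d_box] by (subst lin_on_sum[OF l]) (use box_diff_twice(1) L.e in auto)
      also have "\<dots> = (\<Sum>\<tau>\<in>box s full. shift \<tau> ?y \<kappa> * dp \<tau> a)"
        by (simp add: eq[OF upper_B[OF a] ed] \<beta>_upper uI_def mult.commute)
      finally show "(\<Sum>\<tau>\<in>box s full. ((if \<tau> \<in> box s d then \<phi> (e (d - \<tau>)) \<kappa> else 0) - shift \<tau> ?y \<kappa>) * dp \<tau> a) = 0"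
        by (simp only: left_diff_distrib sum_subtractf) simp
    qed (simp add: card_F)
    then show ?thesis by simp
  qed
  have supp: "\<mu> \<in> box s d" if nz: "?y (\<nu>, \<mu>) \<noteq> 0" for \<nu> \<mu>
  proof (rule ccontr)
    assume "\<mu> \<notin> box s d"
    moreover have "\<mu> \<in> box s full" using I_D[OF yI nz] by blast
    ultimately have "shift \<mu> ?y (\<nu>, 0) = 0" using sh[of \<mu> "(\<nu>, 0)"] by simp
    then show False using nz by (simp add: shift_def)
  qed
  have wts: "int (q - 1) dvd wt \<nu> \<mu> + int (val p s d)" if nz: "?y (\<nu>, \<mu>) \<noteq> 0" for \<nu> \<mu>
  proof (rule dvd_of_power_eq_1)
    fix t assume t: "t \<in> F" "t \<noteq> 0"
    have "\<phi> (act L (torus t) (e d)) = sc (t powi (- int (val p s d))) ?y"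
      using L.torus_e[OF t L.d_box] l ed by (simp add: lin_on_def)
    then have "tI t ?y (\<nu>, \<mu>) = t powi (- int (val p s d)) * ?y (\<nu>, \<mu>)"
      using eq[OF torus_B[OF t] ed] by (simp add: \<beta>_torus sc_def)
    then have "t powi wt \<nu> \<mu> = t powi (- int (val p s d))" using nz by (simp add: tI_def)
    then have "t powi wt \<nu> \<mu> * t powi int (val p s d) = t powi (- int (val p s d)) * t powi int (val p s d)" by simp
    then show "t powi (wt \<nu> \<mu> + int (val p s d)) = 1"
      using t by (simp only: power_int_add[OF disjI1[OF t(2)], symmetric]) simp
  qed
  show "?y \<in> Adm i" unfolding Adm_def I_def using I_D[OF yI] supp wts by blast
  fix x assume x: "x \<in> vecs L"
  have "\<phi> x = \<phi> (\<Sum>\<mu>\<in>box s d. smul L (L.co x \<mu>) (e \<mu>))" using L.vec_co[OF x] by (simp add: L.vec_def)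
  also have "\<dots> = (\<lambda>\<kappa>. \<Sum>\<mu>\<in>box s d. L.co x \<mu> * \<phi> (e \<mu>) \<kappa>)" by (rule lin_on_sum[OF l L.e])
  also have "\<dots> = eta ?y x"
  proof (rule ext)
    fix \<kappa>
    have "\<phi> (e \<mu>) \<kappa> = shift (d - \<mu>) ?y \<kappa>" if \<mu>: "\<mu> \<in> box s d" for \<mu>
      using sh[OF L.box_d_full[OF box_diff_twice(1)[OF \<mu>]], of \<kappa>] box_diff_twice[OF \<mu>] by simp
    then show "(\<Sum>\<mu>\<in>box s d. L.co x \<mu> * \<phi> (e \<mu>) \<kappa>) = eta ?y x \<kappa>" by (simp add: eta_def)
  qed
  finally show "\<phi> x = eta ?y x" .
qed

section \<open>Reduction to critical cells\<close>

lemma hj_weight: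
  assumes x: "x \<in> Adm i" and j: "j \<in> {1..s}"
  shows "hj d j x \<in> Adm (i - 1)"
  unfolding Adm_def
proof (intro CollectI conjI allI impI)
  show "hj d j x \<in> I d (i - 1)" by (rule hj_I[OF _ j]) (use x in \<open>simp add: Adm_def\<close>)
  fix \<nu> \<mu> assume "hj d j x (\<nu>, \<mu>) \<noteq> 0"
  then have c: "cstep j (\<nu> j) \<le> \<mu> j" and "x (\<nu>(j := \<nu> j + 1), \<mu>(j := \<mu> j - cstep j (\<nu> j))) \<noteq> 0"
    by (auto simp: hj_def split: if_splits)
  with x have "int (q - 1) dvd wt (\<nu>(j := \<nu> j + 1)) (\<mu>(j := \<mu> j - cstep j (\<nu> j))) + int (val p s d)"
    unfolding Adm_def by blast
  moreover have "wt (\<nu>(j := \<nu> j + 1)) (\<mu>(j := \<mu> j - cstep j (\<nu> j))) = wt \<nu> \<mu>"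
    using wt_step[OF j, of "\<nu>(j := \<nu> j + 1)" "\<mu>(j := \<mu> j - cstep j (\<nu> j))"] c by simp
  ultimately show "int (q - 1) dvd wt \<nu> \<mu> + int (val p s d)" by simp
qed

lemma Adm_sum: "(\<And>k. k \<in> A \<Longrightarrow> y k \<in> Adm i) \<Longrightarrow> (\<lambda>\<kappa>. \<Sum>k\<in>A. y k \<kappa>) \<in> Adm i"
proof -
  assume y: "\<And>k. k \<in> A \<Longrightarrow> y k \<in> Adm i"
  show ?thesis unfolding Adm_def
  proof (intro CollectI conjI allI impI)
    show "(\<lambda>\<kappa>. \<Sum>k\<in>A. y k \<kappa>) \<in> I d i" by (rule I_sum) (use y in \<open>simp add: Adm_def\<close>)
    fix \<nu> \<mu> assume "(\<Sum>k\<in>A. y k (\<nu>, \<mu>)) \<noteq> 0"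
    then obtain k where "k \<in> A" "y k (\<nu>, \<mu>) \<noteq> 0" by (meson sum.neutral)
    then show "int (q - 1) dvd wt \<nu> \<mu> + int (val p s d)" using y[of k] unfolding Adm_def by blast
  qed
qed

lemma proj_Adm: "x \<in> Adm i \<Longrightarrow> proj d t x \<in> Adm i"
  unfolding Adm_def using proj_I by (auto simp: proj_def)

lemma H_Adm: "x \<in> Adm i \<Longrightarrow> H d s x \<in> Adm (i - 1)"
  unfolding H_def by (intro Adm_sum hj_weight proj_Adm) auto

definition cell :: "(nat \<Rightarrow> nat) \<times> (nat \<Rightarrow> nat) \<Rightarrow> 'k cells" where
  "cell \<kappa> = (\<lambda>\<kappa>'. if \<kappa>' = \<kappa> then 1 else 0)"

text \<open>A critical cell is closed, because a move of \<open>D\<close> in digit j would need a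
  position of at least \<open>cstep j (\<nu> j)\<close>.\<close>

lemma cell_Adm:
  assumes "\<kappa> \<in> critical_cells d i"
  shows "cell \<kappa> \<in> Adm i" "D (cell \<kappa>) = 0"
proof -
  obtain \<nu> \<mu> where [simp]: "\<kappa> = (\<nu>, \<mu>)" by fastforce
  show "cell \<kappa> \<in> Adm i"
    using assms by (auto simp: Adm_def I_def cell_def critical_cells_def)
  have "Dj j (cell \<kappa>) (\<nu>', \<mu>') = 0" if j: "j \<in> {1..s}" for j \<nu>' \<mu>'
  proof (rule ccontr)
    assume "Dj j (cell \<kappa>) (\<nu>', \<mu>') \<noteq> 0"
    then have "(\<nu>'(j := \<nu>' j - 1), \<mu>'(j := \<mu>' j + cstep j (\<nu>' j - 1))) = (\<nu>, \<mu>)"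
      by (auto simp: Dj_def cell_def split: if_splits)
    then have "\<nu> j = \<nu>' j - 1" "\<mu> j = \<mu>' j + cstep j (\<nu>' j - 1)" by auto
    moreover have "\<mu> j < cstep j (\<nu> j)" using assms j by (auto simp: critical_cells_def crit_def)
    ultimately show False by simp
  qed
  then show "D (cell \<kappa>) = 0" unfolding D_def by (intro ext) (auto intro!: sum.neutral)
qed

lemma proj_critical:
  assumes x: "x \<in> Adm i" and g: "bij_betw g {..<r::nat} (critical_cells d i)"
  shows "proj d s x = (\<lambda>\<kappa>. \<Sum>k<r. x (g k) * cell (g k) \<kappa>)"
proof (rule ext)
  fix \<kappa> :: "(nat \<Rightarrow> nat) \<times> (nat \<Rightarrow> nat)"
  obtain \<nu> \<mu> where [simp]: "\<kappa> = (\<nu>, \<mu>)" by fastforce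
  have fin: "finite (critical_cells d i)" using bij_betw_finite[OF g] by simp
  have "(\<Sum>k<r. x (g k) * cell (g k) \<kappa>) = (\<Sum>\<kappa>'\<in>critical_cells d i. x \<kappa>' * cell \<kappa>' \<kappa>)"
    by (rule sum.reindex_bij_betw[OF g])
  also have "\<dots> = (\<Sum>\<kappa>'\<in>critical_cells d i \<inter> {\<kappa>}. x \<kappa>' * cell \<kappa>' \<kappa>)"
    by (rule sum.mono_neutral_right) (auto simp: cell_def fin)
  also have "\<dots> = (if \<kappa> \<in> critical_cells d i then x \<kappa> else 0)"
    by (cases "\<kappa> \<in> critical_cells d i") (auto simp: cell_def)
  also have "\<dots> = proj d s x \<kappa>"
  proof (cases "x (\<nu>, \<mu>) = 0")
    case False
    then have "\<kappa> \<in> critical_cells d i \<longleftrightarrow> (\<forall>j\<in>{1..s}. crit d j (\<nu> j) (\<mu> j))"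
      using x unfolding Adm_def I_def critical_cells_def by auto
    then show ?thesis by (simp add: proj_def)
  qed (simp add: proj_def)
  finally show "proj d s x \<kappa> = (\<Sum>k<r. x (g k) * cell (g k) \<kappa>)" by simp
qed

lemma eta_lin_comb: "eta (\<lambda>\<kappa>. \<Sum>k<r. c k * y k \<kappa>) x = (\<Sum>k<r. sc (c k) (eta (y k) x))"
proof (rule ext)
  fix \<kappa> :: "(nat \<Rightarrow> nat) \<times> (nat \<Rightarrow> nat)"
  have "eta (\<lambda>\<kappa>. \<Sum>k<r. c k * y k \<kappa>) x \<kappa> = (\<Sum>\<mu>\<in>box s d. \<Sum>k<r. c k * (L.co x \<mu> * shift (d - \<mu>) (y k) \<kappa>))"
    by (cases \<kappa>) (simp add: eta_def shift_def sum_distrib_left mult_ac)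
  also have "\<dots> = (\<Sum>k<r. sc (c k) (eta (y k) x)) \<kappa>"
    unfolding sum_fun_apply by (subst sum.swap) (simp add: sc_def eta_def sum_distrib_left)
  finally show "eta (\<lambda>\<kappa>. \<Sum>k<r. c k * y k \<kappa>) x \<kappa> = (\<Sum>k<r. sc (c k) (eta (y k) x)) \<kappa>" .
qed

lemma eta_add: "eta (y + z) x = eta y x + eta z x"
  by (rule ext) (auto simp: eta_def shift_def algebra_simps sum.distrib split: prod.splits)

lemma eta_zero: "eta 0 x = 0"
  by (rule ext) (auto simp: eta_def shift_def intro!: sum.neutral split: prod.splits)

lemma eta_N:
  assumes y: "y \<in> Adm i" and z: "D y = 0"
  shows "R.bhom (R.N i) (eta y)"
proof (rule eta_bhom[OF y])
  fix x
  have "eta y x \<in> I full i" by (rule eta_I) (use y in \<open>simp add: Adm_def\<close>)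
  moreover have "D (eta y x) = 0" by (simp only: eta_sum z eta_zero)
  ultimately show "eta y x \<in> R.N i" unfolding R.N_def by blast
qed

lemma bhom_N:
  assumes "R.bhom (R.N i) \<phi>"
  shows "\<phi> (e d) \<in> Adm i" "D (\<phi> (e d)) = 0" "\<And>x. x \<in> vecs L \<Longrightarrow> \<phi> x = eta (\<phi> (e d)) x"
proof -
  have \<phi>: "R.bhom (I full i) \<phi>" using assms R.N_subset unfolding R.bhom_def by blast
  show "\<phi> (e d) \<in> Adm i" "\<And>x. x \<in> vecs L \<Longrightarrow> \<phi> x = eta (\<phi> (e d)) x" by (rule bhom_eta[OF \<phi>])+
  have "\<phi> (e d) \<in> R.N i" using assms L.e[OF L.d_box] unfolding R.bhom_def by blast
  then show "D (\<phi> (e d)) = 0" unfolding R.N_def by blast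
qed

text \<open>The homotopy for the box d preserves admissibility. So up to the image of a homomorphism
  into \<open>I full m\<close>, a homomorphism into the kernel in degree m + 1 is a combination of
  the homomorphisms attached to critical cells.\<close>

theorem ext_dim_le_critical: "ext_dim G L M (Suc m) \<le> enat (card (critical_cells d (Suc m)))"
proof -
  let ?C = "critical_cells d (Suc m)"
  have fin: "finite ?C" by (rule card_critical_cells(1)[OF d_le]) simp
  obtain g where g: "bij_betw g {..<card ?C} ?C"
    using ex_bij_betw_nat_finite[OF fin] by (auto simp: atLeast0LessThan)
  have gC: "g k \<in> ?C" if "k < card ?C" for k using bij_betwE[OF g] that by auto
  show ?thesis
  proof (rule R.ext_dim_le[where \<eta> = "\<lambda>k. eta (cell (g k))"])
    show "R.bhom (R.N (Suc m)) (eta (cell (g k)))" if "k < card ?C" for k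
      by (rule eta_N; rule cell_Adm[OF gC[OF that]])
    fix \<phi> assume \<phi>: "R.bhom (R.N (Suc m)) \<phi>"
    note b = bhom_N[OF \<phi>]
    let ?y = "\<phi> (e d)"
    have yI: "?y \<in> I d (Suc m)" using b(1) by (simp add: Adm_def)
    have HA: "H d s ?y \<in> Adm m" using H_Adm[OF b(1)] by simp
    have dec: "?y = D (H d s ?y) + (\<lambda>\<kappa>. \<Sum>k<card ?C. ?y (g k) * cell (g k) \<kappa>)"
      using D_H[OF yI d_le b(2) order_refl] unfolding proj_critical[OF b(1) g] .
    have "R.bhom (I full m) (eta (H d s ?y))"
      by (rule eta_bhom[OF HA]) (rule eta_I, use HA in \<open>simp add: Adm_def\<close>)
    moreover have "\<phi> x = D (eta (H d s ?y) x) + (\<Sum>k<card ?C. sc (?y (g k)) (eta (cell (g k)) x))"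
      if x: "x \<in> vecs L" for x
    proof -
      have "\<phi> x = eta ?y x" by (rule b(3)[OF x])
      also have "\<dots> = eta (D (H d s ?y) + (\<lambda>\<kappa>. \<Sum>k<card ?C. ?y (g k) * cell (g k) \<kappa>)) x"
        using dec by (rule arg_cong)
      also have "\<dots> = D (eta (H d s ?y) x) + (\<Sum>k<card ?C. sc (?y (g k)) (eta (cell (g k)) x))"
        by (simp only: eta_add eta_sum eta_lin_comb)
      finally show ?thesis .
    qed
    ultimately show "\<exists>y a. R.bhom (I full m) y \<and> (\<forall>x\<in>vecs L. \<phi> x = D (y x) + (\<Sum>k<card ?C. sc (a k) (eta (cell (g k)) x)))"
      by (intro exI[of _ "eta (H d s ?y)"] exI[of _ "\<lambda>k. ?y (g k)"]) simp
  qed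
qed

text \<open>In degree 0 there is no image to divide out; closed elements are supported on critical
  cells by \<open>I_0_proj\<close>.\<close>

theorem ext_dim_0_le_critical: "ext_dim G L M 0 \<le> enat (card (critical_cells d 0))"
proof -
  let ?C = "critical_cells d 0"
  obtain g where g: "bij_betw g {..<card ?C} ?C"
    using ex_bij_betw_nat_finite[OF card_critical_cells_0(1)[of d]] by (auto simp: atLeast0LessThan)
  have gC: "g k \<in> ?C" if "k < card ?C" for k using bij_betwE[OF g] that by auto
  show ?thesis
  proof (rule R.ext_dim_0_le[where \<eta> = "\<lambda>k. eta (cell (g k))"])
    show "eta (cell (g k)) x \<in> R.N 0" if "k < card ?C" "x \<in> vecs L" for k x
      using eta_N[OF cell_Adm[OF gC[OF that(1)]]] that(2) unfolding R.bhom_def by blast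
    fix \<phi> assume \<phi>: "R.bhom (R.N 0) \<phi>"
    note b = bhom_N[OF \<phi>]
    let ?y = "\<phi> (e d)"
    have yI: "?y \<in> I d 0" using b(1) by (simp add: Adm_def)
    have "proj d s ?y = ?y" by (rule I_0_proj[OF yI d_le b(2)])
    then have dec: "?y = (\<lambda>\<kappa>. \<Sum>k<card ?C. ?y (g k) * cell (g k) \<kappa>)"
      unfolding proj_critical[OF b(1) g] by (rule sym)
    have "\<phi> x = (\<Sum>k<card ?C. sc (?y (g k)) (eta (cell (g k)) x))" if x: "x \<in> vecs L" for x
    proof -
      have "\<phi> x = eta ?y x" by (rule b(3)[OF x])
      also have "\<dots> = eta (\<lambda>\<kappa>. \<Sum>k<card ?C. ?y (g k) * cell (g k) \<kappa>) x" using dec by (rule arg_cong)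
      finally show ?thesis by (simp only: eta_lin_comb)
    qed
    then show "\<exists>a. \<forall>x\<in>vecs L. \<phi> x = (\<Sum>k<card ?C. sc (a k) (eta (cell (g k)) x))"
      by (intro exI[of _ "\<lambda>k. ?y (g k)"]) simp
  qed
qed

end

section \<open>Homomorphisms between simple modules\<close>

context ext_model
begin

definition hom :: "('v \<Rightarrow> 'w) \<Rightarrow> bool" where
  "hom \<phi> \<longleftrightarrow> lin_on L (smul M) \<phi> \<and>
     (\<forall>x\<in>vecs L. \<phi> x \<in> vecs M \<and> (\<forall>g\<in>carrier G. \<phi> (act L g x) = act M g (\<phi> x)))"

lemma homD:
  assumes "hom \<phi>"
  shows "\<And>x y. x \<in> vecs L \<Longrightarrow> y \<in> vecs L \<Longrightarrow> \<phi> (x + y) = \<phi> x + \<phi> y"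
    "\<And>a x. x \<in> vecs L \<Longrightarrow> \<phi> (smul L a x) = smul M a (\<phi> x)"
    "\<And>g x. g \<in> carrier G \<Longrightarrow> x \<in> vecs L \<Longrightarrow> \<phi> (act L g x) = act M g (\<phi> x)"
    "\<And>x. x \<in> vecs L \<Longrightarrow> \<phi> x \<in> vecs M"
  using assms unfolding hom_def lin_on_def by blast+

lemma hom_co: "hom \<phi> \<Longrightarrow> lin_on L sc (\<lambda>x. M.co (\<phi> x))"
  unfolding lin_on_def sc_def by (simp add: homD M.co_add M.co_scale plus_fun_def)

lemma hom_upper:
  assumes h: "hom \<phi>"
    and \<mu>: "\<mu> \<in> box s d" and \<tau>: "\<tau> \<in> box s full"
  shows "M.co (\<phi> (e \<mu>)) (\<kappa> + \<tau>) = (if \<tau> \<in> box s \<mu> then M.co (\<phi> (e (\<mu> - \<tau>))) \<kappa> else 0)"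
proof -
  let ?\<psi> = "\<lambda>x. M.co (\<phi> x)"
  note act = homD(3)[OF h] and vecs = homD(4)[OF h] and l = hom_co[OF h]
  have sub: "\<mu> - \<tau> \<in> box s d" for \<tau>
    using \<mu> unfolding box_def by (auto intro: le_trans[OF diff_le_self])
  have \<mu>full: "box s \<mu> \<subseteq> box s full"
    using L.box_d_full[OF \<mu>] by (intro box_mono) (auto simp: box_def)
  have "M.co (\<phi> (e \<mu>)) (\<kappa> + \<tau>) - (if \<tau> \<in> box s \<mu> then ?\<psi> (e (\<mu> - \<tau>)) \<kappa> else 0) = 0"
  proof (rule dp_independent[OF _ _ \<tau>, where A = F])
    fix a assume a: "a \<in> F"
    have aG: "upper a \<in> carrier G" by (rule M.carrier_B[OF upper_B[OF a]])
    have "(\<Sum>\<tau>\<in>box s full. M.co (\<phi> (e \<mu>)) (\<kappa> + \<tau>) * dp \<tau> a) = M.co (act M (upper a) (\<phi> (e \<mu>))) \<kappa>"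
      by (simp add: M.co_upper[OF a vecs[OF L.e[OF \<mu>]]] mult.commute)
    also have "\<dots> = ?\<psi> (\<Sum>\<tau>\<in>box s \<mu>. smul L (dp \<tau> a) (e (\<mu> - \<tau>))) \<kappa>"
      unfolding act[OF aG L.e[OF \<mu>], symmetric] L.upper_e[OF a \<mu>] ..
    also have "\<dots> = (\<Sum>\<tau>\<in>box s \<mu>. dp \<tau> a * ?\<psi> (e (\<mu> - \<tau>)) \<kappa>)"
      by (subst lin_on_sum[OF l]) (use sub L.e in auto)
    also have "\<dots> = (\<Sum>\<tau>\<in>box s full. (if \<tau> \<in> box s \<mu> then ?\<psi> (e (\<mu> - \<tau>)) \<kappa> else 0) * dp \<tau> a)"
      by (rule sum.mono_neutral_cong_left) (use \<mu>full in auto)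
    finally show "(\<Sum>\<tau>\<in>box s full. (M.co (\<phi> (e \<mu>)) (\<kappa> + \<tau>) - (if \<tau> \<in> box s \<mu> then ?\<psi> (e (\<mu> - \<tau>)) \<kappa> else 0)) * dp \<tau> a) = 0"
      by (simp only: left_diff_distrib sum_subtractf) simp
  qed (simp add: card_F)
  then show ?thesis by simp
qed

text \<open>The image of e 0 is fixed by the unipotent group, hence a multiple y of e' 0. The Weyl
  element turns this into a statement about e d: its image is a multiple of e' f. If d \<noteq> f,
  this gives y = 0 and kills the generator e d. Simplicity of the restrictions to the finite group
  is not presupposed.\<close>

lemma hom_eq_0:
  assumes h: "hom \<phi>"
    and neq: "d \<noteq> f" and x: "x \<in> vecs L"
  shows "\<phi> x = 0"
proof -
  note scale = homD(2)[OF h] and act = homD(3)[OF h] and vecs = homD(4)[OF h] and up = hom_upper[OF h]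
  have z: "(0 :: nat \<Rightarrow> nat) \<in> box s \<delta>" for \<delta> by (simp add: box_def)
  note e0 = L.e[OF z] and ed = L.e[OF L.d_box]
  have box0: "\<tau> \<in> box s 0 \<longleftrightarrow> \<tau> = 0" for \<tau> :: "nat \<Rightarrow> nat"
    by (auto simp: box_def fun_eq_iff split: if_splits)
  define y where "y = M.co (\<phi> (e 0)) 0"
  have "M.co (\<phi> (e 0)) = (\<lambda>\<tau>. if \<tau> = 0 then y else 0)"
  proof (rule ext)
    fix \<tau>
    show "M.co (\<phi> (e 0)) \<tau> = (if \<tau> = 0 then y else 0)"
    proof (cases "\<tau> \<in> box s full")
      case True
      then show ?thesis using up[OF z True, of 0] by (auto simp: y_def box0)
    next
      case False
      then have "\<tau> \<notin> box s f" "\<tau> \<noteq> 0" using M.box_d_full z by blast+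
      then show ?thesis by (simp add: M.co_out)
    qed
  qed
  then have "\<phi> (e 0) = M.vec (\<lambda>\<tau>. if \<tau> = 0 then y else 0)"
    using M.vec_co[OF vecs[OF e0]] by simp
  also have "\<dots> = (\<Sum>\<tau>\<in>{0}. smul M (if \<tau> = 0 then y else 0) (e' \<tau>))"
    unfolding M.vec_def by (rule sum.mono_neutral_right) (use z in auto)
  finally have \<phi>0: "\<phi> (e 0) = smul M y (e' 0)" by simp
  obtain c where c: "c \<noteq> 0" "act L weyl (e 0) = smul L c (e d)" using L.weyl_e by blast
  obtain c' where c': "c' \<noteq> 0" "act M weyl (e' 0) = smul M c' (e' f)" using M.weyl_e by blast
  have "smul M c (\<phi> (e d)) = act M weyl (smul M y (e' 0))"
    using act[OF weyl_G e0] unfolding c(2) scale[OF ed] \<phi>0 .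
  also have "\<dots> = smul M (y * c') (e' f)"
    unfolding M.LD(5)[OF weyl_G M.e[OF z]] c'(2) by simp
  finally have "smul M (inverse c) (smul M c (\<phi> (e d))) = smul M (inverse c) (smul M (y * c') (e' f))" by simp
  then have \<phi>d: "\<phi> (e d) = smul M (inverse c * (y * c')) (e' f)" using c(1) by simp
  \<comment> \<open>Raising e d by all of d gives e 0, so y is the coordinate at d of the image of e
    d.\<close>
  have "y = M.co (\<phi> (e d)) (0 + d)"
    using up[OF L.d_box L.box_d_full[OF L.d_box], of 0] L.d_box by (simp add: y_def)
  also have "\<dots> = 0"
    unfolding \<phi>d M.co_scale[OF M.e[OF M.d_box]] M.co_e[OF M.d_box] using neq by simp
  finally have y: "y = 0" .
  have \<phi>d0: "\<phi> (e d) = 0" unfolding \<phi>d y by simp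
  have co0: "M.co 0 = (\<lambda>_. 0)" by (rule M.co_unique) (auto simp: M.vec_def)
  have "\<phi> (e \<mu>) = 0" if \<mu>: "\<mu> \<in> box s d" for \<mu>
  proof -
    note b = box_diff_twice[OF \<mu>]
    have "M.co (\<phi> (e \<mu>)) \<kappa> = 0" for \<kappa>
      using up[OF L.d_box L.box_d_full[OF b(1)], of \<kappa>] b(1,2) by (simp add: \<phi>d0 co0)
    then have "M.vec (M.co (\<phi> (e \<mu>))) = 0" by (simp add: M.vec_def)
    then show ?thesis using M.vec_co[OF vecs[OF L.e[OF \<mu>]]] by simp
  qed
  then have s0: "M.co (\<phi> (e \<mu>)) \<kappa> = 0" if "\<mu> \<in> box s d" for \<mu> \<kappa> using that co0 by simp
  have "M.co (\<phi> x) = (\<lambda>_. 0)"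
    using lin_on_sum[OF hom_co[OF h], where A = "box s d" and c = "L.co x" and g = e] L.e L.vec_co[OF x] s0 by (simp add: L.vec_def)
  then show "\<phi> x = 0" using M.vec_co[OF vecs[OF x]] by (simp add: M.vec_def)
qed

text \<open>As C_0 = 0, the claimed bound in degree 0 is 0, and a mere estimate would not
  do.\<close>

theorem ext_dim_0_neq:
  assumes neq: "d \<noteq> f"
  shows "ext_dim G L M 0 = 0"
proof -
  have "ext_dim G L M 0 \<le> enat 0"
  proof (rule ext_dim_leI[OF G_group L.L M.L, where \<zeta> = "\<lambda>_ _ _. 0"])
    fix c assume c: "c \<in> cochains G (carrier G) L (smul M) (act M) (vecs M) 0"
      and z: "\<And>w x. w \<in> words G (Suc 0) \<Longrightarrow> x \<in> vecs L \<Longrightarrow> cobd G L c w x = 0"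
    note cD = cochainsD[OF G_group L.L c]
    have w: "[g] \<in> words G 0" if "g \<in> carrier G" for g using that by (simp add: words_def)
    have one: "[\<one>\<^bsub>G\<^esub>] \<in> words G 0" by (rule w) (rule G.one_closed)
    have tr: "c [g] x = c [\<one>\<^bsub>G\<^esub>] (act L g x)" if g: "g \<in> carrier G" and x: "x \<in> vecs L" for g x
    proof -
      have "[\<one>\<^bsub>G\<^esub>, g] \<in> words G (Suc 0)" unfolding words_def using g G.one_closed by auto
      from z[OF this x] have "c [\<one>\<^bsub>G\<^esub> \<otimes>\<^bsub>G\<^esub> g] x - c [\<one>\<^bsub>G\<^esub>] (act L g x) = 0"
        unfolding R.cobd_0 .
      then show ?thesis unfolding G.l_one[OF g] by (simp only: right_minus_eq)
    qed
    have h: "c [\<one>\<^bsub>G\<^esub>] (act L g x) = act M g (c [\<one>\<^bsub>G\<^esub>] x)" if g: "g \<in> carrier G" and x: "x \<in> vecs L" for g x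
    proof -
      have "c (lmult G g [\<one>\<^bsub>G\<^esub>]) x = act M g (c [\<one>\<^bsub>G\<^esub>] x)" by (rule cD(4)[OF one g x])
      moreover have "lmult G g [\<one>\<^bsub>G\<^esub>] = [g]" unfolding lmult_def list.sel G.r_one[OF g] ..
      ultimately show ?thesis using tr[OF g x] by simp
    qed
    have "hom (c [\<one>\<^bsub>G\<^esub>])"
      unfolding hom_def lin_on_def using cD(1,2,3)[OF one] h by blast
    note 0 = hom_eq_0[OF this neq]
    have "c w x = 0" if "w \<in> words G 0" "x \<in> vecs L" for w x
    proof -
      obtain g where g: "w = [g]" "g \<in> carrier G" using \<open>w \<in> words G 0\<close> by (auto simp: words_def length_Suc_conv)
      show ?thesis unfolding g(1) tr[OF g(2) that(2)] by (rule 0[OF L.LD(3)[OF g(2) that(2)]])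
    qed
    then show "\<exists>y a. (0 < (0::nat) \<longrightarrow> y \<in> cochains G (carrier G) L (smul M) (act M) (vecs M) (0 - 1)) \<and>
        (\<forall>w\<in>words G 0. \<forall>x\<in>vecs L. c w x = (if (0::nat) = 0 then 0 else cobd G L y w x) + (\<Sum>k<0. smul M (a k) 0))"
      by simp
  qed
  then show ?thesis by (simp flip: zero_enat_def)
qed

end

section \<open>The bounds\<close>

text \<open>\<open>p_digits\<close> controls only the digits in \<open>{1..s}\<close>; the
  truncation makes them a member of a box.\<close>

definition digits :: "nat \<Rightarrow> (nat \<Rightarrow> nat) \<Rightarrow> nat \<Rightarrow> nat" where
  "digits s d = (\<lambda>j. if j \<in> {1..s} then d j else 0)"

lemma is_gmod_mono: "is_gmod (SL2_over T) L \<Longrightarrow> S \<subseteq> T \<Longrightarrow> is_gmod (SL2_over S) L"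
proof -
  assume L: "is_gmod (SL2_over T) L" and "S \<subseteq> T"
  then have c: "g \<in> carrier (SL2_over S) \<Longrightarrow> g \<in> carrier (SL2_over T)" for g
    by (auto simp: SL2_over_def)
  have ops: "\<one>\<^bsub>SL2_over S\<^esub> = \<one>\<^bsub>SL2_over T\<^esub>" "g \<otimes>\<^bsub>SL2_over S\<^esub> h = g \<otimes>\<^bsub>SL2_over T\<^esub> h" for g h
    by (simp_all add: SL2_over_def)
  show ?thesis
    unfolding is_gmod_def ops by (intro conjI ballI allI) (blast intro: is_gmodD[OF L] c)+
qed

context char_p
begin

lemma digit_module_digits:
  assumes d: "p_digits p s d" and L: "simple_digits_mod p s d L"
  shows "\<exists>e. digit_module p s F (digits s d) L e"
proof -
  have box: "digits s d \<in> box s full" using d by (auto simp: digits_def box_def p_digits_def)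
  have "(\<Sum>i=1..s. d i * p ^ (i - 1)) = val p s (digits s d)"
    unfolding val_def by (rule sum.cong) (auto simp: digits_def)
  then interpret simple_digits p s F "digits s d" L
    by unfold_locales (use box L in \<open>simp_all add: simple_digits_mod_def\<close>)
  have "digit_module p s F (digits s d) L e"
    by unfold_locales (rule box is_gmod_mono[OF V_gmod subset_UNIV] digit_basis_e)+
  then show ?thesis by (rule exI[of _ e])
qed

text \<open>The trivial module in the definition of group cohomology lives on the field itself, so
  its basis, the vector 1 with all digits 0, is checked directly.\<close>

lemma digit_module_trivial: "digit_module p s F (\<lambda>_. 0) (trivial_gmod :: ('k, 'k^2^2, 'k) gmod) (\<lambda>_. 1)"
proof -
  have vs: "vector_space ((*) :: 'k \<Rightarrow> 'k \<Rightarrow> 'k)" by standard (auto simp: algebra_simps)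
  interpret V: vector_space "(*) :: 'k \<Rightarrow> 'k \<Rightarrow> 'k" by (rule vs)
  have b: "box s (\<lambda>_. 0) = {0}"
  proof (intro equalityI subsetI)
    fix x assume x: "x \<in> box s (\<lambda>_. 0)"
    have "x j = 0" for j
      using x[unfolded box_def, THEN CollectD, THEN spec, of j] by (simp split: if_splits)
    then show "x \<in> {0}" by (simp add: fun_eq_iff)
  qed (simp add: box_def)
  have b': "box s 0 = {0}" using b by (simp add: zero_fun_def)
  have "is_gmod (SL2_over F) (trivial_gmod :: ('k, 'k^2^2, 'k) gmod)"
    using vs by (simp add: is_gmod_def trivial_gmod_def)
  moreover have "digit_basis (\<lambda>_. 0) (trivial_gmod :: ('k, 'k^2^2, 'k) gmod) (\<lambda>_. 1)"
    unfolding digit_basis_def b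
    by (auto simp: trivial_gmod_def b' val_def intro: exI[of _ 1])
  ultimately show ?thesis by unfold_locales (auto simp: b box_def)
qed

lemma ext_dim_bounds:
  fixes L :: "('k, 'k^2^2, 'v::ab_group_add) gmod" and M :: "('k, 'k^2^2, 'w::ab_group_add) gmod"
  assumes L: "digit_module p s F d L e" and M: "digit_module p s F f M e'"
  shows "n > 0 \<Longrightarrow> ereal_of_enat (ext_dim G L M n) \<le>
      ereal ((2 * real n + 2) * 4 ^ n * (\<Prod>i=1..s. real (min (d i) (f i)) + 1))"
    and "ereal_of_enat (ext_dim G L M 0) \<le> ereal (\<Prod>i=1..s. real (min (d i) (f i)) + 1)"
    and "d \<noteq> f \<Longrightarrow> ext_dim G L M 0 = 0"
proof -
  interpret L: digit_module p s F d L e by (rule L)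
  interpret M: digit_module p s F f M e' by (rule M)
  interpret ext_model p s F f d L e M e' by unfold_locales (rule M.d)
  show "d \<noteq> f \<Longrightarrow> ext_dim G L M 0 = 0" by (rule ext_dim_0_neq)
  have "ereal_of_enat (ext_dim G L M 0) \<le> ereal (real (card (critical_cells d 0)))"
    using ext_dim_0_le_critical by (simp flip: ereal_of_enat_le_iff)
  also have "\<dots> \<le> ereal (real (\<Prod>j=1..s. min (d j) (f j) + 1))"
    using card_critical_cells_0(2)[of d] by (simp only: ereal_less_eq of_nat_le_iff)
  finally show "ereal_of_enat (ext_dim G L M 0) \<le> ereal (\<Prod>i=1..s. real (min (d i) (f i)) + 1)"
    by (simp only: of_nat_prod of_nat_add of_nat_1)
  show "ereal_of_enat (ext_dim G L M n) \<le>
      ereal ((2 * real n + 2) * 4 ^ n * (\<Prod>i=1..s. real (min (d i) (f i)) + 1))" if n: "n > 0"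
  proof -
    obtain m where m: "n = Suc m" using n by (cases n) auto
    have "ereal_of_enat (ext_dim G L M n) \<le> ereal (real (card (critical_cells d n)))"
      using ext_dim_le_critical[of m] unfolding m by (simp flip: ereal_of_enat_le_iff)
    also have "\<dots> \<le> ereal ((2 * real n + 2) * 4 ^ n * (\<Prod>i=1..s. real (min (d i) (f i)) + 1))"
      using card_critical_cells(2)[OF d_le n] by (simp only: ereal_less_eq)
    finally show ?thesis .
  qed
qed

end

lemma C_bound_ge: "n > 0 \<Longrightarrow> 4 ^ n \<le> C_bound n"
proof -
  assume n: "n > 0"
  have "1 * 4 ^ n * 1 \<le> real n * 4 ^ n * exp (2 * pi * real n / sqrt 3)"
    by (intro mult_mono) (use n in auto)
  then show ?thesis by (simp add: C_bound_def)
qed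

lemma critical_bound_le:
  assumes "n > 0" "0 \<le> P" "0 \<le> m"
  shows "(2 * real n + 2) * 4 ^ n * P \<le> (2 * real n + m + 7) * C_bound n * P"
  using assms C_bound_ge[of n] by (intro mult_right_mono mult_mono) auto

text \<open>The proviso on n and the digits is forced: C_0 = 0, whereas the identity is a nonzero
  homomorphism from L_d to itself. The exponential bound in the middle includes these cases, with
  constants that do not depend on f.\<close>

theorem theorem6p5:
  fixes p :: nat
  assumes "prime p" and "p \<ge> 3" and "CHAR('k::alg_closed_field) = p"
  shows
    "(\<forall>n s d f (L :: ('k, 'k^2^2, 'v::ab_group_add) gmod) (L' :: ('k, 'k^2^2, 'w::ab_group_add) gmod).
        s \<ge> 1 \<longrightarrow> p_digits p s d \<longrightarrow> p_digits p s f \<longrightarrow>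
        simple_digits_mod p s d L \<longrightarrow> simple_digits_mod p s f L' \<longrightarrow>
        n \<ge> 1 \<or> (\<exists>i\<in>{1..s}. d i \<noteq> f i) \<longrightarrow>
        ereal_of_enat (ext_dim (SL2_Fq (p ^ s)) L L' n)
          \<le> ereal ((2 * real n + 2 * real (Max (d ` {1..s})) + 7) * C_bound n *
                    (\<Prod>i=1..s. real (min (d i) (f i)) + 1)))
     \<and>
     (\<forall>s d. s \<ge> 1 \<longrightarrow> p_digits p s d \<longrightarrow>
        (\<exists>A B :: real. \<forall>n f (L :: ('k, 'k^2^2, 'v) gmod) (L' :: ('k, 'k^2^2, 'w) gmod).
           p_digits p s f \<longrightarrow> simple_digits_mod p s d L \<longrightarrow> simple_digits_mod p s f L' \<longrightarrow>
           ereal_of_enat (ext_dim (SL2_Fq (p ^ s)) L L' n) \<le> ereal (A * B ^ n)))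
     \<and>
     (\<forall>n s f (L' :: ('k, 'k^2^2, 'w) gmod).
        s \<ge> 1 \<longrightarrow> p_digits p s f \<longrightarrow> simple_digits_mod p s f L' \<longrightarrow>
        n \<ge> 1 \<or> (\<exists>i\<in>{1..s}. f i \<noteq> 0) \<longrightarrow>
        ereal_of_enat (group_cohomology_dim (SL2_Fq (p ^ s)) L' n)
          \<le> ereal ((2 * real n + 7) * C_bound n))"
proof -
  have prod: "(\<Prod>i=1..s. real (min (digits s d i) (digits s f i)) + 1) = (\<Prod>i=1..s. real (min (d i) (f i)) + 1)" for s d f
    by (rule prod.cong) (auto simp: digits_def)
  have prod0: "(\<Prod>i=1..s. real (min 0 (digits s f i)) + 1) = 1" for s f by simp
  have ne: "digits s d \<noteq> digits s f" if "i \<in> {1..s}" "d i \<noteq> f i" for s d f i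
    using that by (auto simp: digits_def fun_eq_iff)
  have pos: "0 \<le> (\<Prod>i=1..s. real (min (d i) (f i)) + 1)" for s and d f :: "nat \<Rightarrow> nat"
    by (rule prod_nonneg) simp
  show ?thesis
  proof (intro conjI allI impI)
    fix n s :: nat and d f :: "nat \<Rightarrow> nat" and L :: "('k, 'k^2^2, 'v) gmod" and L' :: "('k, 'k^2^2, 'w) gmod"
    assume s: "s \<ge> 1" and d: "p_digits p s d" "p_digits p s f" and L: "simple_digits_mod p s d L" "simple_digits_mod p s f L'"
      and n: "n \<ge> 1 \<or> (\<exists>i\<in>{1..s}. d i \<noteq> f i)"
    interpret char_p p s "{x :: 'k. x ^ (p ^ s) = x}" by unfold_locales (use assms s in auto)
    obtain e where e: "digit_module p s {x :: 'k. x ^ (p ^ s) = x} (digits s d) L e" using digit_module_digits[OF d(1) L(1)] ..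
    obtain e' where e': "digit_module p s {x :: 'k. x ^ (p ^ s) = x} (digits s f) L' e'" using digit_module_digits[OF d(2) L(2)] ..
    note b = ext_dim_bounds[OF e e', unfolded prod]
    show "ereal_of_enat (ext_dim (SL2_Fq (p ^ s)) L L' n)
          \<le> ereal ((2 * real n + 2 * real (Max (d ` {1..s})) + 7) * C_bound n *
                    (\<Prod>i=1..s. real (min (d i) (f i)) + 1))"
      unfolding G_eq
    proof (cases "n = 0")
      \<comment> \<open>Both sides are 0 here, the left one by the vanishing of homomorphisms and
        the right one by C_0 = 0.\<close>
      case True
      then obtain i where "i \<in> {1..s}" "d i \<noteq> f i" using n by auto
      from b(3)[OF ne[where d = d and f = f, OF this]] show "ereal_of_enat (ext_dim G L L' n)
          \<le> ereal ((2 * real n + 2 * real (Max (d ` {1..s})) + 7) * C_bound n *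
                    (\<Prod>i=1..s. real (min (d i) (f i)) + 1))" using True by (simp add: C_bound_def)
    next
      case False
      then have n: "n > 0" by simp
      have "ereal_of_enat (ext_dim G L L' n) \<le> ereal ((2 * real n + 2) * 4 ^ n * (\<Prod>i=1..s. real (min (d i) (f i)) + 1))"
        by (rule b(1)[OF n])
      also have "\<dots> \<le> ereal ((2 * real n + 2 * real (Max (d ` {1..s})) + 7) * C_bound n * (\<Prod>i=1..s. real (min (d i) (f i)) + 1))"
        unfolding ereal_less_eq by (rule critical_bound_le[OF n pos]) simp
      finally show "ereal_of_enat (ext_dim G L L' n)
          \<le> ereal ((2 * real n + 2 * real (Max (d ` {1..s})) + 7) * C_bound n *
                    (\<Prod>i=1..s. real (min (d i) (f i)) + 1))" .
    qed
  next
    fix s :: nat and d :: "nat \<Rightarrow> nat" assume s: "s \<ge> 1" and d: "p_digits p s d"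
    interpret char_p p s "{x :: 'k. x ^ (p ^ s) = x}" by unfold_locales (use assms s in auto)
    let ?P = "\<Prod>i=1..s. real (d i) + 1"
    have P: "0 \<le> ?P" by (rule prod_nonneg) simp
    show "\<exists>A B :: real. \<forall>n f (L :: ('k, 'k^2^2, 'v) gmod) (L' :: ('k, 'k^2^2, 'w) gmod).
           p_digits p s f \<longrightarrow> simple_digits_mod p s d L \<longrightarrow> simple_digits_mod p s f L' \<longrightarrow>
           ereal_of_enat (ext_dim (SL2_Fq (p ^ s)) L L' n) \<le> ereal (A * B ^ n)"
    \<comment> \<open>The base is 8 because n + 1 \<le> 2^n turns (2 n + 2) 4^n into 2 * 8^n.
      Replacing the minimum of d_i and f_i by d_i removes f from the constant, and the same constant
      covers n = 0.\<close>
    proof (rule exI[of _ "2 * ?P"], rule exI[of _ 8], intro allI impI)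
      fix n :: nat and f :: "nat \<Rightarrow> nat" and L :: "('k, 'k^2^2, 'v) gmod" and L' :: "('k, 'k^2^2, 'w) gmod"
      assume f: "p_digits p s f" and L: "simple_digits_mod p s d L" "simple_digits_mod p s f L'"
      obtain e where e: "digit_module p s {x :: 'k. x ^ (p ^ s) = x} (digits s d) L e" using digit_module_digits[OF d L(1)] ..
      obtain e' where e': "digit_module p s {x :: 'k. x ^ (p ^ s) = x} (digits s f) L' e'" using digit_module_digits[OF f L(2)] ..
      note b = ext_dim_bounds[OF e e', unfolded prod]
      let ?Q = "\<Prod>i=1..s. real (min (d i) (f i)) + 1"
      have Q: "?Q \<le> ?P" by (rule prod_mono) auto
      show "ereal_of_enat (ext_dim (SL2_Fq (p ^ s)) L L' n) \<le> ereal (2 * ?P * 8 ^ n)"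
        unfolding G_eq
      proof (cases "n = 0")
        case True
        have "ereal_of_enat (ext_dim G L L' 0) \<le> ereal ?Q" by (rule b(2))
        also have "\<dots> \<le> ereal (2 * ?P)" unfolding ereal_less_eq using Q P by linarith
        finally show "ereal_of_enat (ext_dim G L L' n) \<le> ereal (2 * ?P * 8 ^ n)" using True by simp
      next
        case False
        then have n: "n > 0" by simp
        have "Suc n \<le> 2 ^ n" by (rule Suc_leI) (rule less_exp)
        then have "real (Suc n) \<le> 2 ^ n" by (metis of_nat_le_iff of_nat_power of_nat_numeral)
        then have "(2 * real n + 2) * 4 ^ n \<le> (2 * 2 ^ n) * 4 ^ n" by (intro mult_right_mono) auto
        also have "\<dots> = (2 :: real) * 8 ^ n" by (simp flip: power_mult_distrib)
        finally have "(2 * real n + 2) * 4 ^ n * ?Q \<le> 2 * 8 ^ n * ?P" by (rule mult_mono[OF _ Q]) (simp_all add: pos del: One_nat_def)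
        then have "ereal ((2 * real n + 2) * 4 ^ n * ?Q) \<le> ereal (2 * ?P * 8 ^ n)" by (simp add: mult_ac)
        with b(1)[OF n] show "ereal_of_enat (ext_dim G L L' n) \<le> ereal (2 * ?P * 8 ^ n)" by (rule order_trans)
      qed
    qed
  next
    fix n s :: nat and f :: "nat \<Rightarrow> nat" and L' :: "('k, 'k^2^2, 'w) gmod"
    assume s: "s \<ge> 1" and f: "p_digits p s f" and L': "simple_digits_mod p s f L'"
      and n: "n \<ge> 1 \<or> (\<exists>i\<in>{1..s}. f i \<noteq> 0)"
    interpret char_p p s "{x :: 'k. x ^ (p ^ s) = x}" by unfold_locales (use assms s in auto)
    obtain e' where e': "digit_module p s {x :: 'k. x ^ (p ^ s) = x} (digits s f) L' e'" using digit_module_digits[OF f L'] ..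
    note b = ext_dim_bounds[OF digit_module_trivial e', unfolded prod0]
    show "ereal_of_enat (group_cohomology_dim (SL2_Fq (p ^ s)) L' n) \<le> ereal ((2 * real n + 7) * C_bound n)"
      unfolding G_eq group_cohomology_dim_def
    proof (cases "n = 0")
      case True
      then obtain i where "i \<in> {1..s}" "f i \<noteq> 0" using n by auto
      then have "(\<lambda>_. 0) \<noteq> digits s f" by (auto simp: digits_def fun_eq_iff)
      from b(3)[OF this] show "ereal_of_enat (ext_dim G trivial_gmod L' n) \<le> ereal ((2 * real n + 7) * C_bound n)"
        using True by (simp add: C_bound_def)
    next
      case False
      then have n: "n > 0" by simp
      have "ereal_of_enat (ext_dim G trivial_gmod L' n) \<le> ereal ((2 * real n + 2) * 4 ^ n * 1)" by (rule b(1)[OF n])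
      also have "\<dots> \<le> ereal ((2 * real n + 7) * C_bound n)"
        unfolding ereal_less_eq using critical_bound_le[OF n, of 1 0] by simp
      finally show "ereal_of_enat (ext_dim G trivial_gmod L' n) \<le> ereal ((2 * real n + 7) * C_bound n)" .
    qed
  qed
qed

end
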